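(* Let $a,b,c,d>0$ be constants and let $g_{IK}$ be the generalized Taub-NUT (Iwai-Katayama) metric on $\mathbb{R}^4$, defined on $\mathbb{R}^4\setminus\{0\}\simeq \mathbb{R}^+\times S^3$ by \[g_{IK}=\gamma^2(t)\left(dt^2+4t^2 g_{\lambda(t)}\right),\qquad \gamma(t)=\sqrt{\tfrac{a+bt}{t}},\quad \lambda(t)=\tfrac{1}{\sqrt{1+ct+dt^2}},\] and extended across the origin. Then there are no nonzero $L^2$ harmonic spinors on $(\mathbb{R}^4,g_{IK})$, i.e. no nonzero $L^2$ spinor fields $\Phi$ with $D\Phi=0$, where $D$ is the Dirac operator of $g_{IK}$. In particular, the $L^2$ index of the Dirac operator of $(\mathbb{R}^4,g_{IK})$ vanishes.
   Context: Regard $S^3$ as the unit sphere in the quaternions and let $I,J,K$ be the vector fields on $S^3$ obtained by left translation of the unit quaternions $i,j,k$; they are pointwise orthogonal. For $\lambda>0$ the Berger metric $g_\lambda$ on $S^3$ is the metric for which $I,J,K$ are orthogonal, $I$ and $J$ have length $1$ and $K$ has length $\lambda$. The coordinate $t>0$ on $\mathbb{R}^+\times S^3$ is related to the Euclidean radius $r$ by $r^2=t$; in this coordinate the singularity of $g_{IK}$ at the origin is removable, so $g_{IK}$ is a smooth complete-at-the-origin Riemannian metric on $\mathbb{R}^4$. Spinors are taken for the unique spin structure on $\mathbb{R}^4$. *)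

theory Defs
  imports "HOL-Analysis.Analysis" "HOL-Library.Numeral_Type"
begin

section \<open>Points of R^4 = quaternions, coordinates (x0,x1,x2,x3) = x0 + x1 i + x2 j + x3 k\<close>

definition qmul :: "real^4 \<Rightarrow> real^4 \<Rightarrow> real^4" where
  "qmul p q = (\<chi> m.
     if m = 0 then p$0*q$0 - p$1*q$1 - p$2*q$2 - p$3*q$3
     else if m = 1 then p$0*q$1 + p$1*q$0 + p$2*q$3 - p$3*q$2
     else if m = 2 then p$0*q$2 - p$1*q$3 + p$2*q$0 + p$3*q$1
     else p$0*q$3 + p$1*q$2 - p$2*q$1 + p$3*q$0)"

definition qi :: "real^4" where "qi = axis 1 1"
definition qj :: "real^4" where "qj = axis 2 1"
definition qk :: "real^4" where "qk = axis 3 1"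

text \<open>Left-invariant vector fields I, J, K on S^3 at p: I_p = p i, J_p = p j, K_p = p k.
  Berger metric g_lambda at p in S^3 on tangent vectors u, w: I, J, K orthogonal,
  |I| = |J| = 1, |K| = lambda.\<close>
definition berger :: "real \<Rightarrow> real^4 \<Rightarrow> real^4 \<Rightarrow> real^4 \<Rightarrow> real" where
  "berger lam p u w =
     (u \<bullet> qmul p qi) * (w \<bullet> qmul p qi) + (u \<bullet> qmul p qj) * (w \<bullet> qmul p qj)
     + lam^2 * (u \<bullet> qmul p qk) * (w \<bullet> qmul p qk)"

definition gammaIK :: "real \<Rightarrow> real \<Rightarrow> real \<Rightarrow> real" where
  "gammaIK a b t = sqrt ((a + b*t) / t)"

definition lambdaIK :: "real \<Rightarrow> real \<Rightarrow> real \<Rightarrow> real" where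
  "lambdaIK c d t = 1 / sqrt (1 + c*t + d*t^2)"

text \<open>The Iwai-Katayama metric g_IK at x in R^4 - {0} on vectors v, w, written through
  the diffeomorphism R^4 - {0} = R^+ x S^3, x \<mapsto> (t, p) = (|x|^2, x/|x|)
  (so that r^2 = t with r = |x|).  Here dt(v) = 2 x.v and dp(v) = (v - (x.v/|x|^2) x)/|x|.
  At the origin the metric is extended (by its continuous extension, 4a times Euclidean).\<close>
definition gIK :: "real \<Rightarrow> real \<Rightarrow> real \<Rightarrow> real \<Rightarrow> real^4 \<Rightarrow> real^4 \<Rightarrow> real^4 \<Rightarrow> real" where
  "gIK a b c d x v w =
    (if x = 0 then 4 * a * (v \<bullet> w)
     else
       (let t = norm x ^ 2; p = x /\<^sub>R norm x;
            dt = (\<lambda>u. 2 * (x \<bullet> u));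
            dp = (\<lambda>u. (u - ((x \<bullet> u) / norm x ^ 2) *\<^sub>R x) /\<^sub>R norm x)
        in (gammaIK a b t)^2 * (dt v * dt w + 4 * t^2 * berger (lambdaIK c d t) p (dp v) (dp w))))"

definition Gmat :: "real \<Rightarrow> real \<Rightarrow> real \<Rightarrow> real \<Rightarrow> real^4 \<Rightarrow> real^4^4" where
  "Gmat a b c d x = (\<chi> m n. gIK a b c d x (axis m 1) (axis n 1))"

definition pd :: "(real^4 \<Rightarrow> 'b::real_normed_vector) \<Rightarrow> 4 \<Rightarrow> real^4 \<Rightarrow> 'b" where
  "pd f k x = frechet_derivative f (at x) (axis k 1)"

fun Ck :: "nat \<Rightarrow> (real^4 \<Rightarrow> real) \<Rightarrow> bool" where
  "Ck 0 f = continuous_on UNIV f"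
| "Ck (Suc n) f = ((\<forall>x. f differentiable (at x)) \<and> (\<forall>k. Ck n (pd f k)))"

definition smooth_fun :: "(real^4 \<Rightarrow> real) \<Rightarrow> bool" where
  "smooth_fun f = (\<forall>n. Ck n f)"

definition smooth_orthonormal_frame :: "(real^4 \<Rightarrow> real^4^4) \<Rightarrow> (real^4 \<Rightarrow> real^4^4) \<Rightarrow> bool" where
  "smooth_orthonormal_frame G E =
     ((\<forall>a m. smooth_fun (\<lambda>x. E x $ a $ m)) \<and>
      (\<forall>x a b. (\<Sum>m\<in>UNIV. \<Sum>n\<in>UNIV. G x $ m $ n * E x $ a $ m * E x $ b $ n)
                 = (if a = b then 1 else 0)))"

definition christoffel :: "(real^4 \<Rightarrow> real^4^4) \<Rightarrow> 4 \<Rightarrow> 4 \<Rightarrow> 4 \<Rightarrow> real^4 \<Rightarrow> real" where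
  "christoffel G n k l x =
     (pd (\<lambda>y. G y $ n $ l) k x + pd (\<lambda>y. G y $ n $ k) l x - pd (\<lambda>y. G y $ k $ l) n x) / 2"

text \<open>omega G E c i j x = g(nabla_{E_c} E_i, E_j) at x (Levi-Civita connection).\<close>
definition conn_form :: "(real^4 \<Rightarrow> real^4^4) \<Rightarrow> (real^4 \<Rightarrow> real^4^4) \<Rightarrow> 4 \<Rightarrow> 4 \<Rightarrow> 4 \<Rightarrow> real^4 \<Rightarrow> real" where
  "conn_form G E c i j x =
     (\<Sum>m\<in>UNIV. \<Sum>n\<in>UNIV. G x $ m $ n
         * (\<Sum>k\<in>UNIV. E x $ c $ k * pd (\<lambda>y. E y $ i $ m) k x) * E x $ j $ n)
   + (\<Sum>n\<in>UNIV. \<Sum>k\<in>UNIV. \<Sum>l\<in>UNIV. christoffel G n k l x * E x $ c $ k * E x $ i $ l * E x $ j $ n)"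

definition idx4 :: "4 \<Rightarrow> nat" where
  "idx4 i = (if i = 0 then 0 else if i = 1 then 1 else if i = 2 then 2 else 3)"

definition mat_of_list :: "complex list list \<Rightarrow> complex^4^4" where
  "mat_of_list M = (\<chi> r s. M ! idx4 r ! idx4 s)"

text \<open>Hermitian Euclidean gamma matrices (chiral basis): gam a * gam b + gam b * gam a = 2 delta_ab.\<close>
definition gam :: "4 \<Rightarrow> complex^4^4" where
  "gam a = mat_of_list
    (if a = 0 then [[0,0,0,-\<i>],[0,0,-\<i>,0],[0,\<i>,0,0],[\<i>,0,0,0]]
     else if a = 1 then [[0,0,0,-1],[0,0,1,0],[0,1,0,0],[-1,0,0,0]]
     else if a = 2 then [[0,0,-\<i>,0],[0,0,0,\<i>],[\<i>,0,0,0],[0,-\<i>,0,0]]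
     else [[0,0,1,0],[0,0,0,1],[1,0,0,0],[0,1,0,0]])"

text \<open>Spin connection in the trivialisation given by the frame E (the spin structure of R^4
  is trivial), nabla_{E_c} psi = E_c(psi) - 1/4 sum_{i,j} omega_ij(E_c) gam_i gam_j psi,
  and Dirac operator D psi = sum_c gam_c nabla_{E_c} psi.\<close>
definition spin_cov :: "(real^4 \<Rightarrow> real^4^4) \<Rightarrow> (real^4 \<Rightarrow> real^4^4) \<Rightarrow> (real^4 \<Rightarrow> complex^4) \<Rightarrow> 4 \<Rightarrow> real^4 \<Rightarrow> complex^4" where
  "spin_cov G E \<psi> c x =
     (\<Sum>k\<in>UNIV. E x $ c $ k *\<^sub>R pd \<psi> k x)
     - (\<Sum>i\<in>UNIV. \<Sum>j\<in>UNIV. (conn_form G E c i j x / 4) *\<^sub>R ((gam i ** gam j) *v \<psi> x))"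

definition dirac :: "(real^4 \<Rightarrow> real^4^4) \<Rightarrow> (real^4 \<Rightarrow> real^4^4) \<Rightarrow> (real^4 \<Rightarrow> complex^4) \<Rightarrow> real^4 \<Rightarrow> complex^4" where
  "dirac G E \<psi> x = (\<Sum>c\<in>UNIV. gam c *v spin_cov G E \<psi> c x)"

definition smooth_spinor :: "(real^4 \<Rightarrow> complex^4) \<Rightarrow> bool" where
  "smooth_spinor \<psi> = (\<forall>k. smooth_fun (\<lambda>x. Re (\<psi> x $ k)) \<and> smooth_fun (\<lambda>x. Im (\<psi> x $ k)))"

definition test_spinor :: "(real^4 \<Rightarrow> complex^4) \<Rightarrow> bool" where
  "test_spinor \<psi> = (smooth_spinor \<psi> \<and> compact (closure {x. \<psi> x \<noteq> 0}))"

definition herm :: "complex^4 \<Rightarrow> complex^4 \<Rightarrow> complex" where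
  "herm u v = (\<Sum>k\<in>UNIV. cnj (u $ k) * v $ k)"

definition vol_density :: "(real^4 \<Rightarrow> real^4^4) \<Rightarrow> real^4 \<Rightarrow> real" where
  "vol_density G x = sqrt (det (G x))"

text \<open>L^2 spinor (w.r.t. the Riemannian volume) satisfying D Phi = 0 weakly (in the sense of
  distributions; D is formally skew-adjoint in this convention so the kernel condition is
  the pairing against D psi for all test spinors psi).\<close>
definition L2_harmonic_spinor :: "(real^4 \<Rightarrow> real^4^4) \<Rightarrow> (real^4 \<Rightarrow> real^4^4) \<Rightarrow> (real^4 \<Rightarrow> complex^4) \<Rightarrow> bool" where
  "L2_harmonic_spinor G E \<Phi> =
     (\<Phi> \<in> borel_measurable lborel \<and>
      integrable lborel (\<lambda>x. (norm (\<Phi> x))^2 * vol_density G x) \<and>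
      (\<forall>\<psi>. test_spinor \<psi> \<longrightarrow>
         (\<integral>x. herm (\<Phi> x) (dirac G E \<psi> x) * complex_of_real (vol_density G x) \<partial>lborel) = 0))"

end

theory Submission
  imports Defs
begin

text \<open>Put t = |x|^2. Then g_IK = F^2 g_0 is conformal, with F = 2 sqrt (a + b t), to g_0 =
  dr^2 + r^2 g_lambda. In Cartesian coordinates g_0 is the Euclidean metric minus a radial multiple
  of the square of the one-form dual to \<open>Jw x\<close> = x k (\<open>Gmat_eq\<close>). Thus g_0
  differs from flat space only by shrinking the Hopf direction by the factor 1 / V, where V^2 = 1 +
  c t + d t^2.

  The Dirac operator is conformally covariant. Writing a spinor as eta times phi, with eta^2 = V /
  F^3, turns D into the operator \<open>Lop\<close> built from c and d alone
  (\<open>dirac_Lop\<close>, \<open>dirac_conjugate\<close>). It is the Dirac operator of g_0 acting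
  on half-densities, so it is formally skew for Lebesgue measure. The volume density of g_IK is F^4
  / V, hence the integrand |Phi|^2 vol equals F |phi|^2. Since F is at least 2 sqrt a > 0, an L2
  harmonic spinor Phi yields phi in L2 of Lebesgue measure with \<open>Lop\<close> phi = 0 weakly
  (\<open>harmonic_spinor_zero\<close>).

  Now Lichnerowicz's argument applies to g_0. A quarter of its scalar curvature is the function
  \<open>Wf\<close>, strictly positive because c, d > 0, and the integral of W |psi|^2 is at most
  that of |Lop psi|^2 for smooth compactly supported psi (\<open>Lop_coercive\<close>). The
  pointwise form is \<open>weitzenboeck_divergence\<close>: the two sides differ by a divergence and
  by the squared norm of the covariant derivative. The algebra is in
  \<open>weitzenboeck_pointwise\<close>, and \<open>radial_coefficients\<close> identifies the
  remaining zero-order coefficient with W.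

  The radius has g_0-gradient of length 1, because the Hopf field is orthogonal to x
  (\<open>radial_symb\<close>). A cutoff at radius n therefore costs a factor of order 1 / n, and
  applying coercivity to the cut-off phi shows that the integral of W |phi|^2 over a fixed ball is
  O(1 / n^2), hence zero (\<open>weak_kernel_trivial\<close>). This needs no decay of W at infinity
  to be controlled; positivity at each point is enough.

  Since phi solves the equation only in the sense of distributions, coercivity must be extended from
  smooth fields to weak ones. Elliptic regularity is replaced by Friedrichs mollifiers: the
  commutator of a first-order operator with a mollifier is bounded on L2 uniformly in the scale
  (\<open>friedrichs_commutator\<close>, \<open>schur_bound\<close>), and
  \<open>friedrichs_estimate\<close> transfers the weighted inequality up to a constant.

  The orthonormal frame E trivializing the spinors is arbitrary. It is written as Q times an
  explicit symmetric frame \<open>Fr\<close>, with Q pointwise orthogonal. Instead of lifting Q to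
  the spin group, Q is put into the Clifford generators (\<open>gm\<close>), and the trivial
  connection becomes the flat connection \<open>cov\<close>, for which these generators are parallel
  (\<open>cov_gm\<close>, \<open>cov_commute\<close>). All spinors have four components, so both
  chiral kernels vanish, and with them the L2 index.\<close>

section \<open>Calculus of smooth maps on four-space\<close>

fun Ckv :: "nat \<Rightarrow> (real^4 \<Rightarrow> 'b::real_normed_vector) \<Rightarrow> bool" where
  "Ckv 0 f = continuous_on UNIV f"
| "Ckv (Suc n) f = ((\<forall>x. f differentiable (at x)) \<and> (\<forall>k. Ckv n (pd f k)))"

text \<open>The recursion of \<open>Ck\<close>, with values in an arbitrary normed space, so that
  spinor fields and vector fields can be differentiated without passing to components.\<close>

definition smooth_map :: "(real^4 \<Rightarrow> 'b::real_normed_vector) \<Rightarrow> bool" where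
  "smooth_map f = (\<forall>n. Ckv n f)"

lemma Ck_eq_Ckv: "Ck n f = Ckv n f"
  by (induction n arbitrary: f) auto

lemma smooth_fun_eq: "smooth_fun f = smooth_map f"
  by (simp add: smooth_fun_def smooth_map_def Ck_eq_Ckv)

lemma pd_eq: "(f has_derivative D) (at x) \<Longrightarrow> pd f k x = D (axis k 1)"
  by (metis frechet_derivative_at pd_def)

lemma pd_of_const [simp]: "pd (\<lambda>x. c) k x = 0"
  by (rule pd_eq[OF has_derivative_const])

lemma frechet_derivative_worksI:
  "f differentiable F \<Longrightarrow> (f has_derivative frechet_derivative f F) F"
  using frechet_derivative_works by blast

lemma pd_bilinear:
  assumes "bounded_bilinear b" "f differentiable (at x)" "g differentiable (at x)"
  shows "pd (\<lambda>x. b (f x) (g x)) k x = b (pd f k x) (g x) + b (f x) (pd g k x)"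
proof -
  interpret bounded_bilinear b by fact
  have "((\<lambda>x. b (f x) (g x)) has_derivative
      (\<lambda>h. b (f x) (frechet_derivative g (at x) h) + b (frechet_derivative f (at x) h) (g x))) (at x)"
    by (rule FDERIV) (use assms frechet_derivative_works in blast)+
  from pd_eq[OF this] show ?thesis by (simp add: pd_def)
qed

lemma pd_linear:
  assumes "bounded_linear l" "f differentiable (at x)"
  shows "pd (\<lambda>x. l (f x)) k x = l (pd f k x)"
proof -
  have "((\<lambda>x. l (f x)) has_derivative (\<lambda>h. l (frechet_derivative f (at x) h))) (at x)"
    by (rule bounded_linear.has_derivative[OF assms(1)]) (use assms(2) frechet_derivative_works in blast)
  from pd_eq[OF this] show ?thesis by (simp add: pd_def)
qed

lemma pd_of_linear: "bounded_linear l \<Longrightarrow> pd l k x = l (axis k 1)"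
  by (rule pd_eq) (rule bounded_linear_imp_has_derivative)

lemma pd_add:
  assumes "f differentiable (at x)" "g differentiable (at x)"
  shows "pd (\<lambda>x. f x + g x) k x = pd f k x + pd g k x"
proof -
  have "((\<lambda>x. f x + g x) has_derivative
     (\<lambda>h. frechet_derivative f (at x) h + frechet_derivative g (at x) h)) (at x)"
    by (rule has_derivative_add) (use assms frechet_derivative_works in blast)+
  from pd_eq[OF this] show ?thesis by (simp add: pd_def)
qed

lemma has_derivative_pd:
  assumes "f differentiable (at x)"
  shows "(f has_derivative (\<lambda>h. \<Sum>k\<in>UNIV. (h $ k) *\<^sub>R pd f k x)) (at x)"
proof -
  have d: "(f has_derivative frechet_derivative f (at x)) (at x)"
    using assms frechet_derivative_works by blast
  then interpret bounded_linear "frechet_derivative f (at x)" by (rule has_derivative_bounded_linear)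
  have "frechet_derivative f (at x) h = (\<Sum>k\<in>UNIV. (h $ k) *\<^sub>R pd f k x)" for h
  proof -
    have "h = (\<Sum>k\<in>UNIV. (h $ k) *\<^sub>R axis k 1)"
      using basis_expansion[of h] by (simp add: scalar_mult_eq_scaleR)
    then have "frechet_derivative f (at x) h = frechet_derivative f (at x) (\<Sum>k\<in>UNIV. (h $ k) *\<^sub>R axis k 1)"
      by simp
    then show ?thesis by (simp add: sum scaleR pd_def)
  qed
  then have "frechet_derivative f (at x) = (\<lambda>h. \<Sum>k\<in>UNIV. (h $ k) *\<^sub>R pd f k x)" by blast
  then show ?thesis using d by simp
qed

lemma Ckv_Suc_D: "Ckv (Suc n) f \<Longrightarrow> Ckv n f"
proof (induction n arbitrary: f)
  case 0
  then show ?case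
    by (auto simp: continuous_on_eq_continuous_at intro: differentiable_imp_continuous_within)
next
  case (Suc n)
  then show ?case unfolding Ckv.simps(2)[of "Suc n"] Ckv.simps(2)[of n] by auto
qed

lemma Ckv_add: "Ckv n f \<Longrightarrow> Ckv n g \<Longrightarrow> Ckv n (\<lambda>x. f x + g x)"
proof (induction n arbitrary: f g)
  case (Suc n)
  have "pd (\<lambda>x. f x + g x) k = (\<lambda>x. pd f k x + pd g k x)" for k
    using Suc.prems by (auto simp: pd_add)
  then show ?case using Suc by auto
qed (auto intro: continuous_intros)

lemma Ckv_bilinear:
  assumes "bounded_bilinear b"
  shows "Ckv n f \<Longrightarrow> Ckv n g \<Longrightarrow> Ckv n (\<lambda>x. b (f x) (g x))"
proof (induction n arbitrary: f g)
  case 0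
  then show ?case by (auto intro!: bounded_bilinear.continuous_on[OF assms])
next
  case (Suc n)
  have "pd (\<lambda>x. b (f x) (g x)) k = (\<lambda>x. b (pd f k x) (g x) + b (f x) (pd g k x))" for k
    using Suc.prems by (auto simp: pd_bilinear[OF assms])
  moreover have "(\<lambda>x. b (f x) (g x)) differentiable (at x)" for x
  proof -
    interpret bounded_bilinear b by fact
    have "f differentiable (at x)" "g differentiable (at x)" using Suc.prems by auto
    then show ?thesis
      using FDERIV[OF frechet_derivative_worksI frechet_derivative_worksI] differentiableI by blast
  qed
  moreover have "Ckv n (\<lambda>x. b (pd f k x) (g x) + b (f x) (pd g k x))" for k
    by (intro Ckv_add Suc.IH) (use Suc.prems Ckv_Suc_D in auto)
  ultimately show ?case by simp
qed

lemma Ckv_linear: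
  assumes "bounded_linear l"
  shows "Ckv n f \<Longrightarrow> Ckv n (\<lambda>x. l (f x))"
proof (induction n arbitrary: f)
  case 0
  then show ?case by (auto intro!: bounded_linear.continuous_on[OF assms])
next
  case (Suc n)
  have "pd (\<lambda>x. l (f x)) k = (\<lambda>x. l (pd f k x))" for k
    using Suc.prems by (auto simp: pd_linear[OF assms])
  moreover have "(\<lambda>x. l (f x)) differentiable (at x)" for x
  proof -
    have "f differentiable (at x)" using Suc.prems by auto
    then show ?thesis
      using bounded_linear.has_derivative[OF assms frechet_derivative_worksI] differentiableI by blast
  qed
  moreover have "Ckv n (\<lambda>x. l (pd f k x))" for k
    by (rule Suc.IH) (use Suc.prems in auto)
  ultimately show ?case by simp
qed

lemma Ckv_const: "Ckv n (\<lambda>x. c)"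
proof (induction n arbitrary: c)
  case (Suc n)
  have "pd (\<lambda>x. c) k = (\<lambda>x. 0)" for k by auto
  then show ?case using Suc by simp
qed simp

lemma smooth_const [intro, simp]: "smooth_map (\<lambda>x. c)"
  by (simp add: smooth_map_def Ckv_const)

lemma smooth_add [intro]: "smooth_map f \<Longrightarrow> smooth_map g \<Longrightarrow> smooth_map (\<lambda>x. f x + g x)"
  by (simp add: smooth_map_def Ckv_add)

lemma smooth_bilinear: "bounded_bilinear b \<Longrightarrow> smooth_map f \<Longrightarrow> smooth_map g \<Longrightarrow> smooth_map (\<lambda>x. b (f x) (g x))"
  by (simp add: smooth_map_def Ckv_bilinear)

lemma smooth_linear: "bounded_linear l \<Longrightarrow> smooth_map f \<Longrightarrow> smooth_map (\<lambda>x. l (f x))"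
  by (simp add: smooth_map_def Ckv_linear)

lemma smooth_diff_at: "smooth_map f \<Longrightarrow> f differentiable (at x)"
  unfolding smooth_map_def using Ckv.simps(2)[of 0 f] by blast

lemma smooth_cont: "smooth_map f \<Longrightarrow> continuous_on S f"
  unfolding smooth_map_def using Ckv.simps(1)[of f] continuous_on_subset subset_UNIV by blast

lemma smooth_pd [intro]: "smooth_map f \<Longrightarrow> smooth_map (pd f k)"
  unfolding smooth_map_def using Ckv.simps(2)[of _ f] by blast

lemma smooth_pd' [intro]: "smooth_map f \<Longrightarrow> smooth_map (\<lambda>x. pd f k x)"
  using smooth_pd[of f k] by simp

lemma smooth_scaleR [intro]:
  "smooth_map f \<Longrightarrow> smooth_map g \<Longrightarrow> smooth_map (\<lambda>x. f x *\<^sub>R g x)"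
  by (rule smooth_bilinear[OF bounded_bilinear_scaleR])

lemma smooth_mult [intro]:
  fixes f :: "real^4 \<Rightarrow> 'a::real_normed_algebra"
  shows "smooth_map f \<Longrightarrow> smooth_map g \<Longrightarrow> smooth_map (\<lambda>x. f x * g x)"
  by (rule smooth_bilinear[OF bounded_bilinear_mult])

lemma smooth_inner [intro]:
  "smooth_map f \<Longrightarrow> smooth_map g \<Longrightarrow> smooth_map (\<lambda>x. f x \<bullet> g x)"
  by (rule smooth_bilinear[OF bounded_bilinear_inner])

lemma smooth_uminus [intro]: "smooth_map f \<Longrightarrow> smooth_map (\<lambda>x. - f x)"
  by (rule smooth_linear[OF bounded_linear_minus[OF bounded_linear_ident]])

lemma smooth_diff [intro]: "smooth_map f \<Longrightarrow> smooth_map g \<Longrightarrow> smooth_map (\<lambda>x. f x - g x)"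
  using smooth_add[of f, OF _ smooth_uminus, of g] by simp

lemma smooth_sum [intro]: "(\<And>i. i \<in> I \<Longrightarrow> smooth_map (f i)) \<Longrightarrow> smooth_map (\<lambda>x. \<Sum>i\<in>I. f i x)"
  by (induction I rule: infinite_finite_induct) (simp_all add: smooth_add)

lemma smooth_power [intro]:
  fixes f :: "real^4 \<Rightarrow> real"
  shows "smooth_map f \<Longrightarrow> smooth_map (\<lambda>x. f x ^ n)"
  by (induction n) (simp_all add: smooth_mult)

lemma smooth_divide_const [intro]:
  fixes f :: "real^4 \<Rightarrow> real"
  shows "smooth_map f \<Longrightarrow> smooth_map (\<lambda>x. f x / c)"
  using smooth_mult[OF _ smooth_const, of f "inverse c"] by (simp add: divide_inverse)

lemma smooth_of_linear: "bounded_linear l \<Longrightarrow> smooth_map l"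
  unfolding smooth_map_def
proof
  fix n assume l: "bounded_linear l"
  show "Ckv n l"
  proof (cases n)
    case 0
    then show ?thesis using l by (simp add: linear_continuous_on)
  next
    case (Suc m)
    moreover have "pd l k = (\<lambda>x. l (axis k 1))" for k using pd_of_linear[OF l] by auto
    ultimately show ?thesis using l by (simp add: Ckv_const bounded_linear_imp_differentiable)
  qed
qed

lemma smooth_id [intro, simp]: "smooth_map (\<lambda>x. x)"
  by (rule smooth_of_linear) (rule bounded_linear_ident)

lemma smooth_coord [intro, simp]: "smooth_map (\<lambda>x. x $ k)"
  by (rule smooth_of_linear) (rule bounded_linear_vec_nth)

lemma pd_coord [simp]: "pd (\<lambda>x. x $ m) k x = (if m = k then 1 else 0)"
  using pd_of_linear[OF bounded_linear_vec_nth, of m k x] by (simp add: axis_def)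

lemma smooth_inner_Basis_iff:
  fixes f :: "real^4 \<Rightarrow> 'b::euclidean_space"
  shows "smooth_map f \<longleftrightarrow> (\<forall>b\<in>Basis. smooth_map (\<lambda>x. f x \<bullet> b))"
proof
  assume "\<forall>b\<in>Basis. smooth_map (\<lambda>x. f x \<bullet> b)"
  then have "smooth_map (\<lambda>x. \<Sum>b\<in>Basis. (f x \<bullet> b) *\<^sub>R b)"
    by (intro smooth_sum smooth_scaleR smooth_const) blast
  then show "smooth_map f" by (simp add: euclidean_representation)
qed (intro ballI smooth_inner smooth_const)

text \<open>Induction on the order needs the whole chain of derivatives at once: the partial
  derivative of G_m composed with f is \<open>pd f\<close> times G_{m+1} composed with f, again of
  the same shape. The derivatives are required only on a set \<open>S\<close> containing the values
  of f, which covers powers of positive functions.\<close>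

lemma smooth_comp_real:
  fixes f :: "real^4 \<Rightarrow> real" and G :: "nat \<Rightarrow> real \<Rightarrow> real"
  assumes f: "smooth_map f" and S: "\<And>x. f x \<in> S"
    and G: "\<And>n t. t \<in> S \<Longrightarrow> (G n has_real_derivative G (Suc n) t) (at t)"
  shows "smooth_map (\<lambda>x. G m (f x))"
proof -
  have hd: "((\<lambda>x. G m (f x)) has_derivative (\<lambda>h. frechet_derivative f (at x) h * G (Suc m) (f x))) (at x)" for m x
  proof -
    have "(f has_derivative frechet_derivative f (at x)) (at x)"
      using smooth_diff_at[OF f] frechet_derivative_works by blast
    moreover have "(G m has_derivative (\<lambda>y. y * G (Suc m) (f x))) (at (f x))"
      using G[OF S[of x], of m] by (simp add: has_field_derivative_def mult_commute_abs)
    ultimately show ?thesis using has_derivative_compose by blast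
  qed
  have "Ckv n (\<lambda>x. G m (f x))" for n
  proof (induction n arbitrary: m)
    case 0
    have "continuous (at x) (\<lambda>x. G m (f x))" for x
      using hd[of m x] has_derivative_continuous by blast
    then show ?case by (simp add: continuous_on_eq_continuous_at)
  next
    case (Suc n)
    have "pd (\<lambda>x. G m (f x)) k = (\<lambda>x. pd f k x * G (Suc m) (f x))" for k
      using pd_eq[OF hd] by (auto simp: pd_def)
    moreover have "Ckv n (\<lambda>x. pd f k x * G (Suc m) (f x))" for k
      by (rule Ckv_bilinear[OF bounded_bilinear_mult])
        (use Suc smooth_pd[OF f] smooth_map_def in auto)
    moreover have "(\<lambda>x. G m (f x)) differentiable (at x)" for x using hd differentiableI by blast
    ultimately show ?case by simp
  qed
  then show ?thesis by (simp add: smooth_map_def)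
qed

lemma pd_comp_real:
  fixes f :: "real^4 \<Rightarrow> real"
  assumes "f differentiable (at x)" "(g has_real_derivative g') (at (f x))"
  shows "pd (\<lambda>x. g (f x)) k x = pd f k x * g'"
proof -
  have "(f has_derivative frechet_derivative f (at x)) (at x)"
    using assms(1) frechet_derivative_works by blast
  moreover have "(g has_derivative (\<lambda>y. y * g')) (at (f x))"
    using assms(2) by (simp add: has_field_derivative_def mult_commute_abs)
  ultimately have "((\<lambda>x. g (f x)) has_derivative (\<lambda>h. frechet_derivative f (at x) h * g')) (at x)"
    using has_derivative_compose by blast
  from pd_eq[OF this] show ?thesis by (simp add: pd_def)
qed

lemma smooth_powr:
  fixes f :: "real^4 \<Rightarrow> real"
  assumes f: "smooth_map f" and pos: "\<And>x. f x > 0"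
  shows "smooth_map (\<lambda>x. f x powr \<alpha>)"
proof -
  define G where "G n t = (\<Prod>i<n. \<alpha> - real i) * t powr (\<alpha> - real n)" for n and t :: real
  have "smooth_map (\<lambda>x. G 0 (f x))"
  proof (rule smooth_comp_real[OF f, where S = "{0<..}"])
    fix n and t :: real assume "t \<in> {0<..}"
    then show "(G n has_real_derivative G (Suc n) t) (at t)"
      unfolding G_def by (auto intro!: derivative_eq_intros simp: algebra_simps)
  qed (use pos in auto)
  then show ?thesis by (simp add: G_def)
qed

lemma smooth_inverse:
  fixes f :: "real^4 \<Rightarrow> real"
  assumes "smooth_map f" "\<And>x. f x > 0"
  shows "smooth_map (\<lambda>x. inverse (f x))"
proof -
  have "(\<lambda>x. inverse (f x)) = (\<lambda>x. f x powr (-1))"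
    using assms(2) by (auto simp: powr_minus less_imp_le fun_eq_iff abs_of_pos)
  then show ?thesis using smooth_powr[OF assms, of "-1"] by metis
qed

lemma smooth_divide:
  fixes f :: "real^4 \<Rightarrow> real"
  assumes "smooth_map g" "smooth_map f" "\<And>x. f x > 0"
  shows "smooth_map (\<lambda>x. g x / f x)"
  using smooth_mult[OF assms(1) smooth_inverse[OF assms(2,3)]] by (simp add: divide_inverse)

lemma smooth_sqrt:
  fixes f :: "real^4 \<Rightarrow> real"
  assumes "smooth_map f" "\<And>x. f x > 0"
  shows "smooth_map (\<lambda>x. sqrt (f x))"
proof -
  have "(\<lambda>x. sqrt (f x)) = (\<lambda>x. f x powr (1/2))"
    using assms(2) by (auto simp: powr_half_sqrt less_imp_le)
  then show ?thesis using smooth_powr[OF assms, of "1/2"] by metis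
qed

lemma pd_inner:
  assumes "smooth_map f" "smooth_map g"
  shows "pd (\<lambda>x. f x \<bullet> g x) k x = pd f k x \<bullet> g x + f x \<bullet> pd g k x"
  by (rule pd_bilinear[OF bounded_bilinear_inner smooth_diff_at[OF assms(1)] smooth_diff_at[OF assms(2)]])

lemma pd_mult:
  fixes f :: "real^4 \<Rightarrow> real"
  assumes "smooth_map f" "smooth_map g"
  shows "pd (\<lambda>x. f x * g x) k x = pd f k x * g x + f x * pd g k x"
  by (rule pd_bilinear[OF bounded_bilinear_mult smooth_diff_at[OF assms(1)] smooth_diff_at[OF assms(2)]])

lemma pd_scaleR:
  fixes f :: "real^4 \<Rightarrow> real"
  assumes "smooth_map f" "smooth_map g"
  shows "pd (\<lambda>x. f x *\<^sub>R g x) k x = pd f k x *\<^sub>R g x + f x *\<^sub>R pd g k x"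
  by (rule pd_bilinear[OF bounded_bilinear_scaleR smooth_diff_at[OF assms(1)] smooth_diff_at[OF assms(2)]])

lemma pd_plus:
  assumes "smooth_map f" "smooth_map g"
  shows "pd (\<lambda>x. f x + g x) k x = pd f k x + pd g k x"
  by (rule pd_add[OF smooth_diff_at[OF assms(1)] smooth_diff_at[OF assms(2)]])

lemma pd_minus:
  assumes "smooth_map f"
  shows "pd (\<lambda>x. - f x) k x = - pd f k x"
  by (rule pd_linear[OF bounded_linear_minus[OF bounded_linear_ident] smooth_diff_at[OF assms]])

lemma pd_diff:
  assumes "smooth_map f" "smooth_map g"
  shows "pd (\<lambda>x. f x - g x) k x = pd f k x - pd g k x"
  using pd_plus[OF assms(1) smooth_uminus[OF assms(2)]] pd_minus[OF assms(2)] by simp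

lemma pd_sum:
  assumes "finite I" "\<And>i. i \<in> I \<Longrightarrow> smooth_map (f i)"
  shows "pd (\<lambda>x. \<Sum>i\<in>I. f i x) k x = (\<Sum>i\<in>I. pd (f i) k x)"
  using assms
proof (induction I rule: finite_induct)
  case (insert i I)
  have "smooth_map (f i)" "smooth_map (\<lambda>x. \<Sum>i\<in>I. f i x)" using insert.prems by blast+
  from pd_plus[OF this] show ?case using insert by simp
qed simp

lemma pd_lin:
  assumes "bounded_linear l" "smooth_map f"
  shows "pd (\<lambda>x. l (f x)) k x = l (pd f k x)"
  by (rule pd_linear[OF assms(1) smooth_diff_at[OF assms(2)]])

lemma line_deriv:
  fixes f :: "real^4 \<Rightarrow> real"
  assumes "smooth_map f"
  shows "((\<lambda>s. f (x + s *\<^sub>R axis k 1)) has_real_derivative pd f k (x + s *\<^sub>R axis k 1)) (at s)"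
proof -
  have d: "(f has_derivative frechet_derivative f (at (x + s *\<^sub>R axis k 1))) (at (x + s *\<^sub>R axis k 1))"
    using smooth_diff_at[OF assms] frechet_derivative_works by blast
  have e: "((\<lambda>s. x + s *\<^sub>R axis k 1) has_derivative (\<lambda>h. h *\<^sub>R axis k 1)) (at s)"
    by (auto intro!: derivative_eq_intros)
  have "((\<lambda>s. f (x + s *\<^sub>R axis k 1)) has_derivative
      (\<lambda>h. frechet_derivative f (at (x + s *\<^sub>R axis k 1)) (h *\<^sub>R axis k 1))) (at s)"
    using has_derivative_compose[OF e d] .
  moreover have "linear (frechet_derivative f (at (x + s *\<^sub>R axis k 1)))"
    using d has_derivative_linear by blast
  ultimately show ?thesis
    by (simp add: has_field_derivative_def pd_def linear_cmul mult_commute_abs)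
qed

text \<open>Schwarz's theorem via the second difference over a square of side h. Two applications of
  the mean value theorem write it as h^2 times a mixed partial derivative at a nearby point, in
  either order of the two directions; continuity then lets h tend to 0.\<close>

lemma pd_commute_real:
  fixes f :: "real^4 \<Rightarrow> real"
  assumes f: "smooth_map f"
  shows "pd (pd f k) l x = pd (pd f l) k x"
proof -
  have key: "\<exists>y. norm (y - x) \<le> 2 * h \<and>
      f (x + h *\<^sub>R axis k 1 + h *\<^sub>R axis l 1) - f (x + h *\<^sub>R axis k 1) - f (x + h *\<^sub>R axis l 1) + f x
       = h * h * pd (pd f k) l y"
    if h: "h > 0" for h k l
  proof -
    define F where "F s = f ((x + h *\<^sub>R axis l 1) + s *\<^sub>R axis k 1) - f (x + s *\<^sub>R axis k 1)" for s
    have "\<exists>z>0. z < h \<and> F h - F 0 =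
       (h - 0) * (pd f k ((x + h *\<^sub>R axis l 1) + z *\<^sub>R axis k 1) - pd f k (x + z *\<^sub>R axis k 1))"
      unfolding F_def by (rule MVT2) (use h in \<open>auto intro!: DERIV_diff line_deriv[OF f]\<close>)
    then obtain z where z: "0 < z" "z < h" and 1: "F h - F 0 =
       h * (pd f k ((x + h *\<^sub>R axis l 1) + z *\<^sub>R axis k 1) - pd f k (x + z *\<^sub>R axis k 1))" by auto
    have "\<exists>y>0. y < h \<and> pd f k ((x + z *\<^sub>R axis k 1) + h *\<^sub>R axis l 1)
         - pd f k ((x + z *\<^sub>R axis k 1) + 0 *\<^sub>R axis l 1) =
       (h - 0) * pd (pd f k) l ((x + z *\<^sub>R axis k 1) + y *\<^sub>R axis l 1)"
      by (rule MVT2) (use h in \<open>auto intro!: line_deriv[OF smooth_pd[OF f]]\<close>)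
    then obtain y where y: "0 < y" "y < h" and 2: "pd f k (x + z *\<^sub>R axis k 1 + h *\<^sub>R axis l 1)
         - pd f k (x + z *\<^sub>R axis k 1) = h * pd (pd f k) l (x + z *\<^sub>R axis k 1 + y *\<^sub>R axis l 1)" by auto
    let ?y = "x + z *\<^sub>R axis k 1 + y *\<^sub>R axis l 1"
    have "norm (?y - x) \<le> norm (z *\<^sub>R axis k 1 :: real^4) + norm (y *\<^sub>R axis l 1 :: real^4)"
      using norm_triangle_ineq[of "z *\<^sub>R axis k 1" "y *\<^sub>R axis l (1::real)"] by (simp only: add.assoc add_diff_cancel_left')
    also have "\<dots> \<le> 2 * h" using y z by simp
    finally have "norm (?y - x) \<le> 2 * h" .
    moreover have "f (x + h *\<^sub>R axis k 1 + h *\<^sub>R axis l 1) - f (x + h *\<^sub>R axis k 1) - f (x + h *\<^sub>R axis l 1) + f x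
       = h * h * pd (pd f k) l ?y"
    proof -
      have e: "x + h *\<^sub>R axis l 1 + z *\<^sub>R axis k 1 = x + z *\<^sub>R axis k 1 + h *\<^sub>R axis l 1"
        "x + h *\<^sub>R axis l 1 + h *\<^sub>R axis k 1 = x + h *\<^sub>R axis k 1 + h *\<^sub>R axis l 1"
        by (simp_all add: add_ac)
      have "F h - F 0 = h * (h * pd (pd f k) l ?y)" using 1 2 unfolding e by simp
      then show ?thesis unfolding F_def e by simp
    qed
    ultimately show ?thesis by blast
  qed
  \<comment> \<open>Sides h = 1 / (n + 1) yield two sequences of intermediate points, one for each
    order of differentiation, both converging to \<open>x\<close>.\<close>
  have "\<forall>n. \<exists>y z. norm (y - x) \<le> 2 * (1 / real (Suc n)) \<and> norm (z - x) \<le> 2 * (1 / real (Suc n)) \<and>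
       pd (pd f k) l y = pd (pd f l) k z"
  proof
    fix n
    define h where "h = 1 / real (Suc n)"
    have h: "h > 0" by (simp add: h_def)
    obtain y where y: "norm (y - x) \<le> 2 * h" "f (x + h *\<^sub>R axis k 1 + h *\<^sub>R axis l 1) - f (x + h *\<^sub>R axis k 1) - f (x + h *\<^sub>R axis l 1) + f x
       = h * h * pd (pd f k) l y" using key[OF h] by blast
    obtain z where z: "norm (z - x) \<le> 2 * h" "f (x + h *\<^sub>R axis l 1 + h *\<^sub>R axis k 1) - f (x + h *\<^sub>R axis l 1) - f (x + h *\<^sub>R axis k 1) + f x
       = h * h * pd (pd f l) k z" using key[OF h] by blast
    have e: "x + h *\<^sub>R axis l 1 + h *\<^sub>R axis k 1 = x + h *\<^sub>R axis k 1 + h *\<^sub>R axis l 1"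
      by (simp add: add_ac)
    have "h * h * pd (pd f k) l y = h * h * pd (pd f l) k z"
      using y(2) z(2) unfolding e by linarith
    then have "pd (pd f k) l y = pd (pd f l) k z" using h by simp
    then show "\<exists>y z. norm (y - x) \<le> 2 * (1 / real (Suc n)) \<and> norm (z - x) \<le> 2 * (1 / real (Suc n)) \<and>
       pd (pd f k) l y = pd (pd f l) k z" using y(1) z(1) unfolding h_def by blast
  qed
  from this[THEN choice] obtain Y where "\<forall>n. \<exists>z. norm (Y n - x) \<le> 2 * (1 / real (Suc n)) \<and> norm (z - x) \<le> 2 * (1 / real (Suc n)) \<and>
       pd (pd f k) l (Y n) = pd (pd f l) k z" by blast
  from this[THEN choice] obtain Z where YZ: "\<And>n. norm (Y n - x) \<le> 2 * (1 / real (Suc n))" "\<And>n. norm (Z n - x) \<le> 2 * (1 / real (Suc n))"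
    "\<And>n. pd (pd f k) l (Y n) = pd (pd f l) k (Z n)" by blast
  have lim0: "(\<lambda>n. 2 * (1 / real (Suc n))) \<longlonglongrightarrow> 0"
    using tendsto_mult_right_zero[OF LIMSEQ_inverse_real_of_nat, of 2] by (simp add: divide_inverse)
  have conv: "X \<longlonglongrightarrow> x" if "\<And>n. norm (X n - x) \<le> 2 * (1 / real (Suc n))" for X :: "nat \<Rightarrow> real^4"
    by (rule Lim_transform_bound[OF always_eventually lim0, THEN LIM_zero_cancel])
      (use that in auto)
  have c: "isCont (pd (pd f i) j) x" for i j
    using smooth_cont[OF smooth_pd[OF smooth_pd[OF f]], of UNIV] by (simp add: continuous_on_eq_continuous_at)
  have "(\<lambda>n. pd (pd f k) l (Y n)) \<longlonglongrightarrow> pd (pd f k) l x"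
    by (rule isCont_tendsto_compose[OF c conv[OF YZ(1)]])
  moreover have "(\<lambda>n. pd (pd f k) l (Y n)) \<longlonglongrightarrow> pd (pd f l) k x"
    unfolding YZ(3) by (rule isCont_tendsto_compose[OF c conv[OF YZ(2)]])
  ultimately show ?thesis by (rule LIMSEQ_unique)
qed

lemma pd_commute:
  fixes f :: "real^4 \<Rightarrow> 'b::euclidean_space"
  assumes f: "smooth_map f"
  shows "pd (pd f k) l x = pd (pd f l) k x"
proof (rule euclidean_eqI)
  fix b :: 'b
  have b: "pd (\<lambda>x. g x \<bullet> b) i = (\<lambda>x. pd g i x \<bullet> b)" if "smooth_map g" for g i
    using pd_lin[OF bounded_linear_inner_left that] by auto
  have "pd (pd f i) j x \<bullet> b = pd (pd (\<lambda>x. f x \<bullet> b) i) j x" for i j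
    unfolding b[OF f] by (simp add: b[OF smooth_pd[OF f]])
  moreover have "smooth_map (\<lambda>x. f x \<bullet> b)"
    by (intro smooth_inner f smooth_const)
  ultimately show "pd (pd f k) l x \<bullet> b = pd (pd f l) k x \<bullet> b"
    using pd_commute_real[of "\<lambda>x. f x \<bullet> b" k l x] by simp
qed

section \<open>Functions of bounded support, uniform Taylor bounds and the divergence
  theorem\<close>

section \<open>Compactly supported functions and integration by parts\<close>

definition bsupp :: "(real^4 \<Rightarrow> 'b::zero) \<Rightarrow> bool" where
  "bsupp f = (\<exists>R. \<forall>x. norm x > R \<longrightarrow> f x = 0)"

lemma bsuppI: "(\<And>x. norm x > R \<Longrightarrow> f x = 0) \<Longrightarrow> bsupp f"
  unfolding bsupp_def by blast

lemma bsupp_mono: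
  assumes "bsupp f" "\<And>x. f x = 0 \<Longrightarrow> g x = 0"
  shows "bsupp g"
  using assms unfolding bsupp_def by blast

lemma bsupp_add: "bsupp f \<Longrightarrow> bsupp g \<Longrightarrow> bsupp (\<lambda>x. f x + g x :: 'b::monoid_add)"
proof -
  assume "bsupp f" "bsupp g"
  then obtain R S where "\<forall>x. norm x > R \<longrightarrow> f x = 0" "\<forall>x. norm x > S \<longrightarrow> g x = 0"
    unfolding bsupp_def by blast
  then show ?thesis by (intro bsuppI[of "max R S"]) auto
qed

lemma bsupp_sum: "(\<And>i. i \<in> I \<Longrightarrow> bsupp (f i)) \<Longrightarrow> bsupp (\<lambda>x. \<Sum>i\<in>I. f i x :: 'b::comm_monoid_add)"
proof (induction I rule: infinite_finite_induct)
  case (insert i I)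
  then show ?case using bsupp_add[of "f i" "\<lambda>x. \<Sum>i\<in>I. f i x"] by simp
qed (simp_all add: bsupp_def)

lemma integrable_cont_bsupp:
  fixes f :: "real^4 \<Rightarrow> 'b::euclidean_space"
  assumes "continuous_on UNIV f" "bsupp f"
  shows "integrable lborel f"
proof -
  obtain R where R: "\<And>x. norm x > R \<Longrightarrow> f x = 0" using assms(2) unfolding bsupp_def by blast
  have "integrable lborel (\<lambda>x. indicator (cball 0 R) x *\<^sub>R f x)"
    by (rule borel_integrable_compact[OF _ continuous_on_subset[OF assms(1)]]) auto
  moreover have "indicator (cball 0 R) x *\<^sub>R f x = f x" for x
    using R[of x] by (cases "norm x \<le> R") (auto simp: indicator_def)
  ultimately show ?thesis by simp
qed

lemma bounded_cont_bsupp: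
  fixes f :: "real^4 \<Rightarrow> 'b::real_normed_vector"
  assumes "continuous_on UNIV f" "bsupp f"
  obtains C where "C \<ge> 0" "\<And>x. norm (f x) \<le> C"
proof -
  obtain R where R: "\<And>x. norm x > R \<Longrightarrow> f x = 0" using assms(2) unfolding bsupp_def by blast
  have "compact (f ` cball 0 R)"
    by (rule compact_continuous_image[OF continuous_on_subset[OF assms(1)]]) auto
  then have "bounded (f ` cball 0 R)" by (rule compact_imp_bounded)
  then obtain C where C: "\<And>y. y \<in> f ` cball 0 R \<Longrightarrow> norm y \<le> C"
    unfolding bounded_iff by blast
  have "norm (f x) \<le> max C 0" for x
    using C[of "f x"] R[of x] by (cases "norm x \<le> R") (auto simp: le_max_iff_disj)
  then show ?thesis using that[of "max C 0"] by simp
qed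

lemma smooth_bounded_on_ball:
  fixes f :: "real^4 \<Rightarrow> 'b::real_normed_vector"
  assumes "continuous_on UNIV f"
  obtains C where "C \<ge> 0" "\<And>x. norm x \<le> R \<Longrightarrow> norm (f x) \<le> C"
proof -
  have "compact (f ` cball 0 R)"
    by (rule compact_continuous_image[OF continuous_on_subset[OF assms(1)]]) auto
  then have "bounded (f ` cball 0 R)" by (rule compact_imp_bounded)
  then obtain C where C: "\<And>y. y \<in> f ` cball 0 R \<Longrightarrow> norm y \<le> C"
    unfolding bounded_iff by blast
  have "norm (f x) \<le> max C 0" if "norm x \<le> R" for x
    using C[of "f x"] that by (auto simp: le_max_iff_disj)
  then show ?thesis using that[of "max C 0"] by simp
qed

lemma pd_zero_outside:
  fixes f :: "real^4 \<Rightarrow> 'b::real_normed_vector"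
  assumes "\<And>x. norm x > R \<Longrightarrow> f x = 0" "norm x > R"
  shows "pd f k x = 0"
proof -
  have "((\<lambda>x. 0) has_derivative (\<lambda>h. 0)) (at x)" by (rule has_derivative_const)
  moreover have "open {y::real^4. norm y > R}" by (intro open_Collect_less continuous_intros)
  ultimately have "(f has_derivative (\<lambda>h. 0)) (at x)"
    by (rule has_derivative_transform_within_open) (use assms in auto)
  from pd_eq[OF this] show ?thesis .
qed

lemma bsupp_pd:
  fixes f :: "real^4 \<Rightarrow> 'b::real_normed_vector"
  shows "bsupp f \<Longrightarrow> bsupp (pd f k)"
  using pd_zero_outside unfolding bsupp_def by blast

lemma norm_le_sum_coord: "norm (x::real^4) \<ge> \<bar>x $ k\<bar>"
  using component_le_norm_cart[of x k] by simp

lemma uniform_bound_4: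
  assumes "\<And>k::4. \<exists>C\<ge>(0::real). \<forall>x\<in>S. g k x \<le> C"
  shows "\<exists>C\<ge>0. \<forall>k. \<forall>x\<in>S. g k x \<le> C"
proof -
  have "\<forall>k. \<exists>C. C \<ge> 0 \<and> (\<forall>x\<in>S. g k x \<le> C)" using assms by blast
  from choice[OF this] obtain c where c: "\<And>k. c k \<ge> 0" "\<And>k x. x \<in> S \<Longrightarrow> g k x \<le> c k" by blast
  have "c k \<le> (\<Sum>k\<in>UNIV. c k)" for k by (rule member_le_sum) (use c in auto)
  then have "g k x \<le> (\<Sum>k\<in>UNIV. c k)" if "x \<in> S" for k x using c(2)[OF that] order_trans by blast
  moreover have "(\<Sum>k\<in>UNIV. c k) \<ge> 0" by (rule sum_nonneg) (use c in auto)
  ultimately show ?thesis by blast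
qed

lemma pd_bound_bsupp:
  fixes f :: "real^4 \<Rightarrow> 'b::real_normed_vector"
  assumes "smooth_map f" "bsupp f"
  shows "\<exists>C\<ge>0. \<forall>k. \<forall>x\<in>UNIV. norm (pd f k x) \<le> C"
proof (rule uniform_bound_4)
  fix k
  obtain C where "C \<ge> 0" "\<And>x. norm (pd f k x) \<le> C"
    by (rule bounded_cont_bsupp[OF smooth_cont[OF smooth_pd[OF assms(1)]] bsupp_pd[OF assms(2)]]) blast
  then show "\<exists>C\<ge>0. \<forall>x\<in>UNIV. norm (pd f k x) \<le> C" by blast
qed

lemma pd_bound_ball:
  fixes f :: "real^4 \<Rightarrow> 'b::real_normed_vector"
  assumes "smooth_map f"
  shows "\<exists>C\<ge>0. \<forall>k. \<forall>x\<in>cball 0 R. norm (pd f k x) \<le> C"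
proof (rule uniform_bound_4)
  fix k
  obtain C where "C \<ge> 0" "\<And>x. norm x \<le> R \<Longrightarrow> norm (pd f k x) \<le> C"
    by (rule smooth_bounded_on_ball[OF smooth_cont[OF smooth_pd[OF assms(1)]]]) blast
  then show "\<exists>C\<ge>0. \<forall>x\<in>cball 0 R. norm (pd f k x) \<le> C" by auto
qed

lemma lipschitz_gen:
  fixes f :: "real^4 \<Rightarrow> 'b::euclidean_space"
  assumes f: "smooth_map f" and S: "convex S" and C: "\<And>k x. x \<in> S \<Longrightarrow> norm (pd f k x) \<le> C" and xy: "x \<in> S" "y \<in> S"
  shows "norm (f x - f y) \<le> 4 * C * norm (x - y)"
proof (rule differentiable_bound[OF S _ _ xy])
  show "(f has_derivative (\<lambda>h. \<Sum>k\<in>UNIV. (h $ k) *\<^sub>R pd f k x)) (at x within S)" if "x \<in> S" for x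
    using has_derivative_pd[OF smooth_diff_at[OF f]] has_derivative_at_withinI by blast
  show "onorm (\<lambda>h. \<Sum>k\<in>UNIV. (h $ k) *\<^sub>R pd f k x) \<le> 4 * C" if x: "x \<in> S" for x
  proof (rule onorm_le)
    fix h :: "real^4"
    have "norm (\<Sum>k\<in>UNIV. (h $ k) *\<^sub>R pd f k x) \<le> (\<Sum>k\<in>(UNIV::4 set). norm h * C)"
    proof (rule sum_norm_le)
      fix k :: 4
      show "norm (h $ k *\<^sub>R pd f k x) \<le> norm h * C"
        using mult_mono[OF norm_le_sum_coord[of h k] C[OF x, of k]] by simp
    qed
    then show "norm (\<Sum>k\<in>UNIV. (h $ k) *\<^sub>R pd f k x) \<le> 4 * C * norm h" by (simp add: mult_ac)
  qed
qed

lemma lipschitz_on_ball: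
  fixes f :: "real^4 \<Rightarrow> 'b::euclidean_space"
  assumes f: "smooth_map f"
  obtains C where "C \<ge> 0" "\<And>x y. norm x \<le> R \<Longrightarrow> norm y \<le> R \<Longrightarrow> norm (f x - f y) \<le> C * norm (x - y)"
proof -
  obtain C where C: "C \<ge> 0" "\<And>k x. x \<in> cball 0 R \<Longrightarrow> norm (pd f k x) \<le> C"
    using pd_bound_ball[OF f] by blast
  moreover have "norm (f x - f y) \<le> 4 * C * norm (x - y)" if "norm x \<le> R" "norm y \<le> R" for x y
    by (rule lipschitz_gen[OF f convex_cball[of 0 R] C(2)]) (use that in auto)
  ultimately show ?thesis using that[of "4 * C"] C(1) by simp
qed

lemma lipschitz_bsupp:
  fixes f :: "real^4 \<Rightarrow> 'b::euclidean_space"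
  assumes f: "smooth_map f" "bsupp f"
  obtains C where "C \<ge> 0" "\<And>x y. norm (f x - f y) \<le> C * norm (x - y)"
proof -
  obtain C where C: "C \<ge> 0" "\<And>k x. x \<in> UNIV \<Longrightarrow> norm (pd f k x) \<le> C"
    using pd_bound_bsupp[OF f] by blast
  moreover have "norm (f x - f y) \<le> 4 * C * norm (x - y)" for x y
    by (rule lipschitz_gen[OF f(1) convex_UNIV C(2)]) auto
  ultimately show ?thesis using that[of "4 * C"] C(1) by simp
qed

text \<open>The gradient of a smooth function of bounded support is globally Lipschitz, so the
  linearization error is quadratic with one constant for all base points. This uniformity is what
  permits differentiation of a convolution under the integral sign.\<close>

lemma taylor_bsupp:
  fixes f :: "real^4 \<Rightarrow> real"
  assumes f: "smooth_map f" "bsupp f"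
  obtains C where "C \<ge> 0" "\<And>a v. \<bar>f (a + v) - f a - (\<Sum>k\<in>UNIV. v $ k * pd f k a)\<bar> \<le> C * (norm v)\<^sup>2"
proof -
  \<comment> \<open>Difference quotients are indexed by pairs of distinct points, so that
    \<open>uniform_bound_4\<close> produces a single Lipschitz constant for all four partial
    derivatives.\<close>
  have "\<exists>C\<ge>0. \<forall>k. \<forall>p\<in>{(x, y). x \<noteq> y}. norm (pd f k (fst p) - pd f k (snd p)) / norm (fst p - snd p) \<le> C"
  proof (rule uniform_bound_4)
    fix k
    obtain C where "C \<ge> 0" "\<And>x y. norm (pd f k x - pd f k y) \<le> C * norm (x - y)"
      by (rule lipschitz_bsupp[OF smooth_pd[OF f(1)] bsupp_pd[OF f(2)]]) blast
    then show "\<exists>C\<ge>0. \<forall>p\<in>{(x, y). x \<noteq> y}. norm (pd f k (fst p) - pd f k (snd p)) / norm (fst p - snd p) \<le> C"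
      by (intro exI[of _ C]) (auto simp: divide_le_eq)
  qed
  then obtain C where C0: "C \<ge> 0"
    and CC: "\<And>k p. p \<in> {(x, y). x \<noteq> y} \<Longrightarrow> norm (pd f k (fst p) - pd f k (snd p)) / norm (fst p - snd p) \<le> C" by blast
  have C: "norm (pd f k x - pd f k y) \<le> C * norm (x - y)" for k x y
    using CC[of "(x, y)" k] by (cases "x = y") (auto simp: divide_le_eq)
  have "\<bar>f (a + v) - f a - (\<Sum>k\<in>UNIV. v $ k * pd f k a)\<bar> \<le> norm v * (4 * C * norm v)" for a v
  proof -
    define D where "D x h = (\<Sum>k\<in>UNIV. (h $ k) *\<^sub>R pd f k x)" for x h
    have "norm (f (a + v) - f a - D a ((a + v) - a)) \<le> norm ((a + v) - a) * (4 * C * norm v)"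
    proof (rule differentiable_bound_linearization[where S = "cball a (norm v)"])
      show "(f has_derivative D x) (at x within cball a (norm v))" for x
        unfolding D_def by (rule has_derivative_at_withinI[OF has_derivative_pd[OF smooth_diff_at[OF f(1)]]])
      show "a + t *\<^sub>R (a + v - a) \<in> cball a (norm v)" if "t \<in> {0..1}" for t
        using that mult_left_le_one_le[of "norm v" t] by (simp add: dist_norm)
      show "onorm (D x - D a) \<le> 4 * C * norm v" if x: "x \<in> cball a (norm v)" for x
      proof (rule onorm_le)
        fix h :: "real^4"
        have nx: "norm (x - a) \<le> norm v" using x by (simp add: dist_norm norm_minus_commute)
        have "norm (\<Sum>k\<in>UNIV. (h $ k) *\<^sub>R (pd f k x - pd f k a)) \<le> (\<Sum>k\<in>(UNIV::4 set). norm h * (C * norm v))"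
        proof (rule sum_norm_le)
          fix k :: 4
          have "norm (pd f k x - pd f k a) \<le> C * norm v"
            using order_trans[OF C[of k x a] mult_left_mono[OF nx C0]] .
          then have "\<bar>h $ k\<bar> * norm (pd f k x - pd f k a) \<le> norm h * (C * norm v)"
            by (intro mult_mono norm_le_sum_coord) auto
          then show "norm (h $ k *\<^sub>R (pd f k x - pd f k a)) \<le> norm h * (C * norm v)" by (simp add: abs_mult)
        qed
        moreover have "(\<Sum>k\<in>UNIV. (h $ k) *\<^sub>R (pd f k x - pd f k a)) = (D x - D a) h"
          by (simp only: D_def fun_diff_def sum_subtractf scaleR_diff_right)
        moreover have "(\<Sum>k\<in>(UNIV::4 set). norm h * (C * norm v)) = 4 * C * norm v * norm h"
          by (simp add: mult_ac)
        ultimately show "norm ((D x - D a) h) \<le> 4 * C * norm v * norm h" by (simp add: mult_ac)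
      qed
    qed simp
    then show ?thesis by (simp add: D_def)
  qed
  moreover have "norm v * (4 * C * norm v) = 4 * C * (norm v)\<^sup>2" for v :: "real^4"
    by (simp add: power2_eq_square)
  ultimately show ?thesis using that[of "4 * C"] C0 by simp
qed

lemma integral_translate:
  fixes f :: "real^4 \<Rightarrow> 'b::euclidean_space"
  assumes [measurable]: "f \<in> borel_measurable borel"
  shows "(\<integral>x. f (a + x) \<partial>lborel) = (\<integral>x. f x \<partial>lborel)"
proof -
  have "(\<integral>x. f x \<partial>lborel) = (\<integral>x. f x \<partial>(distr lborel borel ((+) a)))"
    by (simp add: lborel_distr_plus)
  also have "\<dots> = (\<integral>x. f (a + x) \<partial>lborel)"
    by (subst integral_distr) auto
  finally show ?thesis by simp
qed

text \<open>Translation invariance makes every difference quotient integrate to zero. The Lipschitz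
  constant times the indicator of a slightly larger ball dominates the quotients, so the limit may
  be taken under the integral. Every later integration by parts rests on this.\<close>

lemma integral_pd_zero:
  fixes f :: "real^4 \<Rightarrow> real"
  assumes f: "smooth_map f" "bsupp f"
  shows "(\<integral>x. pd f k x \<partial>lborel) = 0"
proof -
  let ?e = "axis k 1 :: real^4"
  have fm: "f \<in> borel_measurable borel" using smooth_cont[OF f(1)] by (rule borel_measurable_continuous_onI)
  have fi: "integrable lborel f" by (rule integrable_cont_bsupp[OF smooth_cont[OF f(1)] f(2)])
  obtain C where C: "C \<ge> 0" "\<And>x y. norm (f x - f y) \<le> C * norm (x - y)" by (rule lipschitz_bsupp[OF f]) blast
  obtain R where R: "\<And>x. norm x > R \<Longrightarrow> f x = 0" using f(2) unfolding bsupp_def by blast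
  define h where "h n = 1 / real (Suc n)" for n
  have h: "0 < h n" "h n \<le> 1" for n by (auto simp: h_def)
  have h0: "h \<longlonglongrightarrow> 0" unfolding h_def using LIMSEQ_inverse_real_of_nat by (simp add: divide_inverse)
  define q where "q n x = (f (h n *\<^sub>R ?e + x) - f x) / h n" for n x
  have shift: "integrable lborel (\<lambda>x. f (h n *\<^sub>R ?e + x))" for n
  proof (rule integrable_cont_bsupp)
    show "continuous_on UNIV (\<lambda>x. f (h n *\<^sub>R ?e + x))"
      by (rule continuous_on_compose2[OF smooth_cont[OF f(1), of UNIV]]) (auto intro!: continuous_intros)
    show "bsupp (\<lambda>x. f (h n *\<^sub>R ?e + x))"
    proof (rule bsuppI[of "R + 1"])
      fix x :: "real^4" assume "norm x > R + 1"
      moreover have "norm x \<le> norm (h n *\<^sub>R ?e + x) + norm (h n *\<^sub>R ?e)"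
        using norm_triangle_ineq4[of "h n *\<^sub>R ?e + x" "h n *\<^sub>R ?e"] by (simp only: add_diff_cancel_left')
      ultimately show "f (h n *\<^sub>R ?e + x) = 0" using h[of n] by (intro R) simp
    qed
  qed
  have q0: "integral\<^sup>L lborel (q n) = 0" for n
    unfolding q_def using shift fi integral_translate[OF fm, of "h n *\<^sub>R ?e"] by simp
  have "(\<lambda>n. integral\<^sup>L lborel (q n)) \<longlonglongrightarrow> integral\<^sup>L lborel (pd f k)"
  proof (rule integral_dominated_convergence)
    show "pd f k \<in> borel_measurable lborel"
      using borel_measurable_continuous_onI[OF smooth_cont[OF smooth_pd[OF f(1)]]] by simp
    show "q n \<in> borel_measurable lborel" for n
      unfolding q_def using shift[of n] fi by (intro borel_measurable_divide borel_measurable_diff) auto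
    show "integrable lborel (\<lambda>x. indicator (cball (0::real^4) (R + 1)) x *\<^sub>R C)"
      by (rule borel_integrable_compact) auto
    show "AE x in lborel. norm (q n x) \<le> indicator (cball 0 (R + 1)) x *\<^sub>R C" for n
    proof (rule AE_I2)
      fix x :: "real^4"
      show "norm (q n x) \<le> indicator (cball 0 (R + 1)) x *\<^sub>R C"
      proof (cases "norm x \<le> R + 1")
        case True
        have "norm (f (h n *\<^sub>R ?e + x) - f x) \<le> C * h n" using C(2)[of "h n *\<^sub>R ?e + x" x] h[of n] by simp
        then show ?thesis using True h[of n] by (simp add: q_def divide_le_eq)
      next
        case False
        moreover have "norm x \<le> norm (h n *\<^sub>R ?e + x) + norm (h n *\<^sub>R ?e)"
          using norm_triangle_ineq4[of "h n *\<^sub>R ?e + x" "h n *\<^sub>R ?e"] by (simp only: add_diff_cancel_left')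
        ultimately have "f (h n *\<^sub>R ?e + x) = 0" "f x = 0" using h[of n] by (auto intro!: R)
        then show ?thesis using C(1) by (simp add: q_def)
      qed
    qed
    show "AE x in lborel. (\<lambda>n. q n x) \<longlonglongrightarrow> pd f k x"
    proof (rule AE_I2)
      fix x
      have "((\<lambda>s. f (x + s *\<^sub>R ?e)) has_real_derivative pd f k x) (at 0)"
        using line_deriv[OF f(1), of x k 0] by simp
      then have "((\<lambda>s. (f (x + s *\<^sub>R ?e) - f x) / s) \<longlongrightarrow> pd f k x) (at 0)"
        by (simp add: DERIV_def)
      moreover have "filterlim h (at 0) sequentially"
        using h0 h by (auto simp: filterlim_at h_def intro!: always_eventually)
      ultimately have "((\<lambda>n. (f (x + h n *\<^sub>R ?e) - f x) / h n) \<longlonglongrightarrow> pd f k x)"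
        by (rule filterlim_compose)
      then show "(\<lambda>n. q n x) \<longlonglongrightarrow> pd f k x" by (simp add: q_def add.commute)
    qed
  qed
  then show ?thesis using q0 by (simp add: LIMSEQ_const_iff)
qed

section \<open>A smooth bump function and mollifiers with scale-invariant bounds\<close>

section \<open>Bump functions and mollifiers\<close>

text \<open>For t > 0 the n-th derivative of exp (-1/t) is P_n(1/t) exp (-1/t), and the chain rule
  gives P_{n+1}(s) = s^2 (P_n(s) - P_n'(s)) with P_0 = 1.\<close>

definition flat_poly :: "nat \<Rightarrow> real poly" where
  "flat_poly n = ((\<lambda>p. monom 1 2 * (p - pderiv p)) ^^ n) 1"

definition flat_exp :: "nat \<Rightarrow> real \<Rightarrow> real" where
  "flat_exp n t = (if t > 0 then poly (flat_poly n) (1 / t) * exp (- (1 / t)) else 0)"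

lemma poly_mult_exp_tendsto_0: "((\<lambda>s. poly p s * exp (- s)) \<longlongrightarrow> (0::real)) at_top"
proof -
  have "((\<lambda>s. \<Sum>i\<le>degree p. coeff p i * (s ^ i / exp s)) \<longlongrightarrow> (\<Sum>i\<le>degree p. coeff p i * 0)) at_top"
    by (intro tendsto_sum tendsto_mult tendsto_const tendsto_power_div_exp_0)
  then show ?thesis
    by (simp add: poly_altdef sum_distrib_right exp_minus divide_inverse mult.assoc)
qed

text \<open>Away from 0 this is the recursion of \<open>flat_poly\<close>. At 0 the right difference
  quotient is a polynomial in 1/t times exp (-1/t) and tends to 0. The result is the chain of
  derivatives that \<open>smooth_comp_real\<close> asks for.\<close>

lemma flat_exp_deriv: "(flat_exp n has_real_derivative flat_exp (Suc n) t) (at t)"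
proof (cases t "0::real" rule: linorder_cases)
  case less
  have "((\<lambda>t. 0) has_real_derivative 0) (at t)" by simp
  then have "(flat_exp n has_real_derivative 0) (at t)"
    by (rule has_field_derivative_transform_within_open[of _ _ _ "{..<0}"])
      (use less in \<open>auto simp: flat_exp_def\<close>)
  then show ?thesis using less by (simp add: flat_exp_def)
next
  case greater
  let ?p = "flat_poly n"
  have "((\<lambda>t. poly ?p (1 / t) * exp (- (1 / t))) has_real_derivative
     (poly (pderiv ?p) (1/t) * (- 1 / t\<^sup>2) * exp (- (1 / t)) + poly ?p (1/t) * (exp (- (1/t)) * (1 / t\<^sup>2)))) (at t)"
    using greater by (auto intro!: derivative_eq_intros simp: power2_eq_square)
  also have "poly (pderiv ?p) (1/t) * (- 1 / t\<^sup>2) * exp (- (1 / t)) + poly ?p (1/t) * (exp (- (1/t)) * (1 / t\<^sup>2))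
     = flat_exp (Suc n) t"
    using greater by (simp add: flat_exp_def flat_poly_def poly_monom field_simps)
  finally have "((\<lambda>t. poly ?p (1 / t) * exp (- (1 / t))) has_real_derivative flat_exp (Suc n) t) (at t)" .
  then show ?thesis
    by (rule has_field_derivative_transform_within_open[of _ _ _ "{0<..}"])
      (use greater in \<open>auto simp: flat_exp_def\<close>)
next
  case equal
  have l: "((\<lambda>s. flat_exp n s / s) \<longlongrightarrow> 0) (at_left 0)"
    by (rule tendsto_eventually) (auto simp: eventually_at_filter flat_exp_def)
  have "((\<lambda>s. poly (pCons 0 (flat_poly n)) (inverse s) * exp (- inverse s)) \<longlongrightarrow> 0) (at_right 0)"
    by (rule filterlim_compose[OF poly_mult_exp_tendsto_0 filterlim_inverse_at_top_right])
  then have r: "((\<lambda>s. flat_exp n s / s) \<longlongrightarrow> 0) (at_right 0)"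
    by (rule Lim_transform_eventually)
      (auto simp: eventually_at_filter flat_exp_def field_simps)
  have "((\<lambda>s. flat_exp n s / s) \<longlongrightarrow> 0) (at 0)"
    using l r by (simp add: filterlim_split_at)
  then show ?thesis using equal by (simp add: DERIV_def flat_exp_def)
qed

definition bump :: "real^4 \<Rightarrow> real" where
  "bump x = flat_exp 0 (1 - x \<bullet> x)"

lemma flat_exp_0: "flat_exp 0 t = (if t > 0 then exp (- (1 / t)) else 0)"
  by (simp add: flat_exp_def flat_poly_def)

lemma bump_nonneg: "bump x \<ge> 0"
  by (simp add: bump_def flat_exp_0)

lemma bump_zero: "norm x \<ge> 1 \<Longrightarrow> bump x = 0"
  by (simp add: bump_def flat_exp_0 dot_square_norm one_le_power not_less)

lemma bump_pos: "norm x < 1 \<Longrightarrow> bump x > 0"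
  by (simp add: bump_def flat_exp_0 dot_square_norm abs_square_less_1)

lemma smooth_flat_exp:
  fixes f :: "real^4 \<Rightarrow> real"
  assumes "smooth_map f"
  shows "smooth_map (\<lambda>x. flat_exp 0 (f x))"
  by (rule smooth_comp_real[OF assms, where S = UNIV]) (auto intro: flat_exp_deriv)

lemma smooth_bump_scaled: "smooth_map (\<lambda>x. bump (s *\<^sub>R x))"
  unfolding bump_def by (intro smooth_flat_exp smooth_diff smooth_inner smooth_scaleR smooth_const smooth_id)

lemma smooth_bump: "smooth_map bump"
  using smooth_bump_scaled[of 1] by simp

lemma bsupp_bump: "bsupp bump"
  by (rule bsuppI[of 1]) (simp add: bump_zero)

lemma integral_bump_pos: "(\<integral>x. bump x \<partial>lborel) > 0"
proof -
  have i: "integrable lborel bump" by (rule integrable_cont_bsupp[OF smooth_cont[OF smooth_bump] bsupp_bump])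
  have "(\<integral>x. bump x \<partial>lborel) \<noteq> 0"
  proof
    assume "(\<integral>x. bump x \<partial>lborel) = 0"
    then have "AE x in lborel. bump x = 0"
      using integral_nonneg_eq_0_iff_AE[OF i] bump_nonneg by simp
    then have "AE x in lborel. x \<notin> ball (0::real^4) 1"
      by eventually_elim (use bump_pos in force)
    then have "emeasure lborel (ball (0::real^4) 1) = 0"
      by (subst (asm) AE_iff_measurable[of "ball 0 1"]) auto
    then show False using content_ball_gt_0_iff[of "0::real^4" 1] by (simp add: measure_def)
  qed
  then show ?thesis using integral_nonneg_AE[of bump lborel] bump_nonneg by (simp add: less_le)
qed

lemma integral_scale:
  fixes f :: "real^4 \<Rightarrow> real"
  assumes [measurable]: "f \<in> borel_measurable borel" and s: "s > 0"
  shows "(\<integral>x. f x \<partial>lborel) = s ^ 4 * (\<integral>x. f (s *\<^sub>R x) \<partial>lborel)"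
proof -
  have "(\<integral>x. f x \<partial>lborel) = (\<integral>x. f x \<partial>(density (distr lborel borel (\<lambda>x. 0 + s *\<^sub>R x)) (\<lambda>_. \<bar>s\<bar> ^ DIM(real^4))))"
    using s by (subst lborel_affine[of s 0]) auto
  also have "\<dots> = (\<integral>x. s ^ 4 * f x \<partial>distr lborel borel (\<lambda>x. s *\<^sub>R x))"
    using s by (subst integral_density) auto
  also have "\<dots> = s ^ 4 * (\<integral>x. f (s *\<^sub>R x) \<partial>lborel)"
    by (subst integral_distr) auto
  finally show ?thesis .
qed

text \<open>The constant \<open>C\<close> is meant to serve all scales at once: the sup norm may
  grow like the inverse fourth power of the scale and the gradient like the inverse fifth. These
  exact powers decide the commutator estimate.\<close>

definition moll :: "real \<Rightarrow> real \<Rightarrow> (real^4 \<Rightarrow> real) \<Rightarrow> bool" where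
  "moll C \<epsilon> m \<longleftrightarrow> smooth_map m \<and> (\<forall>x. norm x > \<epsilon> \<longrightarrow> m x = 0) \<and> (\<forall>x. m x \<ge> 0) \<and> (\<integral>x. m x \<partial>lborel) = 1 \<and>
     (\<forall>x. \<bar>m x\<bar> \<le> C / \<epsilon> ^ 4) \<and> (\<forall>k x. \<bar>pd m k x\<bar> \<le> C / \<epsilon> ^ 5)"

lemma mollifiers_exist: "\<exists>C>0. \<forall>\<epsilon>>0. \<exists>m. moll C \<epsilon> m"
proof -
  define I where "I = (\<integral>x. bump x \<partial>lborel)"
  have I: "I > 0" using integral_bump_pos by (simp add: I_def)
  obtain C0 where C0: "C0 \<ge> 0" "\<And>x. norm (bump x) \<le> C0"
    by (rule bounded_cont_bsupp[OF smooth_cont[OF smooth_bump] bsupp_bump]) blast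
  obtain c where c: "c \<ge> 0" "\<And>k x. x \<in> UNIV \<Longrightarrow> norm (pd bump k x) \<le> c"
    using pd_bound_bsupp[OF smooth_bump bsupp_bump] by blast
  define C where "C = C0 + c + 1"
  have CC: "C0 \<le> C" "c \<le> C" "C > 0"
    using C0(1) c(1) by (auto simp: C_def)
  have "moll (C / I) \<epsilon> (\<lambda>x. bump ((1/\<epsilon>) *\<^sub>R x) / (I * \<epsilon> ^ 4))" if e: "\<epsilon> > 0" for \<epsilon>
    unfolding moll_def
  proof (intro conjI allI impI)
    show "smooth_map (\<lambda>x. bump ((1/\<epsilon>) *\<^sub>R x) / (I * \<epsilon> ^ 4))"
      by (intro smooth_divide_const smooth_bump_scaled)
    fix x :: "real^4"
    show "bump ((1/\<epsilon>) *\<^sub>R x) / (I * \<epsilon> ^ 4) = 0" if "norm x > \<epsilon>"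
      using that e by (simp add: bump_zero)
    show "0 \<le> bump ((1/\<epsilon>) *\<^sub>R x) / (I * \<epsilon> ^ 4)"
      using e I bump_nonneg by simp
    show "\<bar>bump ((1/\<epsilon>) *\<^sub>R x) / (I * \<epsilon> ^ 4)\<bar> \<le> C / I / \<epsilon> ^ 4"
      using e I C0(2)[of "(1/\<epsilon>) *\<^sub>R x"] CC(1) by (simp add: abs_mult divide_simps mult.commute)
  next
    have "I = \<epsilon> ^ 4 * (I / \<epsilon> ^ 4)" using e by simp
    have "(\<integral>x. bump ((1/\<epsilon>) *\<^sub>R x) \<partial>lborel) = \<epsilon> ^ 4 * (\<integral>x. bump ((1/\<epsilon>) *\<^sub>R \<epsilon> *\<^sub>R x) \<partial>lborel)"
      by (rule integral_scale[OF borel_measurable_continuous_onI[OF smooth_cont[OF smooth_bump_scaled]] e])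
    also have "\<dots> = \<epsilon> ^ 4 * I" using e by (simp add: I_def)
    finally show "(\<integral>x. bump ((1/\<epsilon>) *\<^sub>R x) / (I * \<epsilon> ^ 4) \<partial>lborel) = 1" using e I by simp
  next
    fix k and x :: "real^4"
    have bl: "bounded_linear (\<lambda>x::real^4. (1/\<epsilon>) *\<^sub>R x)" by (rule bounded_linear_scaleR_right)
    have "(bump has_derivative frechet_derivative bump (at ((1/\<epsilon>) *\<^sub>R x))) (at ((1/\<epsilon>) *\<^sub>R x))"
      using smooth_diff_at[OF smooth_bump] frechet_derivative_works by blast
    from has_derivative_compose[OF bounded_linear_imp_has_derivative[OF bl] this]
    have "((\<lambda>x. bump ((1/\<epsilon>) *\<^sub>R x)) has_derivative (\<lambda>h. frechet_derivative bump (at ((1/\<epsilon>) *\<^sub>R x)) ((1/\<epsilon>) *\<^sub>R h))) (at x)" .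
    then have "((\<lambda>x. inverse (I * \<epsilon> ^ 4) * bump ((1/\<epsilon>) *\<^sub>R x)) has_derivative
        (\<lambda>h. inverse (I * \<epsilon> ^ 4) * frechet_derivative bump (at ((1/\<epsilon>) *\<^sub>R x)) ((1/\<epsilon>) *\<^sub>R h))) (at x)"
      by (rule has_derivative_mult_right)
    from pd_eq[OF this] have "pd (\<lambda>x. bump ((1/\<epsilon>) *\<^sub>R x) / (I * \<epsilon> ^ 4)) k x
       = inverse (I * \<epsilon> ^ 4) * frechet_derivative bump (at ((1/\<epsilon>) *\<^sub>R x)) ((1/\<epsilon>) *\<^sub>R axis k 1)"
      by (simp add: divide_inverse mult.commute)
    also have "frechet_derivative bump (at ((1/\<epsilon>) *\<^sub>R x)) ((1/\<epsilon>) *\<^sub>R axis k 1) = (1/\<epsilon>) * pd bump k ((1/\<epsilon>) *\<^sub>R x)"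
      using linear_cmul[OF linear_frechet_derivative[OF smooth_diff_at[OF smooth_bump]]] by (simp add: pd_def)
    finally have eq: "pd (\<lambda>x. bump ((1/\<epsilon>) *\<^sub>R x) / (I * \<epsilon> ^ 4)) k x = pd bump k ((1/\<epsilon>) *\<^sub>R x) / (I * \<epsilon> ^ 5)"
      by (simp add: divide_inverse power_Suc numeral_eq_Suc)
    have "\<bar>pd bump k ((1/\<epsilon>) *\<^sub>R x)\<bar> \<le> C" using c(2)[of "(1/\<epsilon>) *\<^sub>R x" k] CC(2) by simp
    then have "\<bar>pd bump k ((1/\<epsilon>) *\<^sub>R x)\<bar> / (I * \<epsilon> ^ 5) \<le> C / (I * \<epsilon> ^ 5)"
      by (rule divide_right_mono) (use e I in simp)
    then show "\<bar>pd (\<lambda>x. bump ((1/\<epsilon>) *\<^sub>R x) / (I * \<epsilon> ^ 4)) k x\<bar> \<le> C / I / \<epsilon> ^ 5"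
      unfolding eq using e I by (simp add: abs_mult)
  qed
  then show ?thesis using CC(3) I by (intro exI[of _ "C / I"]) auto
qed

section \<open>Convolution with a mollifier\<close>

section \<open>Convolution and the Friedrichs lemma\<close>

definition conv :: "(real^4 \<Rightarrow> real) \<Rightarrow> (real^4 \<Rightarrow> 'b::euclidean_space) \<Rightarrow> real^4 \<Rightarrow> 'b" where
  "conv m u x = (\<integral>y. m (x - y) *\<^sub>R u y \<partial>lborel)"

lemma borel_smooth: "smooth_map f \<Longrightarrow> f \<in> borel_measurable borel"
  by (rule borel_measurable_continuous_onI[OF smooth_cont])

lemma borel_shift:
  fixes m :: "real^4 \<Rightarrow> 'b::real_normed_vector"
  assumes "continuous_on UNIV m"
  shows "(\<lambda>y. m (x - y)) \<in> borel_measurable borel"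
  by (rule borel_measurable_continuous_onI, rule continuous_on_compose2[OF assms])
    (auto intro!: continuous_intros)

lemma conv_integrable:
  fixes u :: "real^4 \<Rightarrow> 'b::euclidean_space"
  assumes m: "continuous_on UNIV m" "bsupp m" and u: "integrable lborel u"
  shows "integrable lborel (\<lambda>y. m (x - y) *\<^sub>R u y)"
proof -
  obtain C where C: "C \<ge> 0" "\<And>x. norm (m x) \<le> C" by (rule bounded_cont_bsupp[OF m]) blast
  show ?thesis
  proof (rule Bochner_Integration.integrable_bound)
    show "integrable lborel (\<lambda>y. C * norm (u y))" by (rule integrable_mult_right[OF integrable_norm[OF u]])
    show "(\<lambda>y. m (x - y) *\<^sub>R u y) \<in> borel_measurable lborel"
      using borel_shift[OF m(1)] borel_measurable_integrable[OF u] by simp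
    show "AE y in lborel. norm (m (x - y) *\<^sub>R u y) \<le> norm (C * norm (u y))"
      using C(2)[of "x - _"] C(1) by (intro AE_I2) (simp add: mult_right_mono)
  qed
qed

lemma has_derivative_quadratic:
  assumes D: "bounded_linear D" and C: "\<And>v. norm (f (x + v) - f x - D v) \<le> C * (norm v)\<^sup>2"
  shows "(f has_derivative D) (at x)"
proof -
  have "((\<lambda>h. norm (f (x + h) - f x - D h) / norm h) \<longlongrightarrow> 0) (at 0)"
  proof (rule Lim_null_comparison)
    show "\<forall>\<^sub>F h in at 0. norm (norm (f (x + h) - f x - D h) / norm h) \<le> C * norm h"
    proof (rule always_eventually, rule allI)
      fix h
      show "norm (norm (f (x + h) - f x - D h) / norm h) \<le> C * norm h"
        using C[of h] by (cases "h = 0") (simp_all add: divide_le_eq power2_eq_square mult.assoc)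
    qed
    show "((\<lambda>h. C * norm h) \<longlongrightarrow> 0) (at 0)"
      by (rule tendsto_mult_right_zero[OF tendsto_norm_zero[OF tendsto_ident_at]])
  qed
  then show ?thesis using D by (simp add: has_derivative_at)
qed

text \<open>The quadratic Taylor bound for \<open>m\<close> has a uniform constant and therefore
  survives integration: the linearization error of the convolution is at most that constant times
  |v|^2 times the L1 norm of \<open>u\<close>. All derivatives fall on the mollifier, so
  \<open>u\<close> need only be integrable.\<close>

lemma conv_has_derivative:
  fixes u :: "real^4 \<Rightarrow> 'b::euclidean_space"
  assumes m: "smooth_map m" "bsupp m" and u: "integrable lborel u"
  shows "(conv m u has_derivative (\<lambda>v. \<Sum>k\<in>UNIV. v $ k *\<^sub>R conv (pd m k) u x)) (at x)"
proof -
  obtain C where C: "C \<ge> 0" "\<And>a v. \<bar>m (a + v) - m a - (\<Sum>k\<in>UNIV. v $ k * pd m k a)\<bar> \<le> C * (norm v)\<^sup>2"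
    by (rule taylor_bsupp[OF m]) blast
  have h0: "has_bochner_integral lborel (\<lambda>y. m (z - y) *\<^sub>R u y) (conv m u z)" for z
    unfolding conv_def
    by (rule has_bochner_integral_integrable[OF conv_integrable[OF smooth_cont[OF m(1)] m(2) u]])
  have h1: "has_bochner_integral lborel (\<lambda>y. pd m k (z - y) *\<^sub>R u y) (conv (pd m k) u z)" for k z
    unfolding conv_def
    by (rule has_bochner_integral_integrable[OF conv_integrable[OF smooth_cont[OF smooth_pd[OF m(1)]] bsupp_pd[OF m(2)] u]])
  show ?thesis
  proof (rule has_derivative_quadratic[where C = "C * (\<integral>y. norm (u y) \<partial>lborel)"])
    show "bounded_linear (\<lambda>v. \<Sum>k\<in>UNIV. v $ k *\<^sub>R conv (pd m k) u x)"
      by (intro bounded_linear_sum bounded_linear_scaleR_const bounded_linear_vec_nth)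
    fix v :: "real^4"
    let ?I = "\<lambda>y. (m ((x - y) + v) - m (x - y) - (\<Sum>k\<in>UNIV. v $ k * pd m k (x - y))) *\<^sub>R u y"
    have e: "x + v - y = (x - y) + v" for y by simp
    have eq: "?I = (\<lambda>y. m (x + v - y) *\<^sub>R u y - m (x - y) *\<^sub>R u y - (\<Sum>k\<in>UNIV. v $ k *\<^sub>R (pd m k (x - y) *\<^sub>R u y)))"
      unfolding e by (simp only: scaleR_left_diff_distrib scaleR_sum_left scaleR_scaleR)
    have hS: "has_bochner_integral lborel (\<lambda>y. \<Sum>k\<in>UNIV. v $ k *\<^sub>R (pd m k (x - y) *\<^sub>R u y))
        (\<Sum>k\<in>UNIV. v $ k *\<^sub>R conv (pd m k) u x)"
      by (rule has_bochner_integral_sum, rule has_bochner_integral_scaleR_right, rule h1)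
    have hI: "has_bochner_integral lborel ?I (conv m u (x + v) - conv m u x - (\<Sum>k\<in>UNIV. v $ k *\<^sub>R conv (pd m k) u x))"
      unfolding eq by (rule has_bochner_integral_diff[OF has_bochner_integral_diff[OF h0 h0] hS])
    have I: "integrable lborel ?I" by (rule integrable.intros[OF hI])
    have "norm (conv m u (x + v) - conv m u x - (\<Sum>k\<in>UNIV. v $ k *\<^sub>R conv (pd m k) u x))
        \<le> (\<integral>y. norm (?I y) \<partial>lborel)"
      unfolding has_bochner_integral_integral_eq[OF hI, symmetric] by (rule integral_norm_bound)
    also have "\<dots> \<le> (\<integral>y. C * (norm v)\<^sup>2 * norm (u y) \<partial>lborel)"
    proof (rule integral_mono)
      show "integrable lborel (\<lambda>y. norm (?I y))" by (rule integrable_norm[OF I])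
      show "integrable lborel (\<lambda>y. C * (norm v)\<^sup>2 * norm (u y))" by (rule integrable_mult_right[OF integrable_norm[OF u]])
      show "norm (?I y) \<le> C * (norm v)\<^sup>2 * norm (u y)" for y
        unfolding norm_scaleR by (rule mult_right_mono[OF C(2) norm_ge_zero])
    qed
    also have "\<dots> = C * (\<integral>y. norm (u y) \<partial>lborel) * (norm v)\<^sup>2"
      by (simp add: mult_ac)
    finally show "norm (conv m u (x + v) - conv m u x - (\<Sum>k\<in>UNIV. v $ k *\<^sub>R conv (pd m k) u x))
      \<le> C * (\<integral>y. norm (u y) \<partial>lborel) * (norm v)\<^sup>2" .
  qed
qed

lemma pd_conv:
  fixes u :: "real^4 \<Rightarrow> 'b::euclidean_space"
  assumes m: "smooth_map m" "bsupp m" and u: "integrable lborel u"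
  shows "pd (conv m u) k = conv (pd m k) u"
proof
  fix x
  have "pd (conv m u) k x = (\<Sum>j\<in>UNIV. axis k 1 $ j *\<^sub>R conv (pd m j) u x)"
    by (rule pd_eq[OF conv_has_derivative[OF assms]])
  also have "\<dots> = (\<Sum>j\<in>UNIV. if j = k then conv (pd m j) u x else 0)"
    by (rule sum.cong) (auto simp: axis_def)
  finally show "pd (conv m u) k x = conv (pd m k) u x" by simp
qed

lemma smooth_conv:
  fixes u :: "real^4 \<Rightarrow> 'b::euclidean_space"
  assumes "smooth_map m" "bsupp m" and u: "integrable lborel u"
  shows "smooth_map (conv m u)"
proof -
  have "Ckv n (conv m u)" if "smooth_map m" "bsupp m" for n m
    using that
  proof (induction n arbitrary: m)
    case 0
    have "continuous (at x) (conv m u)" for x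
      using conv_has_derivative[OF 0 u] has_derivative_continuous by blast
    then show ?case by (simp add: continuous_on_eq_continuous_at)
  next
    case (Suc n)
    have "conv m u differentiable (at x)" for x
      using conv_has_derivative[OF Suc.prems u] differentiableI by blast
    moreover have "Ckv n (pd (conv m u) k)" for k
      unfolding pd_conv[OF Suc.prems u] by (rule Suc.IH) (use Suc.prems bsupp_pd in auto)
    ultimately show ?case by simp
  qed
  then show ?thesis using assms by (simp add: smooth_map_def)
qed

lemma mollD:
  assumes "moll C \<epsilon> m"
  shows "smooth_map m" "bsupp m" "\<And>x. norm x > \<epsilon> \<Longrightarrow> m x = 0" "\<And>x. m x \<ge> 0" "(\<integral>x. m x \<partial>lborel) = 1"
    "\<And>x. \<bar>m x\<bar> \<le> C / \<epsilon> ^ 4" "\<And>k x. \<bar>pd m k x\<bar> \<le> C / \<epsilon> ^ 5" "\<And>k x. norm x > \<epsilon> \<Longrightarrow> pd m k x = 0"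
  using assms pd_zero_outside[of \<epsilon> m] unfolding moll_def bsupp_def by blast+

lemma conv_outside:
  assumes "\<And>x. norm x > \<epsilon> \<Longrightarrow> m x = 0" "\<And>x. norm x > R \<Longrightarrow> u x = 0" "norm x > R + \<epsilon>"
  shows "conv m u x = 0"
proof -
  have z: "m (x - y) *\<^sub>R u y = 0" for y
  proof (cases "norm y > R")
    case False
    have "norm (x - y) \<ge> norm x - norm y" by (rule norm_triangle_ineq2)
    then show ?thesis using False assms(1,3) by auto
  qed (use assms(2) in auto)
  show ?thesis unfolding conv_def z by simp
qed

lemma integral_reflect:
  fixes f :: "real^4 \<Rightarrow> real"
  assumes [measurable]: "f \<in> borel_measurable borel"
  shows "(\<integral>y. f (x - y) \<partial>lborel) = (\<integral>y. f y \<partial>lborel)"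
proof -
  have "(\<integral>y. f y \<partial>lborel) = (\<integral>y. f y \<partial>(density (distr lborel borel (\<lambda>y. x + (-1) *\<^sub>R y)) (\<lambda>_. ennreal (\<bar>-1\<bar> ^ DIM(real^4)))))"
    by (subst lborel_affine[of "-1" x]) auto
  also have "\<dots> = (\<integral>y. f y \<partial>distr lborel borel (\<lambda>y. x + (-1) *\<^sub>R y))"
    by (subst integral_density) auto
  also have "\<dots> = (\<integral>y. f (x - y) \<partial>lborel)"
    by (subst integral_distr) auto
  finally show ?thesis by simp
qed

text \<open>The mollifier is a probability density on a small ball and \<open>c\<close> is uniformly
  continuous, so the average of \<open>c\<close> over the ball is close to its value at the centre.
  The threshold depends on \<open>c\<close> and \<open>e\<close> only, not on the mollifier or its
  constant.\<close>

lemma conv_uniform: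
  fixes c :: "real^4 \<Rightarrow> 'b::euclidean_space"
  assumes c: "continuous_on UNIV c" "bsupp c" and e: "e > 0"
  shows "\<exists>\<delta>>0. \<forall>\<epsilon> m C. 0 < \<epsilon> \<and> \<epsilon> < \<delta> \<and> moll C \<epsilon> m \<longrightarrow> (\<forall>x. norm (conv m c x - c x) \<le> e)"
proof -
  obtain R where R: "\<And>x. norm x > R \<Longrightarrow> c x = 0" using c(2) unfolding bsupp_def by blast
  have "uniformly_continuous_on (cball 0 (R + 1)) c"
    by (rule compact_uniformly_continuous[OF continuous_on_subset[OF c(1)]]) auto
  then obtain d where d: "d > 0" "\<And>x y. x \<in> cball 0 (R + 1) \<Longrightarrow> y \<in> cball 0 (R + 1) \<Longrightarrow> dist y x < d \<Longrightarrow> dist (c y) (c x) < e"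
    unfolding uniformly_continuous_on_def using e by meson
  have close: "norm (c y - c x) \<le> e" if xy: "norm (x - y) < min d 1" for x y
  proof (cases "norm x > R + 1 \<or> norm y > R + 1")
    case True
    then have "norm x > R \<and> norm y > R"
      using xy norm_triangle_ineq2[of x y] norm_triangle_ineq2[of y x] norm_minus_commute[of x y] by linarith
    then show ?thesis using R e by simp
  next
    case False
    then have "x \<in> cball 0 (R + 1)" "y \<in> cball 0 (R + 1)" by auto
    moreover have "dist y x < d" using xy by (simp add: dist_norm norm_minus_commute)
    ultimately have "dist (c y) (c x) < e" by (rule d(2))
    then show ?thesis by (simp add: dist_norm)
  qed
  have "norm (conv m c x - c x) \<le> e" if m: "moll C \<epsilon> m" and \<epsilon>: "0 < \<epsilon>" "\<epsilon> < min d 1" for \<epsilon> m C x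
  proof -
    note M = mollD[OF m]
    have ci: "integrable lborel c" by (rule integrable_cont_bsupp[OF c])
    have mb: "continuous_on UNIV (\<lambda>y. m (x - y))"
      by (rule continuous_on_compose2[OF smooth_cont[OF M(1), of UNIV] continuous_on_diff[OF continuous_on_const continuous_on_id]]) simp
    have mi: "integrable lborel (\<lambda>y. m (x - y))"
    proof (rule integrable_cont_bsupp[OF mb])
      show "bsupp (\<lambda>y. m (x - y))"
      proof (rule bsuppI[of "norm x + \<epsilon>"])
        fix y :: "real^4" assume "norm x + \<epsilon> < norm y"
        then show "m (x - y) = 0" using norm_triangle_ineq2[of y x] by (intro M(3)) (simp add: norm_minus_commute)
      qed
    qed
    have m1: "(\<integral>y. m (x - y) \<partial>lborel) = 1"
      using integral_reflect[OF borel_smooth[OF M(1)]] M(5) by simp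
    have ici: "integrable lborel (\<lambda>y. m (x - y) *\<^sub>R c y)"
      by (rule conv_integrable[OF smooth_cont[OF M(1)] M(2) ci])
    have icx: "integrable lborel (\<lambda>y. m (x - y) *\<^sub>R c x)" by (rule integrable_scaleR_left[OF mi])
    have "conv m c x - c x = (\<integral>y. m (x - y) *\<^sub>R c y \<partial>lborel) - (\<integral>y. m (x - y) *\<^sub>R c x \<partial>lborel)"
      using m1 unfolding conv_def integral_scaleR_left[OF mi] by simp
    also have "\<dots> = (\<integral>y. m (x - y) *\<^sub>R (c y - c x) \<partial>lborel)"
      unfolding scaleR_diff_right by (rule Bochner_Integration.integral_diff[OF ici icx, symmetric])
    finally have eq: "conv m c x - c x = (\<integral>y. m (x - y) *\<^sub>R (c y - c x) \<partial>lborel)" .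
    have "norm (conv m c x - c x) \<le> (\<integral>y. norm (m (x - y) *\<^sub>R (c y - c x)) \<partial>lborel)"
      unfolding eq by (rule integral_norm_bound)
    also have "\<dots> \<le> (\<integral>y. m (x - y) * e \<partial>lborel)"
    proof (rule integral_mono)
      show "integrable lborel (\<lambda>y. norm (m (x - y) *\<^sub>R (c y - c x)))"
        using integrable_norm[OF Bochner_Integration.integrable_diff[OF ici icx]] by (simp only: scaleR_diff_right)
      show "integrable lborel (\<lambda>y. m (x - y) * e)" by (rule integrable_mult_left[OF mi])
      show "norm (m (x - y) *\<^sub>R (c y - c x)) \<le> m (x - y) * e" for y
      proof (cases "norm (x - y) > \<epsilon>")
        case False
        then have "norm (c y - c x) \<le> e" using \<epsilon> by (intro close) auto
        then show ?thesis using mult_left_mono[OF _ M(4)[of "x - y"]] M(4)[of "x - y"] by simp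
      qed (use M(3) in auto)
    qed
    also have "\<dots> = e" using m1 by simp
    finally show ?thesis .
  qed
  then have "\<forall>\<epsilon> m C. 0 < \<epsilon> \<and> \<epsilon> < min d 1 \<and> moll C \<epsilon> m \<longrightarrow> (\<forall>x. norm (conv m c x - c x) \<le> e)"
    by (intro allI impI) (elim conjE, assumption)
  moreover have "min d 1 > 0" using d(1) by simp
  ultimately show ?thesis by (intro exI conjI)
qed

section \<open>Square norms, Schur's test and smooth approximation in L2\<close>

definition N2 :: "(real^4 \<Rightarrow> 'b::euclidean_space) \<Rightarrow> ennreal" where
  "N2 f = (\<integral>\<^sup>+x. ennreal ((norm (f x))\<^sup>2) \<partial>lborel)"

lemma norm_add_sq: "(norm (a + b))\<^sup>2 \<le> 2 * (norm a)\<^sup>2 + 2 * (norm (b::'b::real_normed_vector))\<^sup>2"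
proof -
  have "(norm (a + b))\<^sup>2 \<le> (norm a + norm b)\<^sup>2" by (rule power_mono[OF norm_triangle_ineq]) simp
  also have "\<dots> \<le> 2 * (norm a)\<^sup>2 + 2 * (norm b)\<^sup>2"
    using sum_squares_bound[of "norm a" "norm b"] by (simp add: power2_sum)
  finally show ?thesis .
qed

lemma weighted_N2_add:
  assumes [measurable]: "f \<in> borel_measurable borel" "g \<in> borel_measurable borel" "W \<in> borel_measurable borel"
    and W: "\<And>x. W x \<ge> 0"
  shows "(\<integral>\<^sup>+x. ennreal (W x * (norm (f x + g x :: 'b::euclidean_space))\<^sup>2) \<partial>(lborel :: (real^4) measure))
    \<le> 2 * (\<integral>\<^sup>+x. ennreal (W x * (norm (f x))\<^sup>2) \<partial>lborel) + 2 * (\<integral>\<^sup>+x. ennreal (W x * (norm (g x))\<^sup>2) \<partial>lborel)"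
proof -
  have "(\<integral>\<^sup>+x. ennreal (W x * (norm (f x + g x))\<^sup>2) \<partial>lborel)
     \<le> (\<integral>\<^sup>+x. 2 * ennreal (W x * (norm (f x))\<^sup>2) + 2 * ennreal (W x * (norm (g x))\<^sup>2) \<partial>lborel)"
  proof (rule nn_integral_mono)
    fix x
    have "W x * (norm (f x + g x))\<^sup>2 \<le> 2 * (W x * (norm (f x))\<^sup>2) + 2 * (W x * (norm (g x))\<^sup>2)"
      using mult_left_mono[OF norm_add_sq[of "f x" "g x"] W[of x]] by (simp add: algebra_simps)
    then have "ennreal (W x * (norm (f x + g x))\<^sup>2) \<le> ennreal (2 * (W x * (norm (f x))\<^sup>2) + 2 * (W x * (norm (g x))\<^sup>2))"
      by (rule ennreal_leI)
    also have "\<dots> = 2 * ennreal (W x * (norm (f x))\<^sup>2) + 2 * ennreal (W x * (norm (g x))\<^sup>2)"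
      using W[of x] by (simp add: ennreal_plus ennreal_mult')
    finally show "ennreal (W x * (norm (f x + g x))\<^sup>2) \<le> 2 * ennreal (W x * (norm (f x))\<^sup>2) + 2 * ennreal (W x * (norm (g x))\<^sup>2)" .
  qed
  also have "\<dots> = 2 * (\<integral>\<^sup>+x. ennreal (W x * (norm (f x))\<^sup>2) \<partial>lborel) + 2 * (\<integral>\<^sup>+x. ennreal (W x * (norm (g x))\<^sup>2) \<partial>lborel)"
    by (subst nn_integral_add) (auto simp: nn_integral_cmult)
  finally show ?thesis .
qed

lemma N2_add:
  assumes "f \<in> borel_measurable borel" "g \<in> borel_measurable borel"
  shows "N2 (\<lambda>x. f x + g x) \<le> 2 * N2 f + 2 * N2 g"
  using weighted_N2_add[OF assms, of "\<lambda>_. 1"] by (simp add: N2_def)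

lemma N2_uniform:
  assumes "\<And>x. norm (f x) \<le> e" "\<And>x. norm x > R \<Longrightarrow> f x = 0"
  shows "N2 f \<le> ennreal (e\<^sup>2) * emeasure lborel (cball (0::real^4) R)"
proof -
  have "N2 f \<le> (\<integral>\<^sup>+x. ennreal (e\<^sup>2) * indicator (cball (0::real^4) R) x \<partial>lborel)"
    unfolding N2_def
  proof (rule nn_integral_mono)
    fix x :: "real^4"
    have "(norm (f x))\<^sup>2 \<le> e\<^sup>2" using assms(1)[of x] by (intro power_mono) auto
    then show "ennreal ((norm (f x))\<^sup>2) \<le> ennreal (e\<^sup>2) * indicator (cball 0 R) x"
      using assms(2)[of x] by (cases "norm x > R") (auto simp: indicator_def ennreal_leI)
  qed
  also have "\<dots> = ennreal (e\<^sup>2) * emeasure lborel (cball (0::real^4) R)"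
    by (subst nn_integral_cmult_indicator) auto
  finally show ?thesis .
qed

text \<open>Schur's test for a kernel of size K / \<epsilon>^4 supported within distance \<epsilon>
  of the diagonal. Cauchy-Schwarz contributes one volume of the \<epsilon>-ball and Fubini a second
  one; that volume is proportional to \<epsilon>^4, so all powers of \<epsilon> cancel.\<close>

lemma schur_bound:
  fixes F :: "real^4 \<Rightarrow> 'b::euclidean_space" and w :: "real^4 \<Rightarrow> real"
  assumes w[measurable]: "w \<in> borel_measurable borel" and w0: "\<And>x. w x \<ge> 0" and \<epsilon>: "\<epsilon> > 0" and K: "K \<ge> 0"
    and F: "\<And>x. ennreal (norm (F x)) \<le> ennreal (K / \<epsilon> ^ 4) * (\<integral>\<^sup>+y. (if dist x y \<le> \<epsilon> then ennreal (w y) else 0) \<partial>lborel)"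
  shows "N2 F \<le> ennreal ((K * unit_ball_vol 4)\<^sup>2) * (\<integral>\<^sup>+x. ennreal ((w x)\<^sup>2) \<partial>lborel)"
proof -
  define V where "V = unit_ball_vol 4 * \<epsilon> ^ 4"
  have V0: "V \<ge> 0" using \<epsilon> by (simp add: V_def)
  have ball: "(\<integral>\<^sup>+y. (if dist x y \<le> \<epsilon> then 1 else 0) \<partial>lborel) = ennreal V" for x :: "real^4"
  proof -
    have "(\<integral>\<^sup>+y. (if dist x y \<le> \<epsilon> then 1 else 0) \<partial>lborel) = (\<integral>\<^sup>+y. indicator (cball x \<epsilon>) y \<partial>lborel)"
      by (rule nn_integral_cong) (auto simp: indicator_def)
    also have "\<dots> = ennreal V" using \<epsilon> by (simp add: emeasure_cball V_def)
    finally show ?thesis .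
  qed
  define A where "A x = (\<integral>\<^sup>+y. (if dist x y \<le> \<epsilon> then ennreal (w y) else 0) \<partial>lborel)" for x
  define A2 where "A2 x = (\<integral>\<^sup>+y. (if dist x y \<le> \<epsilon> then ennreal ((w y)\<^sup>2) else 0) \<partial>lborel)" for x
  have cs: "(A x)\<^sup>2 \<le> ennreal V * A2 x" for x
  proof -
    have "(\<integral>\<^sup>+y. (if dist x y \<le> \<epsilon> then 1 else 0) * (if dist x y \<le> \<epsilon> then ennreal (w y) else 0) \<partial>lborel)\<^sup>2
      \<le> (\<integral>\<^sup>+y. (if dist x y \<le> \<epsilon> then 1 else 0)\<^sup>2 \<partial>lborel) * (\<integral>\<^sup>+y. (if dist x y \<le> \<epsilon> then ennreal (w y) else 0)\<^sup>2 \<partial>lborel)"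
      by (rule Cauchy_Schwarz_nn_integral) measurable
    moreover have "(\<integral>\<^sup>+y. (if dist x y \<le> \<epsilon> then 1 else 0) * (if dist x y \<le> \<epsilon> then ennreal (w y) else 0) \<partial>lborel) = A x"
      unfolding A_def by (rule nn_integral_cong) auto
    moreover have "(\<integral>\<^sup>+y. (if dist x y \<le> \<epsilon> then 1 else 0)\<^sup>2 \<partial>lborel) = ennreal V"
      unfolding ball[of x, symmetric] by (rule nn_integral_cong) auto
    moreover have "(\<integral>\<^sup>+y. (if dist x y \<le> \<epsilon> then ennreal (w y) else 0)\<^sup>2 \<partial>lborel) = A2 x"
      unfolding A2_def by (rule nn_integral_cong) (auto simp: ennreal_power w0)
    ultimately show ?thesis by simp
  qed
  have A2: "(\<integral>\<^sup>+x. A2 x \<partial>lborel) = ennreal V * (\<integral>\<^sup>+y. ennreal ((w y)\<^sup>2) \<partial>lborel)"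
  proof -
    have "(\<integral>\<^sup>+x. A2 x \<partial>lborel) = (\<integral>\<^sup>+y. \<integral>\<^sup>+x. (if dist x y \<le> \<epsilon> then ennreal ((w y)\<^sup>2) else 0) \<partial>lborel \<partial>lborel)"
      unfolding A2_def by (rule lborel_pair.Fubini') measurable
    also have "\<dots> = (\<integral>\<^sup>+y. ennreal V * ennreal ((w y)\<^sup>2) \<partial>lborel)"
    proof (rule nn_integral_cong)
      fix y :: "real^4"
      have "(\<integral>\<^sup>+x. (if dist x y \<le> \<epsilon> then ennreal ((w y)\<^sup>2) else 0) \<partial>lborel)
         = (\<integral>\<^sup>+x. (if dist y x \<le> \<epsilon> then 1 else 0) * ennreal ((w y)\<^sup>2) \<partial>lborel)"
        by (rule nn_integral_cong) (auto simp: dist_commute)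
      also have "\<dots> = ennreal V * ennreal ((w y)\<^sup>2)"
        by (subst nn_integral_multc) (auto simp: ball)
      finally show "(\<integral>\<^sup>+x. (if dist x y \<le> \<epsilon> then ennreal ((w y)\<^sup>2) else 0) \<partial>lborel) = ennreal V * ennreal ((w y)\<^sup>2)" .
    qed
    also have "\<dots> = ennreal V * (\<integral>\<^sup>+y. ennreal ((w y)\<^sup>2) \<partial>lborel)"
      by (subst nn_integral_cmult) auto
    finally show ?thesis .
  qed
  have [measurable]: "A2 \<in> borel_measurable borel"
    unfolding A2_def by measurable
  have K0: "K / \<epsilon> ^ 4 \<ge> 0" using K \<epsilon> by simp
  have "N2 F \<le> (\<integral>\<^sup>+x. ennreal ((K / \<epsilon> ^ 4)\<^sup>2 * V) * A2 x \<partial>lborel)"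
    unfolding N2_def
  proof (rule nn_integral_mono)
    fix x
    have "ennreal ((norm (F x))\<^sup>2) = (ennreal (norm (F x)))\<^sup>2" by (simp add: ennreal_power)
    also have "\<dots> \<le> (ennreal (K / \<epsilon> ^ 4) * A x)\<^sup>2" using F[of x] unfolding A_def by (rule power_mono) simp
    also have "\<dots> = ennreal ((K / \<epsilon> ^ 4)\<^sup>2) * (A x)\<^sup>2" using K0 by (simp add: power_mult_distrib ennreal_power)
    also have "\<dots> \<le> ennreal ((K / \<epsilon> ^ 4)\<^sup>2) * (ennreal V * A2 x)" by (rule mult_left_mono[OF cs]) simp
    also have "\<dots> = ennreal ((K / \<epsilon> ^ 4)\<^sup>2 * V) * A2 x" using V0 by (simp add: ennreal_mult' mult.assoc)
    finally show "ennreal ((norm (F x))\<^sup>2) \<le> ennreal ((K / \<epsilon> ^ 4)\<^sup>2 * V) * A2 x" .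
  qed
  also have "\<dots> = ennreal ((K / \<epsilon> ^ 4)\<^sup>2 * V) * (ennreal V * (\<integral>\<^sup>+y. ennreal ((w y)\<^sup>2) \<partial>lborel))"
    by (subst nn_integral_cmult) (auto simp: A2)
  also have "\<dots> = ennreal ((K / \<epsilon> ^ 4)\<^sup>2 * V * V) * (\<integral>\<^sup>+y. ennreal ((w y)\<^sup>2) \<partial>lborel)"
    using V0 by (simp add: ennreal_mult' mult.assoc)
  also have "(K / \<epsilon> ^ 4)\<^sup>2 * V * V = (K / \<epsilon> ^ 4 * V)\<^sup>2"
    by (simp add: power2_eq_square mult_ac)
  also have "K / \<epsilon> ^ 4 * V = K * unit_ball_vol 4"
    using \<epsilon> by (simp add: V_def)
  finally show ?thesis .
qed

lemma integrable_L2_bsupp: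
  fixes u :: "real^4 \<Rightarrow> 'b::euclidean_space"
  assumes [measurable]: "u \<in> borel_measurable borel" and R: "\<And>x. norm x > R \<Longrightarrow> u x = 0" and n: "N2 u < \<infinity>"
  shows "integrable lborel u"
proof (rule integrableI_bounded)
  have "(\<integral>\<^sup>+x. ennreal (norm (u x)) \<partial>lborel) \<le> (\<integral>\<^sup>+x. indicator (cball 0 R) x + ennreal ((norm (u x))\<^sup>2) \<partial>lborel)"
  proof (rule nn_integral_mono)
    fix x
    have "norm (u x) \<le> 1 + (norm (u x))\<^sup>2"
      using sum_squares_bound[of "norm (u x)" 1] norm_ge_zero[of "u x"]
      unfolding power_one mult_1_right by linarith
    then have "ennreal (norm (u x)) \<le> ennreal (1 + (norm (u x))\<^sup>2)" by (rule ennreal_leI)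
    also have "\<dots> = 1 + ennreal ((norm (u x))\<^sup>2)" by (subst ennreal_plus) auto
    finally show "ennreal (norm (u x)) \<le> indicator (cball 0 R) x + ennreal ((norm (u x))\<^sup>2)"
      using R[of x] by (cases "norm x > R") (simp_all add: indicator_def)
  qed
  also have "\<dots> = emeasure lborel (cball (0::real^4) R) + N2 u"
    by (subst nn_integral_add) (auto simp: N2_def intro!: borel_measurable_indicator)
  also have "\<dots> < \<infinity>" using n emeasure_bounded_finite[of "cball (0::real^4) R"] by simp
  finally show "(\<integral>\<^sup>+x. ennreal (norm (u x)) \<partial>lborel) < \<infinity>" .
qed simp

text \<open>The Bochner integral of a non-integrable function is 0 by convention, so the bound holds
  without an integrability hypothesis.\<close>

lemma integral_norm_bound_ennreal_gen:
  fixes f :: "_ \<Rightarrow> _::{banach, second_countable_topology}"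
  shows "ennreal (norm (\<integral>x. f x \<partial>M)) \<le> (\<integral>\<^sup>+x. ennreal (norm (f x)) \<partial>M)"
  by (cases "integrable M f") (simp_all add: integral_norm_bound_ennreal not_integrable_integral_eq)

lemma conv_L2:
  fixes u :: "real^4 \<Rightarrow> 'b::euclidean_space"
  assumes u[measurable]: "u \<in> borel_measurable borel" and m: "moll C \<epsilon> m" and C: "C \<ge> 0" and \<epsilon>: "\<epsilon> > 0"
  shows "N2 (conv m u) \<le> ennreal ((C * unit_ball_vol 4)\<^sup>2) * N2 u"
proof -
  note M = mollD[OF m]
  have "ennreal (norm (conv m u x)) \<le> ennreal (C / \<epsilon> ^ 4) * (\<integral>\<^sup>+y. (if dist x y \<le> \<epsilon> then ennreal (norm (u y)) else 0) \<partial>lborel)" for x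
  proof -
    have "ennreal (norm (conv m u x)) \<le> (\<integral>\<^sup>+y. ennreal (norm (m (x - y) *\<^sub>R u y)) \<partial>lborel)"
      unfolding conv_def by (rule integral_norm_bound_ennreal_gen)
    also have "\<dots> \<le> (\<integral>\<^sup>+y. ennreal (C / \<epsilon> ^ 4) * (if dist x y \<le> \<epsilon> then ennreal (norm (u y)) else 0) \<partial>lborel)"
    proof (rule nn_integral_mono)
      fix y
      show "ennreal (norm (m (x - y) *\<^sub>R u y)) \<le> ennreal (C / \<epsilon> ^ 4) * (if dist x y \<le> \<epsilon> then ennreal (norm (u y)) else 0)"
      proof (cases "dist x y \<le> \<epsilon>")
        case True
        have "norm (m (x - y) *\<^sub>R u y) \<le> C / \<epsilon> ^ 4 * norm (u y)"
          using mult_right_mono[OF M(6)[of "x - y"] norm_ge_zero[of "u y"]] by simp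
        then have "ennreal (norm (m (x - y) *\<^sub>R u y)) \<le> ennreal (C / \<epsilon> ^ 4 * norm (u y))" by (rule ennreal_leI)
        also have "\<dots> = ennreal (C / \<epsilon> ^ 4) * ennreal (norm (u y))" using C \<epsilon> by (intro ennreal_mult) auto
        finally show ?thesis using True by simp
      next
        case False
        then show ?thesis using M(3)[of "x - y"] by (simp add: dist_norm)
      qed
    qed
    also have "\<dots> = ennreal (C / \<epsilon> ^ 4) * (\<integral>\<^sup>+y. (if dist x y \<le> \<epsilon> then ennreal (norm (u y)) else 0) \<partial>lborel)"
      by (rule nn_integral_cmult) measurable
    finally show ?thesis .
  qed
  from schur_bound[OF _ _ \<epsilon> C this] show ?thesis by (simp add: N2_def)
qed

lemma N2_minus_commute: "N2 (\<lambda>x. f x - g x) = N2 (\<lambda>x. g x - f x)"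
  by (simp add: N2_def norm_minus_commute)

lemma N2_tendsto_0:
  fixes U :: "nat \<Rightarrow> real^4 \<Rightarrow> 'b::euclidean_space"
  assumes [measurable]: "\<And>n. U n \<in> borel_measurable borel" "w \<in> borel_measurable borel"
    and b: "\<And>n x. (norm (U n x))\<^sup>2 \<le> w x" and w: "(\<integral>\<^sup>+x. ennreal (w x) \<partial>lborel) < \<infinity>"
    and lim: "AE x in lborel. (\<lambda>n. U n x) \<longlonglongrightarrow> 0"
  shows "(\<lambda>n. N2 (U n)) \<longlonglongrightarrow> 0"
proof -
  have "(\<lambda>n. N2 (U n)) \<longlonglongrightarrow> (\<integral>\<^sup>+x. 0 \<partial>(lborel :: (real^4) measure))"
    unfolding N2_def
  proof (rule nn_integral_dominated_convergence[where w = "\<lambda>x. ennreal (w x)"])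
    show "AE x in lborel. ennreal ((norm (U j x))\<^sup>2) \<le> ennreal (w x)" for j
      by (intro AE_I2 ennreal_leI b)
    show "AE x in lborel. (\<lambda>n. ennreal ((norm (U n x))\<^sup>2)) \<longlonglongrightarrow> 0"
      using lim
    proof eventually_elim
      case (elim x)
      have "(\<lambda>n. (norm (U n x))\<^sup>2) \<longlonglongrightarrow> 0\<^sup>2"
        by (intro tendsto_power tendsto_norm_zero elim)
      then have "(\<lambda>n. ennreal ((norm (U n x))\<^sup>2)) \<longlonglongrightarrow> ennreal (0\<^sup>2)" by (rule tendsto_ennrealI)
      then show ?case by simp
    qed
  qed (use w in auto)
  then show ?thesis by simp
qed

lemma N2_eventually_small:
  assumes "(\<lambda>n. N2 (U n)) \<longlonglongrightarrow> 0" "e > (0::real)"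
  shows "\<exists>n. N2 (U n) < ennreal e"
proof -
  have "0 < ennreal e" using assms(2) by simp
  from order_tendstoD(2)[OF assms(1) this] show ?thesis
    by (rule eventually_happens'[OF sequentially_bot])
qed

text \<open>Values of norm above n are replaced by 0; dominated convergence with |u|^2 as dominating
  function gives convergence in L2.\<close>

lemma L2_approx_bounded:
  fixes u :: "real^4 \<Rightarrow> 'b::euclidean_space"
  assumes u: "u \<in> borel_measurable borel" and R: "\<And>x. norm x > R \<Longrightarrow> u x = 0" "R \<ge> 0" and e: "e > 0"
  shows "\<exists>U. (\<forall>n. U n \<in> borel_measurable borel \<and> (\<forall>x. norm (U n x) \<le> real n \<and> (norm x > R \<longrightarrow> U n x = 0))) \<and>
     (N2 u < \<infinity> \<longrightarrow> (\<lambda>n. N2 (\<lambda>x. u x - U n x)) \<longlonglongrightarrow> 0)"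
proof -
  define U where "U n x = (if norm (u x) \<le> real n then u x else 0)" for n x
  have m[measurable]: "U n \<in> borel_measurable borel" for n
    unfolding U_def using u by measurable
  note u[measurable]
  have "norm (U n x) \<le> real n" "norm x > R \<Longrightarrow> U n x = 0" for n x
    using R(1)[of x] by (auto simp: U_def)
  moreover have "(\<lambda>n. N2 (\<lambda>x. u x - U n x)) \<longlonglongrightarrow> 0" if n: "N2 u < \<infinity>"
  proof (rule N2_tendsto_0[where w = "\<lambda>x. (norm (u x))\<^sup>2"])
    show "AE x in lborel. (\<lambda>n. u x - U n x) \<longlonglongrightarrow> 0"
    proof (rule AE_I2)
      fix x
      have "eventually (\<lambda>n. norm (u x) \<le> real n) sequentially"
      proof -
        obtain N where "norm (u x) \<le> real N" using real_arch_simple by blast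
        then have "norm (u x) \<le> real n" if "n \<ge> N" for n using that by linarith
        then show ?thesis by (rule eventually_sequentiallyI)
      qed
      then have "eventually (\<lambda>n. u x - U n x = 0) sequentially"
        by eventually_elim (simp add: U_def)
      then show "(\<lambda>n. u x - U n x) \<longlonglongrightarrow> 0" by (rule tendsto_eventually)
    qed
    show "(norm (u x - U n x))\<^sup>2 \<le> (norm (u x))\<^sup>2" for n x
      by (simp add: U_def)
    show "(\<integral>\<^sup>+x. ennreal ((norm (u x))\<^sup>2) \<partial>lborel) < \<infinity>" using n by (simp add: N2_def)
  qed measurable
  ultimately show ?thesis using m by (intro exI[of _ U]) blast
qed

text \<open>A measurable function is almost everywhere a limit of continuous functions. Retracting
  these to a ball of values and multiplying by a cutoff in space supplies a dominating function,
  hence convergence in L2.\<close>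

lemma L2_approx_continuous:
  fixes u :: "real^4 \<Rightarrow> 'b::euclidean_space"
  assumes u[measurable]: "u \<in> borel_measurable borel" and R: "\<And>x. norm x > R \<Longrightarrow> u x = 0"
    and b: "\<And>x. norm (u x) \<le> b" "b \<ge> 0" and e: "e > 0"
  shows "\<exists>c. continuous_on UNIV c \<and> (\<forall>x. norm x > R + 1 \<longrightarrow> c x = 0) \<and> N2 (\<lambda>x. u x - c x) < ennreal e"
proof -
  have "u \<in> borel_measurable lebesgue"
    using u by (intro measurable_completion) simp
  then have "u measurable_on UNIV" by (rule lebesgue_measurable_imp_measurable_on) simp
  then obtain N g where N: "negligible N" and g: "\<And>n. continuous_on UNIV (g n)"
    and lim: "\<And>x. x \<notin> N \<Longrightarrow> (\<lambda>n. g n x) \<longlonglongrightarrow> u x"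
    unfolding measurable_on_def by auto
  define clamp where "clamp y = (b / max b (norm y)) *\<^sub>R y" for y :: 'b
  \<comment> \<open>Radial retraction onto the ball of radius b + 1. It fixes every value of
    \<open>u\<close>, and the added 1 keeps the denominator positive even for b = 0.\<close>
  define clamp1 where "clamp1 y = ((b + 1) / max (b + 1) (norm y)) *\<^sub>R y" for y :: 'b
  define cut where "cut x = max 0 (min 1 (R + 1 - norm x))" for x :: "real^4"
  define c where "c n x = cut x *\<^sub>R clamp1 (g n x)" for n x
  have clampc: "continuous_on UNIV clamp1"
    unfolding clamp1_def using b(2) by (intro continuous_intros) (auto simp: max_def)
  have clampb: "norm (clamp1 y) \<le> b + 1" for y
    using b(2) by (auto simp: clamp1_def max_def divide_le_eq)
  have clampu: "clamp1 (u x) = u x" for x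
    using b(1)[of x] b(2) by (auto simp: clamp1_def max_def)
  have cutb: "0 \<le> cut x" "cut x \<le> 1" for x by (auto simp: cut_def)
  have cutc: "continuous_on UNIV cut" unfolding cut_def by (intro continuous_intros)
  have cutu: "cut x *\<^sub>R u x = u x" for x
    using R[of x] by (cases "norm x > R") (auto simp: cut_def)
  have cutz: "cut x = 0" if "norm x > R + 1" for x using that by (simp add: cut_def)
  have cc: "continuous_on UNIV (c n)" for n
  proof -
    have "continuous_on UNIV (\<lambda>x. clamp1 (g n x))"
      by (rule continuous_on_compose2[OF clampc g]) simp
    then show ?thesis unfolding c_def by (intro continuous_on_scaleR cutc)
  qed
  note cm[measurable] = borel_measurable_continuous_onI[OF cc]
  have cb: "norm (c n x) \<le> b + 1" for n x
    using mult_mono[OF cutb(2)[of x] clampb[of "g n x"]] cutb(1)[of x] b(2) by (simp add: c_def)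
  have cz: "c n x = 0" if "norm x > R + 1" for n x using cutz[OF that] by (simp add: c_def)
  have "(\<lambda>n. N2 (\<lambda>x. u x - c n x)) \<longlonglongrightarrow> 0"
  proof (rule N2_tendsto_0[where w = "\<lambda>x. (2 * b + 1)\<^sup>2 * indicator (cball 0 (R + 1)) x"])
    show "(norm (u x - c n x))\<^sup>2 \<le> (2 * b + 1)\<^sup>2 * indicator (cball 0 (R + 1)) x" for n x
    proof (cases "norm x > R + 1")
      case True
      then show ?thesis using R[of x] cz[of x n] by (simp add: indicator_def)
    next
      case False
      have "norm (u x - c n x) \<le> norm (u x) + norm (c n x)" by (rule norm_triangle_ineq4)
      also have "\<dots> \<le> 2 * b + 1" using b(1)[of x] cb[of n x] by simp
      finally show ?thesis using False by (simp add: indicator_def power_mono)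
    qed
    have "(\<integral>\<^sup>+x. ennreal ((2 * b + 1)\<^sup>2 * indicator (cball (0::real^4) (R + 1)) x) \<partial>lborel)
      = (\<integral>\<^sup>+x. ennreal ((2 * b + 1)\<^sup>2) * indicator (cball (0::real^4) (R + 1)) x \<partial>lborel)"
      by (rule nn_integral_cong) (simp add: indicator_def)
    also have "\<dots> = ennreal ((2 * b + 1)\<^sup>2) * emeasure lborel (cball (0::real^4) (R + 1))"
      by (rule nn_integral_cmult_indicator) simp
    also have "\<dots> < \<infinity>"
      using emeasure_bounded_finite[of "cball (0::real^4) (R + 1)"] by (simp add: ennreal_mult_less_top)
    finally show "(\<integral>\<^sup>+x. ennreal ((2 * b + 1)\<^sup>2 * indicator (cball (0::real^4) (R + 1)) x) \<partial>lborel) < \<infinity>" .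
    have "AE x in lebesgue. x \<notin> N" using N by (simp add: negligible_iff_null_sets AE_not_in)
    then have "AE x in lborel. x \<notin> N" by (simp add: AE_completion_iff)
    show "(\<lambda>x. (2 * b + 1)\<^sup>2 * indicator (cball (0::real^4) (R + 1)) x) \<in> borel_measurable borel"
      by (intro borel_measurable_times borel_measurable_const borel_measurable_indicator) simp
    from \<open>AE x in lborel. x \<notin> N\<close> show "AE x in lborel. (\<lambda>n. u x - c n x) \<longlonglongrightarrow> 0"
    proof eventually_elim
      case (elim x)
      have "isCont clamp1 (u x)" using clampc by (simp add: continuous_on_eq_continuous_at)
      then have "(\<lambda>n. clamp1 (g n x)) \<longlonglongrightarrow> clamp1 (u x)"
        by (rule isCont_tendsto_compose) (rule lim[OF elim])
      then have "(\<lambda>n. u x - cut x *\<^sub>R clamp1 (g n x)) \<longlonglongrightarrow> u x - cut x *\<^sub>R u x"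
        unfolding clampu by (intro tendsto_intros)
      then show ?case unfolding c_def cutu by simp
    qed
  qed measurable
  from N2_eventually_small[OF this e] obtain n where "N2 (\<lambda>x. u x - c n x) < ennreal e" by blast
  then show ?thesis using cc[of n] cz[of _ n] by (intro exI[of _ "c n"]) simp
qed

text \<open>Truncation, continuous approximation and mollification, combined by the triangle
  inequality for squares.\<close>

lemma L2_approx_smooth:
  fixes u :: "real^4 \<Rightarrow> 'b::euclidean_space"
  assumes u[measurable]: "u \<in> borel_measurable borel" and R: "\<And>x. norm x > R \<Longrightarrow> u x = 0" "R \<ge> 0"
    and n: "N2 u < \<infinity>" and e: "e > 0"
  shows "\<exists>v. smooth_map v \<and> (\<forall>x. norm x > R + 2 \<longrightarrow> v x = 0) \<and> N2 (\<lambda>x. u x - v x) \<le> ennreal e"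
proof -
  obtain U where U: "\<And>n. U n \<in> borel_measurable borel" "\<And>n x. norm (U n x) \<le> real n" "\<And>n x. norm x > R \<Longrightarrow> U n x = 0"
    and lim: "(\<lambda>n. N2 (\<lambda>x. u x - U n x)) \<longlonglongrightarrow> 0"
  proof -
    have "\<exists>U. (\<forall>n. U n \<in> borel_measurable borel \<and> (\<forall>x. norm (U n x) \<le> real n \<and> (norm x > R \<longrightarrow> U n x = 0))) \<and>
     (N2 u < \<infinity> \<longrightarrow> (\<lambda>n. N2 (\<lambda>x. u x - U n x)) \<longlonglongrightarrow> 0)"
      by (rule L2_approx_bounded[OF u R(1) R(2) e])
    then obtain U where "\<forall>n. U n \<in> borel_measurable borel \<and> (\<forall>x. norm (U n x) \<le> real n \<and> (norm x > R \<longrightarrow> U n x = 0))"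
      "(\<lambda>n. N2 (\<lambda>x. u x - U n x)) \<longlonglongrightarrow> 0" using n by blast
    then show ?thesis by (intro that[of U]) auto
  qed
  have e8: "e / 10 > 0" using e by simp
  obtain n where n: "N2 (\<lambda>x. u x - U n x) < ennreal (e / 10)"
    using N2_eventually_small[OF lim e8] by blast
  obtain c where c: "continuous_on UNIV c" "\<And>x. norm x > R + 1 \<Longrightarrow> c x = 0" "N2 (\<lambda>x. U n x - c x) < ennreal (e / 10)"
  proof -
    have "\<exists>c. continuous_on UNIV c \<and> (\<forall>x. norm x > R + 1 \<longrightarrow> c x = 0) \<and> N2 (\<lambda>x. U n x - c x) < ennreal (e / 10)"
      by (rule L2_approx_continuous[OF U(1) U(3) U(2) of_nat_0_le_iff e8])
    then show ?thesis using that by blast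
  qed
  have cb: "bsupp c" by (rule bsuppI[OF c(2)])
  define V where "V = measure lborel (cball (0::real^4) (R + 2))"
  have V: "emeasure lborel (cball (0::real^4) (R + 2)) = ennreal V" "V > 0"
  proof -
    show "emeasure lborel (cball (0::real^4) (R + 2)) = ennreal V"
      unfolding V_def using emeasure_lborel_cball_finite[of "0::real^4" "R + 2"]
      by (intro emeasure_eq_ennreal_measure) auto
    show "V > 0" unfolding V_def using R(2) content_cball_gt_0_iff[of "0::real^4" "R + 2"] by simp
  qed
  \<comment> \<open>Each use of \<open>N2_add\<close> doubles, so the three errors carry weights 2,
    4 and 4; a tolerance of e / 10 for each adds up to \<open>e\<close>. This \<open>e'\<close> is
    the uniform error whose square integrates to e / 10 over the ball of radius R + 2.\<close>
  define e' where "e' = sqrt (e / (10 * V))"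
  have e': "e' > 0" "e'\<^sup>2 * V = e / 10" using e V by (simp_all add: e'_def)
  obtain \<delta> where \<delta>: "\<delta> > 0" "\<forall>\<epsilon> m C. 0 < \<epsilon> \<and> \<epsilon> < \<delta> \<and> moll C \<epsilon> m \<longrightarrow> (\<forall>x. norm (conv m c x - c x) \<le> e')"
    using conv_uniform[OF c(1) cb e'(1)] by (elim exE conjE) (rule that)
  obtain C where "\<forall>\<epsilon>>0. \<exists>m. moll C \<epsilon> m" using mollifiers_exist by blast
  then obtain m where m: "moll C (min (\<delta>/2) 1) m" using \<delta>(1)
    by (elim allE[of _ "min (\<delta>/2) 1"] impE) auto
  note M = mollD[OF m]
  have ci: "integrable lborel c" by (rule integrable_cont_bsupp[OF c(1) cb])
  have sv: "smooth_map (conv m c)" by (rule smooth_conv[OF M(1,2) ci])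
  have vz: "conv m c x = 0" if x: "norm x > R + 2" for x
  proof (rule conv_outside[where R = "R + 1" and \<epsilon> = "min (\<delta>/2) 1"])
    show "R + 1 + min (\<delta>/2) 1 < norm x" using x by (simp add: min_def)
  qed (use M(3) c(2) in auto)
  have close: "norm (c x - conv m c x) \<le> e'" for x
    using \<delta>(2)[rule_format, of "min (\<delta>/2) 1" C m x] \<delta>(1) m by (simp add: norm_minus_commute)
  note cm[measurable] = borel_measurable_continuous_onI[OF c(1)] and vm[measurable] = borel_smooth[OF sv] and U(1)[measurable]
  have "N2 (\<lambda>x. c x - conv m c x) \<le> ennreal (e'\<^sup>2) * emeasure lborel (cball (0::real^4) (R + 2))"
    by (rule N2_uniform[OF close]) (use vz c(2) in auto)
  also have "\<dots> = ennreal (e'\<^sup>2 * V)" unfolding V(1) using V(2) by (intro ennreal_mult[symmetric]) auto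
  finally have 3: "N2 (\<lambda>x. c x - conv m c x) \<le> ennreal (e / 10)" unfolding e'(2) .
  have 4: "N2 (\<lambda>x. (u x - U n x) + ((U n x - c x) + (c x - conv m c x)))
     \<le> 2 * N2 (\<lambda>x. u x - U n x) + 2 * N2 (\<lambda>x. (U n x - c x) + (c x - conv m c x))"
    by (rule N2_add) measurable
  have 5: "N2 (\<lambda>x. (U n x - c x) + (c x - conv m c x)) \<le> 2 * N2 (\<lambda>x. U n x - c x) + 2 * N2 (\<lambda>x. c x - conv m c x)"
    by (rule N2_add) measurable
  have 6: "(u x - U n x) + ((U n x - c x) + (c x - conv m c x)) = u x - conv m c x" for x by simp
  have "N2 (\<lambda>x. u x - conv m c x) \<le> 2 * N2 (\<lambda>x. u x - U n x) + 2 * (2 * N2 (\<lambda>x. U n x - c x) + 2 * N2 (\<lambda>x. c x - conv m c x))"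
    by (rule order_trans[OF 4[unfolded 6] add_left_mono[OF mult_left_mono[OF 5]]]) simp
  also have "\<dots> \<le> 2 * ennreal (e / 10) + 2 * (2 * ennreal (e / 10) + 2 * ennreal (e / 10))"
    by (intro add_mono mult_left_mono) (use n c(3) 3 in auto)
  also have "\<dots> = (2 + 2 * (2 + 2)) * ennreal (e / 10)"
    by (simp only: distrib_right distrib_left mult.assoc)
  also have "(2 + 2 * (2 + 2) :: ennreal) = ennreal 10" by simp
  also have "ennreal 10 * ennreal (e / 10) = ennreal (10 * (e / 10))" using e by (intro ennreal_mult[symmetric]) auto
  finally have "N2 (\<lambda>x. u x - conv m c x) \<le> ennreal e" by simp
  then show ?thesis using sv vz by blast
qed

section \<open>Smooth families of linear maps and first-order operators\<close>

lemma smooth_apply: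
  fixes A :: "real^4 \<Rightarrow> 'a::euclidean_space \<Rightarrow> 'b::euclidean_space"
  assumes A: "\<And>v. smooth_map (\<lambda>x. A x v)" and l: "\<And>x. linear (A x)" and f: "smooth_map f"
  shows "smooth_map (\<lambda>x. A x (f x))"
proof -
  have "A x (f x) = (\<Sum>b\<in>Basis. (f x \<bullet> b) *\<^sub>R A x b)" for x
  proof -
    have "A x (f x) = A x (\<Sum>b\<in>Basis. (f x \<bullet> b) *\<^sub>R b)" by (simp add: euclidean_representation)
    also have "\<dots> = (\<Sum>b\<in>Basis. (f x \<bullet> b) *\<^sub>R A x b)" by (simp add: linear_sum[OF l] linear_cmul[OF l])
    finally show ?thesis .
  qed
  moreover have "smooth_map (\<lambda>x. \<Sum>b\<in>Basis. (f x \<bullet> b) *\<^sub>R A x b)"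
    by (intro smooth_sum smooth_scaleR smooth_inner f smooth_const A)
  ultimately show ?thesis by simp
qed

lemma finite_uniform_bound:
  assumes "finite I" "\<And>i. i \<in> I \<Longrightarrow> \<exists>C\<ge>(0::real). P i C" "\<And>i C D. P i C \<Longrightarrow> C \<le> D \<Longrightarrow> P i D"
  shows "\<exists>C\<ge>0. \<forall>i\<in>I. P i C"
  using assms(1,2)
proof (induction I rule: finite_induct)
  case (insert i I)
  then obtain D where D: "D \<ge> 0" "\<forall>i\<in>I. P i D" by auto
  obtain C where C: "C \<ge> 0" "P i C" using insert.prems[of i] by auto
  have "P i (max C D)" by (rule assms(3)[OF C(2)]) simp
  moreover have "\<forall>i\<in>I. P i (max C D)" using D assms(3)[of _ D "max C D"] by simp
  ultimately show ?case using C by (intro exI[of _ "max C D"]) auto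
qed auto

text \<open>A linear map is determined by its values on a basis, so sup and Lipschitz bounds on a
  ball for each basis vector give operator bounds, with the dimension as an extra factor.\<close>

lemma operator_bound:
  fixes A :: "real^4 \<Rightarrow> 'a::euclidean_space \<Rightarrow> 'b::euclidean_space"
  assumes A: "\<And>v. smooth_map (\<lambda>x. A x v)" and l: "\<And>x. linear (A x)"
  shows "\<exists>C\<ge>0. \<forall>(x::real^4) v. norm x \<le> R \<longrightarrow> norm (A x v) \<le> C * norm v"
    and "\<exists>C\<ge>0. \<forall>(x::real^4) (y::real^4) v. norm x \<le> R \<and> norm y \<le> R \<longrightarrow> norm (A x v - A y v) \<le> C * norm (x - y) * norm v"
proof -
  have exp: "B v = (\<Sum>b\<in>Basis. (v \<bullet> b) *\<^sub>R B b)" if "linear B" for B :: "'a \<Rightarrow> 'b" and v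
  proof -
    have "B v = B (\<Sum>b\<in>Basis. (v \<bullet> b) *\<^sub>R b)" by (simp add: euclidean_representation)
    also have "\<dots> = (\<Sum>b\<in>Basis. (v \<bullet> b) *\<^sub>R B b)" by (simp add: linear_sum[OF that] linear_cmul[OF that])
    finally show ?thesis .
  qed
  have gen: "norm (B v) \<le> (real DIM('a) * c) * norm v" if "linear B" "\<And>b. b \<in> Basis \<Longrightarrow> norm (B b) \<le> c"
    for B :: "'a \<Rightarrow> 'b" and v c
  proof -
    have "norm (\<Sum>b\<in>Basis. (v \<bullet> b) *\<^sub>R B b) \<le> (\<Sum>b\<in>(Basis::'a set). norm v * c)"
    proof (rule sum_norm_le)
      fix b :: 'a assume b: "b \<in> Basis"
      have "\<bar>v \<bullet> b\<bar> * norm (B b) \<le> norm v * c"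
        by (intro mult_mono Basis_le_norm b that) auto
      then show "norm ((v \<bullet> b) *\<^sub>R B b) \<le> norm v * c" by simp
    qed
    then show ?thesis unfolding exp[OF that(1), symmetric] by (simp add: mult_ac)
  qed
  have "\<exists>C\<ge>0. \<forall>b\<in>Basis. \<forall>x::real^4. norm x \<le> R \<longrightarrow> norm (A x b) \<le> C"
  proof (rule finite_uniform_bound)
    fix b
    obtain C where "C \<ge> 0" "\<And>x. norm x \<le> R \<Longrightarrow> norm (A x b) \<le> C"
      by (rule smooth_bounded_on_ball[OF smooth_cont[OF A[of b]]]) blast
    then show "\<exists>C\<ge>0. \<forall>x::real^4. norm x \<le> R \<longrightarrow> norm (A x b) \<le> C" by blast
  next
    fix b :: 'a and C D :: real
    assume "\<forall>x::real^4. norm x \<le> R \<longrightarrow> norm (A x b) \<le> C" "C \<le> D"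
    then show "\<forall>x::real^4. norm x \<le> R \<longrightarrow> norm (A x b) \<le> D" by force
  qed simp
  then obtain C where C: "C \<ge> 0" "\<And>b x. b \<in> Basis \<Longrightarrow> norm x \<le> R \<Longrightarrow> norm (A x b) \<le> C" by blast
  have "norm (A x v) \<le> (real DIM('a) * C) * norm v" if "norm x \<le> R" for x :: "real^4" and v
    by (rule gen[OF l C(2)]) (use that in auto)
  then show "\<exists>C\<ge>0. \<forall>(x::real^4) v. norm x \<le> R \<longrightarrow> norm (A x v) \<le> C * norm v"
    using C(1) by (intro exI[of _ "real DIM('a) * C"]) auto
  have "\<exists>C\<ge>0. \<forall>b\<in>Basis. \<forall>(x::real^4) (y::real^4). norm x \<le> R \<and> norm y \<le> R \<longrightarrow> norm (A x b - A y b) \<le> C * norm (x - y)"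
  proof (rule finite_uniform_bound)
    fix b
    obtain C where "C \<ge> 0" "\<And>x y. norm x \<le> R \<Longrightarrow> norm y \<le> R \<Longrightarrow> norm (A x b - A y b) \<le> C * norm (x - y)"
      by (rule lipschitz_on_ball[OF A[of b]]) blast
    then show "\<exists>C\<ge>0. \<forall>(x::real^4) (y::real^4). norm x \<le> R \<and> norm y \<le> R \<longrightarrow> norm (A x b - A y b) \<le> C * norm (x - y)" by blast
  next
    fix b :: 'a and C D :: real
    assume *: "\<forall>(x::real^4) (y::real^4). norm x \<le> R \<and> norm y \<le> R \<longrightarrow> norm (A x b - A y b) \<le> C * norm (x - y)" "C \<le> D"
    show "\<forall>(x::real^4) (y::real^4). norm x \<le> R \<and> norm y \<le> R \<longrightarrow> norm (A x b - A y b) \<le> D * norm (x - y)"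
    proof (intro allI impI)
      fix x y :: "real^4" assume "norm x \<le> R \<and> norm y \<le> R"
      then have "norm (A x b - A y b) \<le> C * norm (x - y)" using *(1) by blast
      also have "\<dots> \<le> D * norm (x - y)" using *(2) by (intro mult_right_mono) auto
      finally show "norm (A x b - A y b) \<le> D * norm (x - y)" .
    qed
  qed simp
  then obtain D where D: "D \<ge> 0" "\<And>b x y. b \<in> Basis \<Longrightarrow> norm x \<le> R \<Longrightarrow> norm y \<le> R \<Longrightarrow> norm (A x b - A y b) \<le> D * norm (x - y)" by blast
  have "norm (A x v - A y v) \<le> (real DIM('a) * D) * norm (x - y) * norm v" if "norm x \<le> R" "norm y \<le> R" for x y :: "real^4" and v
  proof -
    have "linear (\<lambda>v. A x v - A y v)" by (intro linear_compose_sub l)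
    from gen[OF this, of "D * norm (x - y)" v] show ?thesis using D(2) that by (simp add: mult.assoc)
  qed
  then show "\<exists>C\<ge>0. \<forall>(x::real^4) (y::real^4) v. norm x \<le> R \<and> norm y \<le> R \<longrightarrow> norm (A x v - A y v) \<le> C * norm (x - y) * norm v"
    using D(1) by (intro exI[of _ "real DIM('a) * D"]) auto
qed

lemma pd_reflected:
  fixes m :: "real^4 \<Rightarrow> real" and \<xi> :: "'b::real_normed_vector"
  assumes m: "smooth_map m"
  shows "pd (\<lambda>y. m (x - y) *\<^sub>R \<xi>) k y = - pd m k (x - y) *\<^sub>R \<xi>"
proof -
  have a: "((\<lambda>y. x - y) has_derivative (\<lambda>h. - h)) (at y)"
    by (rule derivative_eq_intros | simp)+
  have b: "(m has_derivative frechet_derivative m (at (x - y))) (at (x - y))"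
    by (rule frechet_derivative_worksI[OF smooth_diff_at[OF m]])
  have "((\<lambda>y. m (x - y)) has_derivative (\<lambda>h. frechet_derivative m (at (x - y)) (- h))) (at y)"
    by (rule has_derivative_compose[OF a b])
  then have "((\<lambda>y. m (x - y) *\<^sub>R \<xi>) has_derivative (\<lambda>h. frechet_derivative m (at (x - y)) (- h) *\<^sub>R \<xi>)) (at y)"
    by (rule has_derivative_scaleR_left)
  from pd_eq[OF this] show ?thesis
    using linear_neg[OF linear_frechet_derivative[OF smooth_diff_at[OF m]]] by (simp add: pd_def)
qed

lemma smooth_reflected:
  fixes m :: "real^4 \<Rightarrow> real" and \<xi> :: "'b::real_normed_vector"
  assumes m: "smooth_map m"
  shows "smooth_map (\<lambda>y. m (x - y) *\<^sub>R \<xi>)"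
proof -
  have "Ckv n (\<lambda>y. m (x - y) *\<^sub>R \<xi>)" if "smooth_map m" for n m and \<xi> :: 'b
    using that
  proof (induction n arbitrary: m \<xi>)
    case 0
    have "continuous_on UNIV (\<lambda>y. m (x - y))"
      by (rule continuous_on_compose2[OF smooth_cont[OF 0, of UNIV] continuous_on_diff[OF continuous_on_const continuous_on_id]]) simp
    then show ?case by (simp add: continuous_on_scaleR)
  next
    case (Suc n)
    have "(\<lambda>y. m (x - y) *\<^sub>R \<xi>) differentiable (at y)" for y
    proof -
      have "m differentiable (at (x - y))" by (rule smooth_diff_at[OF Suc.prems])
      then have "(\<lambda>y. m (x - y)) differentiable (at y)"
        by (intro differentiable_compose[of m "\<lambda>y. x - y"] differentiable_diff) auto
      then show ?thesis by (intro differentiable_scaleR differentiable_const)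
    qed
    moreover have eq: "pd (\<lambda>y. m (x - y) *\<^sub>R \<xi>) k = (\<lambda>y. pd m k (x - y) *\<^sub>R (- \<xi>))" for k
      using pd_reflected[OF Suc.prems, of x \<xi> k] by (simp add: fun_eq_iff)
    moreover have "Ckv n (pd (\<lambda>y. m (x - y) *\<^sub>R \<xi>) k)" for k
      unfolding eq by (rule Suc.IH[OF smooth_pd[OF Suc.prems]])
    ultimately show ?case by simp
  qed
  then show ?thesis using m by (simp add: smooth_map_def)
qed

lemma bsupp_reflected:
  assumes "bsupp m"
  shows "bsupp (\<lambda>y. m (x - y) *\<^sub>R (\<xi>::'b::real_vector))"
proof -
  obtain R where R: "\<And>x. norm x > R \<Longrightarrow> m x = 0" using assms unfolding bsupp_def by blast
  show ?thesis
  proof (rule bsuppI[of "norm x + R"])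
    fix y :: "real^4" assume "norm x + R < norm y"
    then have "m (x - y) = 0" using norm_triangle_ineq2[of y x] by (intro R) (simp add: norm_minus_commute)
    then show "m (x - y) *\<^sub>R \<xi> = 0" by simp
  qed
qed

text \<open>Integration by parts in the integration variable, carried out for each component; the
  reflection in m (x - y) supplies the sign.\<close>

lemma conv_pd_swap:
  fixes u :: "real^4 \<Rightarrow> 'b::euclidean_space"
  assumes m: "smooth_map m" "bsupp m" and u: "smooth_map u" "bsupp u"
  shows "conv (pd m k) u x = conv m (pd u k) x"
proof (rule euclidean_eqI)
  fix b :: 'b
  have ui: "integrable lborel u" by (rule integrable_cont_bsupp[OF smooth_cont[OF u(1)] u(2)])
  have di: "integrable lborel (pd u k)" by (rule integrable_cont_bsupp[OF smooth_cont[OF smooth_pd[OF u(1)]] bsupp_pd[OF u(2)]])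
  have i1: "integrable lborel (\<lambda>y. pd m k (x - y) *\<^sub>R u y)"
    by (rule conv_integrable[OF smooth_cont[OF smooth_pd[OF m(1)]] bsupp_pd[OF m(2)] ui])
  have i2: "integrable lborel (\<lambda>y. m (x - y) *\<^sub>R pd u k y)"
    by (rule conv_integrable[OF smooth_cont[OF m(1)] m(2) di])
  define F where "F y = m (x - y) *\<^sub>R (1::real) * (u y \<bullet> b)" for y
  have sm: "smooth_map (\<lambda>y. m (x - y) *\<^sub>R (1::real))" by (rule smooth_reflected[OF m(1)])
  have sub: "smooth_map (\<lambda>y. u y \<bullet> b)" by (intro smooth_inner u smooth_const)
  have sF: "smooth_map F" unfolding F_def by (rule smooth_mult[OF sm sub])
  have bF: "bsupp F" unfolding F_def by (rule bsupp_mono[OF u(2)]) simp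
  have pF: "pd F k y = - (pd m k (x - y) *\<^sub>R u y) \<bullet> b + (m (x - y) *\<^sub>R pd u k y) \<bullet> b" for y
    unfolding F_def pd_mult[OF sm sub] pd_reflected[OF m(1)] pd_lin[OF bounded_linear_inner_left u(1)] by simp
  have "0 = (\<integral>y. pd F k y \<partial>lborel)" using integral_pd_zero[OF sF bF] by simp
  also have "\<dots> = (\<integral>y. (m (x - y) *\<^sub>R pd u k y) \<bullet> b - (pd m k (x - y) *\<^sub>R u y) \<bullet> b \<partial>lborel)"
    unfolding pF by (rule Bochner_Integration.integral_cong) auto
  also have "\<dots> = (\<integral>y. (m (x - y) *\<^sub>R pd u k y) \<bullet> b \<partial>lborel) - (\<integral>y. (pd m k (x - y) *\<^sub>R u y) \<bullet> b \<partial>lborel)"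
    by (rule Bochner_Integration.integral_diff) (intro integrable_inner_left i1 i2)+
  also have "\<dots> = conv m (pd u k) x \<bullet> b - conv (pd m k) u x \<bullet> b"
    unfolding conv_def using i1 i2 by (simp only: integral_inner_left)
  finally show "conv (pd m k) u x \<bullet> b = conv m (pd u k) x \<bullet> b" by simp
qed

text \<open>Symmetric first-order coefficients are those of a formally skew operator. Ellipticity is
  not among the assumptions: the mollification argument rests on smoothness of the coefficients
  alone.\<close>

locale symmetric_first_order =
  fixes B :: "4 \<Rightarrow> real^4 \<Rightarrow> 'v::euclidean_space \<Rightarrow> 'v" and Z :: "real^4 \<Rightarrow> 'v \<Rightarrow> 'v"
  assumes linear_B: "\<And>k x. linear (B k x)" and linear_Z: "\<And>x. linear (Z x)"
    and smooth_B: "\<And>k v. smooth_map (\<lambda>x. B k x v)" and smooth_Z: "\<And>v. smooth_map (\<lambda>x. Z x v)"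
    and sym_B: "\<And>k x v w. B k x v \<bullet> w = v \<bullet> B k x w"
begin

definition dop :: "(real^4 \<Rightarrow> 'v) \<Rightarrow> real^4 \<Rightarrow> 'v" where
  "dop \<psi> x = (\<Sum>k\<in>UNIV. B k x (pd \<psi> k x)) + Z x (\<psi> x)"

lemma smooth_dop: "smooth_map \<psi> \<Longrightarrow> smooth_map (dop \<psi>)"
  unfolding dop_def
  by (intro smooth_add smooth_sum smooth_apply[OF smooth_B linear_B] smooth_apply[OF smooth_Z linear_Z] smooth_pd)

lemma dop_outside: "(\<And>x. norm x > R \<Longrightarrow> \<psi> x = 0) \<Longrightarrow> norm x > R \<Longrightarrow> dop \<psi> x = 0"
  using pd_zero_outside[of R \<psi> x] by (simp add: dop_def linear_0[OF linear_B] linear_0[OF linear_Z])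

lemma bsupp_dop: "bsupp \<psi> \<Longrightarrow> bsupp (dop \<psi>)"
proof -
  assume "bsupp \<psi>"
  then obtain R where "\<And>x. norm x > R \<Longrightarrow> \<psi> x = 0" unfolding bsupp_def by blast
  from dop_outside[OF this] show ?thesis by (rule bsuppI)
qed

text \<open>The distributional equation tested from the adjoint side. When the operator is formally
  skew it says that \<open>dop\<close> of u equals - g weakly, which explains why
  \<open>conv m g\<close> is added and not subtracted in the commutator estimate.\<close>

definition weak_adj :: "(real^4 \<Rightarrow> 'v) \<Rightarrow> (real^4 \<Rightarrow> 'v) \<Rightarrow> bool" where
  "weak_adj u g \<longleftrightarrow> (\<forall>\<psi>. smooth_map \<psi> \<longrightarrow> bsupp \<psi> \<longrightarrow> (\<integral>x. u x \<bullet> dop \<psi> x \<partial>lborel) = (\<integral>x. g x \<bullet> \<psi> x \<partial>lborel))"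

lemma integrable_inner_cont:
  fixes f :: "real^4 \<Rightarrow> 'v"
  assumes u: "integrable lborel u" and f: "continuous_on UNIV f" "bsupp f"
  shows "integrable lborel (\<lambda>x. u x \<bullet> f x)"
proof -
  obtain C where C: "C \<ge> 0" "\<And>x. norm (f x) \<le> C" by (rule bounded_cont_bsupp[OF f]) blast
  show ?thesis
  proof (rule Bochner_Integration.integrable_bound)
    show "integrable lborel (\<lambda>y. C * norm (u y))" by (rule integrable_mult_right[OF integrable_norm[OF u]])
    show "(\<lambda>y. u y \<bullet> f y) \<in> borel_measurable lborel"
      using borel_measurable_continuous_onI[OF f(1)] borel_measurable_integrable[OF u] by simp
    show "AE y in lborel. norm (u y \<bullet> f y) \<le> norm (C * norm (u y))"
    proof (rule AE_I2)
      fix y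
      have "\<bar>u y \<bullet> f y\<bar> \<le> norm (u y) * norm (f y)" by (rule Cauchy_Schwarz_ineq2)
      also have "\<dots> \<le> norm (u y) * C" using C(2)[of y] by (rule mult_left_mono) simp
      finally show "norm (u y \<bullet> f y) \<le> norm (C * norm (u y))" using C(1) by (simp add: mult.commute)
    qed
  qed
qed

text \<open>Friedrichs' lemma. In the skew case the expression is the commutator of the operator
  with the mollifier, applied to u. Moving all derivatives onto the mollifier leaves the kernel
  \<open>pd m k (x - y)\<close> times B(x) - B(y), plus zero-order terms. The Lipschitz coefficients
  gain one power of \<epsilon> against \<epsilon>^-5, so the kernel has the size that
  \<open>schur_bound\<close> handles. \<open>K\<close> is fixed before u, g, \<epsilon> and
  m.\<close>

lemma friedrichs_commutator:
  assumes C: "C \<ge> 0" and R: "R \<ge> 0"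
  shows "\<exists>K\<ge>0. \<forall>u g \<epsilon> m x. integrable lborel u \<longrightarrow> integrable lborel g \<longrightarrow> (\<forall>x. norm x > R \<longrightarrow> u x = 0) \<longrightarrow> weak_adj u g \<longrightarrow>
     0 < \<epsilon> \<longrightarrow> \<epsilon> \<le> 1 \<longrightarrow> moll C \<epsilon> m \<longrightarrow>
     ennreal (norm (dop (conv m u) x + conv m g x)) \<le> ennreal (K / \<epsilon> ^ 4) * (\<integral>\<^sup>+y. (if dist x y \<le> \<epsilon> then ennreal (norm (u y)) else 0) \<partial>lborel)"
proof -
  obtain CZ where CZ: "CZ \<ge> 0" "\<And>x v. norm x \<le> R + 1 \<Longrightarrow> norm (Z x v) \<le> CZ * norm v"
    using operator_bound(1)[OF smooth_Z linear_Z, of "R + 1"] by blast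
  have "\<exists>C\<ge>0. \<forall>k\<in>UNIV. \<forall>(x::real^4) (y::real^4) v. norm x \<le> R + 1 \<and> norm y \<le> R + 1 \<longrightarrow> norm (B k x v - B k y v) \<le> C * norm (x - y) * norm v"
  proof (rule finite_uniform_bound)
    show "\<exists>C\<ge>0. \<forall>(x::real^4) (y::real^4) v. norm x \<le> R + 1 \<and> norm y \<le> R + 1 \<longrightarrow> norm (B k x v - B k y v) \<le> C * norm (x - y) * norm v" for k
      by (rule operator_bound(2)[OF smooth_B linear_B])
  next
    fix k and C D :: real
    assume *: "\<forall>(x::real^4) (y::real^4) v. norm x \<le> R + 1 \<and> norm y \<le> R + 1 \<longrightarrow> norm (B k x v - B k y v) \<le> C * norm (x - y) * norm v" "C \<le> D"
    show "\<forall>(x::real^4) (y::real^4) v. norm x \<le> R + 1 \<and> norm y \<le> R + 1 \<longrightarrow> norm (B k x v - B k y v) \<le> D * norm (x - y) * norm v"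
    proof (intro allI impI)
      fix x y :: "real^4" and v assume "norm x \<le> R + 1 \<and> norm y \<le> R + 1"
      then have "norm (B k x v - B k y v) \<le> C * norm (x - y) * norm v" using *(1) by blast
      also have "\<dots> \<le> D * norm (x - y) * norm v" using *(2) by (intro mult_right_mono) auto
      finally show "norm (B k x v - B k y v) \<le> D * norm (x - y) * norm v" .
    qed
  qed simp
  then obtain CB where CB: "CB \<ge> 0" "\<And>k x y v. norm x \<le> R + 1 \<Longrightarrow> norm y \<le> R + 1 \<Longrightarrow> norm (B k x v - B k y v) \<le> CB * norm (x - y) * norm v" by blast
  \<comment> \<open>Four derivative terms with Lipschitz constant \<open>CB\<close>, and two
    zero-order terms, one with coefficient at x and one with coefficient at y.\<close>
  define K where "K = C * (4 * CB + 2 * CZ)"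
  have K: "K \<ge> 0" unfolding K_def using C CB(1) CZ(1) by simp
  have "ennreal (norm (dop (conv m u) x + conv m g x)) \<le> ennreal (K / \<epsilon> ^ 4) * (\<integral>\<^sup>+y. (if dist x y \<le> \<epsilon> then ennreal (norm (u y)) else 0) \<partial>lborel)"
    if u: "integrable lborel u" and g: "integrable lborel g" and Ru: "\<forall>x. norm x > R \<longrightarrow> u x = 0" and w: "weak_adj u g"
      and \<epsilon>: "0 < \<epsilon>" "\<epsilon> \<le> 1" and m: "moll C \<epsilon> m" for u g \<epsilon> m x
  proof -
    note M = mollD[OF m]
    define F where "F = dop (conv m u) x + conv m g x"
    \<comment> \<open>A vector of norm at most 1 that realizes the norm of \<open>F\<close>, with
      value 0 if \<open>F\<close> vanishes; pairing with it reduces the estimate to real-valued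
      integrals.\<close>
    define \<xi> where "\<xi> = sgn F"
    have \<xi>: "norm \<xi> \<le> 1" "F \<bullet> \<xi> = norm F"
      by (simp_all add: \<xi>_def norm_sgn, cases "F = 0") (simp_all add: sgn_div_norm dot_square_norm power2_eq_square)
    \<comment> \<open>The reflected mollifier in the direction \<xi> is the test field for which the
      weak equation evaluates \<open>conv m g x \<bullet> \<xi>\<close>.\<close>
    define \<psi> where "\<psi> y = m (x - y) *\<^sub>R \<xi>" for y
    have s\<psi>: "smooth_map \<psi>" unfolding \<psi>_def by (rule smooth_reflected[OF M(1)])
    have b\<psi>: "bsupp \<psi>" unfolding \<psi>_def by (rule bsupp_reflected[OF M(2)])
    have pd\<psi>: "pd \<psi> k y = - pd m k (x - y) *\<^sub>R \<xi>" for k y unfolding \<psi>_def by (rule pd_reflected[OF M(1)])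
    have hm: "has_bochner_integral lborel (\<lambda>y. m (x - y) *\<^sub>R u y) (conv m u x)"
      unfolding conv_def by (rule has_bochner_integral_integrable[OF conv_integrable[OF smooth_cont[OF M(1)] M(2) u]])
    have hp: "has_bochner_integral lborel (\<lambda>y. pd m k (x - y) *\<^sub>R u y) (conv (pd m k) u x)" for k
      unfolding conv_def by (rule has_bochner_integral_integrable[OF conv_integrable[OF smooth_cont[OF smooth_pd[OF M(1)]] bsupp_pd[OF M(2)] u]])
    have hg: "integrable lborel (\<lambda>y. m (x - y) *\<^sub>R g y)"
      by (rule conv_integrable[OF smooth_cont[OF M(1)] M(2) g])
    have h1: "has_bochner_integral lborel (\<lambda>y. (pd m k (x - y) *\<^sub>R u y) \<bullet> B k x \<xi>) (conv (pd m k) u x \<bullet> B k x \<xi>)" for k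
      by (rule has_bochner_integral_inner_left) (rule hp)
    have blZ: "bounded_linear (\<lambda>v. Z x v \<bullet> \<xi>)"
      using bounded_linear_compose[OF bounded_linear_inner_left linear_conv_bounded_linear[THEN iffD1, OF linear_Z]] .
    have h2: "has_bochner_integral lborel (\<lambda>y. Z x (m (x - y) *\<^sub>R u y) \<bullet> \<xi>) (Z x (conv m u x) \<bullet> \<xi>)"
      by (rule has_bochner_integral_bounded_linear[OF blZ hm])
    have "conv m g x \<bullet> \<xi> = (\<integral>y. (m (x - y) *\<^sub>R g y) \<bullet> \<xi> \<partial>lborel)"
      unfolding conv_def by (rule integral_inner_left[symmetric]) (rule hg)
    also have "\<dots> = (\<integral>y. g y \<bullet> \<psi> y \<partial>lborel)" by (simp add: \<psi>_def)
    also have "\<dots> = (\<integral>y. u y \<bullet> dop \<psi> y \<partial>lborel)" using w s\<psi> b\<psi> unfolding weak_adj_def by simp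
    finally have e3: "conv m g x \<bullet> \<xi> = (\<integral>y. u y \<bullet> dop \<psi> y \<partial>lborel)" .
    have h3: "has_bochner_integral lborel (\<lambda>y. u y \<bullet> dop \<psi> y) (conv m g x \<bullet> \<xi>)"
      unfolding e3 by (rule has_bochner_integral_integrable[OF integrable_inner_cont[OF u smooth_cont[OF smooth_dop[OF s\<psi>]] bsupp_dop[OF b\<psi>]]])
    define H where "H y = (\<Sum>k\<in>UNIV. (pd m k (x - y) *\<^sub>R u y) \<bullet> B k x \<xi>) + Z x (m (x - y) *\<^sub>R u y) \<bullet> \<xi> + u y \<bullet> dop \<psi> y" for y
    have hH: "has_bochner_integral lborel H ((\<Sum>k\<in>UNIV. conv (pd m k) u x \<bullet> B k x \<xi>) + Z x (conv m u x) \<bullet> \<xi> + conv m g x \<bullet> \<xi>)"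
      unfolding H_def by (intro has_bochner_integral_add has_bochner_integral_sum h1 h2 h3)
    have "F \<bullet> \<xi> = (\<Sum>k\<in>UNIV. conv (pd m k) u x \<bullet> B k x \<xi>) + Z x (conv m u x) \<bullet> \<xi> + conv m g x \<bullet> \<xi>"
      unfolding F_def dop_def pd_conv[OF M(1,2) u] inner_add_left inner_sum_left sym_B by simp
    then have nF: "norm F = (\<integral>y. H y \<partial>lborel)" using \<xi>(2) has_bochner_integral_integral_eq[OF hH] by simp
    have bound: "\<bar>H y\<bar> \<le> (if dist x y \<le> \<epsilon> then K / \<epsilon> ^ 4 * norm (u y) else 0)" for y
    proof -
      \<comment> \<open>The cancellation: B(x) comes from differentiating the convolution, B(y) from
        applying the operator to the reflected mollifier, and the reflection gives them opposite
        signs.\<close>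
      have Hy: "H y = (\<Sum>k\<in>UNIV. pd m k (x - y) * (u y \<bullet> (B k x \<xi> - B k y \<xi>))) + m (x - y) * (Z x (u y) \<bullet> \<xi> + u y \<bullet> Z y \<xi>)"
        unfolding H_def dop_def pd\<psi> unfolding \<psi>_def
        by (simp add: linear_cmul[OF linear_B] linear_cmul[OF linear_Z] linear_neg[OF linear_B] inner_add_right inner_sum_right inner_diff_right
            sum_subtractf sum.distrib sum_negf algebra_simps)
      consider (far) "dist x y > \<epsilon>" | (out) "u y = 0" | (near) "dist x y \<le> \<epsilon>" "norm y \<le> R"
        using Ru by (metis not_le)
      then show ?thesis
      proof cases
        case far
        then have "m (x - y) = 0" "pd m k (x - y) = 0" for k using M(3)[of "x - y"] M(8)[of "x - y" k] by (simp_all add: dist_norm)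
        then show ?thesis using far unfolding Hy by simp
      next
        case out
        then show ?thesis unfolding Hy using K \<epsilon> by (simp add: linear_0[OF linear_Z])
      next
        case near
        have nx: "norm x \<le> R + 1" using near \<epsilon> norm_triangle_ineq2[of x y] by (simp add: dist_norm)
        have ny: "norm y \<le> R + 1" using near by simp
        have t1: "\<bar>pd m k (x - y) * (u y \<bullet> (B k x \<xi> - B k y \<xi>))\<bar> \<le> C / \<epsilon> ^ 5 * (norm (u y) * (CB * \<epsilon>))" for k
        proof -
          have "norm (B k x \<xi> - B k y \<xi>) \<le> CB * norm (x - y) * norm \<xi>" by (rule CB(2)[OF nx ny])
          also have "\<dots> \<le> CB * \<epsilon> * 1"
            using near \<xi>(1) CB(1) \<epsilon> by (intro mult_mono mult_left_mono mult_nonneg_nonneg) (auto simp: dist_norm)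
          finally have "norm (B k x \<xi> - B k y \<xi>) \<le> CB * \<epsilon>" by simp
          then have "\<bar>u y \<bullet> (B k x \<xi> - B k y \<xi>)\<bar> \<le> norm (u y) * (CB * \<epsilon>)"
            using Cauchy_Schwarz_ineq2[of "u y" "B k x \<xi> - B k y \<xi>"] mult_left_mono[OF _ norm_ge_zero[of "u y"]] order_trans by blast
          then show ?thesis unfolding abs_mult using M(7)[of k "x - y"] C \<epsilon> by (intro mult_mono) auto
        qed
        have t1': "C / \<epsilon> ^ 5 * (norm (u y) * (CB * \<epsilon>)) = C * CB / \<epsilon> ^ 4 * norm (u y)"
          using \<epsilon> by (simp add: field_simps power_Suc numeral_eq_Suc)
        have t2: "\<bar>Z x (u y) \<bullet> \<xi>\<bar> \<le> CZ * norm (u y)"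
        proof -
          have "\<bar>Z x (u y) \<bullet> \<xi>\<bar> \<le> norm (Z x (u y)) * norm \<xi>" by (rule Cauchy_Schwarz_ineq2)
          also have "\<dots> \<le> (CZ * norm (u y)) * 1" by (rule mult_mono[OF CZ(2)[OF nx] \<xi>(1)]) (use CZ in auto)
          finally show ?thesis by simp
        qed
        have t3: "\<bar>u y \<bullet> Z y \<xi>\<bar> \<le> CZ * norm (u y)"
        proof -
          have "\<bar>u y \<bullet> Z y \<xi>\<bar> \<le> norm (u y) * norm (Z y \<xi>)" by (rule Cauchy_Schwarz_ineq2)
          also have "norm (Z y \<xi>) \<le> CZ * 1" using CZ(2)[OF ny, of \<xi>] mult_left_mono[OF \<xi>(1) CZ(1)] by linarith
          then have "norm (u y) * norm (Z y \<xi>) \<le> norm (u y) * (CZ * 1)" by (rule mult_left_mono) simp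
          finally show ?thesis by (simp add: mult.commute)
        qed
        have "\<bar>m (x - y) * (Z x (u y) \<bullet> \<xi> + u y \<bullet> Z y \<xi>)\<bar> \<le> C / \<epsilon> ^ 4 * (2 * CZ * norm (u y))"
          unfolding abs_mult using M(6)[of "x - y"] t2 t3 C \<epsilon> by (intro mult_mono) auto
        moreover have "\<bar>\<Sum>k\<in>UNIV. pd m k (x - y) * (u y \<bullet> (B k x \<xi> - B k y \<xi>))\<bar> \<le> (\<Sum>k\<in>(UNIV::4 set). C * CB / \<epsilon> ^ 4 * norm (u y))"
          using t1 unfolding t1' by (intro order_trans[OF sum_abs sum_mono])
        ultimately have "\<bar>H y\<bar> \<le> 4 * (C * CB / \<epsilon> ^ 4 * norm (u y)) + C / \<epsilon> ^ 4 * (2 * CZ * norm (u y))"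
          unfolding Hy by (simp del: abs_mult)
        also have "\<dots> = K / \<epsilon> ^ 4 * norm (u y)" unfolding K_def by (simp add: add_divide_distrib algebra_simps)
        finally show ?thesis using near by simp
      qed
    qed
    have um: "u \<in> borel_measurable borel" using borel_measurable_integrable[OF u] by simp
    have "ennreal (norm F) = ennreal (norm (\<integral>y. H y \<partial>lborel))" unfolding nF[symmetric] by simp
    also have "\<dots> \<le> (\<integral>\<^sup>+y. ennreal (norm (H y)) \<partial>lborel)" by (rule integral_norm_bound_ennreal_gen)
    also have "\<dots> \<le> (\<integral>\<^sup>+y. ennreal (K / \<epsilon> ^ 4) * (if dist x y \<le> \<epsilon> then ennreal (norm (u y)) else 0) \<partial>lborel)"
    proof (rule nn_integral_mono)
      fix y
      have "ennreal (norm (H y)) \<le> ennreal (if dist x y \<le> \<epsilon> then K / \<epsilon> ^ 4 * norm (u y) else 0)"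
        using bound[of y] by (intro ennreal_leI) simp
      also have "\<dots> = ennreal (K / \<epsilon> ^ 4) * (if dist x y \<le> \<epsilon> then ennreal (norm (u y)) else 0)"
        using ennreal_mult[of "K / \<epsilon> ^ 4" "norm (u y)"] K \<epsilon> by simp
      finally show "ennreal (norm (H y)) \<le> ennreal (K / \<epsilon> ^ 4) * (if dist x y \<le> \<epsilon> then ennreal (norm (u y)) else 0)" .
    qed
    also have "\<dots> = ennreal (K / \<epsilon> ^ 4) * (\<integral>\<^sup>+y. (if dist x y \<le> \<epsilon> then ennreal (norm (u y)) else 0) \<partial>lborel)"
      by (rule nn_integral_cmult) (use um in measurable)
    finally show ?thesis unfolding F_def .
  qed
  then show ?thesis using K by blast
qed

definition formally_skew :: bool where
  "formally_skew \<longleftrightarrow> (\<forall>\<phi> \<psi>. smooth_map \<phi> \<longrightarrow> bsupp \<phi> \<longrightarrow> smooth_map \<psi> \<longrightarrow> bsupp \<psi> \<longrightarrow>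
     (\<integral>x. \<phi> x \<bullet> dop \<psi> x \<partial>lborel) = (\<integral>x. - dop \<phi> x \<bullet> \<psi> x \<partial>lborel))"

text \<open>For smooth \<open>v\<close> of bounded support, convolution commutes with partial
  derivatives, so \<open>dop (conv m v)\<close> and \<open>conv m (dop v)\<close> both tend
  uniformly to \<open>dop v\<close>.\<close>

lemma dop_conv_smooth_limit:
  assumes v: "smooth_map v" "bsupp v" and e: "e > 0"
  shows "\<exists>\<delta>>0. \<forall>\<epsilon> m C. 0 < \<epsilon> \<and> \<epsilon> < \<delta> \<and> moll C \<epsilon> m \<longrightarrow>
     (\<forall>x. norm (dop (conv m v) x - conv m (dop v) x) \<le> e) \<and> (\<forall>x. norm (v x - conv m v x) \<le> e)"
proof -
  obtain R where R: "\<And>x. norm x > R \<Longrightarrow> v x = 0" using v(2) unfolding bsupp_def by blast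
  obtain CZ where CZ: "CZ \<ge> 0" "\<And>x w. norm x \<le> R + 1 \<Longrightarrow> norm (Z x w) \<le> CZ * norm w"
    using operator_bound(1)[OF smooth_Z linear_Z, of "R + 1"] by blast
  have "\<exists>C\<ge>0. \<forall>k\<in>UNIV. \<forall>(x::real^4) w. norm x \<le> R + 1 \<longrightarrow> norm (B k x w) \<le> C * norm w"
  proof (rule finite_uniform_bound)
    show "\<exists>C\<ge>0. \<forall>(x::real^4) w. norm x \<le> R + 1 \<longrightarrow> norm (B k x w) \<le> C * norm w" for k
      by (rule operator_bound(1)[OF smooth_B linear_B])
  next
    fix k and C D :: real
    assume *: "\<forall>(x::real^4) w. norm x \<le> R + 1 \<longrightarrow> norm (B k x w) \<le> C * norm w" "C \<le> D"
    show "\<forall>(x::real^4) w. norm x \<le> R + 1 \<longrightarrow> norm (B k x w) \<le> D * norm w"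
    proof (intro allI impI)
      fix x :: "real^4" and w assume "norm x \<le> R + 1"
      then have "norm (B k x w) \<le> C * norm w" using *(1) by blast
      also have "\<dots> \<le> D * norm w" using *(2) by (intro mult_right_mono) auto
      finally show "norm (B k x w) \<le> D * norm w" .
    qed
  qed simp
  then obtain CB where CB: "CB \<ge> 0" "\<And>k x w. norm x \<le> R + 1 \<Longrightarrow> norm (B k x w) \<le> CB * norm w" by blast
  define s where "s = 4 * CB + CZ + 1"
  have s: "s > 0" using CB CZ by (simp add: s_def)
  define e' where "e' = e / s"
  have e': "e' > 0" "s * e' = e" using e s by (auto simp: e'_def)
  have vi: "integrable lborel v" by (rule integrable_cont_bsupp[OF smooth_cont[OF v(1)] v(2)])
  have U: "\<exists>\<delta>>0. \<forall>\<epsilon> m C. 0 < \<epsilon> \<and> \<epsilon> < \<delta> \<and> moll C \<epsilon> m \<longrightarrow> (\<forall>x. norm (conv m c x - c x) \<le> e')"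
    if "smooth_map c" "bsupp c" for c :: "real^4 \<Rightarrow> 'v"
    by (rule conv_uniform[OF smooth_cont[OF that(1)] that(2) e'(1)])
  obtain d0 where d0: "d0 > 0" "\<forall>\<epsilon> m C. 0 < \<epsilon> \<and> \<epsilon> < d0 \<and> moll C \<epsilon> m \<longrightarrow> (\<forall>x. norm (conv m v x - v x) \<le> e')"
    using U[OF v] by (elim exE conjE) (rule that)
  obtain d1 where d1: "d1 > 0" "\<forall>\<epsilon> m C. 0 < \<epsilon> \<and> \<epsilon> < d1 \<and> moll C \<epsilon> m \<longrightarrow> (\<forall>x. norm (conv m (dop v) x - dop v x) \<le> e')"
    using U[OF smooth_dop[OF v(1)] bsupp_dop[OF v(2)]] by (elim exE conjE) (rule that)
  have "\<forall>k. \<exists>\<delta>. \<delta> > 0 \<and> (\<forall>\<epsilon> m C. 0 < \<epsilon> \<and> \<epsilon> < \<delta> \<and> moll C \<epsilon> m \<longrightarrow> (\<forall>x. norm (conv m (pd v k) x - pd v k x) \<le> e'))"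
    using U[OF smooth_pd[OF v(1)] bsupp_pd[OF v(2)]] by simp
  from choice[OF this] obtain d where dd: "\<forall>k. d k > 0 \<and>
    (\<forall>\<epsilon> m C. 0 < \<epsilon> \<and> \<epsilon> < d k \<and> moll C \<epsilon> m \<longrightarrow> (\<forall>x. norm (conv m (pd v k) x - pd v k x) \<le> e'))"
    by (rule exE)
  then have d1': "d k > 0" for k by simp
  \<comment> \<open>Below this scale six convolutions are uniformly close to their limits: those of
    \<open>v\<close>, of \<open>dop v\<close> and of the four partial derivatives of
    \<open>v\<close>. The bound 1 keeps all supports within radius R + 1.\<close>
  define \<delta> where "\<delta> = min 1 (min d0 (min d1 (Min (range d))))"
  have \<delta>: "\<delta> > 0" "\<delta> \<le> 1" "\<delta> \<le> d0" "\<delta> \<le> d1" "\<delta> \<le> d k" for k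
    using d0(1) d1(1) d1' Min_le[of "range d" "d k"] by (auto simp: \<delta>_def min_le_iff_disj)
  have "norm (dop (conv m v) x - conv m (dop v) x) \<le> e \<and> norm (v x - conv m v x) \<le> e"
    if \<epsilon>: "0 < \<epsilon>" "\<epsilon> < \<delta>" and m: "moll C \<epsilon> m" for \<epsilon> m C x
  proof -
    note M = mollD[OF m]
    have a0: "norm (conv m v y - v y) \<le> e'" for y
      using d0(2)[rule_format, of \<epsilon> C m y] \<epsilon> m \<delta>(3) by simp
    have a1: "norm (conv m (dop v) y - dop v y) \<le> e'" for y
      using d1(2)[rule_format, of \<epsilon> C m y] \<epsilon> m \<delta>(4) by simp
    have a2: "norm (conv m (pd v k) y - pd v k y) \<le> e'" for k y
      using dd[THEN spec, of k, THEN conjunct2, rule_format, of \<epsilon> C m y] \<epsilon> m \<delta>(5)[of k] by simp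
    have "e' \<le> e" using e' CB CZ mult_right_mono[of 1 s e'] by (simp add: s_def)
    then have 2: "norm (v x - conv m v x) \<le> e" using a0[of x] by (simp add: norm_minus_commute)
    have 1: "norm (dop (conv m v) x - conv m (dop v) x) \<le> e"
    proof (cases "norm x \<le> R + 1")
      case True
      have eq: "dop (conv m v) x - conv m (dop v) x =
        (\<Sum>k\<in>UNIV. B k x (conv m (pd v k) x - pd v k x)) + Z x (conv m v x - v x) - (conv m (dop v) x - dop v x)"
        unfolding dop_def[of "conv m v"] dop_def[of v x] pd_conv[OF M(1,2) vi] conv_pd_swap[OF M(1,2) v]
        by (simp add: linear_diff[OF linear_B] linear_diff[OF linear_Z] sum_subtractf)
      have "norm (\<Sum>k\<in>UNIV. B k x (conv m (pd v k) x - pd v k x)) \<le> (\<Sum>k\<in>(UNIV::4 set). CB * e')"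
        by (rule sum_norm_le) (rule order_trans[OF CB(2)[OF True] mult_left_mono[OF a2 CB(1)]])
      moreover have "norm (Z x (conv m v x - v x)) \<le> CZ * e'"
        by (rule order_trans[OF CZ(2)[OF True] mult_left_mono[OF a0 CZ(1)]])
      ultimately have "norm (dop (conv m v) x - conv m (dop v) x) \<le> 4 * (CB * e') + CZ * e' + e'"
        unfolding eq using a1[of x]
          norm_triangle_ineq4[of "(\<Sum>k\<in>UNIV. B k x (conv m (pd v k) x - pd v k x)) + Z x (conv m v x - v x)" "conv m (dop v) x - dop v x"]
          norm_triangle_ineq[of "(\<Sum>k\<in>UNIV. B k x (conv m (pd v k) x - pd v k x))" "Z x (conv m v x - v x)"] by simp
      also have "\<dots> = s * e'" by (simp add: s_def algebra_simps)
      finally show ?thesis using e'(2) by simp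
    next
      case False
      have z: "conv m w y = 0" if "norm y > R + 1" "\<And>x. norm x > R \<Longrightarrow> w x = 0" for w :: "real^4 \<Rightarrow> 'v" and y
        by (rule conv_outside[where R = R and \<epsilon> = \<epsilon>]) (use that M(3) \<epsilon> \<delta>(2) in auto)
      have "conv m (dop v) x = 0" by (rule z) (use False dop_outside[OF R] in auto)
      moreover have "dop (conv m v) x = 0" by (rule dop_outside[of "R + 1"]) (use False z[OF _ R] in auto)
      ultimately show ?thesis using e by simp
    qed
    from 1 2 show ?thesis by blast
  qed
  then have "\<forall>\<epsilon> m C. 0 < \<epsilon> \<and> \<epsilon> < \<delta> \<and> moll C \<epsilon> m \<longrightarrow>
     (\<forall>x. norm (dop (conv m v) x - conv m (dop v) x) \<le> e) \<and> (\<forall>x. norm (v x - conv m v x) \<le> e)" by blast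
  then show ?thesis using \<delta>(1) by (intro exI conjI)
qed

text \<open>The coercive inequality \<open>Q\<close> is applied to the mollified field and passed to
  the limit. Split u = v + (u - v) with v smooth and close to u in L2. The commutator on u - v is
  small by the scale-independent L2 bound, the one on v is small uniformly, and what remains of
  \<open>dop (conv m u)\<close> is - \<open>conv m g\<close>, whose square norm is bounded by that
  of g. Strong convergence of the commutators on rough fields is thereby avoided, at the price of a
  constant factor.\<close>

theorem friedrichs_estimate:
  assumes C: "C > 0" and mex: "\<forall>\<epsilon>>0. \<exists>m. moll C \<epsilon> m" and skew: formally_skew and R: "R \<ge> 0"
    and u: "u \<in> borel_measurable borel" "\<And>x. norm x > R \<Longrightarrow> u x = 0" "N2 u < \<infinity>"
    and g: "g \<in> borel_measurable borel" "\<And>x. norm x > R \<Longrightarrow> g x = 0" "N2 g < \<infinity>"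
    and w: "weak_adj u g"
    and W: "continuous_on UNIV W" "\<And>x. W x \<ge> 0"
    and Q: "\<And>\<psi>. smooth_map \<psi> \<Longrightarrow> bsupp \<psi> \<Longrightarrow> (\<integral>\<^sup>+x. ennreal (W x * (norm (\<psi> x))\<^sup>2) \<partial>lborel) \<le> N2 (dop \<psi>)"
  shows "(\<integral>\<^sup>+x. ennreal (W x * (norm (u x))\<^sup>2) \<partial>lborel) \<le> 4 * ennreal ((C * unit_ball_vol 4)\<^sup>2) * N2 g"
proof -
  define C1 where "C1 = (C * unit_ball_vol 4)\<^sup>2"
  have C1: "C1 \<ge> 0" by (simp add: C1_def)
  obtain K where K: "K \<ge> 0" "\<forall>u g \<epsilon> m x. integrable lborel u \<longrightarrow> integrable lborel g \<longrightarrow> (\<forall>x. norm x > R + 2 \<longrightarrow> u x = 0) \<longrightarrow> weak_adj u g \<longrightarrow>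
     0 < \<epsilon> \<longrightarrow> \<epsilon> \<le> 1 \<longrightarrow> moll C \<epsilon> m \<longrightarrow>
     ennreal (norm (dop (conv m u) x + conv m g x)) \<le> ennreal (K / \<epsilon> ^ 4) * (\<integral>\<^sup>+y. (if dist x y \<le> \<epsilon> then ennreal (norm (u y)) else 0) \<partial>lborel)"
    using friedrichs_commutator[of C "R + 2"] C R by auto
  define K1 where "K1 = (K * unit_ball_vol 4)\<^sup>2"
  have K1: "K1 \<ge> 0" by (simp add: K1_def)
  obtain Wm where Wm: "Wm \<ge> 0" "\<And>x. norm x \<le> R + 3 \<Longrightarrow> norm (W x) \<le> Wm"
    by (rule smooth_bounded_on_ball[OF W(1)]) blast
  have ui: "integrable lborel u" by (rule integrable_L2_bsupp[OF u])
  have gi: "integrable lborel g" by (rule integrable_L2_bsupp[OF g])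
  have Wb: "W \<in> borel_measurable borel" by (rule borel_measurable_continuous_onI[OF W(1)])
  show ?thesis
  proof (rule ennreal_le_epsilon)
    fix e :: real assume e: "e > 0"
    \<comment> \<open>The sum of all coefficients with which \<eta> enters the final estimate, so
      that the total error is exactly \<open>e\<close>.\<close>
    define T where "T = 8 + 8 * K1 + 2 * Wm * (2 + 4 * C1 + 4)"
    have T: "T > 0" using K1 Wm(1) C1 by (simp add: T_def add_pos_nonneg)
    define \<eta> where "\<eta> = e / T"
    have \<eta>: "\<eta> > 0" "T * \<eta> = e" using e T by (auto simp: \<eta>_def)
    obtain v where v: "smooth_map v" "\<forall>x. norm x > R + 2 \<longrightarrow> v x = 0" "N2 (\<lambda>x. u x - v x) \<le> ennreal \<eta>"
      using L2_approx_smooth[OF u(1,2) R u(3) \<eta>(1)] by blast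
    have vb: "bsupp v" by (rule bsuppI[of "R + 2"]) (use v(2) in simp)
    have vi: "integrable lborel v" by (rule integrable_cont_bsupp[OF smooth_cont[OF v(1)] vb])
    have dvi: "integrable lborel (dop v)" by (rule integrable_cont_bsupp[OF smooth_cont[OF smooth_dop[OF v(1)]] bsupp_dop[OF vb]])
    define vol where "vol = measure lborel (cball (0::real^4) (R + 3))"
    have vol: "emeasure lborel (cball (0::real^4) (R + 3)) = ennreal vol" "vol > 0"
    proof -
      show "emeasure lborel (cball (0::real^4) (R + 3)) = ennreal vol"
        unfolding vol_def using emeasure_lborel_cball_finite[of "0::real^4" "R + 3"]
        by (intro emeasure_eq_ennreal_measure) auto
      show "vol > 0" unfolding vol_def using R content_cball_gt_0_iff[of "0::real^4" "R + 3"] by simp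
    qed
    define e' where "e' = sqrt (\<eta> / vol)"
    have e': "e' > 0" "e'\<^sup>2 * vol = \<eta>" using \<eta>(1) vol(2) by (simp_all add: e'_def)
    obtain \<delta> where \<delta>: "\<delta> > 0" "\<forall>\<epsilon> m C. 0 < \<epsilon> \<and> \<epsilon> < \<delta> \<and> moll C \<epsilon> m \<longrightarrow>
     (\<forall>x. norm (dop (conv m v) x - conv m (dop v) x) \<le> e') \<and> (\<forall>x. norm (v x - conv m v x) \<le> e')"
      using dop_conv_smooth_limit[OF v(1) vb e'(1)] by (elim exE conjE) (rule that)
    define \<epsilon> where "\<epsilon> = min (\<delta> / 2) 1"
    have \<epsilon>: "0 < \<epsilon>" "\<epsilon> \<le> 1" "\<epsilon> < \<delta>" using \<delta>(1) by (auto simp: \<epsilon>_def)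
    obtain m where m: "moll C \<epsilon> m" using mex \<epsilon>(1) by blast
    note M = mollD[OF m]
    have F1: "norm (dop (conv m v) x - conv m (dop v) x) \<le> e'" and F0: "norm (v x - conv m v x) \<le> e'" for x
      using \<delta>(2)[rule_format, of \<epsilon> C m] \<epsilon> m by auto
    have cz: "conv m h y = 0" if "norm y > R + 3" "\<And>x. norm x > R + 2 \<Longrightarrow> h x = 0" for h :: "real^4 \<Rightarrow> 'v" and y
      by (rule conv_outside[where R = "R + 2" and \<epsilon> = \<epsilon>]) (use that M(3) \<epsilon>(2) in auto)
    have uz: "u x = 0" "g x = 0" "v x = 0" if "norm x > R + 2" for x using that u(2) g(2) v(2) by auto
    have scu: "smooth_map (conv m u)" by (rule smooth_conv[OF M(1,2) ui])
    have scv: "smooth_map (conv m v)" by (rule smooth_conv[OF M(1,2) vi])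
    have bcu: "bsupp (conv m u)" by (rule bsuppI[of "R + 3"], rule cz) (use uz in auto)
    have scg: "smooth_map (conv m g)" by (rule smooth_conv[OF M(1,2) gi])
    have scd: "smooth_map (conv m (dop v))" by (rule smooth_conv[OF M(1,2) dvi])
    have umv: "integrable lborel (\<lambda>x. u x - v x)" by (rule Bochner_Integration.integrable_diff[OF ui vi])
    have gpv: "integrable lborel (\<lambda>x. g x + dop v x)" by (rule Bochner_Integration.integrable_add[OF gi dvi])
    have wd: "weak_adj (\<lambda>x. u x - v x) (\<lambda>x. g x + dop v x)"
      unfolding weak_adj_def
    proof (intro allI impI)
      fix \<psi> :: "real^4 \<Rightarrow> 'v" assume \<psi>: "smooth_map \<psi>" "bsupp \<psi>"
      have i: "integrable lborel (\<lambda>x. u x \<bullet> dop \<psi> x)" "integrable lborel (\<lambda>x. v x \<bullet> dop \<psi> x)"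
        by (intro integrable_inner_cont[OF _ smooth_cont[OF smooth_dop[OF \<psi>(1)]] bsupp_dop[OF \<psi>(2)]] ui vi)+
      have j: "integrable lborel (\<lambda>x. g x \<bullet> \<psi> x)" "integrable lborel (\<lambda>x. dop v x \<bullet> \<psi> x)"
        by (intro integrable_inner_cont[OF _ smooth_cont[OF \<psi>(1)] \<psi>(2)] gi dvi)+
      have sk: "(\<integral>x. v x \<bullet> dop \<psi> x \<partial>lborel) = (\<integral>x. - dop v x \<bullet> \<psi> x \<partial>lborel)"
        using skew v(1) vb \<psi> unfolding formally_skew_def by blast
      have "(\<integral>x. (u x - v x) \<bullet> dop \<psi> x \<partial>lborel) = (\<integral>x. u x \<bullet> dop \<psi> x \<partial>lborel) - (\<integral>x. v x \<bullet> dop \<psi> x \<partial>lborel)"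
        unfolding inner_diff_left by (rule Bochner_Integration.integral_diff[OF i])
      also have "\<dots> = (\<integral>x. g x \<bullet> \<psi> x \<partial>lborel) + (\<integral>x. dop v x \<bullet> \<psi> x \<partial>lborel)"
        using w \<psi> unfolding sk weak_adj_def by simp
      also have "\<dots> = (\<integral>x. (g x + dop v x) \<bullet> \<psi> x \<partial>lborel)"
        unfolding inner_add_left by (rule Bochner_Integration.integral_add[OF j, symmetric])
      finally show "(\<integral>x. (u x - v x) \<bullet> dop \<psi> x \<partial>lborel) = (\<integral>x. (g x + dop v x) \<bullet> \<psi> x \<partial>lborel)" .
    qed
    define F2 where "F2 x = dop (conv m (\<lambda>x. u x - v x)) x + conv m (\<lambda>x. g x + dop v x) x" for x
    have "ennreal (norm (F2 x)) \<le> ennreal (K / \<epsilon> ^ 4) * (\<integral>\<^sup>+y. (if dist x y \<le> \<epsilon> then ennreal (norm (u y - v y)) else 0) \<partial>lborel)" for x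
      unfolding F2_def by (rule K(2)[rule_format]) (use umv gpv uz wd \<epsilon> m in auto)
    then have "N2 F2 \<le> ennreal K1 * (\<integral>\<^sup>+x. ennreal ((norm (u x - v x))\<^sup>2) \<partial>lborel)"
      unfolding K1_def
      by (intro schur_bound[OF _ _ \<epsilon>(1) K(1)]) (use u(1) borel_smooth[OF v(1)] in auto)
    also have "\<dots> \<le> ennreal K1 * ennreal \<eta>" by (rule mult_left_mono) (use v(3) in \<open>auto simp: N2_def\<close>)
    finally have n2: "N2 F2 \<le> ennreal K1 * ennreal \<eta>" .
    define F3 where "F3 x = dop (conv m v) x - conv m (dop v) x" for x
    have "N2 F3 \<le> ennreal (e'\<^sup>2) * ennreal vol"
      unfolding vol(1)[symmetric] F3_def
    proof (rule N2_uniform[OF F1])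
      fix x :: "real^4" assume x: "norm x > R + 3"
      have "dop (conv m v) x = 0" by (rule dop_outside[of "R + 3"]) (use x cz[OF _ uz(3)] in auto)
      moreover have "conv m (dop v) x = 0" by (rule cz[OF x dop_outside[of "R + 2"]]) (use uz in auto)
      ultimately show "dop (conv m v) x - conv m (dop v) x = 0" by simp
    qed
    also have "\<dots> = ennreal \<eta>" unfolding e'(2)[symmetric] using vol(2) by (intro ennreal_mult[symmetric]) auto
    finally have n3: "N2 F3 \<le> ennreal \<eta>" .
    have "N2 (\<lambda>x. v x - conv m v x) \<le> ennreal (e'\<^sup>2) * ennreal vol"
      unfolding vol(1)[symmetric]
      by (rule N2_uniform[OF F0]) (use uz cz[OF _ uz(3)] in auto)
    also have "\<dots> = ennreal \<eta>" unfolding e'(2)[symmetric] using vol(2) by (intro ennreal_mult[symmetric]) auto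
    finally have n0: "N2 (\<lambda>x. v x - conv m v x) \<le> ennreal \<eta>" .
    have lin: "conv m (\<lambda>x. a x - b x) = (\<lambda>x. conv m a x - conv m b x)" "conv m (\<lambda>x. a x + b x) = (\<lambda>x. conv m a x + conv m b x)"
      if "integrable lborel a" "integrable lborel b" for a b :: "real^4 \<Rightarrow> 'v"
      unfolding conv_def scaleR_diff_right scaleR_add_right fun_eq_iff
      using Bochner_Integration.integral_diff[OF conv_integrable[OF smooth_cont[OF M(1)] M(2) that(1)] conv_integrable[OF smooth_cont[OF M(1)] M(2) that(2)]]
        Bochner_Integration.integral_add[OF conv_integrable[OF smooth_cont[OF M(1)] M(2) that(1)] conv_integrable[OF smooth_cont[OF M(1)] M(2) that(2)]]
      by blast+
    have dopd: "dop (\<lambda>x. a x - b x) x = dop a x - dop b x" if "smooth_map a" "smooth_map b" for a b x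
      unfolding dop_def pd_diff[OF that]
      by (simp add: linear_diff[OF linear_B] linear_diff[OF linear_Z] sum_subtractf)
    \<comment> \<open>Commutator on the small remainder, commutator on the smooth approximation, and
      the mollified right-hand side.\<close>
    have dec: "dop (conv m u) x = (F2 x + F3 x) + - conv m g x" for x
      unfolding F2_def F3_def lin(1)[OF ui vi] lin(2)[OF gi dvi] dopd[OF scu scv] by simp
    have mF: "F2 \<in> borel_measurable borel" "F3 \<in> borel_measurable borel" "(\<lambda>x. - conv m g x) \<in> borel_measurable borel"
      unfolding F2_def F3_def
      by (intro borel_smooth smooth_add smooth_diff smooth_uminus smooth_dop smooth_conv M(1,2) umv gpv vi dvi gi)+
    have a1: "N2 (dop (conv m u)) \<le> 2 * N2 (\<lambda>x. F2 x + F3 x) + 2 * N2 (\<lambda>x. - conv m g x)"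
      unfolding dec[abs_def] by (rule N2_add) (use mF in auto)
    have a2: "N2 (\<lambda>x. F2 x + F3 x) \<le> 2 * N2 F2 + 2 * N2 F3" by (rule N2_add) (use mF in auto)
    have a3: "N2 (\<lambda>x. - conv m g x) \<le> ennreal C1 * N2 g"
      using conv_L2[OF g(1) m _ \<epsilon>(1)] C unfolding C1_def by (simp add: N2_def)
    have b1: "N2 (\<lambda>x. (u x - v x) + ((v x - conv m v x) + - conv m (\<lambda>x. u x - v x) x))
       \<le> 2 * N2 (\<lambda>x. u x - v x) + 2 * N2 (\<lambda>x. (v x - conv m v x) + - conv m (\<lambda>x. u x - v x) x)"
      by (rule N2_add) (use u(1) borel_smooth[OF v(1)] borel_smooth[OF scv] borel_smooth[OF smooth_conv[OF M(1,2) umv]] in auto)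
    have b2: "N2 (\<lambda>x. (v x - conv m v x) + - conv m (\<lambda>x. u x - v x) x) \<le> 2 * N2 (\<lambda>x. v x - conv m v x) + 2 * N2 (\<lambda>x. - conv m (\<lambda>x. u x - v x) x)"
      by (rule N2_add) (use borel_smooth[OF v(1)] borel_smooth[OF scv] borel_smooth[OF smooth_conv[OF M(1,2) umv]] in auto)
    have b3: "N2 (\<lambda>x. - conv m (\<lambda>x. u x - v x) x) \<le> ennreal C1 * N2 (\<lambda>x. u x - v x)"
      using conv_L2[OF _ m _ \<epsilon>(1), of "\<lambda>x. u x - v x"] C u(1) borel_smooth[OF v(1)] unfolding C1_def by (simp add: N2_def)
    have beq: "(u x - v x) + ((v x - conv m v x) + - conv m (\<lambda>x. u x - v x) x) = u x - conv m u x" for x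
      unfolding lin(1)[OF ui vi] by simp
    have b4: "N2 (\<lambda>x. u x - conv m u x) \<le> 2 * ennreal \<eta> + 2 * (2 * ennreal \<eta> + 2 * (ennreal C1 * ennreal \<eta>))"
      by (rule order_trans[OF b1[unfolded beq]], intro add_mono mult_left_mono order_trans[OF b2] order_trans[OF b3] v(3) n0) auto
    have c1: "(\<integral>\<^sup>+x. ennreal (W x * (norm (conv m u x + (u x - conv m u x)))\<^sup>2) \<partial>lborel)
      \<le> 2 * (\<integral>\<^sup>+x. ennreal (W x * (norm (conv m u x))\<^sup>2) \<partial>lborel) + 2 * (\<integral>\<^sup>+x. ennreal (W x * (norm (u x - conv m u x))\<^sup>2) \<partial>lborel)"
      by (rule weighted_N2_add) (use u(1) borel_smooth[OF scu] Wb W(2) in auto)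
    have c2: "(\<integral>\<^sup>+x. ennreal (W x * (norm (u x - conv m u x))\<^sup>2) \<partial>lborel) \<le> ennreal Wm * N2 (\<lambda>x. u x - conv m u x)"
    proof -
      have "(\<integral>\<^sup>+x. ennreal (W x * (norm (u x - conv m u x))\<^sup>2) \<partial>lborel) \<le> (\<integral>\<^sup>+x. ennreal Wm * ennreal ((norm (u x - conv m u x))\<^sup>2) \<partial>lborel)"
      proof (rule nn_integral_mono)
        fix x
        show "ennreal (W x * (norm (u x - conv m u x))\<^sup>2) \<le> ennreal Wm * ennreal ((norm (u x - conv m u x))\<^sup>2)"
        proof (cases "norm x > R + 3")
          case True
          then have "u x - conv m u x = 0" using uz(1)[of x] cz[OF True uz(1)] by simp
          then show ?thesis by simp
        next
          case False
          then have "W x * (norm (u x - conv m u x))\<^sup>2 \<le> Wm * (norm (u x - conv m u x))\<^sup>2"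
            using Wm(2)[of x] by (intro mult_right_mono) auto
          then show ?thesis using Wm(1) by (simp add: ennreal_mult[symmetric] ennreal_leI)
        qed
      qed
      also have "\<dots> = ennreal Wm * N2 (\<lambda>x. u x - conv m u x)"
        unfolding N2_def by (rule nn_integral_cmult) (use u(1) borel_smooth[OF scu] in auto)
      finally show ?thesis .
    qed
    have c3: "(\<integral>\<^sup>+x. ennreal (W x * (norm (conv m u x))\<^sup>2) \<partial>lborel) \<le> 2 * (2 * (ennreal K1 * ennreal \<eta>) + 2 * ennreal \<eta>) + 2 * (ennreal C1 * N2 g)"
      by (rule order_trans[OF Q[OF scu bcu]], rule order_trans[OF a1], intro add_mono mult_left_mono order_trans[OF a2] n2 n3 a3) auto
    have ceq: "conv m u x + (u x - conv m u x) = u x" for x by simp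
    have "(\<integral>\<^sup>+x. ennreal (W x * (norm (u x))\<^sup>2) \<partial>lborel) \<le>
        2 * (2 * (2 * (ennreal K1 * ennreal \<eta>) + 2 * ennreal \<eta>) + 2 * (ennreal C1 * N2 g))
      + 2 * (ennreal Wm * (2 * ennreal \<eta> + 2 * (2 * ennreal \<eta> + 2 * (ennreal C1 * ennreal \<eta>))))"
      by (rule order_trans[OF c1[unfolded ceq]], intro add_mono mult_left_mono c3 order_trans[OF c2] b4) auto
    also have "\<dots> = 4 * ennreal C1 * N2 g + ennreal e"
    proof -
      have "2 * (2 * (2 * (ennreal K1 * ennreal \<eta>) + 2 * ennreal \<eta>)) + 2 * (ennreal Wm * (2 * ennreal \<eta> + 2 * (2 * ennreal \<eta> + 2 * (ennreal C1 * ennreal \<eta>)))) = ennreal e"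
      proof -
        have n2: "2 * ennreal x = ennreal (2 * x)" if "x \<ge> 0" for x using that by (simp add: ennreal_mult)
        have "2 * (2 * (2 * (ennreal K1 * ennreal \<eta>) + 2 * ennreal \<eta>)) + 2 * (ennreal Wm * (2 * ennreal \<eta> + 2 * (2 * ennreal \<eta> + 2 * (ennreal C1 * ennreal \<eta>))))
          = ennreal (2 * (2 * (2 * (K1 * \<eta>) + 2 * \<eta>)) + 2 * (Wm * (2 * \<eta> + 2 * (2 * \<eta> + 2 * (C1 * \<eta>)))))"
          using K1 C1 Wm(1) \<eta>(1) by (simp add: n2 ennreal_mult[symmetric] ennreal_plus[symmetric] del: ennreal_plus)
        also have "2 * (2 * (2 * (K1 * \<eta>) + 2 * \<eta>)) + 2 * (Wm * (2 * \<eta> + 2 * (2 * \<eta> + 2 * (C1 * \<eta>))))  = e"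
          unfolding \<eta>(2)[symmetric] T_def by (simp add: algebra_simps)
        finally show ?thesis .
      qed
      then show ?thesis by (simp only: distrib_left mult.assoc[symmetric] add.assoc add.left_commute add.commute) (simp add: algebra_simps)
    qed
    finally show "(\<integral>\<^sup>+x. ennreal (W x * (norm (u x))\<^sup>2) \<partial>lborel) \<le> 4 * ennreal ((C * unit_ball_vol 4)\<^sup>2) * N2 g + ennreal e"
      unfolding C1_def .
  qed
qed

end

section \<open>Clifford modules and the spin representation of bivectors\<close>

section \<open>Clifford modules in a moving frame\<close>

text \<open>A real Clifford module with symmetric generators of square +1. Complex spinors enter
  through their underlying real inner product.\<close>

locale clifford =
  fixes g :: "4 \<Rightarrow> 'v::euclidean_space \<Rightarrow> 'v"
  assumes lin_g: "\<And>a. linear (g a)"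
    and sym_g: "\<And>a v w. g a v \<bullet> w = v \<bullet> g a w"
    and anticomm_g: "\<And>a b v. g a (g b v) + g b (g a v) = (if a = b then 2 else 0) *\<^sub>R v"
begin

lemma g_simps:
  "g a (v + w) = g a v + g a w" "g a (v - w) = g a v - g a w" "g a (c *\<^sub>R v) = c *\<^sub>R g a v" "g a (- v) = - g a v"
  "g a 0 = 0" "g a (\<Sum>i\<in>I. f i) = (\<Sum>i\<in>I. g a (f i))"
  by (simp_all add: linear_add[OF lin_g] linear_diff[OF lin_g] linear_cmul[OF lin_g] linear_neg[OF lin_g]
      linear_0[OF lin_g] linear_sum[OF lin_g])

lemma g_swap: "g a (g b v) = (if a = b then 2 else 0) *\<^sub>R v - g b (g a v)"
  using anticomm_g[of a b v] by (simp add: algebra_simps)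

lemma bl_g: "bounded_linear (g a)"
  using lin_g linear_conv_bounded_linear by blast

lemma g_triple: "g i (g j (g m v)) = (if j = m then 2 else 0) *\<^sub>R g i v - (if i = m then 2 else 0) *\<^sub>R g j v + g m (g i (g j v))"
proof -
  have "g i (g j (g m v)) = (if j = m then 2 else 0) *\<^sub>R g i v - g i (g m (g j v))"
    by (subst g_swap[of j m v]) (simp add: g_simps)
  also have "g i (g m (g j v)) = (if i = m then 2 else 0) *\<^sub>R g j v - g m (g i (g j v))"
    by (rule g_swap)
  finally show ?thesis by simp
qed

definition biv :: "(4 \<Rightarrow> 4 \<Rightarrow> real) \<Rightarrow> 'v \<Rightarrow> 'v" where
  "biv M v = (\<Sum>i\<in>UNIV. \<Sum>j\<in>UNIV. M i j *\<^sub>R g i (g j v))"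

lemma lin_biv: "linear (biv M)"
  unfolding biv_def by (intro linear_compose_sum ballI linear_compose_scale_right linear_compose[OF lin_g lin_g, unfolded o_def])

text \<open>Moving one generator past a product of two produces two contractions, which agree by
  antisymmetry of M. Thus a quarter of \<open>biv M\<close> acts on generators by the infinitesimal
  rotation M.\<close>

lemma biv_g:
  assumes M: "\<And>i j. M i j = - M j i"
  shows "biv M (g m v) = g m (biv M v) + 4 *\<^sub>R (\<Sum>i\<in>UNIV. M i m *\<^sub>R g i v)"
proof -
  have "biv M (g m v) = (\<Sum>i\<in>UNIV. \<Sum>j\<in>UNIV. M i j *\<^sub>R ((if j = m then 2 else 0) *\<^sub>R g i v)) -
     (\<Sum>i\<in>UNIV. \<Sum>j\<in>UNIV. M i j *\<^sub>R ((if i = m then 2 else 0) *\<^sub>R g j v)) + (\<Sum>i\<in>UNIV. \<Sum>j\<in>UNIV. M i j *\<^sub>R g m (g i (g j v)))"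
    unfolding biv_def g_triple[of _ _ m] by (simp only: scaleR_add_right scaleR_diff_right sum.distrib sum_subtractf)
  also have "(\<Sum>i\<in>UNIV. \<Sum>j\<in>UNIV. M i j *\<^sub>R ((if j = m then 2 else 0) *\<^sub>R g i v)) = 2 *\<^sub>R (\<Sum>i\<in>UNIV. M i m *\<^sub>R g i v)"
    by (simp add: scaleR_sum_right if_distrib[of "\<lambda>c. c *\<^sub>R _"] if_distrib[of "\<lambda>c. _ *\<^sub>R c"] if_distrib[of "\<lambda>c. _ * c"] mult.commute cong: if_cong)
  also have "(\<Sum>i\<in>UNIV. \<Sum>j\<in>UNIV. M i j *\<^sub>R ((if i = m then 2 else 0) *\<^sub>R g j v)) = - (2 *\<^sub>R (\<Sum>i\<in>UNIV. M i m *\<^sub>R g i v))"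
  proof -
    have "(\<Sum>i\<in>UNIV. \<Sum>j\<in>UNIV. M i j *\<^sub>R ((if i = m then 2 else 0) *\<^sub>R g j v)) = (\<Sum>j\<in>UNIV. \<Sum>i\<in>UNIV. M i j *\<^sub>R ((if i = m then 2 else 0) *\<^sub>R g j v))"
      by (rule sum.swap)
    also have "\<dots> = (\<Sum>j\<in>UNIV. (2 * M m j) *\<^sub>R g j v)"
      by (rule sum.cong) (simp_all add: if_distrib[of "\<lambda>c. c *\<^sub>R _"] if_distrib[of "\<lambda>c. _ *\<^sub>R c"] if_distrib[of "\<lambda>c. _ * c"] mult.commute cong: if_cong)
    also have "\<dots> = (\<Sum>j\<in>UNIV. - (2 *\<^sub>R (M j m *\<^sub>R g j v)))"
      by (rule sum.cong) (simp_all add: M[of m])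
    finally show ?thesis by (simp add: sum_negf scaleR_sum_right)
  qed
  also have "(\<Sum>i\<in>UNIV. \<Sum>j\<in>UNIV. M i j *\<^sub>R g m (g i (g j v))) = g m (biv M v)"
    unfolding biv_def by (simp add: g_simps)
  finally show ?thesis by (simp add: algebra_simps flip: scaleR_add_left)
qed

lemma biv_sym:
  assumes M: "\<And>i j. M i j = - M j i"
  shows "biv M v \<bullet> w = - (v \<bullet> biv M w)"
proof -
  have "biv M v \<bullet> w = (\<Sum>i\<in>UNIV. \<Sum>j\<in>UNIV. M i j * (v \<bullet> g j (g i w)))"
    unfolding biv_def by (simp add: inner_sum_left sym_g)
  also have "\<dots> = (\<Sum>j\<in>UNIV. \<Sum>i\<in>UNIV. M i j * (v \<bullet> g j (g i w)))" by (rule sum.swap)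
  also have "\<dots> = (\<Sum>j\<in>UNIV. \<Sum>i\<in>UNIV. - (M j i * (v \<bullet> g j (g i w))))"
  proof (intro sum.cong refl)
    fix i j
    show "M i j * (v \<bullet> g j (g i w)) = - (M j i * (v \<bullet> g j (g i w)))" unfolding M[of i j] by simp
  qed
  also have "\<dots> = - (v \<bullet> biv M w)" unfolding biv_def by (simp add: inner_sum_right sum_negf)
  finally show ?thesis .
qed

text \<open>By \<open>biv_g\<close> the commutator acts as a derivation on each product of two
  generators. After division by 4 on both sides this says that bivectors represent the Lie algebra
  of antisymmetric matrices.\<close>

lemma biv_commutator:
  assumes M: "\<And>i j. M i j = - M j i" and N: "\<And>i j. N i j = - N j i"
  shows "biv M (biv N v) - biv N (biv M v) = 4 *\<^sub>R biv (\<lambda>i j. (\<Sum>m\<in>UNIV. M i m * N m j) - (\<Sum>m\<in>UNIV. N i m * M m j)) v"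
proof -
  have 1: "biv M (g i (g j v)) = g i (g j (biv M v)) + 4 *\<^sub>R (\<Sum>m\<in>UNIV. M m j *\<^sub>R g i (g m v)) + 4 *\<^sub>R (\<Sum>m\<in>UNIV. M m i *\<^sub>R g m (g j v))" for i j
    unfolding biv_g[OF M] by (simp add: g_simps scaleR_sum_right)
  have "biv M (biv N v) = (\<Sum>i\<in>UNIV. \<Sum>j\<in>UNIV. N i j *\<^sub>R biv M (g i (g j v)))"
    unfolding biv_def[of N] by (simp add: linear_sum[OF lin_biv] linear_cmul[OF lin_biv])
  also have "\<dots> = (\<Sum>i\<in>UNIV. \<Sum>j\<in>UNIV. N i j *\<^sub>R g i (g j (biv M v)))
     + (\<Sum>i\<in>UNIV. \<Sum>j\<in>UNIV. N i j *\<^sub>R 4 *\<^sub>R (\<Sum>m\<in>UNIV. M m j *\<^sub>R g i (g m v)))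
     + (\<Sum>i\<in>UNIV. \<Sum>j\<in>UNIV. N i j *\<^sub>R 4 *\<^sub>R (\<Sum>m\<in>UNIV. M m i *\<^sub>R g m (g j v)))"
    unfolding 1 by (simp only: scaleR_add_right sum.distrib)
  also have "(\<Sum>i\<in>UNIV. \<Sum>j\<in>UNIV. N i j *\<^sub>R g i (g j (biv M v))) = biv N (biv M v)" by (simp add: biv_def)
  also have "(\<Sum>i\<in>UNIV. \<Sum>j\<in>UNIV. N i j *\<^sub>R 4 *\<^sub>R (\<Sum>m\<in>UNIV. M m j *\<^sub>R g i (g m v)))
     = 4 *\<^sub>R (\<Sum>i\<in>UNIV. \<Sum>m\<in>UNIV. (- (\<Sum>j\<in>UNIV. N i j * M j m)) *\<^sub>R g i (g m v))"
  proof -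
    have "(\<Sum>j\<in>UNIV. N i j *\<^sub>R 4 *\<^sub>R (\<Sum>m\<in>UNIV. M m j *\<^sub>R g i (g m v))) = (\<Sum>m\<in>UNIV. 4 *\<^sub>R (- (\<Sum>j\<in>UNIV. N i j * M j m)) *\<^sub>R g i (g m v))" for i
    proof -
      have "(\<Sum>j\<in>UNIV. N i j *\<^sub>R 4 *\<^sub>R (\<Sum>m\<in>UNIV. M m j *\<^sub>R g i (g m v))) = (\<Sum>j\<in>UNIV. \<Sum>m\<in>UNIV. (4 * (N i j * M m j)) *\<^sub>R g i (g m v))"
        by (simp add: scaleR_sum_right mult_ac)
      also have "\<dots> = (\<Sum>m\<in>UNIV. \<Sum>j\<in>UNIV. (4 * (N i j * M m j)) *\<^sub>R g i (g m v))" by (rule sum.swap)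
      also have "\<dots> = (\<Sum>m\<in>UNIV. 4 *\<^sub>R (- (\<Sum>j\<in>UNIV. N i j * M j m)) *\<^sub>R g i (g m v))"
      proof (rule sum.cong[OF refl])
        fix m
        have h: "(- (\<Sum>j\<in>UNIV. N i j * M j m)) = (\<Sum>j\<in>UNIV. N i j * M m j)"
          by (subst sum_negf[symmetric]) (rule sum.cong, simp_all add: M[of m])
        show "(\<Sum>j\<in>UNIV. (4 * (N i j * M m j)) *\<^sub>R g i (g m v)) = 4 *\<^sub>R (- (\<Sum>j\<in>UNIV. N i j * M j m)) *\<^sub>R g i (g m v)"
          unfolding h scaleR_sum_left[symmetric] sum_distrib_left[symmetric] by simp
      qed
      finally show ?thesis .
    qed
    then show ?thesis by (simp only: scaleR_sum_right)
  qed
  also have "(\<Sum>i\<in>UNIV. \<Sum>j\<in>UNIV. N i j *\<^sub>R 4 *\<^sub>R (\<Sum>m\<in>UNIV. M m i *\<^sub>R g m (g j v)))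
     = 4 *\<^sub>R (\<Sum>m\<in>UNIV. \<Sum>j\<in>UNIV. (\<Sum>i\<in>UNIV. M m i * N i j) *\<^sub>R g m (g j v))"
  proof -
    have "(\<Sum>i\<in>UNIV. \<Sum>j\<in>UNIV. N i j *\<^sub>R 4 *\<^sub>R (\<Sum>m\<in>UNIV. M m i *\<^sub>R g m (g j v))) =
       (\<Sum>i\<in>UNIV. \<Sum>j\<in>UNIV. \<Sum>m\<in>UNIV. (4 * (M m i * N i j)) *\<^sub>R g m (g j v))"
      by (simp add: scaleR_sum_right mult_ac)
    also have "\<dots> = (\<Sum>i\<in>UNIV. \<Sum>m\<in>UNIV. \<Sum>j\<in>UNIV. (4 * (M m i * N i j)) *\<^sub>R g m (g j v))"
      by (rule sum.cong[OF refl]) (rule sum.swap)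
    also have "\<dots> = (\<Sum>m\<in>UNIV. \<Sum>i\<in>UNIV. \<Sum>j\<in>UNIV. (4 * (M m i * N i j)) *\<^sub>R g m (g j v))"
      by (rule sum.swap)
    also have "\<dots> = (\<Sum>m\<in>UNIV. \<Sum>j\<in>UNIV. \<Sum>i\<in>UNIV. (4 * (M m i * N i j)) *\<^sub>R g m (g j v))"
      by (rule sum.cong[OF refl]) (rule sum.swap)
    also have "\<dots> = 4 *\<^sub>R (\<Sum>m\<in>UNIV. \<Sum>j\<in>UNIV. (\<Sum>i\<in>UNIV. M m i * N i j) *\<^sub>R g m (g j v))"
      by (simp only: scaleR_sum_right scaleR_scaleR scaleR_sum_left sum_distrib_left)
    finally show ?thesis .
  qed
  finally show ?thesis
    unfolding biv_def[of "\<lambda>i j. (\<Sum>m\<in>UNIV. M i m * N m j) - (\<Sum>m\<in>UNIV. N i m * M m j)"]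
    by (simp add: scaleR_diff_left sum_subtractf sum_negf scaleR_diff_right)
qed

end

section \<open>Clifford generators rotated by an orthogonal matrix field, and their flat
  connection\<close>

locale moving_clifford = clifford g
  for g :: "4 \<Rightarrow> 'v::euclidean_space \<Rightarrow> 'v" +
  fixes Q :: "real^4 \<Rightarrow> 4 \<Rightarrow> 4 \<Rightarrow> real"
  assumes smooth_Q: "\<And>a m. smooth_map (\<lambda>x. Q x a m)"
    and orth_row: "\<And>x a b. (\<Sum>m\<in>UNIV. Q x a m * Q x b m) = (if a = b then 1 else 0)"
    and orth_col: "\<And>x m n. (\<Sum>a\<in>UNIV. Q x a m * Q x a n) = (if m = n then 1 else 0)"
begin

text \<open>The rotation Q is applied to the generators and not to the spinors, so no lift of Q to
  the spin group has to be constructed.\<close>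

definition gm :: "real^4 \<Rightarrow> 4 \<Rightarrow> 'v \<Rightarrow> 'v" where
  "gm x m v = (\<Sum>a\<in>UNIV. Q x a m *\<^sub>R g a v)"

definition Om :: "4 \<Rightarrow> real^4 \<Rightarrow> 4 \<Rightarrow> 4 \<Rightarrow> real" where
  "Om k x i j = (\<Sum>m\<in>UNIV. pd (\<lambda>y. Q y i m) k x * Q x j m)"

text \<open>\<open>Om\<close> is the pure gauge form dQ times the transpose of Q. This is the
  connection that makes the rotated generators parallel, in place of the plain derivative that would
  be used if Q were constant.\<close>

definition cov :: "4 \<Rightarrow> (real^4 \<Rightarrow> 'v) \<Rightarrow> real^4 \<Rightarrow> 'v" where
  "cov k \<phi> x = pd \<phi> k x - (1/4) *\<^sub>R biv (Om k x) (\<phi> x)"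

lemma lin_gm: "linear (gm x m)"
  unfolding gm_def by (intro linear_compose_sum ballI linear_compose_scale_right lin_g)

lemma gm_sym: "gm x m v \<bullet> w = v \<bullet> gm x m w"
  by (simp add: gm_def inner_sum_left inner_sum_right sym_g)

lemma gm_anticomm: "gm x m (gm x n v) + gm x n (gm x m v) = (if m = n then 2 else 0) *\<^sub>R v"
proof -
  have "gm x m (gm x n v) + gm x n (gm x m v)
    = (\<Sum>a\<in>UNIV. \<Sum>b\<in>UNIV. (Q x a m * Q x b n) *\<^sub>R g a (g b v)) + (\<Sum>a\<in>UNIV. \<Sum>b\<in>UNIV. (Q x a n * Q x b m) *\<^sub>R g a (g b v))"
    by (simp add: gm_def g_simps scaleR_sum_right)
  also have "(\<Sum>a\<in>UNIV. \<Sum>b\<in>UNIV. (Q x a n * Q x b m) *\<^sub>R g a (g b v)) = (\<Sum>b\<in>UNIV. \<Sum>a\<in>UNIV. (Q x a n * Q x b m) *\<^sub>R g a (g b v))"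
    by (rule sum.swap)
  also have "(\<Sum>a\<in>UNIV. \<Sum>b\<in>UNIV. (Q x a m * Q x b n) *\<^sub>R g a (g b v)) + (\<Sum>b\<in>UNIV. \<Sum>a\<in>UNIV. (Q x a n * Q x b m) *\<^sub>R g a (g b v))
     = (\<Sum>a\<in>UNIV. \<Sum>b\<in>UNIV. (Q x a m * Q x b n) *\<^sub>R (g a (g b v) + g b (g a v)))"
    by (simp add: sum.distrib scaleR_add_right mult.commute)
  also have "\<dots> = (\<Sum>a\<in>UNIV. (2 * (Q x a m * Q x a n)) *\<^sub>R v)"
    unfolding anticomm_g
    by (rule sum.cong) (simp_all add: if_distrib[of "\<lambda>c. c *\<^sub>R _"] if_distrib[of "\<lambda>c. _ *\<^sub>R c"] if_distrib[of "\<lambda>c. _ * c"] mult.commute cong: if_cong)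
  also have "\<dots> = (2 * (\<Sum>a\<in>UNIV. Q x a m * Q x a n)) *\<^sub>R v"
    by (simp only: sum_distrib_left scaleR_sum_left)
  finally show ?thesis by (simp add: orth_col)
qed

lemma smooth_gm_const: "smooth_map (\<lambda>x. gm x m v)"
  unfolding gm_def by (intro smooth_sum smooth_scaleR smooth_Q smooth_const)

lemma smooth_gm: "smooth_map \<phi> \<Longrightarrow> smooth_map (\<lambda>x. gm x m (\<phi> x))"
  by (rule smooth_apply[OF smooth_gm_const lin_gm])

lemma smooth_Om: "smooth_map (\<lambda>x. Om k x i j)"
  unfolding Om_def by (intro smooth_sum smooth_mult smooth_pd' smooth_Q)

lemma smooth_biv_Om: "smooth_map (\<lambda>x. biv (Om k x) v)"
  unfolding biv_def by (intro smooth_sum smooth_scaleR smooth_Om smooth_const)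

lemma smooth_cov: "smooth_map \<phi> \<Longrightarrow> smooth_map (cov k \<phi>)"
  unfolding cov_def[abs_def]
  by (intro smooth_diff smooth_pd' smooth_scaleR smooth_const smooth_apply[OF smooth_biv_Om lin_biv])

lemma cov_outside: "(\<And>x. norm x > R \<Longrightarrow> \<phi> x = 0) \<Longrightarrow> norm x > R \<Longrightarrow> cov k \<phi> x = 0"
  using pd_zero_outside[of R \<phi> x] by (simp add: cov_def linear_0[OF lin_biv])

lemma Om_antisym: "Om k x i j = - Om k x j i"
proof -
  have "(\<lambda>y. \<Sum>m\<in>UNIV. Q y i m * Q y j m) = (\<lambda>y. if i = j then 1 else 0)" using orth_row by blast
  then have "pd (\<lambda>y. \<Sum>m\<in>UNIV. Q y i m * Q y j m) k x = 0" by simp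
  then have "(\<Sum>m\<in>UNIV. pd (\<lambda>y. Q y i m * Q y j m) k x) = 0"
    by (subst (asm) pd_sum) (auto intro: smooth_mult smooth_Q)
  then have "(\<Sum>m\<in>UNIV. pd (\<lambda>y. Q y i m) k x * Q x j m + Q x i m * pd (\<lambda>y. Q y j m) k x) = 0"
    by (simp add: pd_mult smooth_Q)
  then show ?thesis by (simp add: Om_def sum.distrib mult.commute)
qed

lemma Om_Q: "(\<Sum>j\<in>UNIV. Om k x i j * Q x j m) = pd (\<lambda>y. Q y i m) k x"
proof -
  have "(\<Sum>j\<in>UNIV. Om k x i j * Q x j m) = (\<Sum>j\<in>UNIV. \<Sum>n\<in>UNIV. pd (\<lambda>y. Q y i n) k x * (Q x j n * Q x j m))"
    unfolding Om_def by (simp add: sum_distrib_right mult.assoc)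
  also have "\<dots> = (\<Sum>n\<in>UNIV. \<Sum>j\<in>UNIV. pd (\<lambda>y. Q y i n) k x * (Q x j n * Q x j m))" by (rule sum.swap)
  also have "\<dots> = (\<Sum>n\<in>UNIV. pd (\<lambda>y. Q y i n) k x * (if n = m then 1 else 0))"
    by (simp only: sum_distrib_left[symmetric] orth_col)
  also have "\<dots> = pd (\<lambda>y. Q y i m) k x" by (simp add: if_distrib[of "\<lambda>c. _ * c"] cong: if_cong)
  finally show ?thesis .
qed

text \<open>The Maurer-Cartan equation for dQ times the transpose of Q: the second derivatives of Q
  cancel by symmetry, and the products of first derivatives are rewritten by
  \<open>Om_Q\<close>.\<close>

lemma pd_Om: "pd (\<lambda>y. Om l y i j) k x - pd (\<lambda>y. Om k y i j) l x
   = (\<Sum>m\<in>UNIV. Om k x i m * Om l x m j) - (\<Sum>m\<in>UNIV. Om l x i m * Om k x m j)"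
proof -
  have p: "pd (\<lambda>y. Om l y i j) k x = (\<Sum>m\<in>UNIV. pd (pd (\<lambda>y. Q y i m) l) k x * Q x j m) + (\<Sum>m\<in>UNIV. pd (\<lambda>y. Q y i m) l x * pd (\<lambda>y. Q y j m) k x)" for k l
  proof -
    have "pd (\<lambda>y. Om l y i j) k x = (\<Sum>m\<in>UNIV. pd (\<lambda>y. pd (\<lambda>y. Q y i m) l y * Q y j m) k x)"
      unfolding Om_def by (rule pd_sum) (simp, intro smooth_mult smooth_pd smooth_Q)
    also have "\<dots> = (\<Sum>m\<in>UNIV. pd (pd (\<lambda>y. Q y i m) l) k x * Q x j m + pd (\<lambda>y. Q y i m) l x * pd (\<lambda>y. Q y j m) k x)"
      by (rule sum.cong[OF refl]) (rule pd_mult[OF smooth_pd[OF smooth_Q] smooth_Q])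
    finally show ?thesis by (simp add: sum.distrib)
  qed
  have q: "(\<Sum>m\<in>UNIV. pd (\<lambda>y. Q y i m) l x * pd (\<lambda>y. Q y j m) k x) = - (\<Sum>n\<in>UNIV. Om l x i n * Om k x n j)" for k l
  proof -
    have "(\<Sum>m\<in>UNIV. pd (\<lambda>y. Q y i m) l x * pd (\<lambda>y. Q y j m) k x) = (\<Sum>m\<in>UNIV. \<Sum>n\<in>UNIV. Om k x j n * (pd (\<lambda>y. Q y i m) l x * Q x n m))"
      unfolding Om_Q[of k x j, symmetric] by (simp add: sum_distrib_left mult_ac)
    also have "\<dots> = (\<Sum>n\<in>UNIV. \<Sum>m\<in>UNIV. Om k x j n * (pd (\<lambda>y. Q y i m) l x * Q x n m))" by (rule sum.swap)
    also have "\<dots> = (\<Sum>n\<in>UNIV. Om k x j n * Om l x i n)" by (simp only: sum_distrib_left[symmetric] Om_def[of l, symmetric])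
    also have "\<dots> = (\<Sum>n\<in>UNIV. - (Om l x i n * Om k x n j))" by (rule sum.cong) (simp_all add: Om_antisym[of k x j])
    finally show ?thesis by (simp add: sum_negf)
  qed
  show ?thesis unfolding p q pd_commute[OF smooth_Q, of i _ k l x] by simp
qed

lemma cov_inner:
  assumes "smooth_map \<phi>" "smooth_map \<theta>"
  shows "pd (\<lambda>x. \<phi> x \<bullet> \<theta> x) k x = cov k \<phi> x \<bullet> \<theta> x + \<phi> x \<bullet> cov k \<theta> x"
  unfolding pd_inner[OF assms] cov_def
  using biv_sym[of "Om k x" "\<phi> x" "\<theta> x", OF Om_antisym] by (simp add: inner_diff_left inner_diff_right)

lemma cov_add:
  assumes "smooth_map \<phi>" "smooth_map \<theta>"
  shows "cov k (\<lambda>x. \<phi> x + \<theta> x) x = cov k \<phi> x + cov k \<theta> x"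
  unfolding cov_def pd_plus[OF assms] by (simp add: linear_add[OF lin_biv] scaleR_add_right)

lemma cov_scaleR:
  assumes "smooth_map f" "smooth_map \<phi>"
  shows "cov k (\<lambda>x. f x *\<^sub>R \<phi> x) x = pd f k x *\<^sub>R \<phi> x + f x *\<^sub>R cov k \<phi> x"
  unfolding cov_def pd_scaleR[OF assms] by (simp add: linear_cmul[OF lin_biv] scaleR_diff_right)

lemma cov_sum:
  assumes "finite I" "\<And>i. i \<in> I \<Longrightarrow> smooth_map (\<phi> i)"
  shows "cov k (\<lambda>x. \<Sum>i\<in>I. \<phi> i x) x = (\<Sum>i\<in>I. cov k (\<phi> i) x)"
proof -
  have "pd (\<lambda>x. \<Sum>i\<in>I. \<phi> i x) k x = (\<Sum>i\<in>I. pd (\<phi> i) k x)" by (rule pd_sum[OF assms])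
  then show ?thesis unfolding cov_def by (simp add: linear_sum[OF lin_biv] scaleR_sum_right sum_subtractf)
qed

text \<open>The derivative of Q is exactly cancelled by the commutator of the bivector with the
  generators. From here on calculations run as with constant gamma matrices.\<close>

lemma cov_gm:
  assumes "smooth_map \<phi>"
  shows "cov k (\<lambda>x. gm x m (\<phi> x)) x = gm x m (cov k \<phi> x)"
proof -
  have "pd (\<lambda>x. gm x m (\<phi> x)) k x = (\<Sum>a\<in>UNIV. pd (\<lambda>x. Q x a m *\<^sub>R g a (\<phi> x)) k x)"
    unfolding gm_def by (rule pd_sum) (auto intro!: smooth_scaleR smooth_Q smooth_linear[OF bl_g] assms)
  also have "\<dots> = (\<Sum>a\<in>UNIV. pd (\<lambda>y. Q y a m) k x *\<^sub>R g a (\<phi> x) + Q x a m *\<^sub>R g a (pd \<phi> k x))"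
    by (rule sum.cong[OF refl]) (simp add: pd_scaleR[OF smooth_Q smooth_linear[OF bl_g assms]] pd_lin[OF bl_g assms])
  also have "\<dots> = (\<Sum>a\<in>UNIV. pd (\<lambda>y. Q y a m) k x *\<^sub>R g a (\<phi> x)) + gm x m (pd \<phi> k x)"
    by (simp add: sum.distrib gm_def)
  finally have 1: "pd (\<lambda>x. gm x m (\<phi> x)) k x = (\<Sum>a\<in>UNIV. pd (\<lambda>y. Q y a m) k x *\<^sub>R g a (\<phi> x)) + gm x m (pd \<phi> k x)" .
  have "biv (Om k x) (gm x m (\<phi> x)) = (\<Sum>a\<in>UNIV. Q x a m *\<^sub>R biv (Om k x) (g a (\<phi> x)))"
    unfolding gm_def by (simp add: linear_sum[OF lin_biv] linear_cmul[OF lin_biv])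
  also have "\<dots> = (\<Sum>a\<in>UNIV. Q x a m *\<^sub>R g a (biv (Om k x) (\<phi> x))) + (\<Sum>a\<in>UNIV. \<Sum>i\<in>UNIV. (4 * (Om k x i a * Q x a m)) *\<^sub>R g i (\<phi> x))"
    unfolding biv_g[OF Om_antisym] by (simp add: sum.distrib scaleR_add_right scaleR_sum_right mult_ac)
  also have "(\<Sum>a\<in>UNIV. \<Sum>i\<in>UNIV. (4 * (Om k x i a * Q x a m)) *\<^sub>R g i (\<phi> x)) = (\<Sum>i\<in>UNIV. \<Sum>a\<in>UNIV. (4 * (Om k x i a * Q x a m)) *\<^sub>R g i (\<phi> x))"
    by (rule sum.swap)
  also have "\<dots> = (\<Sum>i\<in>UNIV. (4 * pd (\<lambda>y. Q y i m) k x) *\<^sub>R g i (\<phi> x))"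
    by (simp only: scaleR_sum_left[symmetric] sum_distrib_left[symmetric] Om_Q)
  finally have 2: "biv (Om k x) (gm x m (\<phi> x)) = gm x m (biv (Om k x) (\<phi> x)) + 4 *\<^sub>R (\<Sum>i\<in>UNIV. pd (\<lambda>y. Q y i m) k x *\<^sub>R g i (\<phi> x))"
    by (simp add: gm_def scaleR_sum_right)
  show ?thesis unfolding cov_def 1 2
    by (simp add: linear_diff[OF lin_gm] linear_cmul[OF lin_gm] scaleR_add_right)
qed

text \<open>The curvature is the derivative part of \<open>Om\<close> weighed against the commutator
  of two bivectors. The factors 1/4 and 1/16 fit with the 4 in \<open>biv_commutator\<close>, and
  the Maurer-Cartan equation makes the two parts equal.\<close>

lemma cov_commute:
  assumes \<phi>: "smooth_map \<phi>"
  shows "cov k (cov l \<phi>) x = cov l (cov k \<phi>) x"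
proof -
  have pb: "pd (\<lambda>y. biv (Om l y) (\<phi> y)) k x = biv (\<lambda>i j. pd (\<lambda>y. Om l y i j) k x) (\<phi> x) + biv (Om l x) (pd \<phi> k x)" for k l
  proof -
    have s: "smooth_map (\<lambda>y. g i (g j (\<phi> y)))" for i j by (intro smooth_linear[OF bl_g] \<phi>)
    define T where "T i j y = Om l y i j *\<^sub>R g i (g j (\<phi> y))" for i j y
    have sT: "smooth_map (T i j)" for i j
      unfolding T_def by (intro smooth_scaleR smooth_Om s)
    have sT': "smooth_map (\<lambda>y. \<Sum>j\<in>UNIV. T i j y)" for i by (rule smooth_sum) (rule sT)
    have "pd (\<lambda>y. \<Sum>i\<in>UNIV. \<Sum>j\<in>UNIV. T i j y) k x = (\<Sum>i\<in>UNIV. pd (\<lambda>y. \<Sum>j\<in>UNIV. T i j y) k x)"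
      by (rule pd_sum) (simp, rule sT')
    also have "\<dots> = (\<Sum>i\<in>UNIV. \<Sum>j\<in>UNIV. pd (T i j) k x)"
      by (rule sum.cong[OF refl], rule pd_sum) (simp, rule sT)
    finally have "pd (\<lambda>y. biv (Om l y) (\<phi> y)) k x = (\<Sum>i\<in>UNIV. \<Sum>j\<in>UNIV. pd (\<lambda>y. Om l y i j *\<^sub>R g i (g j (\<phi> y))) k x)"
      unfolding biv_def T_def[abs_def] .
    also have "\<dots> = (\<Sum>i\<in>UNIV. \<Sum>j\<in>UNIV. pd (\<lambda>y. Om l y i j) k x *\<^sub>R g i (g j (\<phi> x)) + Om l x i j *\<^sub>R g i (g j (pd \<phi> k x)))"
      by (intro sum.cong refl) (simp add: pd_scaleR[OF smooth_Om s] pd_lin[OF bl_g smooth_linear[OF bl_g \<phi>]] pd_lin[OF bl_g \<phi>])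
    finally show ?thesis by (simp add: biv_def sum.distrib)
  qed
  have e: "cov k (cov l \<phi>) x = pd (pd \<phi> l) k x - (1/4) *\<^sub>R biv (\<lambda>i j. pd (\<lambda>y. Om l y i j) k x) (\<phi> x) - (1/4) *\<^sub>R biv (Om l x) (pd \<phi> k x)
     - (1/4) *\<^sub>R biv (Om k x) (pd \<phi> l x) + (1/16) *\<^sub>R biv (Om k x) (biv (Om l x) (\<phi> x))" for k l
  proof -
    have sb: "smooth_map (\<lambda>y. biv (Om l y) (\<phi> y))" by (rule smooth_apply[OF smooth_biv_Om lin_biv \<phi>])
    have P: "pd (cov l \<phi>) k x = pd (pd \<phi> l) k x - (1/4) *\<^sub>R pd (\<lambda>y. biv (Om l y) (\<phi> y)) k x"
      unfolding cov_def[abs_def] pd_diff[OF smooth_pd[OF \<phi>] smooth_scaleR[OF smooth_const sb]] pd_scaleR[OF smooth_const sb] by simp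
    show ?thesis unfolding cov_def[of k "cov l \<phi>"] P pb cov_def[of l \<phi> x]
      by (simp add: linear_diff[OF lin_biv] linear_cmul[OF lin_biv] scaleR_diff_right scaleR_add_right)
  qed
  have biv_diff: "biv (\<lambda>i j. M i j - N i j) v = biv M v - biv N v" for M N v
    by (simp add: biv_def scaleR_diff_left sum_subtractf)
  have c1: "biv (\<lambda>i j. pd (\<lambda>y. Om l y i j) k x) (\<phi> x) - biv (\<lambda>i j. pd (\<lambda>y. Om k y i j) l x) (\<phi> x)
    = biv (\<lambda>i j. (\<Sum>m\<in>UNIV. Om k x i m * Om l x m j) - (\<Sum>m\<in>UNIV. Om l x i m * Om k x m j)) (\<phi> x)"
    unfolding biv_diff[symmetric] pd_Om ..
  have c2: "biv (Om k x) (biv (Om l x) (\<phi> x)) - biv (Om l x) (biv (Om k x) (\<phi> x))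
    = 4 *\<^sub>R biv (\<lambda>i j. (\<Sum>m\<in>UNIV. Om k x i m * Om l x m j) - (\<Sum>m\<in>UNIV. Om l x i m * Om k x m j)) (\<phi> x)"
    by (rule biv_commutator[OF Om_antisym Om_antisym])
  have c: "biv (Om k x) (biv (Om l x) (\<phi> x)) - biv (Om l x) (biv (Om k x) (\<phi> x))
    = 4 *\<^sub>R (biv (\<lambda>i j. pd (\<lambda>y. Om l y i j) k x) (\<phi> x) - biv (\<lambda>i j. pd (\<lambda>y. Om k y i j) l x) (\<phi> x))"
    unfolding c1 by (rule c2)
  have alg: "(p - s *\<^sub>R d1 - u - w + t *\<^sub>R b1) - (p - s *\<^sub>R d2 - w - u + t *\<^sub>R b2) = t *\<^sub>R (b1 - b2) - s *\<^sub>R (d1 - d2)"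
    for p d1 d2 u w b1 b2 :: 'v and s t :: real
    by (simp add: scaleR_diff_right)
  have "cov k (cov l \<phi>) x - cov l (cov k \<phi>) x
     = (1/16) *\<^sub>R (biv (Om k x) (biv (Om l x) (\<phi> x)) - biv (Om l x) (biv (Om k x) (\<phi> x)))
      - (1/4) *\<^sub>R (biv (\<lambda>i j. pd (\<lambda>y. Om l y i j) k x) (\<phi> x) - biv (\<lambda>i j. pd (\<lambda>y. Om k y i j) l x) (\<phi> x))"
    unfolding e pd_commute[OF \<phi>, of k l x] by (rule alg)
  also have "\<dots> = 0" unfolding c by simp
  finally show ?thesis by simp
qed

end

text \<open>Arithmetic in the type \<open>4\<close> is modulo 4, so the index written 4 is 0; this
  gives the order 0, 1, 2, 3 of quaternion coordinates.\<close>

lemma sum4: "(\<Sum>i\<in>UNIV. f i) = f (0::4) + f 1 + f 2 + f 3"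
proof -
  have four: "(4::4) = 0" by simp
  show ?thesis unfolding sum_4 four by (simp add: add_ac)
qed

lemma exhaust4: "(i::4) = 0 \<or> i = 1 \<or> i = 2 \<or> i = 3"
proof -
  have "(4::4) = 0" by simp
  then show ?thesis using exhaust_4[of i] by auto
qed

lemma all4: "(\<forall>i::4. P i) \<longleftrightarrow> P 0 \<and> P 1 \<and> P 2 \<and> P 3"
  using exhaust4 by metis

section \<open>Pointwise algebra of the Lichnerowicz formula\<close>

section \<open>The Weitzenboeck identity\<close>

context clifford
begin

lemma g_sq [simp]: "g a (g a v) = v"
proof -
  have "2 *\<^sub>R g a (g a v) = 2 *\<^sub>R v" using anticomm_g[of a a v] by (simp add: scaleR_2)
  then show ?thesis by simp
qed

lemma g_order:
  "g 1 (g 0 v) = - g 0 (g 1 v)" "g 2 (g 0 v) = - g 0 (g 2 v)" "g 3 (g 0 v) = - g 0 (g 3 v)"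
  "g 2 (g 1 v) = - g 1 (g 2 v)" "g 3 (g 1 v) = - g 1 (g 3 v)" "g 3 (g 2 v) = - g 2 (g 3 v)"
  by (simp_all add: g_swap[of 1 0] g_swap[of 2 0] g_swap[of 3 0] g_swap[of 2 1] g_swap[of 3 1] g_swap[of 3 2])

text \<open>The orientation element: a symmetric involution anticommuting with every generator,
  whose eigenspaces are the two spaces of half-spinors.\<close>

definition vol4 :: "'v \<Rightarrow> 'v" where
  "vol4 v = g 0 (g 1 (g 2 (g 3 v)))"

lemma vol4_sym: "vol4 v \<bullet> w = v \<bullet> vol4 w"
  unfolding vol4_def by (simp add: sym_g g_order g_simps)

lemma lin_vol4: "linear vol4"
  unfolding vol4_def using linear_compose[OF linear_compose[OF linear_compose[OF lin_g lin_g] lin_g] lin_g]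
  by (simp add: o_def)

lemma vol4_g: "vol4 (g a v) = - g a (vol4 v)"
proof -
  have "\<forall>a. vol4 (g a v) = - g a (vol4 v)"
    unfolding all4 vol4_def by (simp add: g_order g_simps)
  then show ?thesis by simp
qed

text \<open>The Lichnerowicz formula at one point, in an orthonormal frame with direction 0 radial
  and direction 3 along the Hopf field. Here \<open>z\<close> is the spinor, \<open>y a\<close> its
  flat covariant derivatives, \<open>D\<close> the flat Dirac operator and \<open>M\<close> the
  zero-order term. The two sides differ by four squares: in the application these are the
  Levi-Civita derivatives of dr^2 + r^2 g_lambda on half-densities. The terms with
  \<open>d0\<close>, \<open>d1\<close>, \<open>\<nu>0\<close> and \<open>\<nu>1\<close> come from
  the divergence of a radial field, chosen to absorb all products of \<open>z\<close> with
  \<open>y 0\<close>.\<close>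

lemma weitzenboeck_pointwise:
  fixes y :: "4 \<Rightarrow> 'v" and z M :: 'v and t r h h' \<kappa> v q \<beta> \<nu>0 \<nu>1 \<omega>0 \<omega>1 d0 d1 :: real
  assumes r: "r * r = t" and v: "v = 1 + h * t" "v > 0" and \<kappa>: "\<kappa> * v = h" and q: "q = h\<^sup>2 * t + 2 * h"
    and \<nu>0: "\<nu>0 = \<beta> + h / 2" and \<nu>1: "\<nu>1 = h * \<kappa> * t / 2"
    and M: "M = - (h * r / 2) *\<^sub>R g 0 (z + (\<kappa> * t) *\<^sub>R vol4 z)"
    and D: "D = g 0 (y 0) + g 1 (y 1) + g 2 (y 2) + g 3 (y 3)"
    and \<omega>0: "\<omega>0 = h\<^sup>2 * t * (1 + \<kappa>\<^sup>2 * t\<^sup>2) / 4 - \<kappa>\<^sup>2 * t / 2 - t / (4 * v\<^sup>2) * ((q + h + 2 * t * h')\<^sup>2 + q\<^sup>2) - t * \<beta>\<^sup>2 + d0"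
    and \<omega>1: "\<omega>1 = h\<^sup>2 * t * \<kappa> * t / 2 - t / (4 * v\<^sup>2) * (2 * (q + h + 2 * t * h') * q) + d1"
  shows "\<omega>0 * (z \<bullet> z) + \<omega>1 * (z \<bullet> vol4 z) \<le>
     (y 0 \<bullet> y 0 + y 1 \<bullet> y 1 + y 2 \<bullet> y 2 + y 3 \<bullet> y 3) + q * t * (y 3 \<bullet> y 3)
     - z \<bullet> ((2 * h' * t * r) *\<^sub>R g 0 (g 3 (y 3)) - (2 * h * r) *\<^sub>R (g 3 (g 0 (y 3)) + g 1 (g 2 (y 3)))
           + (h * r) *\<^sub>R g 3 (g 3 (y 0) - g 0 (y 3) - g 2 (y 1) + g 1 (y 2)) - (h * r) *\<^sub>R g 0 D)
     + 2 * (M \<bullet> (D + (h * t) *\<^sub>R g 3 (y 3))) + M \<bullet> M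
     + (d0 * (z \<bullet> z) + d1 * (z \<bullet> vol4 z) + 2 * r * (z \<bullet> (\<nu>0 *\<^sub>R y 0 + \<nu>1 *\<^sub>R vol4 (y 0))))"
proof -
  define p where "p = q + h + 2 * t * h'"
  \<comment> \<open>The spin connection in the Hopf direction. The unit vector there is v times the
    Euclidean one, which is why \<open>y 3\<close> appears with the factor \<open>v\<close> in the
    last square.\<close>
  define s3 where "s3 = (r / (2 * v)) *\<^sub>R (p *\<^sub>R g 0 (g 3 z) - q *\<^sub>R g 1 (g 2 z))"
  \<comment> \<open>In the application \<open>r * \<beta>\<close> is the radial logarithmic
    derivative of the square root of V; the other added terms are the spin connection coefficients
    of the Berger spheres.\<close>
  have "0 \<le> (y 0 + (r * \<beta>) *\<^sub>R z) \<bullet> (y 0 + (r * \<beta>) *\<^sub>R z)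
     + (y 1 + (\<kappa> * r / 2) *\<^sub>R g 2 (g 3 z)) \<bullet> (y 1 + (\<kappa> * r / 2) *\<^sub>R g 2 (g 3 z))
     + (y 2 - (\<kappa> * r / 2) *\<^sub>R g 1 (g 3 z)) \<bullet> (y 2 - (\<kappa> * r / 2) *\<^sub>R g 1 (g 3 z))
     + (v *\<^sub>R y 3 + s3) \<bullet> (v *\<^sub>R y 3 + s3)" (is "0 \<le> ?S0 + ?S1 + ?S2 + ?S3")
    by (intro add_nonneg_nonneg inner_ge_zero)
  moreover have S0: "?S0 = y 0 \<bullet> y 0 + 2 * r * \<beta> * (z \<bullet> y 0) + t * \<beta>\<^sup>2 * (z \<bullet> z)"
    unfolding r[symmetric] by (simp add: inner_add_left inner_add_right inner_commute power2_eq_square algebra_simps)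
  have nn: "g a (g b z) \<bullet> g a (g b z) = z \<bullet> z" for a b by (simp add: sym_g)
  have S1: "?S1 = y 1 \<bullet> y 1 - \<kappa> * r * (z \<bullet> g 2 (g 3 (y 1))) + t * \<kappa>\<^sup>2 / 4 * (z \<bullet> z)"
  proof -
    have "y 1 \<bullet> g 2 (g 3 z) = - (z \<bullet> g 2 (g 3 (y 1)))" by (subst inner_commute) (simp add: sym_g g_order g_simps)
    then show ?thesis unfolding r[symmetric]
      by (simp add: inner_add_left inner_add_right nn inner_commute[of "g 2 (g 3 z)" "y 1"] power2_eq_square algebra_simps)
  qed
  have S2: "?S2 = y 2 \<bullet> y 2 + \<kappa> * r * (z \<bullet> g 1 (g 3 (y 2))) + t * \<kappa>\<^sup>2 / 4 * (z \<bullet> z)"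
  proof -
    have "y 2 \<bullet> g 1 (g 3 z) = - (z \<bullet> g 1 (g 3 (y 2)))" by (subst inner_commute) (simp add: sym_g g_order g_simps)
    then show ?thesis unfolding r[symmetric]
      by (simp add: inner_diff_left inner_diff_right nn inner_commute[of "g 1 (g 3 z)" "y 2"] power2_eq_square algebra_simps)
  qed
  have ss: "s3 \<bullet> s3 = t / (4 * v\<^sup>2) * ((p\<^sup>2 + q\<^sup>2) * (z \<bullet> z) + 2 * p * q * (z \<bullet> vol4 z))"
  proof -
    have x: "g 0 (g 3 z) \<bullet> g 1 (g 2 z) = - (z \<bullet> vol4 z)" "g 1 (g 2 z) \<bullet> g 0 (g 3 z) = - (z \<bullet> vol4 z)"
      unfolding vol4_def by (simp_all add: sym_g g_order g_simps)
    show ?thesis unfolding s3_def r[symmetric]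
      by (simp add: inner_diff_left inner_diff_right nn x power2_eq_square algebra_simps add_divide_distrib)
  qed
  have ys: "v * (y 3 \<bullet> s3) = (r / 2) * (- p * (z \<bullet> g 0 (g 3 (y 3))) + q * (z \<bullet> g 1 (g 2 (y 3))))"
  proof -
    have x: "y 3 \<bullet> g 0 (g 3 z) = - (z \<bullet> g 0 (g 3 (y 3)))" "y 3 \<bullet> g 1 (g 2 z) = - (z \<bullet> g 1 (g 2 (y 3)))"
      by (subst inner_commute, simp add: sym_g g_order g_simps)+
    show ?thesis unfolding s3_def using v(2)
      by (simp add: inner_diff_right x algebra_simps)
  qed
  have S3: "?S3 = v\<^sup>2 * (y 3 \<bullet> y 3) + r * (- p * (z \<bullet> g 0 (g 3 (y 3))) + q * (z \<bullet> g 1 (g 2 (y 3))))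
      + t / (4 * v\<^sup>2) * ((p\<^sup>2 + q\<^sup>2) * (z \<bullet> z) + 2 * p * q * (z \<bullet> vol4 z))"
  proof -
    have "?S3 = v\<^sup>2 * (y 3 \<bullet> y 3) + 2 * (v * (y 3 \<bullet> s3)) + s3 \<bullet> s3"
      by (simp add: inner_add_left inner_add_right inner_commute[of s3 "y 3"] power2_eq_square algebra_simps)
    then show ?thesis unfolding ss ys by (simp add: algebra_simps)
  qed
  have v2: "v\<^sup>2 = 1 + q * t" unfolding v(1) q by (simp add: power2_eq_square algebra_simps)
  have MM: "M \<bullet> M = h\<^sup>2 * t / 4 * ((1 + \<kappa>\<^sup>2 * t\<^sup>2) * (z \<bullet> z) + 2 * \<kappa> * t * (z \<bullet> vol4 z))"
  proof -
    have "vol4 z \<bullet> vol4 z = z \<bullet> z" by (simp add: vol4_sym) (simp add: vol4_def g_order g_simps)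
    then show ?thesis unfolding M r[symmetric]
      by (simp add: sym_g inner_add_left inner_add_right vol4_sym power2_eq_square algebra_simps)
  qed
  have vc: "vol4 z \<bullet> w = z \<bullet> vol4 w" for w by (rule vol4_sym)
  have MD: "M \<bullet> (D + (h * t) *\<^sub>R g 3 (y 3)) = - (h * r / 2) *
     ((z \<bullet> y 0) + \<kappa> * t * (z \<bullet> vol4 (y 0))
       + (z \<bullet> g 0 (g 1 (y 1))) - \<kappa> * t * (z \<bullet> g 2 (g 3 (y 1)))
       + (z \<bullet> g 0 (g 2 (y 2))) + \<kappa> * t * (z \<bullet> g 1 (g 3 (y 2)))
       + (1 + h * t) * ((z \<bullet> g 0 (g 3 (y 3))) - \<kappa> * t * (z \<bullet> g 1 (g 2 (y 3)))))"
    unfolding M D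
    by (simp add: sym_g g_simps inner_add_left inner_add_right vc) (simp add: vol4_def g_order g_simps algebra_simps add_divide_distrib diff_divide_distrib)
  have N: "z \<bullet> ((2 * h' * t * r) *\<^sub>R g 0 (g 3 (y 3)) - (2 * h * r) *\<^sub>R (g 3 (g 0 (y 3)) + g 1 (g 2 (y 3)))
           + (h * r) *\<^sub>R g 3 (g 3 (y 0) - g 0 (y 3) - g 2 (y 1) + g 1 (y 2)) - (h * r) *\<^sub>R g 0 D)
     = r * ((2 * h' * t + 2 * h) * (z \<bullet> g 0 (g 3 (y 3))) - 2 * h * (z \<bullet> g 1 (g 2 (y 3)))
       + h * ((z \<bullet> g 2 (g 3 (y 1))) - (z \<bullet> g 1 (g 3 (y 2))) - (z \<bullet> g 0 (g 1 (y 1))) - (z \<bullet> g 0 (g 2 (y 2)))))"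
    unfolding D by (simp add: g_simps g_order inner_add_right inner_diff_right algebra_simps)
  have k1: "h * \<kappa> * t = h - \<kappa>" using \<kappa> v(1) by (metis add_diff_cancel_left' mult.assoc mult.commute mult.left_neutral distrib_left)
  have k2: "h * ((1 + h * t) * (\<kappa> * t)) = q - 2 * h"
  proof -
    have "(1 + h * t) * \<kappa> = h" using \<kappa> v(1) by (simp add: mult.commute)
    then have "h * ((1 + h * t) * (\<kappa> * t)) = h * (h * t)" by (metis mult.assoc)
    then show ?thesis unfolding q by (simp add: power2_eq_square)
  qed
  have k3: "h * (1 + h * t) = q - h" unfolding q by (simp add: power2_eq_square algebra_simps)
  define a0 a1 a2 b1 b2 c03 c12 zz zv zv0 where abb: "a0 = z \<bullet> y 0" "a1 = z \<bullet> g 2 (g 3 (y 1))" "a2 = z \<bullet> g 1 (g 3 (y 2))"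
    "b1 = z \<bullet> g 0 (g 1 (y 1))" "b2 = z \<bullet> g 0 (g 2 (y 2))" "c03 = z \<bullet> g 0 (g 3 (y 3))" "c12 = z \<bullet> g 1 (g 2 (y 3))"
    "zz = z \<bullet> z" "zv = z \<bullet> vol4 z" "zv0 = z \<bullet> vol4 (y 0)"
  have e1: "2 * (- (h * r / 2) * (a0 + \<kappa> * t * zv0 + b1 - \<kappa> * t * a1 + b2 + \<kappa> * t * a2 + (1 + h * t) * (c03 - \<kappa> * t * c12)))
     = - r * (h * a0 + (h * \<kappa> * t) * zv0 + h * b1 - (h * \<kappa> * t) * a1 + h * b2 + (h * \<kappa> * t) * a2 + (h * (1 + h * t)) * c03 - (h * ((1 + h * t) * (\<kappa> * t))) * c12)"
    by (simp add: algebra_simps)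
  have e2: "2 * r * (z \<bullet> (\<nu>0 *\<^sub>R y 0 + \<nu>1 *\<^sub>R vol4 (y 0))) = r * (2 * \<beta> * a0 + h * a0 + (h * \<kappa> * t) * zv0)"
    unfolding \<nu>0 \<nu>1 abb by (simp add: inner_add_right algebra_simps)
  have "\<omega>0 * zz + \<omega>1 * zv + (?S0 + ?S1 + ?S2 + ?S3) =
     (y 0 \<bullet> y 0 + y 1 \<bullet> y 1 + y 2 \<bullet> y 2 + y 3 \<bullet> y 3) + q * t * (y 3 \<bullet> y 3)
     - z \<bullet> ((2 * h' * t * r) *\<^sub>R g 0 (g 3 (y 3)) - (2 * h * r) *\<^sub>R (g 3 (g 0 (y 3)) + g 1 (g 2 (y 3)))
           + (h * r) *\<^sub>R g 3 (g 3 (y 0) - g 0 (y 3) - g 2 (y 1) + g 1 (y 2)) - (h * r) *\<^sub>R g 0 D)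
     + 2 * (M \<bullet> (D + (h * t) *\<^sub>R g 3 (y 3))) + M \<bullet> M
     + (d0 * zz + d1 * zv + 2 * r * (z \<bullet> (\<nu>0 *\<^sub>R y 0 + \<nu>1 *\<^sub>R vol4 (y 0))))"
    unfolding S0 S1 S2 S3 MM MD N unfolding abb[symmetric] e1 e2 k1 k2 k3 v2 \<omega>0 \<omega>1 p_def[symmetric]
    unfolding p_def
    by (simp add: algebra_simps add_divide_distrib diff_divide_distrib)
  ultimately show ?thesis unfolding abb by linarith
qed

text \<open>Clifford multiplication by a vector (Feynman's slash), the generators being attached to
  the coordinate axes.\<close>

definition sl :: "real^4 \<Rightarrow> 'v \<Rightarrow> 'v" where
  "sl u v = (\<Sum>k\<in>UNIV. u $ k *\<^sub>R g k v)"

lemma lin_sl: "linear (sl u)"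
  unfolding sl_def by (intro linear_compose_sum ballI linear_compose_scale_right lin_g)

lemma sl_sym: "sl u v \<bullet> w = v \<bullet> sl u w"
  by (simp add: sl_def inner_sum_left inner_sum_right sym_g)

lemma sl_add_left: "sl (u + w) v = sl u v + sl w v"
  by (simp add: sl_def scaleR_add_left sum.distrib)

lemma sl_scaleR_left: "sl (c *\<^sub>R u) v = c *\<^sub>R sl u v"
  by (simp add: sl_def scaleR_sum_right)

lemma sl_minus_left: "sl (- u) v = - sl u v"
  using sl_scaleR_left[of "-1" u v] by simp

lemma sl_axis: "sl (axis k 1) v = g k v"
  by (simp add: sl_def axis_def if_distrib[of "\<lambda>c. c *\<^sub>R _"] cong: if_cong)

lemma sl_anticomm: "sl u (sl w v) + sl w (sl u v) = (2 * (u \<bullet> w)) *\<^sub>R v"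
proof -
  have "sl u (sl w v) + sl w (sl u v) = (\<Sum>i\<in>UNIV. \<Sum>j\<in>UNIV. (u $ i * w $ j) *\<^sub>R g i (g j v)) + (\<Sum>i\<in>UNIV. \<Sum>j\<in>UNIV. (w $ i * u $ j) *\<^sub>R g i (g j v))"
    by (simp add: sl_def g_simps scaleR_sum_right)
  also have "(\<Sum>i\<in>UNIV. \<Sum>j\<in>UNIV. (w $ i * u $ j) *\<^sub>R g i (g j v)) = (\<Sum>j\<in>UNIV. \<Sum>i\<in>UNIV. (w $ i * u $ j) *\<^sub>R g i (g j v))"
    by (rule sum.swap)
  also have "(\<Sum>i\<in>UNIV. \<Sum>j\<in>UNIV. (u $ i * w $ j) *\<^sub>R g i (g j v)) + (\<Sum>j\<in>UNIV. \<Sum>i\<in>UNIV. (w $ i * u $ j) *\<^sub>R g i (g j v))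
     = (\<Sum>i\<in>UNIV. \<Sum>j\<in>UNIV. (u $ i * w $ j) *\<^sub>R (g i (g j v) + g j (g i v)))"
    by (simp add: sum.distrib scaleR_add_right mult.commute)
  also have "\<dots> = (\<Sum>i\<in>UNIV. (2 * (u $ i * w $ i)) *\<^sub>R v)"
    unfolding anticomm_g
    by (rule sum.cong) (simp_all add: if_distrib[of "\<lambda>c. c *\<^sub>R _"] if_distrib[of "\<lambda>c. _ *\<^sub>R c"] if_distrib[of "\<lambda>c. _ * c"] mult.commute cong: if_cong)
  finally show ?thesis by (simp add: inner_vec_def scaleR_sum_left[symmetric] sum_distrib_left)
qed

lemma sl_sq: "sl u (sl u v) = (u \<bullet> u) *\<^sub>R v"
proof -
  have "2 *\<^sub>R sl u (sl u v) = 2 *\<^sub>R ((u \<bullet> u) *\<^sub>R v)"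
    using sl_anticomm[of u u v] by (simp add: scaleR_2)
  then show ?thesis by (rule scaleR_left_imp_eq[rotated]) simp
qed

lemma clifford_sl:
  assumes "\<And>a b. e a \<bullet> e b = (if a = b then 1 else 0)"
  shows "clifford (\<lambda>a. sl (e a))"
  by unfold_locales (simp_all add: linear_add[OF lin_sl] linear_cmul[OF lin_sl] sl_sym sl_anticomm assms)

text \<open>A contraction of generators with a family of vectors does not depend on the orthonormal
  basis. Only the completeness relation of the new basis is needed, inserted once for each
  index.\<close>

lemma change_basis:
  fixes Y :: "4 \<Rightarrow> 'v" and e :: "4 \<Rightarrow> real^4"
  assumes e: "\<And>k l. (\<Sum>a\<in>UNIV. e a $ k * e a $ l) = (if k = l then 1 else 0)"
  shows "(\<Sum>k\<in>UNIV. \<Sum>l\<in>UNIV. M k l *\<^sub>R g k (Y l)) =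
    (\<Sum>a\<in>UNIV. \<Sum>b\<in>UNIV. (\<Sum>k\<in>UNIV. \<Sum>l\<in>UNIV. M k l * e a $ k * e b $ l) *\<^sub>R sl (e a) (\<Sum>l\<in>UNIV. e b $ l *\<^sub>R Y l))"
proof -
  have gk: "g k v = (\<Sum>a\<in>UNIV. e a $ k *\<^sub>R sl (e a) v)" for k v
  proof -
    have "(\<Sum>a\<in>UNIV. e a $ k *\<^sub>R sl (e a) v) = (\<Sum>a\<in>UNIV. \<Sum>l\<in>UNIV. (e a $ k * e a $ l) *\<^sub>R g l v)"
      by (simp add: sl_def scaleR_sum_right)
    also have "\<dots> = (\<Sum>l\<in>UNIV. \<Sum>a\<in>UNIV. (e a $ k * e a $ l) *\<^sub>R g l v)" by (rule sum.swap)
    also have "\<dots> = (\<Sum>l\<in>UNIV. (if k = l then 1 else 0) *\<^sub>R g l v)" by (simp only: scaleR_sum_left[symmetric] e)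
    also have "\<dots> = g k v" by (simp add: if_distrib[of "\<lambda>c. c *\<^sub>R _"] cong: if_cong)
    finally show ?thesis by simp
  qed
  have Yl: "Y l = (\<Sum>b\<in>UNIV. e b $ l *\<^sub>R (\<Sum>m\<in>UNIV. e b $ m *\<^sub>R Y m))" for l
  proof -
    have "(\<Sum>b\<in>UNIV. e b $ l *\<^sub>R (\<Sum>m\<in>UNIV. e b $ m *\<^sub>R Y m)) = (\<Sum>b\<in>UNIV. \<Sum>m\<in>UNIV. (e b $ l * e b $ m) *\<^sub>R Y m)"
      by (simp add: scaleR_sum_right)
    also have "\<dots> = (\<Sum>m\<in>UNIV. \<Sum>b\<in>UNIV. (e b $ l * e b $ m) *\<^sub>R Y m)" by (rule sum.swap)
    also have "\<dots> = (\<Sum>m\<in>UNIV. (if l = m then 1 else 0) *\<^sub>R Y m)" by (simp only: scaleR_sum_left[symmetric] e)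
    also have "\<dots> = Y l" by (simp add: if_distrib[of "\<lambda>c. c *\<^sub>R _"] cong: if_cong)
    finally show ?thesis by simp
  qed
  define y where "y b = (\<Sum>m\<in>UNIV. e b $ m *\<^sub>R Y m)" for b
  have 1: "M k l *\<^sub>R g k (Y l) = (\<Sum>a\<in>UNIV. \<Sum>b\<in>UNIV. (M k l * e a $ k * e b $ l) *\<^sub>R sl (e a) (y b))" for k l
  proof -
    have "g k (Y l) = (\<Sum>a\<in>UNIV. e a $ k *\<^sub>R sl (e a) (\<Sum>b\<in>UNIV. e b $ l *\<^sub>R y b))"
      unfolding gk[of k] y_def by (subst Yl[of l]) simp
    then show ?thesis
      by (simp add: linear_sum[OF lin_sl] linear_cmul[OF lin_sl] scaleR_sum_right mult.assoc)
  qed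
  have "(\<Sum>k\<in>UNIV. \<Sum>l\<in>UNIV. M k l *\<^sub>R g k (Y l)) = (\<Sum>k\<in>UNIV. \<Sum>l\<in>UNIV. \<Sum>a\<in>UNIV. \<Sum>b\<in>UNIV. (M k l * e a $ k * e b $ l) *\<^sub>R sl (e a) (y b))"
    by (simp only: 1)
  also have "\<dots> = (\<Sum>k\<in>UNIV. \<Sum>a\<in>UNIV. \<Sum>l\<in>UNIV. \<Sum>b\<in>UNIV. (M k l * e a $ k * e b $ l) *\<^sub>R sl (e a) (y b))"
    by (rule sum.cong[OF refl], rule sum.swap)
  also have "\<dots> = (\<Sum>a\<in>UNIV. \<Sum>k\<in>UNIV. \<Sum>l\<in>UNIV. \<Sum>b\<in>UNIV. (M k l * e a $ k * e b $ l) *\<^sub>R sl (e a) (y b))"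
    by (rule sum.swap)
  also have "\<dots> = (\<Sum>a\<in>UNIV. \<Sum>k\<in>UNIV. \<Sum>b\<in>UNIV. \<Sum>l\<in>UNIV. (M k l * e a $ k * e b $ l) *\<^sub>R sl (e a) (y b))"
    by (rule sum.cong[OF refl], rule sum.cong[OF refl], rule sum.swap)
  also have "\<dots> = (\<Sum>a\<in>UNIV. \<Sum>b\<in>UNIV. \<Sum>k\<in>UNIV. \<Sum>l\<in>UNIV. (M k l * e a $ k * e b $ l) *\<^sub>R sl (e a) (y b))"
    by (rule sum.cong[OF refl], rule sum.swap)
  finally show ?thesis by (simp only: scaleR_sum_left y_def)
qed

end

section \<open>The orthonormal frame formed by the radial and the three left-invariant
  directions\<close>

section \<open>The polar frame of four-space\<close>

text \<open>The left-invariant field K extended linearly to four-space: tangent to all spheres, and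
  a complex structure, hence smooth through the origin.\<close>

definition Jw :: "real^4 \<Rightarrow> real^4" where "Jw x = qmul x qk"

lemma qmul_comp:
  "qmul x qi $ 0 = - x $ 1" "qmul x qi $ 1 = x $ 0" "qmul x qi $ 2 = x $ 3" "qmul x qi $ 3 = - x $ 2"
  "qmul x qj $ 0 = - x $ 2" "qmul x qj $ 1 = - x $ 3" "qmul x qj $ 2 = x $ 0" "qmul x qj $ 3 = x $ 1"
  "Jw x $ 0 = - x $ 3" "Jw x $ 1 = x $ 2" "Jw x $ 2 = - x $ 1" "Jw x $ 3 = x $ 0"
  by (simp_all add: qmul_def qi_def qj_def qk_def Jw_def axis_def)

lemma vec4_eq_iff: "(x::'a^4) = y \<longleftrightarrow> x $ 0 = y $ 0 \<and> x $ 1 = y $ 1 \<and> x $ 2 = y $ 2 \<and> x $ 3 = y $ 3"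
  unfolding vec_eq_iff all4 ..

lemma lin_Jw: "linear Jw"
  by (rule linearI) (simp_all add: vec4_eq_iff qmul_comp)

lemma bl_Jw: "bounded_linear Jw"
  using lin_Jw linear_conv_bounded_linear by blast

lemma inner4: "(x::real^4) \<bullet> y = x $ 0 * y $ 0 + x $ 1 * y $ 1 + x $ 2 * y $ 2 + x $ 3 * y $ 3"
  by (simp add: inner_vec_def sum4)

lemma Jw_inner: "x \<bullet> Jw x = 0" "Jw x \<bullet> Jw x = x \<bullet> x" "Jw (Jw x) = - x"
  by (simp_all add: inner4 qmul_comp vec4_eq_iff algebra_simps)

text \<open>The frame x, x i, x j, x k, normalized. At the origin division by zero makes it vanish,
  so its orthonormality is claimed elsewhere only.\<close>

definition polar :: "real^4 \<Rightarrow> 4 \<Rightarrow> real^4" where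
  "polar x a = (1 / norm x) *\<^sub>R (if a = 0 then x else if a = 1 then qmul x qi else if a = 2 then qmul x qj else Jw x)"

lemma polar_simps:
  "polar x 0 = (1 / norm x) *\<^sub>R x" "polar x 1 = (1 / norm x) *\<^sub>R qmul x qi"
  "polar x 2 = (1 / norm x) *\<^sub>R qmul x qj" "polar x 3 = (1 / norm x) *\<^sub>R Jw x"
  by (simp_all add: polar_def)

lemma polar_cols:
  assumes "x \<noteq> 0"
  shows "(\<Sum>a\<in>UNIV. polar x a $ k * polar x a $ l) = (if k = l then 1 else 0)"
proof -
  define s where "s = 1 / norm x"
  have n: "s * s * (x $ 0 * x $ 0 + x $ 1 * x $ 1 + x $ 2 * x $ 2 + x $ 3 * x $ 3) = 1"
    using dot_square_norm[of x] assms by (simp add: inner4 power2_eq_square s_def)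
  have "\<forall>k l. (\<Sum>a\<in>UNIV. polar x a $ k * polar x a $ l) = (if k = l then 1 else 0)"
    unfolding all4 sum4 polar_simps s_def[symmetric]
    using n by (simp add: qmul_comp algebra_simps)
  then show ?thesis by simp
qed

lemma polar_rows:
  assumes "x \<noteq> 0"
  shows "polar x a \<bullet> polar x b = (if a = b then 1 else 0)"
proof -
  define s where "s = 1 / norm x"
  have n: "s * s * (x $ 0 * x $ 0 + x $ 1 * x $ 1 + x $ 2 * x $ 2 + x $ 3 * x $ 3) = 1"
    using dot_square_norm[of x] assms by (simp add: inner4 power2_eq_square s_def)
  have "\<forall>a b. polar x a \<bullet> polar x b = (if a = b then 1 else 0)"
    unfolding all4 polar_simps inner4 s_def[symmetric]
    using n by (simp add: qmul_comp algebra_simps)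
  then show ?thesis by simp
qed

lemma polar_J:
  assumes "x \<noteq> 0"
  shows "(\<Sum>k\<in>UNIV. \<Sum>l\<in>UNIV. Jw (axis k 1) $ l * polar x a $ k * polar x b $ l) =
    (if a = 0 \<and> b = 3 then 1 else if a = 3 \<and> b = 0 then - 1 else if a = 1 \<and> b = 2 then - 1 else if a = 2 \<and> b = 1 then 1 else 0)"
proof -
  define s where "s = 1 / norm x"
  have n: "s * s * (x $ 0 * x $ 0 + x $ 1 * x $ 1 + x $ 2 * x $ 2 + x $ 3 * x $ 3) = 1"
    using dot_square_norm[of x] assms by (simp add: inner4 power2_eq_square s_def)
  have "(\<Sum>k\<in>UNIV. \<Sum>l\<in>UNIV. Jw (axis k 1) $ l * polar x a $ k * polar x b $ l) =
     polar x a $ 0 * polar x b $ 3 - polar x a $ 1 * polar x b $ 2 + polar x a $ 2 * polar x b $ 1 - polar x a $ 3 * polar x b $ 0" for a b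
    unfolding sum4 by (simp add: qmul_comp axis_def)
  note S = this
  have "\<forall>a b. (\<Sum>k\<in>UNIV. \<Sum>l\<in>UNIV. Jw (axis k 1) $ l * polar x a $ k * polar x b $ l) =
    (if a = 0 \<and> b = 3 then 1 else if a = 3 \<and> b = 0 then - 1 else if a = 1 \<and> b = 2 then - 1 else if a = 2 \<and> b = 1 then 1 else 0)"
    unfolding S unfolding all4 polar_simps s_def[symmetric]
    using n by (simp add: qmul_comp algebra_simps)
  then show ?thesis by simp
qed

context clifford
begin

lemma polar_dirac:
  assumes "x \<noteq> 0"
  shows "(\<Sum>k\<in>UNIV. g k (y k)) = (\<Sum>a\<in>UNIV. sl (polar x a) (\<Sum>l\<in>UNIV. polar x a $ l *\<^sub>R y l))"
proof -
  have "(\<Sum>k\<in>UNIV. g k (y k)) = (\<Sum>k\<in>UNIV. \<Sum>l\<in>UNIV. (if k = l then 1 else 0) *\<^sub>R g k (y l))"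
    by (simp add: if_distrib[of "\<lambda>c. c *\<^sub>R _"] cong: if_cong)
  also have "\<dots> = (\<Sum>a\<in>UNIV. \<Sum>b\<in>UNIV. (\<Sum>k\<in>UNIV. \<Sum>l\<in>UNIV. (if k = l then 1 else 0) * polar x a $ k * polar x b $ l) *\<^sub>R sl (polar x a) (\<Sum>l\<in>UNIV. polar x b $ l *\<^sub>R y l))"
    by (rule change_basis[OF polar_cols[OF assms]])
  also have "\<dots> = (\<Sum>a\<in>UNIV. \<Sum>b\<in>UNIV. (polar x a \<bullet> polar x b) *\<^sub>R sl (polar x a) (\<Sum>l\<in>UNIV. polar x b $ l *\<^sub>R y l))"
    by (simp add: inner_vec_def if_distrib[of "\<lambda>c. c * _"] mult.assoc cong: if_cong)
  also have "\<dots> = (\<Sum>a\<in>UNIV. sl (polar x a) (\<Sum>l\<in>UNIV. polar x a $ l *\<^sub>R y l))"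
    unfolding polar_rows[OF assms] by (simp add: if_distrib[of "\<lambda>c. c *\<^sub>R _"] cong: if_cong)
  finally show ?thesis .
qed

lemma polar_norm:
  fixes y :: "4 \<Rightarrow> 'w::real_inner"
  assumes "x \<noteq> 0"
  shows "(\<Sum>k\<in>UNIV. y k \<bullet> y k) = (\<Sum>a\<in>UNIV. (\<Sum>l\<in>UNIV. polar x a $ l *\<^sub>R y l) \<bullet> (\<Sum>l\<in>UNIV. polar x a $ l *\<^sub>R y l))"
proof -
  have "(\<Sum>a\<in>UNIV. (\<Sum>l\<in>UNIV. polar x a $ l *\<^sub>R y l) \<bullet> (\<Sum>l\<in>UNIV. polar x a $ l *\<^sub>R y l))
    = (\<Sum>a\<in>UNIV. \<Sum>k\<in>UNIV. \<Sum>l\<in>UNIV. (polar x a $ k * polar x a $ l) * (y l \<bullet> y k))"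
    by (simp only: inner_sum_left inner_sum_right inner_scaleR_left inner_scaleR_right)
      (simp add: sum_distrib_left mult.assoc)
  also have "\<dots> = (\<Sum>k\<in>UNIV. \<Sum>a\<in>UNIV. \<Sum>l\<in>UNIV. (polar x a $ k * polar x a $ l) * (y l \<bullet> y k))"
    by (rule sum.swap)
  also have "\<dots> = (\<Sum>k\<in>UNIV. \<Sum>l\<in>UNIV. \<Sum>a\<in>UNIV. (polar x a $ k * polar x a $ l) * (y l \<bullet> y k))"
    by (rule sum.cong[OF refl], rule sum.swap)
  also have "\<dots> = (\<Sum>k\<in>UNIV. \<Sum>l\<in>UNIV. (if k = l then 1 else 0) * (y l \<bullet> y k))"
    by (simp only: sum_distrib_right[symmetric] polar_cols[OF assms])
  also have "\<dots> = (\<Sum>k\<in>UNIV. y k \<bullet> y k)" by (simp add: if_distrib[of "\<lambda>c. c * _"] cong: if_cong)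
  finally show ?thesis by simp
qed

lemma polar_J_sum:
  assumes "x \<noteq> 0"
  defines "E \<equiv> \<lambda>a. sl (polar x a)" and "Y \<equiv> \<lambda>y a. \<Sum>l\<in>UNIV. polar x a $ l *\<^sub>R y l"
  shows "(\<Sum>k\<in>UNIV. \<Sum>l\<in>UNIV. Jw (axis k 1) $ l *\<^sub>R g k (y l)) = E 0 (Y y 3) - E 3 (Y y 0) - E 1 (Y y 2) + E 2 (Y y 1)"
  unfolding change_basis[OF polar_cols[OF assms(1)], of "\<lambda>k l. Jw (axis k 1) $ l" y] polar_J[OF assms(1)]
  unfolding sum4 E_def Y_def by simp

lemma polar_J_clifford:
  assumes "x \<noteq> 0"
  defines "E \<equiv> \<lambda>a. sl (polar x a)"
  shows "(\<Sum>k\<in>UNIV. g k (sl (Jw (axis k 1)) z)) = E 0 (E 3 z) - E 3 (E 0 z) - E 1 (E 2 z) + E 2 (E 1 z)"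
proof -
  have "(\<Sum>k\<in>UNIV. g k (sl (Jw (axis k 1)) z)) = (\<Sum>k\<in>UNIV. \<Sum>l\<in>UNIV. Jw (axis k 1) $ l *\<^sub>R g k (g l z))"
    by (simp add: sl_def g_simps)
  also have "\<dots> = E 0 (E 3 z) - E 3 (E 0 z) - E 1 (E 2 z) + E 2 (E 1 z)"
    unfolding polar_J_sum[OF assms(1), of "\<lambda>l. g l z"] E_def by (simp add: sl_def)
  finally show ?thesis .
qed

lemma polar_J_clifford_flat:
  "(\<Sum>k\<in>UNIV. g k (sl (Jw (axis k 1)) z)) = 2 *\<^sub>R (g 0 (g 3 z) - g 1 (g 2 z))"
proof -
  have "(\<Sum>k\<in>UNIV. g k (sl (Jw (axis k 1)) z)) = g 0 (g 3 z) - g 1 (g 2 z) + g 2 (g 1 z) - g 3 (g 0 z)"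
    unfolding sl_def sum4 by (simp add: qmul_comp axis_def g_simps)
  then show ?thesis by (simp add: g_order g_simps scaleR_2 algebra_simps)
qed

text \<open>The orientation element is independent of the oriented orthonormal frame: it is recovered from
  the square of the Clifford action of the two-form attached to \<open>Jw\<close>.\<close>

lemma polar_vol4:
  assumes "x \<noteq> 0"
  shows "clifford.vol4 (\<lambda>a. sl (polar x a)) z = vol4 z"
proof -
  interpret E: clifford "\<lambda>a. sl (polar x a)" by (rule clifford_sl[OF polar_rows[OF assms]])
  let ?E = "\<lambda>a. sl (polar x a)"
  define F where "F z = g 0 (g 3 z) - g 1 (g 2 z)" for z
  have FE: "F z = ?E 0 (?E 3 z) - ?E 1 (?E 2 z)" for z
  proof -
    have "2 *\<^sub>R F z = 2 *\<^sub>R (?E 0 (?E 3 z) - ?E 1 (?E 2 z))"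
      unfolding F_def polar_J_clifford_flat[symmetric] polar_J_clifford[OF assms]
      by (simp add: E.g_order E.g_simps scaleR_2 algebra_simps)
    then show ?thesis by simp
  qed
  have "F (F z) = - 2 *\<^sub>R z - 2 *\<^sub>R vol4 z"
    unfolding F_def vol4_def by (simp add: g_order g_simps scaleR_2)
  moreover have "F (F z) = - 2 *\<^sub>R z - 2 *\<^sub>R E.vol4 z"
    unfolding FE E.vol4_def by (simp add: E.g_order E.g_simps scaleR_2)
  ultimately show ?thesis by simp
qed

end

text \<open>The zero-order coefficients of the Weitzenboeck formula, evaluated for the Berger
  profile. \<open>H\<close>, \<open>K\<close> and their derivatives are rational in t, V and V1, so
  both claims are rational identities. The first value is a quarter of the scalar curvature of g_0;
  the second says that the orientation element drops out.\<close>

lemma radial_coefficients: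
  fixes t c d V V1 H H1 K K1 :: real
  assumes t: "t > 0" and V: "V > 0" "V\<^sup>2 = 1 + c * t + d * t\<^sup>2" and V1: "2 * V * V1 = c + 2 * d * t"
    and H: "H * t = V - 1" and H1: "H1 * t = V1 - H" and K: "K * V = H" and K1: "K1 * V\<^sup>2 = H1 * V - H * V1"
  defines "q \<equiv> H\<^sup>2 * t + 2 * H" and "\<beta> \<equiv> V1 / V" and "\<beta>1 \<equiv> (d - 2 * V1\<^sup>2) / V\<^sup>2"
  shows "H\<^sup>2 * t * (1 + K\<^sup>2 * t\<^sup>2) / 4 - K\<^sup>2 * t / 2 - t / (4 * V\<^sup>2) * ((q + H + 2 * t * H1)\<^sup>2 + q\<^sup>2) - t * \<beta>\<^sup>2
       + (4 * (\<beta> + H / 2) + 2 * t * (\<beta>1 + H1 / 2))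
      = (12 * c + 30 * d * t + 6 * c\<^sup>2 * t + 18 * c * d * t\<^sup>2 + 6 * d\<^sup>2 * t^3) / (4 * V^4)" (is "?A = ?B")
    and "H\<^sup>2 * t * K * t / 2 - t / (4 * V\<^sup>2) * (2 * (q + H + 2 * t * H1) * q)
       + (4 * (H * K * t / 2) + 2 * t * ((H1 * K * t + H * K1 * t + H * K) / 2)) = 0"
proof -
  have H': "H = (V - 1) / t" using H t by (simp add: field_simps)
  have H1': "H1 = (V1 - (V - 1) / t) / t" using H1 t unfolding H' by (simp add: field_simps)
  have "K = K * V / V" using V(1) by simp
  also have "\<dots> = ((V - 1) / t) / V" unfolding K H' ..
  finally have "K = ((V - 1) / t) / V" .
  then have K': "K = (V - 1) / (t * V)" by simp
  have K1': "K1 = (((V1 - (V - 1) / t) / t) * V - (V - 1) / t * V1) / V\<^sup>2"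
    using K1 V(1) unfolding H1' H' by (simp add: field_simps)
  \<comment> \<open>Solving for d, and then for c, in terms of V, V1 and t removes all relations
    between the variables; what remains is an identity of rational functions.\<close>
  have d': "d = (2 * V * V1 * t - V\<^sup>2 + 1) / t\<^sup>2" using V1 V(2) t by (simp add: field_simps power2_eq_square)
  have c': "c = 2 * V * V1 - 2 * ((2 * V * V1 * t - V\<^sup>2 + 1) / t\<^sup>2) * t" using V1 unfolding d'[symmetric] by simp
  show "?A = ?B"
    unfolding q_def \<beta>_def \<beta>1_def H1' K' unfolding H' unfolding c' d'
    using t V(1) by (simp add: divide_simps) (simp add: algebra_simps power_numeral_reduce)
  show "H\<^sup>2 * t * K * t / 2 - t / (4 * V\<^sup>2) * (2 * (q + H + 2 * t * H1) * q)
       + (4 * (H * K * t / 2) + 2 * t * ((H1 * K * t + H * K1 * t + H * K) / 2)) = 0"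
    unfolding q_def K1' H1' K' unfolding H'
    using t V(1) by (simp add: divide_simps) (simp add: algebra_simps power_numeral_reduce)
qed

section \<open>The radial functions of g_0 and their derivatives\<close>

section \<open>Radial profiles of the conformal metric\<close>

definition Uf :: "real \<Rightarrow> real \<Rightarrow> real \<Rightarrow> real" where "Uf c d t = 1 + c * t + d * t\<^sup>2"
definition Vf :: "real \<Rightarrow> real \<Rightarrow> real \<Rightarrow> real" where "Vf c d t = sqrt (Uf c d t)"
definition V1f :: "real \<Rightarrow> real \<Rightarrow> real \<Rightarrow> real" where "V1f c d t = (c + 2 * d * t) / (2 * Vf c d t)"
text \<open>This is (V - 1) / t in a form without singularity at t = 0. The matrix with entries
  \<open>(if m = n then 1 else 0) + H * (Jw x $ m * Jw x $ n)\<close> stretches the Hopf direction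
  by V and is the symmetric square root of the inverse metric of g_0.\<close>

definition Hf :: "real \<Rightarrow> real \<Rightarrow> real \<Rightarrow> real" where "Hf c d t = (c + d * t) / (1 + Vf c d t)"
definition H1f :: "real \<Rightarrow> real \<Rightarrow> real \<Rightarrow> real" where
  "H1f c d t = (d * (1 + Vf c d t) - (c + d * t) * V1f c d t) / (1 + Vf c d t)\<^sup>2"
text \<open>For t > 0 equal to (1 - 1 / V) / t. Subtracting this multiple of the square of
  \<open>Jw\<close> from the identity inverts the matrix described by \<open>Hf\<close>.\<close>

definition Kf :: "real \<Rightarrow> real \<Rightarrow> real \<Rightarrow> real" where "Kf c d t = Hf c d t / Vf c d t"
definition K1f :: "real \<Rightarrow> real \<Rightarrow> real \<Rightarrow> real" where
  "K1f c d t = (H1f c d t * Vf c d t - Hf c d t * V1f c d t) / (Vf c d t)\<^sup>2"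
text \<open>With \<open>N1f\<close>, the coefficients of the radial field whose divergence absorbs
  the products of the spinor with its radial derivative; \<open>N01f\<close> and \<open>N11f\<close>
  are their derivatives in t.\<close>

definition N0f :: "real \<Rightarrow> real \<Rightarrow> real \<Rightarrow> real" where "N0f c d t = V1f c d t / Vf c d t + Hf c d t / 2"
definition N01f :: "real \<Rightarrow> real \<Rightarrow> real \<Rightarrow> real" where
  "N01f c d t = (d - 2 * (V1f c d t)\<^sup>2) / (Vf c d t)\<^sup>2 + H1f c d t / 2"
definition N1f :: "real \<Rightarrow> real \<Rightarrow> real \<Rightarrow> real" where "N1f c d t = Hf c d t * Kf c d t * t / 2"
definition N11f :: "real \<Rightarrow> real \<Rightarrow> real \<Rightarrow> real" where
  "N11f c d t = (H1f c d t * Kf c d t * t + Hf c d t * K1f c d t * t + Hf c d t * Kf c d t) / 2"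

text \<open>A quarter of the scalar curvature of the conformal metric \<open>dr^2 + r^2 g\<close> with \<open>g\<close> the Berger metric.\<close>

definition Wf :: "real \<Rightarrow> real \<Rightarrow> real \<Rightarrow> real" where
  "Wf c d t = (12 * c + 30 * d * t + 6 * c\<^sup>2 * t + 18 * c * d * t\<^sup>2 + 6 * d\<^sup>2 * t^3) / (4 * (Uf c d t)\<^sup>2)"

locale radial_profile =
  fixes c d :: real
  assumes c: "c > 0" and d: "d > 0"
begin

lemma U_pos: "t \<ge> 0 \<Longrightarrow> Uf c d t > 0"
  using c d by (simp add: Uf_def add_pos_nonneg)

lemma V_pos: "t \<ge> 0 \<Longrightarrow> Vf c d t > 0"
  using U_pos by (simp add: Vf_def)

lemma V_sq: "t \<ge> 0 \<Longrightarrow> (Vf c d t)\<^sup>2 = 1 + c * t + d * t\<^sup>2"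
  using U_pos[of t] by (simp add: Vf_def) (simp add: Uf_def)

lemma V1_eq: "t \<ge> 0 \<Longrightarrow> 2 * Vf c d t * V1f c d t = c + 2 * d * t"
  using V_pos[of t] by (simp add: V1f_def)

lemma H_eq: assumes t: "t \<ge> 0" shows "Hf c d t * t = Vf c d t - 1"
proof -
  have "(c + d * t) * t = (Vf c d t - 1) * (1 + Vf c d t)"
    using V_sq[OF t] by (simp add: power2_eq_square algebra_simps)
  then show ?thesis using V_pos[OF t] by (simp add: Hf_def)
qed

lemma H1_eq: assumes t: "t \<ge> 0" shows "H1f c d t * t = V1f c d t - Hf c d t"
proof -
  define V V1 where "V = Vf c d t" and "V1 = V1f c d t"
  have V: "V > 0" "V\<^sup>2 = 1 + c * t + d * t\<^sup>2" "2 * V * V1 = c + 2 * d * t"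
    using V_pos[OF t] V_sq[OF t] V1_eq[OF t] by (simp_all add: V_def V1_def)
  have a: "(c + d * t) * t = V\<^sup>2 - 1" using V(2) by (simp add: power2_eq_square algebra_simps)
  have b: "c + d * t = 2 * V * V1 - d * t" using V(3) by simp
  have "(d * (1 + V) - (c + d * t) * V1) * t = d * t * (1 + V) - ((c + d * t) * t) * V1" by (simp add: algebra_simps)
  also have "\<dots> = d * t * (1 + V) - (V\<^sup>2 - 1) * V1" unfolding a ..
  also have "\<dots> = V1 * (1 + V)\<^sup>2 - (2 * V * V1 - d * t) * (1 + V)" by (simp add: power2_eq_square algebra_simps)
  also have "\<dots> = V1 * (1 + V)\<^sup>2 - (c + d * t) * (1 + V)" unfolding b ..
  finally have e: "(d * (1 + V) - (c + d * t) * V1) * t = V1 * (1 + V)\<^sup>2 - (c + d * t) * (1 + V)" .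
  have p: "(1 + V) \<noteq> 0" using V(1) by simp
  have "H1f c d t * t = ((d * (1 + V) - (c + d * t) * V1) * t) / (1 + V)\<^sup>2"
    by (simp add: H1f_def V_def V1_def)
  also have "\<dots> = V1 - (c + d * t) / (1 + V)" unfolding e using p by (simp add: diff_divide_distrib power2_eq_square)
  finally show ?thesis by (simp add: Hf_def V_def V1_def)
qed

lemma K_eq: "t \<ge> 0 \<Longrightarrow> Kf c d t * Vf c d t = Hf c d t"
  using V_pos[of t] by (simp add: Kf_def)

lemma K1_eq: "t \<ge> 0 \<Longrightarrow> K1f c d t * (Vf c d t)\<^sup>2 = H1f c d t * Vf c d t - Hf c d t * V1f c d t"
  using V_pos[of t] by (simp add: K1f_def)

text \<open>The Hopf coefficient of the inverse metric, where the square root disappears: (1 + H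
  t)^2 = V^2 = 1 + (c + d t) t.\<close>

lemma q_eq: assumes t: "t \<ge> 0" shows "(Hf c d t)\<^sup>2 * t + 2 * Hf c d t = c + d * t"
proof -
  have "(Hf c d t)\<^sup>2 * t + 2 * Hf c d t = Hf c d t * (Hf c d t * t + 2)" by (simp add: power2_eq_square algebra_simps)
  also have "\<dots> = Hf c d t * (1 + Vf c d t)" unfolding H_eq[OF t] by (simp add: algebra_simps)
  also have "\<dots> = c + d * t" using V_pos[OF t] by (simp add: Hf_def)
  finally show ?thesis .
qed

lemma DERIV_U: "(Uf c d has_real_derivative (c + 2 * d * t)) (at t)"
  unfolding Uf_def[abs_def] by (auto intro!: derivative_eq_intros)

lemma DERIV_V: assumes "t \<ge> 0" shows "(Vf c d has_real_derivative V1f c d t) (at t)"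
proof -
  have "((\<lambda>t. sqrt (Uf c d t)) has_real_derivative (inverse (sqrt (Uf c d t)) / 2 * (c + 2 * d * t))) (at t)"
    by (rule DERIV_chain2[OF DERIV_real_sqrt[OF U_pos[OF assms]] DERIV_U])
  then show ?thesis by (simp add: Vf_def[abs_def] V1f_def divide_simps mult.commute)
qed

lemma DERIV_V1: assumes "t \<ge> 0" shows "(V1f c d has_real_derivative (d - (V1f c d t)\<^sup>2) / Vf c d t) (at t)"
proof -
  have V: "Vf c d t > 0" by (rule V_pos[OF assms])
  have "((\<lambda>t. (c + 2 * d * t) / (2 * Vf c d t)) has_real_derivative
     ((2 * d) * (2 * Vf c d t) - (c + 2 * d * t) * (2 * V1f c d t)) / ((2 * Vf c d t) * (2 * Vf c d t))) (at t)"
    by (rule DERIV_divide) (use V in \<open>auto intro!: derivative_eq_intros DERIV_V assms\<close>)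
  also have "((2 * d) * (2 * Vf c d t) - (c + 2 * d * t) * (2 * V1f c d t)) / ((2 * Vf c d t) * (2 * Vf c d t)) = (d - (V1f c d t)\<^sup>2) / Vf c d t"
    unfolding V1_eq[OF assms, symmetric] using V by (simp add: divide_simps power2_eq_square algebra_simps)
  finally show ?thesis by (simp add: V1f_def[abs_def])
qed

lemma DERIV_H: assumes "t \<ge> 0" shows "(Hf c d has_real_derivative H1f c d t) (at t)"
proof -
  have V: "1 + Vf c d t \<noteq> 0" using V_pos[OF assms] by simp
  have "((\<lambda>t. (c + d * t) / (1 + Vf c d t)) has_real_derivative
     (d * (1 + Vf c d t) - (c + d * t) * V1f c d t) / ((1 + Vf c d t) * (1 + Vf c d t))) (at t)"
    by (rule DERIV_divide) (use V in \<open>auto intro!: derivative_eq_intros DERIV_V assms\<close>)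
  then show ?thesis by (simp add: Hf_def[abs_def] H1f_def power2_eq_square)
qed

lemma DERIV_K: assumes "t \<ge> 0" shows "(Kf c d has_real_derivative K1f c d t) (at t)"
proof -
  have V: "Vf c d t \<noteq> 0" using V_pos[OF assms] by simp
  have "((\<lambda>t. Hf c d t / Vf c d t) has_real_derivative
     (H1f c d t * Vf c d t - Hf c d t * V1f c d t) / (Vf c d t * Vf c d t)) (at t)"
    by (rule DERIV_divide[OF DERIV_H[OF assms] DERIV_V[OF assms] V])
  then show ?thesis by (simp add: Kf_def[abs_def] K1f_def power2_eq_square)
qed

lemma DERIV_N0: assumes "t \<ge> 0" shows "(N0f c d has_real_derivative N01f c d t) (at t)"
proof -
  have V: "Vf c d t \<noteq> 0" using V_pos[OF assms] by simp
  have "((\<lambda>t. V1f c d t / Vf c d t) has_real_derivative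
     ((d - (V1f c d t)\<^sup>2) / Vf c d t * Vf c d t - V1f c d t * V1f c d t) / (Vf c d t * Vf c d t)) (at t)"
    by (rule DERIV_divide[OF DERIV_V1[OF assms] DERIV_V[OF assms] V])
  also have "((d - (V1f c d t)\<^sup>2) / Vf c d t * Vf c d t - V1f c d t * V1f c d t) / (Vf c d t * Vf c d t) = (d - 2 * (V1f c d t)\<^sup>2) / (Vf c d t)\<^sup>2"
    using V by (simp add: power2_eq_square)
  finally have "((\<lambda>t. V1f c d t / Vf c d t) has_real_derivative (d - 2 * (V1f c d t)\<^sup>2) / (Vf c d t)\<^sup>2) (at t)" .
  from DERIV_add[OF this DERIV_cdivide[OF DERIV_H[OF assms], of 2]]
  show ?thesis by (simp add: N0f_def[abs_def] N01f_def)
qed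

lemma DERIV_N1: assumes "t \<ge> 0" shows "(N1f c d has_real_derivative N11f c d t) (at t)"
proof -
  have "((\<lambda>t. Hf c d t * Kf c d t * t / 2) has_real_derivative
    ((H1f c d t * Kf c d t + K1f c d t * Hf c d t) * t + 1 * (Hf c d t * Kf c d t)) / 2) (at t)"
    by (rule DERIV_cdivide[OF DERIV_mult[OF DERIV_mult[OF DERIV_H[OF assms] DERIV_K[OF assms]] DERIV_ident]])
  then show ?thesis by (simp add: N1f_def[abs_def] N11f_def algebra_simps)
qed

lemma W_pos: "t \<ge> 0 \<Longrightarrow> Wf c d t > 0"
  unfolding Wf_def using c d U_pos[of t]
  by (intro divide_pos_pos) (auto intro!: add_pos_nonneg)

lemma pd_radial:
  assumes "\<And>t. t \<ge> 0 \<Longrightarrow> (F has_real_derivative F1 t) (at t)"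
  shows "pd (\<lambda>x::real^4. F (x \<bullet> x)) k x = 2 * x $ k * F1 (x \<bullet> x)"
proof -
  have "pd (\<lambda>x::real^4. x \<bullet> x) k x = 2 * x $ k"
    unfolding pd_inner[OF smooth_id smooth_id] pd_of_linear[OF bounded_linear_ident]
    by (simp add: inner_axis inner_axis' )
  then show ?thesis
    using pd_comp_real[OF smooth_diff_at[OF smooth_inner[OF smooth_id smooth_id]] assms[of "x \<bullet> x"], of k] by simp
qed

lemma smooth_U: "smooth_map (\<lambda>x::real^4. Uf c d (x \<bullet> x))"
  unfolding Uf_def by (intro smooth_add smooth_mult smooth_const smooth_power smooth_inner smooth_id)

lemma smooth_V: "smooth_map (\<lambda>x::real^4. Vf c d (x \<bullet> x))"
  unfolding Vf_def by (rule smooth_sqrt[OF smooth_U]) (simp add: U_pos)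

lemma smooth_H: "smooth_map (\<lambda>x::real^4. Hf c d (x \<bullet> x))"
  unfolding Hf_def
  by (rule smooth_divide) (auto intro!: smooth_add smooth_mult smooth_inner smooth_V add_pos_pos V_pos)

lemma smooth_K: "smooth_map (\<lambda>x::real^4. Kf c d (x \<bullet> x))"
  unfolding Kf_def by (rule smooth_divide[OF smooth_H smooth_V]) (simp add: V_pos)

lemma smooth_N0: "smooth_map (\<lambda>x::real^4. N0f c d (x \<bullet> x))"
  unfolding N0f_def V1f_def
  by (intro smooth_add smooth_divide smooth_mult smooth_inner smooth_id smooth_const smooth_V smooth_divide_const smooth_H)
    (simp_all add: V_pos)

lemma smooth_N1: "smooth_map (\<lambda>x::real^4. N1f c d (x \<bullet> x))"
  unfolding N1f_def by (intro smooth_divide_const smooth_mult smooth_H smooth_K smooth_inner smooth_id)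

lemma smooth_W: "smooth_map (\<lambda>x::real^4. Wf c d (x \<bullet> x))"
  unfolding Wf_def
proof (rule smooth_divide)
  show "smooth_map (\<lambda>x::real^4. 4 * (Uf c d (x \<bullet> x))\<^sup>2)" by (intro smooth_mult smooth_power smooth_U smooth_const)
  show "0 < 4 * (Uf c d (x \<bullet> x))\<^sup>2" for x :: "real^4" using U_pos[of "x \<bullet> x"] by simp
qed (intro smooth_add smooth_mult smooth_power smooth_inner smooth_id smooth_const)

end

section \<open>The half-density Dirac operator of g_0 and its formal skewness\<close>

section \<open>The Dirac operator of the conformal metric\<close>

locale berger_dirac = moving_clifford g Q + radial_profile c d
  for g :: "4 \<Rightarrow> 'v::euclidean_space \<Rightarrow> 'v" and Q :: "real^4 \<Rightarrow> 4 \<Rightarrow> 4 \<Rightarrow> real" and c d :: real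
begin

lemma clifford_gm: "clifford (gm x)"
  by unfold_locales (simp_all add: linear_add[OF lin_gm] linear_cmul[OF lin_gm] gm_sym gm_anticomm)

sublocale P: clifford "gm x" for x
  by (rule clifford_gm)

abbreviation sl' where "sl' x \<equiv> P.sl x"
abbreviation vol' where "vol' x \<equiv> P.vol4 x"
abbreviation hh where "hh x \<equiv> Hf c d (x \<bullet> (x::real^4))"
abbreviation kk where "kk x \<equiv> Kf c d (x \<bullet> (x::real^4))"

lemma smooth_sl: "smooth_map u \<Longrightarrow> smooth_map \<phi> \<Longrightarrow> smooth_map (\<lambda>x. sl' x (u x) (\<phi> x))"
  unfolding P.sl_def
  by (intro smooth_sum smooth_scaleR smooth_gm smooth_linear[OF bounded_linear_vec_nth])

lemma smooth_vol: "smooth_map \<phi> \<Longrightarrow> smooth_map (\<lambda>x. vol' x (\<phi> x))"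
  unfolding P.vol4_def by (intro smooth_gm)

lemma cov_sl:
  assumes u: "smooth_map u" and \<phi>: "smooth_map \<phi>"
  shows "cov k (\<lambda>x. sl' x (u x) (\<phi> x)) x = sl' x (pd u k x) (\<phi> x) + sl' x (u x) (cov k \<phi> x)"
proof -
  have uj: "smooth_map (\<lambda>x. u x $ j)" for j by (rule smooth_linear[OF bounded_linear_vec_nth u])
  have pj: "pd (\<lambda>x. u x $ j) k x = pd u k x $ j" for j by (rule pd_lin[OF bounded_linear_vec_nth u])
  have "cov k (\<lambda>x. \<Sum>j\<in>UNIV. u x $ j *\<^sub>R gm x j (\<phi> x)) x = (\<Sum>j\<in>UNIV. cov k (\<lambda>x. u x $ j *\<^sub>R gm x j (\<phi> x)) x)"
    by (rule cov_sum) (simp, intro smooth_scaleR uj smooth_gm \<phi>)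
  also have "\<dots> = (\<Sum>j\<in>UNIV. pd u k x $ j *\<^sub>R gm x j (\<phi> x) + u x $ j *\<^sub>R gm x j (cov k \<phi> x))"
    by (rule sum.cong[OF refl]) (simp add: cov_scaleR[OF uj smooth_gm[OF \<phi>]] pj cov_gm[OF \<phi>])
  finally show ?thesis by (simp add: P.sl_def sum.distrib)
qed

lemma cov_vol: "smooth_map \<phi> \<Longrightarrow> cov k (\<lambda>x. vol' x (\<phi> x)) x = vol' x (cov k \<phi> x)"
  unfolding P.vol4_def by (simp add: cov_gm smooth_gm)

definition dirac0 :: "(real^4 \<Rightarrow> 'v) \<Rightarrow> real^4 \<Rightarrow> 'v" where
  "dirac0 \<phi> x = (\<Sum>k\<in>UNIV. gm x k (cov k \<phi> x))"

definition covw :: "(real^4 \<Rightarrow> 'v) \<Rightarrow> real^4 \<Rightarrow> 'v" where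
  "covw \<phi> x = (\<Sum>k\<in>UNIV. Jw x $ k *\<^sub>R cov k \<phi> x)"

text \<open>The multiple of x is what formal skewness for Lebesgue measure forces. The part with the
  orientation element is the totally antisymmetric part of the spin connection of g_0.\<close>

definition zo :: "real^4 \<Rightarrow> 'v \<Rightarrow> 'v" where
  "zo x v = - (hh x / 2) *\<^sub>R sl' x x (v + (kk x * (x \<bullet> x)) *\<^sub>R vol' x v)"

text \<open>The Dirac operator of g_0, conjugated so that Lebesgue measure replaces the volume of
  g_0. The first two terms pair the generators with the frame given by the square root of the
  inverse metric.\<close>

definition Lop :: "(real^4 \<Rightarrow> 'v) \<Rightarrow> real^4 \<Rightarrow> 'v" where
  "Lop \<phi> x = dirac0 \<phi> x + hh x *\<^sub>R sl' x (Jw x) (covw \<phi> x) + zo x (\<phi> x)"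

lemma smooth_Jw: "smooth_map Jw" by (rule smooth_of_linear[OF bl_Jw])
lemma smooth_Jw_k: "smooth_map (\<lambda>x. Jw x $ k)" by (rule smooth_linear[OF bounded_linear_vec_nth smooth_Jw])
lemma pd_Jw: "pd Jw k x = Jw (axis k 1)" by (rule pd_of_linear[OF bl_Jw])
lemma pd_Jw_k: "pd (\<lambda>x. Jw x $ j) k x = Jw (axis k 1) $ j"
  using pd_lin[OF bounded_linear_vec_nth smooth_Jw, of j k x] by (simp add: pd_Jw)
lemma pd_ident: "pd (\<lambda>x. x) k x = axis k 1" by (rule pd_of_linear[OF bounded_linear_ident])

lemma smooth_dirac0: "smooth_map \<phi> \<Longrightarrow> smooth_map (dirac0 \<phi>)"
  unfolding dirac0_def[abs_def] by (intro smooth_sum smooth_gm smooth_cov)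

lemma smooth_covw: "smooth_map \<phi> \<Longrightarrow> smooth_map (covw \<phi>)"
  unfolding covw_def[abs_def] by (intro smooth_sum smooth_scaleR smooth_Jw_k smooth_cov)

lemma smooth_zo: "smooth_map \<phi> \<Longrightarrow> smooth_map (\<lambda>x. zo x (\<phi> x))"
  unfolding zo_def
  by (intro smooth_scaleR smooth_uminus smooth_divide_const smooth_H smooth_sl smooth_id smooth_add smooth_vol smooth_mult smooth_K smooth_inner)

lemma smooth_Lop: "smooth_map \<phi> \<Longrightarrow> smooth_map (Lop \<phi>)"
  unfolding Lop_def[abs_def]
  by (intro smooth_add smooth_dirac0 smooth_scaleR smooth_H smooth_sl smooth_Jw smooth_covw smooth_zo)

lemma dirac0_sym: "(\<Sum>k\<in>UNIV. cov k \<phi> x \<bullet> gm x k v) = dirac0 \<phi> x \<bullet> v"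
  unfolding dirac0_def by (simp add: inner_sum_left gm_sym)

lemma sl_sum_axis: "(\<Sum>k\<in>UNIV. u $ k *\<^sub>R sl' x (axis k 1) v) = sl' x u v"
  unfolding P.sl_axis by (simp add: P.sl_def)

lemma sl_zero_left: "sl' x 0 v = 0"
  using P.sl_scaleR_left[of x 0 0 v] by simp

lemma sl_sum_Jw: "(\<Sum>k\<in>UNIV. u $ k *\<^sub>R sl' x (Jw (axis k 1)) v) = sl' x (Jw u) v"
proof -
  have "sl' x (Jw u) v = u $ 0 *\<^sub>R sl' x (Jw (axis 0 1)) v + u $ 1 *\<^sub>R sl' x (Jw (axis 1 1)) v
     + u $ 2 *\<^sub>R sl' x (Jw (axis 2 1)) v + u $ 3 *\<^sub>R sl' x (Jw (axis 3 1)) v"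
    unfolding P.sl_scaleR_left[symmetric] P.sl_add_left[symmetric]
    by (rule arg_cong[of _ _ "\<lambda>w. sl' x w v"]) (simp add: vec4_eq_iff qmul_comp axis_def)
  then show ?thesis by (simp add: sum4)
qed

lemma pd_hh: "pd (\<lambda>x. hh x) k x = 2 * x $ k * H1f c d (x \<bullet> x)"
  by (rule pd_radial[OF DERIV_H])

lemma weight_div: "(\<Sum>k\<in>UNIV. pd (\<lambda>x. hh x * Jw x $ k) k x * F k) = (\<Sum>k\<in>UNIV. 2 * x $ k * H1f c d (x \<bullet> x) * Jw x $ k * F k + hh x * Jw (axis k 1) $ k * F k)"
  unfolding pd_mult[OF smooth_H smooth_Jw_k] pd_hh pd_Jw_k
  by (rule sum.cong[OF refl]) (simp add: algebra_simps)

text \<open>The field \<open>hh\<close> times \<open>Jw\<close> has divergence zero: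
  \<open>Jw\<close> is linear and trace-free, and it is orthogonal to the gradient of a radial
  function.\<close>

lemma weight_div0: "(\<Sum>k\<in>UNIV. pd (\<lambda>x. hh x * Jw x $ k) k x * s) = 0"
  unfolding weight_div unfolding sum4 by (simp add: qmul_comp axis_def algebra_simps)

lemma div_weighted:
  assumes f: "smooth_map f"
  shows "(\<Sum>k\<in>UNIV. pd (\<lambda>x. (hh x * Jw x $ k) * f x) k x) = hh x * (\<Sum>k\<in>UNIV. Jw x $ k * pd f k x)"
proof -
  have "(\<Sum>k\<in>UNIV. pd (\<lambda>x. (hh x * Jw x $ k) * f x) k x) = (\<Sum>k\<in>UNIV. pd (\<lambda>x. hh x * Jw x $ k) k x * f x + hh x * Jw x $ k * pd f k x)"
    by (rule sum.cong[OF refl]) (rule pd_mult[OF smooth_mult[OF smooth_H smooth_Jw_k] f])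
  also have "\<dots> = hh x * (\<Sum>k\<in>UNIV. Jw x $ k * pd f k x)"
    using weight_div0[of x "f x"] by (simp add: sum.distrib sum_distrib_left mult.assoc)
  finally show ?thesis .
qed

text \<open>Everything of first order is a divergence, because the generators are parallel and
  symmetric and the weighted Hopf field has no divergence. The one defect comes from differentiating
  \<open>Jw\<close> along itself, which gives - x. It is cancelled by \<open>zo\<close>, whose
  orientation part is skew by itself because \<open>vol'\<close> anticommutes with vectors.\<close>

lemma Lop_skew_pointwise:
  assumes \<phi>: "smooth_map \<phi>" and \<psi>: "smooth_map \<psi>"
  shows "(\<Sum>k\<in>UNIV. pd (\<lambda>x. \<phi> x \<bullet> gm x k (\<psi> x) + (hh x * Jw x $ k) * (\<phi> x \<bullet> sl' x (Jw x) (\<psi> x))) k x)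
    = Lop \<phi> x \<bullet> \<psi> x + \<phi> x \<bullet> Lop \<psi> x"
proof -
  have s1: "smooth_map (\<lambda>x. \<phi> x \<bullet> gm x k (\<psi> x))" for k by (intro smooth_inner smooth_gm \<phi> \<psi>)
  have s2: "smooth_map (\<lambda>x. \<phi> x \<bullet> sl' x (Jw x) (\<psi> x))" by (intro smooth_inner smooth_sl smooth_Jw \<phi> \<psi>)
  have p1: "pd (\<lambda>x. \<phi> x \<bullet> gm x k (\<psi> x)) k x = cov k \<phi> x \<bullet> gm x k (\<psi> x) + \<phi> x \<bullet> gm x k (cov k \<psi> x)" for k
    by (simp add: cov_inner[OF \<phi> smooth_gm[OF \<psi>]] cov_gm[OF \<psi>])
  have p2: "pd (\<lambda>x. \<phi> x \<bullet> sl' x (Jw x) (\<psi> x)) k x = cov k \<phi> x \<bullet> sl' x (Jw x) (\<psi> x) + \<phi> x \<bullet> sl' x (Jw (axis k 1)) (\<psi> x) + \<phi> x \<bullet> sl' x (Jw x) (cov k \<psi> x)" for k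
    by (simp add: cov_inner[OF \<phi> smooth_sl[OF smooth_Jw \<psi>]] cov_sl[OF smooth_Jw \<psi>] pd_Jw inner_add_right)
  have "(\<Sum>k\<in>UNIV. pd (\<lambda>x. \<phi> x \<bullet> gm x k (\<psi> x) + (hh x * Jw x $ k) * (\<phi> x \<bullet> sl' x (Jw x) (\<psi> x))) k x)
     = (\<Sum>k\<in>UNIV. pd (\<lambda>x. \<phi> x \<bullet> gm x k (\<psi> x)) k x) + (\<Sum>k\<in>UNIV. pd (\<lambda>x. (hh x * Jw x $ k) * (\<phi> x \<bullet> sl' x (Jw x) (\<psi> x))) k x)"
    unfolding sum.distrib[symmetric]
    by (rule sum.cong[OF refl]) (rule pd_plus[OF s1 smooth_mult[OF smooth_mult[OF smooth_H smooth_Jw_k] s2]])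
  also have "(\<Sum>k\<in>UNIV. pd (\<lambda>x. \<phi> x \<bullet> gm x k (\<psi> x)) k x) = dirac0 \<phi> x \<bullet> \<psi> x + \<phi> x \<bullet> dirac0 \<psi> x"
    unfolding p1 sum.distrib dirac0_sym by (simp add: dirac0_def inner_sum_right)
  also have "(\<Sum>k\<in>UNIV. pd (\<lambda>x. (hh x * Jw x $ k) * (\<phi> x \<bullet> sl' x (Jw x) (\<psi> x))) k x)
     = hh x * (covw \<phi> x \<bullet> sl' x (Jw x) (\<psi> x) - \<phi> x \<bullet> sl' x x (\<psi> x) + \<phi> x \<bullet> sl' x (Jw x) (covw \<psi> x))"
  proof -
    have "(\<Sum>k\<in>UNIV. Jw x $ k * pd (\<lambda>x. \<phi> x \<bullet> sl' x (Jw x) (\<psi> x)) k x)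
      = covw \<phi> x \<bullet> sl' x (Jw x) (\<psi> x) + \<phi> x \<bullet> (\<Sum>k\<in>UNIV. Jw x $ k *\<^sub>R sl' x (Jw (axis k 1)) (\<psi> x)) + \<phi> x \<bullet> sl' x (Jw x) (covw \<psi> x)"
      unfolding p2 covw_def
      by (simp add: distrib_left sum.distrib inner_sum_left inner_sum_right linear_sum[OF P.lin_sl] linear_cmul[OF P.lin_sl])
    also have "(\<Sum>k\<in>UNIV. Jw x $ k *\<^sub>R sl' x (Jw (axis k 1)) (\<psi> x)) = - sl' x x (\<psi> x)"
      unfolding sl_sum_Jw Jw_inner(3) P.sl_minus_left ..
    finally show ?thesis unfolding div_weighted[OF s2] by simp
  qed
  finally have 1: "(\<Sum>k\<in>UNIV. pd (\<lambda>x. \<phi> x \<bullet> gm x k (\<psi> x) + (hh x * Jw x $ k) * (\<phi> x \<bullet> sl' x (Jw x) (\<psi> x))) k x)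
    = dirac0 \<phi> x \<bullet> \<psi> x + \<phi> x \<bullet> dirac0 \<psi> x + hh x * (covw \<phi> x \<bullet> sl' x (Jw x) (\<psi> x) - \<phi> x \<bullet> sl' x x (\<psi> x) + \<phi> x \<bullet> sl' x (Jw x) (covw \<psi> x))" .
  have v: "vol' x (\<phi> x) \<bullet> sl' x x (\<psi> x) = - (\<phi> x \<bullet> sl' x x (vol' x (\<psi> x)))"
  proof -
    have "vol' x (sl' x x (\<psi> x)) = - sl' x x (vol' x (\<psi> x))"
      by (simp add: P.sl_def linear_sum[OF P.lin_vol4] linear_cmul[OF P.lin_vol4] P.vol4_g sum_negf)
    then show ?thesis by (simp add: P.sl_sym P.vol4_sym)
  qed
  have z: "zo x (\<phi> x) \<bullet> \<psi> x + \<phi> x \<bullet> zo x (\<psi> x) = - hh x * (\<phi> x \<bullet> sl' x x (\<psi> x))"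
    unfolding zo_def by (simp add: linear_add[OF P.lin_sl] linear_cmul[OF P.lin_sl] inner_add_left inner_add_right v P.sl_sym algebra_simps)
  show ?thesis unfolding 1 Lop_def inner_add_left inner_add_right
    using z by (simp add: P.sl_sym algebra_simps)
qed

text \<open>Flatness of \<open>cov\<close> lets the double sum be symmetrized, and the Clifford
  relation then leaves the connection Laplacian, with a plus sign since the generators square to
  +1.\<close>

lemma dirac0_sq:
  assumes \<psi>: "smooth_map \<psi>"
  shows "(\<Sum>k\<in>UNIV. gm x k (cov k (dirac0 \<psi>) x)) = (\<Sum>k\<in>UNIV. cov k (cov k \<psi>) x)"
proof -
  have c: "cov k (dirac0 \<psi>) x = (\<Sum>l\<in>UNIV. gm x l (cov k (cov l \<psi>) x))" for k
  proof -
    have "cov k (\<lambda>x. \<Sum>l\<in>UNIV. gm x l (cov l \<psi> x)) x = (\<Sum>l\<in>UNIV. cov k (\<lambda>x. gm x l (cov l \<psi> x)) x)"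
      by (rule cov_sum) (simp, intro smooth_gm smooth_cov \<psi>)
    also have "\<dots> = (\<Sum>l\<in>UNIV. gm x l (cov k (cov l \<psi>) x))"
      by (rule sum.cong[OF refl]) (rule cov_gm[OF smooth_cov[OF \<psi>]])
    finally show ?thesis by (simp add: dirac0_def[abs_def])
  qed
  have "(\<Sum>k\<in>UNIV. gm x k (cov k (dirac0 \<psi>) x)) = (\<Sum>k\<in>UNIV. \<Sum>l\<in>UNIV. gm x k (gm x l (cov k (cov l \<psi>) x)))"
    unfolding c by (simp add: P.g_simps)
  then have 1: "2 *\<^sub>R (\<Sum>k\<in>UNIV. gm x k (cov k (dirac0 \<psi>) x)) = (\<Sum>k\<in>UNIV. \<Sum>l\<in>UNIV. gm x k (gm x l (cov k (cov l \<psi>) x))) + (\<Sum>l\<in>UNIV. \<Sum>k\<in>UNIV. gm x k (gm x l (cov k (cov l \<psi>) x)))"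
    using sum.swap[of "\<lambda>k l. gm x k (gm x l (cov k (cov l \<psi>) x))" UNIV UNIV] by (simp add: scaleR_2)
  also have "\<dots> = (\<Sum>k\<in>UNIV. \<Sum>l\<in>UNIV. gm x k (gm x l (cov k (cov l \<psi>) x)) + gm x l (gm x k (cov k (cov l \<psi>) x)))"
    unfolding sum.distrib[symmetric] by (simp only: cov_commute[OF \<psi>, of _ _ x])
  also have "\<dots> = (\<Sum>k\<in>UNIV. 2 *\<^sub>R cov k (cov k \<psi>) x)"
    unfolding gm_anticomm
    by (rule sum.cong) (simp_all add: if_distrib[of "\<lambda>c. c *\<^sub>R _"] cong: if_cong)
  finally show ?thesis by (simp add: scaleR_sum_right[symmetric])
qed

text \<open>The commutator of the flat Dirac operator with differentiation along \<open>Jw\<close>,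
  which arises because \<open>Jw\<close> is not a constant field.\<close>

definition dJ :: "(real^4 \<Rightarrow> 'v) \<Rightarrow> real^4 \<Rightarrow> 'v" where
  "dJ \<psi> x = (\<Sum>k\<in>UNIV. \<Sum>l\<in>UNIV. Jw (axis k 1) $ l *\<^sub>R gm x k (cov l \<psi> x))"

lemma dirac0_covw:
  assumes \<psi>: "smooth_map \<psi>"
  shows "dirac0 (covw \<psi>) x = dJ \<psi> x + covw (dirac0 \<psi>) x"
proof -
  have c: "cov k (covw \<psi>) x = (\<Sum>l\<in>UNIV. Jw (axis k 1) $ l *\<^sub>R cov l \<psi> x + Jw x $ l *\<^sub>R cov k (cov l \<psi>) x)" for k
  proof -
    have "cov k (\<lambda>x. \<Sum>l\<in>UNIV. Jw x $ l *\<^sub>R cov l \<psi> x) x = (\<Sum>l\<in>UNIV. cov k (\<lambda>x. Jw x $ l *\<^sub>R cov l \<psi> x) x)"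
      by (rule cov_sum) (simp, intro smooth_scaleR smooth_Jw_k smooth_cov \<psi>)
    also have "\<dots> = (\<Sum>l\<in>UNIV. Jw (axis k 1) $ l *\<^sub>R cov l \<psi> x + Jw x $ l *\<^sub>R cov k (cov l \<psi>) x)"
      by (rule sum.cong[OF refl]) (simp add: cov_scaleR[OF smooth_Jw_k smooth_cov[OF \<psi>]] pd_Jw_k)
    finally show ?thesis by (simp add: covw_def[abs_def])
  qed
  have e: "cov l (dirac0 \<psi>) x = (\<Sum>k\<in>UNIV. gm x k (cov k (cov l \<psi>) x))" for l
  proof -
    have "cov l (\<lambda>x. \<Sum>k\<in>UNIV. gm x k (cov k \<psi> x)) x = (\<Sum>k\<in>UNIV. cov l (\<lambda>x. gm x k (cov k \<psi> x)) x)"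
      by (rule cov_sum) (simp, intro smooth_gm smooth_cov \<psi>)
    also have "\<dots> = (\<Sum>k\<in>UNIV. gm x k (cov k (cov l \<psi>) x))"
      by (rule sum.cong[OF refl]) (simp add: cov_gm[OF smooth_cov[OF \<psi>]] cov_commute[OF \<psi>, of l])
    finally show ?thesis by (simp add: dirac0_def[abs_def])
  qed
  have "dirac0 (covw \<psi>) x = dJ \<psi> x + (\<Sum>k\<in>UNIV. \<Sum>l\<in>UNIV. Jw x $ l *\<^sub>R gm x k (cov k (cov l \<psi>) x))"
    unfolding dirac0_def[of "covw \<psi>"] c dJ_def by (simp add: P.g_simps sum.distrib)
  also have "(\<Sum>k\<in>UNIV. \<Sum>l\<in>UNIV. Jw x $ l *\<^sub>R gm x k (cov k (cov l \<psi>) x)) = (\<Sum>l\<in>UNIV. \<Sum>k\<in>UNIV. Jw x $ l *\<^sub>R gm x k (cov k (cov l \<psi>) x))"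
    by (rule sum.swap)
  also have "\<dots> = covw (dirac0 \<psi>) x" unfolding covw_def e by (simp add: scaleR_sum_right)
  finally show ?thesis .
qed

section \<open>Divergence identities and the Weitzenboeck inequality\<close>

lemma div_laplace:
  assumes \<psi>: "smooth_map \<psi>"
  shows "(\<Sum>k\<in>UNIV. pd (\<lambda>x. \<psi> x \<bullet> gm x k (dirac0 \<psi> x) - \<psi> x \<bullet> cov k \<psi> x) k x)
    = dirac0 \<psi> x \<bullet> dirac0 \<psi> x - (\<Sum>k\<in>UNIV. cov k \<psi> x \<bullet> cov k \<psi> x)"
proof -
  note sd = smooth_dirac0[OF \<psi>] and sc = smooth_cov[OF \<psi>]
  have p: "pd (\<lambda>x. \<psi> x \<bullet> gm x k (dirac0 \<psi> x) - \<psi> x \<bullet> cov k \<psi> x) k x =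
     (cov k \<psi> x \<bullet> gm x k (dirac0 \<psi> x) + \<psi> x \<bullet> gm x k (cov k (dirac0 \<psi>) x)) - (cov k \<psi> x \<bullet> cov k \<psi> x + \<psi> x \<bullet> cov k (cov k \<psi>) x)" for k
    unfolding pd_diff[OF smooth_inner[OF \<psi> smooth_gm[OF sd]] smooth_inner[OF \<psi> sc]]
      cov_inner[OF \<psi> smooth_gm[OF sd]] cov_inner[OF \<psi> sc] cov_gm[OF sd] ..
  show ?thesis unfolding p
    by (simp add: sum_subtractf sum.distrib dirac0_sym inner_sum_right[symmetric] dirac0_sq[OF \<psi>])
qed

text \<open>The fields are chosen so that no second derivatives survive. Anticommuting
  \<open>gm\<close> past Clifford multiplication by \<open>Jw\<close> creates the second derivative
  along \<open>Jw\<close>, removed by the second sum, and a mixed term, removed by the third up to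
  the commutator \<open>dJ\<close>.\<close>

lemma div_mixed:
  assumes \<psi>: "smooth_map \<psi>"
  shows "(\<Sum>k\<in>UNIV. pd (\<lambda>x. hh x * (\<psi> x \<bullet> gm x k (sl' x (Jw x) (covw \<psi> x)))) k x)
     - (\<Sum>k\<in>UNIV. pd (\<lambda>x. (hh x * Jw x $ k) * (2 * (\<psi> x \<bullet> covw \<psi> x))) k x)
     + (\<Sum>k\<in>UNIV. pd (\<lambda>x. (hh x * Jw x $ k) * (\<psi> x \<bullet> sl' x (Jw x) (dirac0 \<psi> x))) k x)
   = 2 * hh x * (dirac0 \<psi> x \<bullet> sl' x (Jw x) (covw \<psi> x)) - 2 * hh x * (covw \<psi> x \<bullet> covw \<psi> x)
     + \<psi> x \<bullet> ((2 * H1f c d (x \<bullet> x)) *\<^sub>R sl' x x (sl' x (Jw x) (covw \<psi> x))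
       + hh x *\<^sub>R (\<Sum>k\<in>UNIV. gm x k (sl' x (Jw (axis k 1)) (covw \<psi> x)))
       - hh x *\<^sub>R sl' x (Jw x) (dJ \<psi> x) - hh x *\<^sub>R sl' x x (dirac0 \<psi> x))"
proof -
  note sd = smooth_dirac0[OF \<psi>] and sw = smooth_covw[OF \<psi>]
  note ssw = smooth_sl[OF smooth_Jw sw] and ssd = smooth_sl[OF smooth_Jw sd]
  let ?Y = "covw \<psi> x" and ?D = "dirac0 \<psi> x" and ?w = "Jw x"
  have 1: "(\<Sum>k\<in>UNIV. pd (\<lambda>x. hh x * (\<psi> x \<bullet> gm x k (sl' x (Jw x) (covw \<psi> x)))) k x)
    = 2 * H1f c d (x \<bullet> x) * (\<psi> x \<bullet> sl' x x (sl' x ?w ?Y)) + hh x * (?D \<bullet> sl' x ?w ?Y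
       + \<psi> x \<bullet> (\<Sum>k\<in>UNIV. gm x k (sl' x (Jw (axis k 1)) ?Y)) + \<psi> x \<bullet> (\<Sum>k\<in>UNIV. gm x k (sl' x ?w (cov k (covw \<psi>) x))))"
  proof -
    have p: "pd (\<lambda>x. hh x * (\<psi> x \<bullet> gm x k (sl' x (Jw x) (covw \<psi> x)))) k x =
      2 * x $ k * H1f c d (x \<bullet> x) * (\<psi> x \<bullet> gm x k (sl' x ?w ?Y)) + hh x * (cov k \<psi> x \<bullet> gm x k (sl' x ?w ?Y)
        + (\<psi> x \<bullet> gm x k (sl' x (Jw (axis k 1)) ?Y) + \<psi> x \<bullet> gm x k (sl' x ?w (cov k (covw \<psi>) x))))" for k
      unfolding pd_mult[OF smooth_H smooth_inner[OF \<psi> smooth_gm[OF ssw]]] pd_hh cov_inner[OF \<psi> smooth_gm[OF ssw]]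
        cov_gm[OF ssw] cov_sl[OF smooth_Jw sw] pd_Jw P.g_simps inner_add_right ..
    have a: "(\<Sum>k\<in>UNIV. 2 * x $ k * H1f c d (x \<bullet> x) * (\<psi> x \<bullet> gm x k (sl' x ?w ?Y))) = 2 * H1f c d (x \<bullet> x) * (\<psi> x \<bullet> sl' x x (sl' x ?w ?Y))"
      unfolding P.sl_def[of x x] by (simp add: inner_sum_right sum_distrib_left mult_ac)
    show ?thesis unfolding p sum.distrib a sum_distrib_left[symmetric] dirac0_sym inner_sum_right by simp
  qed
  have 2: "(\<Sum>k\<in>UNIV. pd (\<lambda>x. (hh x * Jw x $ k) * (2 * (\<psi> x \<bullet> covw \<psi> x))) k x) = hh x * (2 * (?Y \<bullet> ?Y) + 2 * (\<psi> x \<bullet> covw (covw \<psi>) x))"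
  proof -
    have s: "smooth_map (\<lambda>x. 2 * (\<psi> x \<bullet> covw \<psi> x))" by (intro smooth_mult smooth_const smooth_inner \<psi> sw)
    have q: "pd (\<lambda>x. 2 * (\<psi> x \<bullet> covw \<psi> x)) k x = 2 * (cov k \<psi> x \<bullet> ?Y + \<psi> x \<bullet> cov k (covw \<psi>) x)" for k
      unfolding pd_mult[OF smooth_const smooth_inner[OF \<psi> sw]] cov_inner[OF \<psi> sw] by simp
    have y: "(\<Sum>k\<in>UNIV. ?w $ k * (cov k \<psi> x \<bullet> v)) = ?Y \<bullet> v" for v
      by (simp add: covw_def inner_sum_left)
    have yy: "(\<Sum>k\<in>UNIV. ?w $ k * (\<psi> x \<bullet> cov k (covw \<psi>) x)) = \<psi> x \<bullet> covw (covw \<psi>) x"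
      unfolding covw_def[of "covw \<psi>"] by (simp add: inner_sum_right)
    have l: "(\<Sum>k\<in>UNIV. ?w $ k * (2 * (a k + b k))) = 2 * (\<Sum>k\<in>UNIV. ?w $ k * a k) + 2 * (\<Sum>k\<in>UNIV. ?w $ k * b k)" for a b :: "4 \<Rightarrow> real"
      by (simp add: sum_distrib_left sum.distrib algebra_simps)
    show ?thesis unfolding div_weighted[OF s] q l y yy ..
  qed
  have 3: "(\<Sum>k\<in>UNIV. pd (\<lambda>x. (hh x * Jw x $ k) * (\<psi> x \<bullet> sl' x (Jw x) (dirac0 \<psi> x))) k x)
     = hh x * (?Y \<bullet> sl' x ?w ?D - \<psi> x \<bullet> sl' x x ?D + \<psi> x \<bullet> sl' x ?w (covw (dirac0 \<psi>) x))"
  proof -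
    have s: "smooth_map (\<lambda>x. \<psi> x \<bullet> sl' x (Jw x) (dirac0 \<psi> x))" by (rule smooth_inner[OF \<psi> ssd])
    have p: "pd (\<lambda>x. \<psi> x \<bullet> sl' x (Jw x) (dirac0 \<psi> x)) k x = cov k \<psi> x \<bullet> sl' x ?w ?D
       + (\<psi> x \<bullet> sl' x (Jw (axis k 1)) ?D + \<psi> x \<bullet> sl' x ?w (cov k (dirac0 \<psi>) x))" for k
      unfolding cov_inner[OF \<psi> ssd] cov_sl[OF smooth_Jw sd] pd_Jw inner_add_right ..
    have "(\<Sum>k\<in>UNIV. Jw x $ k * pd (\<lambda>x. \<psi> x \<bullet> sl' x (Jw x) (dirac0 \<psi> x)) k x)
      = ?Y \<bullet> sl' x ?w ?D + (\<psi> x \<bullet> (\<Sum>k\<in>UNIV. Jw x $ k *\<^sub>R sl' x (Jw (axis k 1)) ?D) + \<psi> x \<bullet> sl' x ?w (covw (dirac0 \<psi>) x))"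
      unfolding p covw_def
      by (simp add: distrib_left sum.distrib inner_sum_left inner_sum_right linear_sum[OF P.lin_sl] linear_cmul[OF P.lin_sl])
    then show ?thesis unfolding div_weighted[OF s] sl_sum_Jw Jw_inner(3) P.sl_minus_left by simp
  qed
  have 4: "(\<Sum>k\<in>UNIV. gm x k (sl' x ?w (cov k (covw \<psi>) x))) = 2 *\<^sub>R covw (covw \<psi>) x - sl' x ?w (dJ \<psi> x) - sl' x ?w (covw (dirac0 \<psi>) x)"
  proof -
    have a: "gm x k (sl' x ?w v) = (2 * ?w $ k) *\<^sub>R v - sl' x ?w (gm x k v)" for k v
    proof -
      have "gm x k (sl' x ?w v) + sl' x ?w (gm x k v) = (2 * ?w $ k) *\<^sub>R v"
        using P.sl_anticomm[of x "axis k 1" ?w v] unfolding P.sl_axis by (simp add: inner_axis')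
      then show ?thesis by (simp add: algebra_simps)
    qed
    have "(\<Sum>k\<in>UNIV. gm x k (sl' x ?w (cov k (covw \<psi>) x))) = 2 *\<^sub>R covw (covw \<psi>) x - sl' x ?w (dirac0 (covw \<psi>) x)"
      unfolding a sum_subtractf covw_def[of "covw \<psi>"] dirac0_def[of "covw \<psi>"]
      by (simp add: linear_sum[OF P.lin_sl] scaleR_sum_right)
    then show ?thesis unfolding dirac0_covw[OF \<psi>] linear_add[OF P.lin_sl] by (simp add: algebra_simps)
  qed
  have 5: "?Y \<bullet> sl' x ?w ?D = ?D \<bullet> sl' x ?w ?Y" by (subst inner_commute) (simp add: P.sl_sym)
  show ?thesis unfolding 1 2 3 4 5
    by (simp add: inner_add_right inner_diff_right algebra_simps)
qed

text \<open>The divergence of x is 4 and the derivative of a radial function along x is 2 t times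
  its derivative in t. This is the origin of the coefficients called \<open>d0\<close> and
  \<open>d1\<close> in the pointwise inequality.\<close>

lemma div_radial:
  assumes \<psi>: "smooth_map \<psi>"
  defines "N0 \<equiv> \<lambda>x::real^4. N0f c d (x \<bullet> x)" and "N1 \<equiv> \<lambda>x::real^4. N1f c d (x \<bullet> x)"
  shows "(\<Sum>k\<in>UNIV. pd (\<lambda>x. x $ k * (N0 x * (\<psi> x \<bullet> \<psi> x) + N1 x * (\<psi> x \<bullet> vol' x (\<psi> x)))) k x)
    = (4 * N0 x + 2 * (x \<bullet> x) * N01f c d (x \<bullet> x)) * (\<psi> x \<bullet> \<psi> x)
    + (4 * N1 x + 2 * (x \<bullet> x) * N11f c d (x \<bullet> x)) * (\<psi> x \<bullet> vol' x (\<psi> x))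
    + 2 * (\<psi> x \<bullet> (N0 x *\<^sub>R (\<Sum>k\<in>UNIV. x $ k *\<^sub>R cov k \<psi> x) + N1 x *\<^sub>R vol' x (\<Sum>k\<in>UNIV. x $ k *\<^sub>R cov k \<psi> x)))"
proof -
  have s0: "smooth_map N0" and s1: "smooth_map N1" unfolding N0_def N1_def by (rule smooth_N0 smooth_N1)+
  note sp = smooth_inner[OF \<psi> \<psi>] and sv = smooth_inner[OF \<psi> smooth_vol[OF \<psi>]]
  have pf: "pd (\<lambda>x. N0 x * (\<psi> x \<bullet> \<psi> x) + N1 x * (\<psi> x \<bullet> vol' x (\<psi> x))) k x
    = 2 * x $ k * N01f c d (x \<bullet> x) * (\<psi> x \<bullet> \<psi> x) + N0 x * (2 * (\<psi> x \<bullet> cov k \<psi> x))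
     + (2 * x $ k * N11f c d (x \<bullet> x) * (\<psi> x \<bullet> vol' x (\<psi> x)) + N1 x * (2 * (\<psi> x \<bullet> vol' x (cov k \<psi> x))))" for k
  proof -
    have a: "pd N0 k x = 2 * x $ k * N01f c d (x \<bullet> x)" unfolding N0_def by (rule pd_radial[OF DERIV_N0])
    have b: "pd N1 k x = 2 * x $ k * N11f c d (x \<bullet> x)" unfolding N1_def by (rule pd_radial[OF DERIV_N1])
    have e: "cov k \<psi> x \<bullet> vol' x (\<psi> x) = \<psi> x \<bullet> vol' x (cov k \<psi> x)" by (subst inner_commute) (rule P.vol4_sym)
    show ?thesis
      unfolding pd_plus[OF smooth_mult[OF s0 sp] smooth_mult[OF s1 sv]] pd_mult[OF s0 sp] pd_mult[OF s1 sv] a b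
        cov_inner[OF \<psi> \<psi>] cov_inner[OF \<psi> smooth_vol[OF \<psi>]] cov_vol[OF \<psi>] e
      by (simp add: inner_commute[of "cov k \<psi> x"])
  qed
  have sf: "smooth_map (\<lambda>x. N0 x * (\<psi> x \<bullet> \<psi> x) + N1 x * (\<psi> x \<bullet> vol' x (\<psi> x)))"
    by (intro smooth_add smooth_mult s0 s1 sp sv)
  have tt: "(\<Sum>k\<in>UNIV. x $ k * (2 * x $ k * s)) = 2 * (x \<bullet> x) * s" for s by (simp add: inner4 sum4 algebra_simps)
  have "(\<Sum>k\<in>UNIV. pd (\<lambda>x. x $ k * (N0 x * (\<psi> x \<bullet> \<psi> x) + N1 x * (\<psi> x \<bullet> vol' x (\<psi> x)))) k x)
    = (\<Sum>k\<in>(UNIV::4 set). (N0 x * (\<psi> x \<bullet> \<psi> x) + N1 x * (\<psi> x \<bullet> vol' x (\<psi> x)))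
       + (x $ k * (2 * x $ k * (N01f c d (x \<bullet> x) * (\<psi> x \<bullet> \<psi> x) + N11f c d (x \<bullet> x) * (\<psi> x \<bullet> vol' x (\<psi> x))))
       + 2 * (\<psi> x \<bullet> (N0 x *\<^sub>R (x $ k *\<^sub>R cov k \<psi> x) + N1 x *\<^sub>R vol' x (x $ k *\<^sub>R cov k \<psi> x)))))"
    unfolding pd_mult[OF smooth_coord sf] pf
    by (rule sum.cong[OF refl]) (simp add: inner_add_right linear_cmul[OF P.lin_vol4] algebra_simps)
  also have "\<dots> = 4 * (N0 x * (\<psi> x \<bullet> \<psi> x) + N1 x * (\<psi> x \<bullet> vol' x (\<psi> x)))
     + (2 * (x \<bullet> x) * (N01f c d (x \<bullet> x) * (\<psi> x \<bullet> \<psi> x) + N11f c d (x \<bullet> x) * (\<psi> x \<bullet> vol' x (\<psi> x)))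
      + 2 * (\<psi> x \<bullet> (N0 x *\<^sub>R (\<Sum>k\<in>UNIV. x $ k *\<^sub>R cov k \<psi> x) + N1 x *\<^sub>R vol' x (\<Sum>k\<in>UNIV. x $ k *\<^sub>R cov k \<psi> x))))"
    unfolding sum.distrib[of "\<lambda>k. N0 x * (\<psi> x \<bullet> \<psi> x) + N1 x * (\<psi> x \<bullet> vol' x (\<psi> x))"] 
    unfolding sum.distrib[of "\<lambda>k. x $ k * (2 * x $ k * (N01f c d (x \<bullet> x) * (\<psi> x \<bullet> \<psi> x) + N11f c d (x \<bullet> x) * (\<psi> x \<bullet> vol' x (\<psi> x))))"] tt
    by (simp add: inner_add_right inner_sum_right linear_sum[OF P.lin_vol4] scaleR_sum_right sum_distrib_left sum.distrib)
  finally show ?thesis by (simp add: algebra_simps)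
qed

text \<open>All contractions are rewritten in the polar frame, where \<open>Jw\<close> and x are r
  times a unit vector, and \<open>weitzenboeck_pointwise\<close> is applied. The orientation element
  is the same in both frames by \<open>polar_vol4\<close>, and its coefficient vanishes by
  \<open>radial_coefficients\<close>.\<close>

lemma weitzenboeck_divergence:
  assumes \<psi>: "smooth_map \<psi>" and x: "x \<noteq> 0"
  shows "Wf c d (x \<bullet> x) * (\<psi> x \<bullet> \<psi> x) \<le> Lop \<psi> x \<bullet> Lop \<psi> x
     - (\<Sum>k\<in>UNIV. pd (\<lambda>x. \<psi> x \<bullet> gm x k (dirac0 \<psi> x) - \<psi> x \<bullet> cov k \<psi> x) k x)
     - ((\<Sum>k\<in>UNIV. pd (\<lambda>x. hh x * (\<psi> x \<bullet> gm x k (sl' x (Jw x) (covw \<psi> x)))) k x)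
       - (\<Sum>k\<in>UNIV. pd (\<lambda>x. (hh x * Jw x $ k) * (2 * (\<psi> x \<bullet> covw \<psi> x))) k x)
       + (\<Sum>k\<in>UNIV. pd (\<lambda>x. (hh x * Jw x $ k) * (\<psi> x \<bullet> sl' x (Jw x) (dirac0 \<psi> x))) k x))
     + (\<Sum>k\<in>UNIV. pd (\<lambda>x. x $ k * (N0f c d (x \<bullet> x) * (\<psi> x \<bullet> \<psi> x) + N1f c d (x \<bullet> x) * (\<psi> x \<bullet> vol' x (\<psi> x)))) k x)"
proof -
  interpret E: clifford "\<lambda>a. sl' x (polar x a)" by (rule clifford.clifford_sl[OF clifford_gm polar_rows[OF x]])
  define E where "E a = sl' x (polar x a)" for a
  define r where "r = norm x"
  define y where "y a = (\<Sum>l\<in>UNIV. polar x a $ l *\<^sub>R cov l \<psi> x)" for a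
  define t where "t = x \<bullet> x"
  define h h1 q where "h = hh x" and "h1 = H1f c d t" and "q = h\<^sup>2 * t + 2 * h"
  define \<beta> where "\<beta> = V1f c d t / Vf c d t"
  define d0 where "d0 = 4 * (\<beta> + h / 2) + 2 * t * N01f c d t"
  define d1 where "d1 = 4 * (h * kk x * t / 2) + 2 * t * N11f c d t"
  have t0: "t > 0" "t \<ge> 0" using x by (auto simp: t_def)
  have r: "r > 0" "r * r = t" using x by (simp_all add: r_def t_def dot_square_norm power2_eq_square)
  have D: "dirac0 \<psi> x = E 0 (y 0) + E 1 (y 1) + E 2 (y 2) + E 3 (y 3)"
    unfolding dirac0_def P.polar_dirac[OF x] unfolding sum4 E_def y_def ..
  have rx: "x = r *\<^sub>R polar x 0" and rw: "Jw x = r *\<^sub>R polar x 3" using r(1) by (simp_all add: polar_simps r_def)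
  have slx: "sl' x x v = r *\<^sub>R E 0 v" for v
  proof -
    have "sl' x x v = sl' x (r *\<^sub>R polar x 0) v" using rx by simp
    then show ?thesis unfolding P.sl_scaleR_left E_def .
  qed
  have slw: "sl' x (Jw x) v = r *\<^sub>R E 3 v" for v unfolding rw P.sl_scaleR_left E_def ..
  have Y: "covw \<psi> x = r *\<^sub>R y 3" unfolding covw_def rw y_def by (simp add: scaleR_sum_right)
  have nx: "(\<Sum>k\<in>UNIV. x $ k *\<^sub>R cov k \<psi> x) = r *\<^sub>R y 0"
  proof -
    have "x $ k = r * polar x 0 $ k" for k using arg_cong[OF rx, of "\<lambda>v. v $ k"] by simp
    then show ?thesis unfolding y_def by (simp add: scaleR_sum_right)
  qed
  have N: "(\<Sum>k\<in>UNIV. cov k \<psi> x \<bullet> cov k \<psi> x) = y 0 \<bullet> y 0 + y 1 \<bullet> y 1 + y 2 \<bullet> y 2 + y 3 \<bullet> y 3"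
    unfolding P.polar_norm[OF x, where y = "\<lambda>k. cov k \<psi> x"] unfolding sum4 y_def ..
  have J: "dJ \<psi> x = E 0 (y 3) - E 3 (y 0) - E 1 (y 2) + E 2 (y 1)"
    unfolding dJ_def P.polar_J_sum[OF x, where y = "\<lambda>l. cov l \<psi> x"] E_def y_def ..
  have A: "(\<Sum>k\<in>UNIV. gm x k (sl' x (Jw (axis k 1)) v)) = - 2 *\<^sub>R (E 3 (E 0 v) + E 1 (E 2 v))" for v
    unfolding P.polar_J_clifford[OF x] E_def[symmetric]
    using E.g_order[of v] unfolding E_def[symmetric] by (simp add: scaleR_2 algebra_simps)
  have vol: "E.vol4 v = vol' x v" for v by (rule P.polar_vol4[OF x])
  have lin: "linear (E a)" for a unfolding E_def by (rule P.lin_sl)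
  \<comment> \<open>The values of the zero-order coefficients: \<open>Wf\<close> for the norm
    squared, and 0 for the term with the orientation element.\<close>
  have rc: "h\<^sup>2 * t * (1 + (kk x)\<^sup>2 * t\<^sup>2) / 4 - (kk x)\<^sup>2 * t / 2 - t / (4 * (Vf c d t)\<^sup>2) * ((q + h + 2 * t * h1)\<^sup>2 + q\<^sup>2) - t * \<beta>\<^sup>2 + d0 = Wf c d t"
    "h\<^sup>2 * t * kk x * t / 2 - t / (4 * (Vf c d t)\<^sup>2) * (2 * (q + h + 2 * t * h1) * q) + d1 = 0"
    using radial_coefficients[OF t0(1) V_pos[OF t0(2)] V_sq[OF t0(2)] V1_eq[OF t0(2)] H_eq[OF t0(2)] H1_eq[OF t0(2)] K_eq[OF t0(2)] K1_eq[OF t0(2)]]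
    unfolding q_def d0_def d1_def h_def h1_def \<beta>_def N01f_def N11f_def Wf_def t_def[symmetric] V_sq[OF t0(2)]
      Uf_def power4_eq_xxxx power2_eq_square by (simp_all add: mult.assoc V_sq[OF t0(2), unfolded power2_eq_square])
  have M: "zo x (\<psi> x) = - (h * r / 2) *\<^sub>R E 0 (\<psi> x + (kk x * t) *\<^sub>R E.vol4 (\<psi> x))"
    unfolding zo_def slx vol t_def h_def by simp
  have ineq: "Wf c d t * (\<psi> x \<bullet> \<psi> x) + 0 * (\<psi> x \<bullet> E.vol4 (\<psi> x)) \<le>
     (y 0 \<bullet> y 0 + y 1 \<bullet> y 1 + y 2 \<bullet> y 2 + y 3 \<bullet> y 3) + q * t * (y 3 \<bullet> y 3)
     - \<psi> x \<bullet> ((2 * h1 * t * r) *\<^sub>R E 0 (E 3 (y 3)) - (2 * h * r) *\<^sub>R (E 3 (E 0 (y 3)) + E 1 (E 2 (y 3)))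
           + (h * r) *\<^sub>R E 3 (E 3 (y 0) - E 0 (y 3) - E 2 (y 1) + E 1 (y 2)) - (h * r) *\<^sub>R E 0 (dirac0 \<psi> x))
     + 2 * (zo x (\<psi> x) \<bullet> (dirac0 \<psi> x + (h * t) *\<^sub>R E 3 (y 3))) + zo x (\<psi> x) \<bullet> zo x (\<psi> x)
     + (d0 * (\<psi> x \<bullet> \<psi> x) + d1 * (\<psi> x \<bullet> E.vol4 (\<psi> x)) + 2 * r * (\<psi> x \<bullet> (N0f c d t *\<^sub>R y 0 + N1f c d t *\<^sub>R E.vol4 (y 0))))"
    unfolding E_def
  proof (rule E.weitzenboeck_pointwise[where v = "Vf c d t" and \<kappa> = "kk x" and \<beta> = \<beta>])
    show "r * r = t" by (rule r(2))
    show "Vf c d t = 1 + h * t" using H_eq[OF t0(2)] by (simp add: h_def t_def)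
    show "Vf c d t > 0" by (rule V_pos[OF t0(2)])
    show "kk x * Vf c d t = h" using K_eq[OF t0(2)] by (simp add: h_def t_def)
    show "q = h\<^sup>2 * t + 2 * h" by (rule q_def)
    show "N0f c d t = \<beta> + h / 2" by (simp add: N0f_def \<beta>_def h_def t_def)
    show "N1f c d t = h * kk x * t / 2" by (simp add: N1f_def h_def t_def)
    show "zo x (\<psi> x) = - (h * r / 2) *\<^sub>R sl' x (polar x 0) (\<psi> x + (kk x * t) *\<^sub>R E.vol4 (\<psi> x))" using M unfolding E_def .
    show "dirac0 \<psi> x = sl' x (polar x 0) (y 0) + sl' x (polar x 1) (y 1) + sl' x (polar x 2) (y 2) + sl' x (polar x 3) (y 3)" using D unfolding E_def .
    show "Wf c d t = h\<^sup>2 * t * (1 + (kk x)\<^sup>2 * t\<^sup>2) / 4 - (kk x)\<^sup>2 * t / 2 - t / (4 * (Vf c d t)\<^sup>2) * ((q + h + 2 * t * h1)\<^sup>2 + q\<^sup>2) - t * \<beta>\<^sup>2 + d0"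
      using rc(1) by simp
    show "0 = h\<^sup>2 * t * kk x * t / 2 - t / (4 * (Vf c d t)\<^sup>2) * (2 * (q + h + 2 * t * h1) * q) + d1"
      using rc(2) by simp
  qed
  have EE: "E a v \<bullet> E a w = v \<bullet> w" for a v w unfolding E_def E.sym_g E.g_sq ..
  have L: "Lop \<psi> x = dirac0 \<psi> x + (h * t) *\<^sub>R E 3 (y 3) + zo x (\<psi> x)"
    unfolding Lop_def slw Y linear_cmul[OF lin] h_def r(2)[symmetric] by (simp add: mult.assoc)
  have hx: "hh x = h" and h1x: "H1f c d (x \<bullet> x) = h1" by (simp_all add: h_def h1_def t_def)
  have mixed: "2 * hh x * (dirac0 \<psi> x \<bullet> sl' x (Jw x) (covw \<psi> x)) - 2 * hh x * (covw \<psi> x \<bullet> covw \<psi> x)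
     + \<psi> x \<bullet> ((2 * H1f c d (x \<bullet> x)) *\<^sub>R sl' x x (sl' x (Jw x) (covw \<psi> x))
       + hh x *\<^sub>R (\<Sum>k\<in>UNIV. gm x k (sl' x (Jw (axis k 1)) (covw \<psi> x)))
       - hh x *\<^sub>R sl' x (Jw x) (dJ \<psi> x) - hh x *\<^sub>R sl' x x (dirac0 \<psi> x))
    = 2 * h * t * (dirac0 \<psi> x \<bullet> E 3 (y 3)) - 2 * h * t * (y 3 \<bullet> y 3)
     + \<psi> x \<bullet> ((2 * h1 * t * r) *\<^sub>R E 0 (E 3 (y 3)) - (2 * h * r) *\<^sub>R (E 3 (E 0 (y 3)) + E 1 (E 2 (y 3)))
           + (h * r) *\<^sub>R E 3 (E 3 (y 0) - E 0 (y 3) - E 2 (y 1) + E 1 (y 2)) - (h * r) *\<^sub>R E 0 (dirac0 \<psi> x))"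
    unfolding A slx slw J Y hx h1x r(2)[symmetric]
    by (simp add: linear_cmul[OF lin] linear_add[OF lin] linear_diff[OF lin] inner_add_right inner_diff_right algebra_simps)
  have LL: "Lop \<psi> x \<bullet> Lop \<psi> x = dirac0 \<psi> x \<bullet> dirac0 \<psi> x + 2 * h * t * (dirac0 \<psi> x \<bullet> E 3 (y 3)) + (h * t)\<^sup>2 * (y 3 \<bullet> y 3)
     + 2 * (zo x (\<psi> x) \<bullet> (dirac0 \<psi> x + (h * t) *\<^sub>R E 3 (y 3))) + zo x (\<psi> x) \<bullet> zo x (\<psi> x)"
  proof -
    have gen: "(a + s *\<^sub>R b + m) \<bullet> (a + s *\<^sub>R b + m) = a \<bullet> a + 2 * s * (a \<bullet> b) + s\<^sup>2 * (b \<bullet> b) + 2 * (m \<bullet> (a + s *\<^sub>R b)) + m \<bullet> m"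
      for a b m :: 'v and s :: real
      by (simp add: inner_add_left inner_add_right inner_commute[of b a] inner_commute[of a m] inner_commute[of b m] power2_eq_square algebra_simps)
    show ?thesis unfolding L gen EE by simp
  qed
  have nr: "2 * (\<psi> x \<bullet> (N0f c d (x \<bullet> x) *\<^sub>R (r *\<^sub>R y 0) + N1f c d (x \<bullet> x) *\<^sub>R vol' x (r *\<^sub>R y 0)))
     = 2 * r * (\<psi> x \<bullet> (N0f c d t *\<^sub>R y 0 + N1f c d t *\<^sub>R vol' x (y 0)))"
    unfolding linear_cmul[OF P.lin_vol4] t_def by (simp add: inner_add_right algebra_simps)
  have e0: "4 * N0f c d (x \<bullet> x) + 2 * (x \<bullet> x) * N01f c d (x \<bullet> x) = d0"
    by (simp add: d0_def N0f_def \<beta>_def h_def t_def)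
  have e1: "4 * N1f c d (x \<bullet> x) + 2 * (x \<bullet> x) * N11f c d (x \<bullet> x) = d1"
    by (simp add: d1_def N1f_def h_def t_def)
  have qt: "q * t * (y 3 \<bullet> y 3) = (h * t)\<^sup>2 * (y 3 \<bullet> y 3) + 2 * h * t * (y 3 \<bullet> y 3)"
    by (simp add: q_def power2_eq_square algebra_simps)
  show ?thesis
    unfolding div_laplace[OF \<psi>] div_mixed[OF \<psi>] div_radial[OF \<psi>] mixed nx nr e0 e1 LL N
    using ineq unfolding vol qt t_def[symmetric] by linarith
qed

end

section \<open>Coercivity by integration of the Weitzenboeck inequality\<close>

lemma integrable_div:
  assumes "\<And>k::4. smooth_map (F k)" "\<And>k. bsupp (F k :: real^4 \<Rightarrow> real)"
  shows "integrable lborel (\<lambda>x. \<Sum>k\<in>UNIV. pd (F k) k x)" "(\<integral>x. (\<Sum>k\<in>UNIV. pd (F k) k x) \<partial>lborel) = 0"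
proof -
  have i: "integrable lborel (pd (F k) k)" for k
    by (rule integrable_cont_bsupp[OF smooth_cont[OF smooth_pd[OF assms(1)]] bsupp_pd[OF assms(2)]])
  show "integrable lborel (\<lambda>x. \<Sum>k\<in>UNIV. pd (F k) k x)"
    by (rule Bochner_Integration.integrable_sum) (rule i)
  have "(\<integral>x. (\<Sum>k\<in>UNIV. pd (F k) k x) \<partial>lborel) = (\<Sum>k\<in>UNIV. (\<integral>x. pd (F k) k x \<partial>lborel))"
    by (rule Bochner_Integration.integral_sum) (rule i)
  then show "(\<integral>x. (\<Sum>k\<in>UNIV. pd (F k) k x) \<partial>lborel) = 0"
    by (simp add: integral_pd_zero[OF assms])
qed

context berger_dirac
begin

text \<open>The five families of fields in the pointwise inequality are smooth and of bounded
  support, so their divergences integrate to zero and leave the weighted inequality.\<close>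

lemma Lop_coercive:
  assumes \<psi>: "smooth_map \<psi>" "bsupp \<psi>"
  shows "(\<integral>\<^sup>+x. ennreal (Wf c d (x \<bullet> x) * (norm (\<psi> x))\<^sup>2) \<partial>lborel) \<le> N2 (Lop \<psi>)"
proof -
  obtain R where R: "\<And>x. norm x > R \<Longrightarrow> \<psi> x = 0" using \<psi>(2) unfolding bsupp_def by blast
  have z: "cov k \<psi> x = 0" "dirac0 \<psi> x = 0" "covw \<psi> x = 0" "Lop \<psi> x = 0" if "norm x > R" for x k
  proof -
    show a: "cov k \<psi> x = 0" for k by (rule cov_outside[OF R that])
    show b: "dirac0 \<psi> x = 0" unfolding dirac0_def a by (simp add: linear_0[OF lin_gm])
    show e: "covw \<psi> x = 0" unfolding covw_def a by simp
    show "Lop \<psi> x = 0" unfolding Lop_def zo_def b e R[OF that] by (simp add: linear_0[OF P.lin_sl] linear_0[OF P.lin_vol4])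
  qed
  note sm = smooth_dirac0[OF \<psi>(1)] smooth_covw[OF \<psi>(1)] smooth_cov[OF \<psi>(1)]
  define F1 where "F1 k x = \<psi> x \<bullet> gm x k (dirac0 \<psi> x) - \<psi> x \<bullet> cov k \<psi> x" for k x
  define F2 where "F2 k x = hh x * (\<psi> x \<bullet> gm x k (sl' x (Jw x) (covw \<psi> x)))" for k x
  define F3 where "F3 k x = (hh x * Jw x $ k) * (2 * (\<psi> x \<bullet> covw \<psi> x))" for k x
  define F4 where "F4 k x = (hh x * Jw x $ k) * (\<psi> x \<bullet> sl' x (Jw x) (dirac0 \<psi> x))" for k x
  define F5 where "F5 k x = x $ k * (N0f c d (x \<bullet> x) * (\<psi> x \<bullet> \<psi> x) + N1f c d (x \<bullet> x) * (\<psi> x \<bullet> vol' x (\<psi> x)))" for k and x :: "real^4"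
  have s: "smooth_map (F1 k)" "smooth_map (F2 k)" "smooth_map (F3 k)" "smooth_map (F4 k)" "smooth_map (F5 k)" for k
    unfolding F1_def[abs_def] F2_def[abs_def] F3_def[abs_def] F4_def[abs_def] F5_def[abs_def]
    by (intro smooth_diff smooth_add smooth_mult smooth_inner smooth_gm smooth_sl smooth_Jw smooth_Jw_k smooth_H smooth_N0 smooth_N1
        smooth_vol smooth_const smooth_coord sm \<psi>(1))+
  have b: "bsupp (F1 k)" "bsupp (F2 k)" "bsupp (F3 k)" "bsupp (F4 k)" "bsupp (F5 k)" for k
    by (rule bsuppI[of R], simp add: F1_def F2_def F3_def F4_def F5_def R)+
  note d1 = integrable_div[of F1, OF s(1) b(1)] and d2 = integrable_div[of F2, OF s(2) b(2)] and d3 = integrable_div[of F3, OF s(3) b(3)]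
    and d4 = integrable_div[of F4, OF s(4) b(4)] and d5 = integrable_div[of F5, OF s(5) b(5)]
  define T where "T x = - (\<Sum>k\<in>UNIV. pd (F1 k) k x) - ((\<Sum>k\<in>UNIV. pd (F2 k) k x) - (\<Sum>k\<in>UNIV. pd (F3 k) k x) + (\<Sum>k\<in>UNIV. pd (F4 k) k x))
     + (\<Sum>k\<in>UNIV. pd (F5 k) k x)" for x
  have Ti: "integrable lborel T" "(\<integral>x. T x \<partial>lborel) = 0"
  proof -
    have "has_bochner_integral lborel T (- 0 - (0 - 0 + 0) + 0)"
      unfolding T_def[abs_def]
      by (intro has_bochner_integral_add has_bochner_integral_diff has_bochner_integral_minus)
        (simp_all add: has_bochner_integral_iff d1 d2 d3 d4 d5)
    then show "integrable lborel T" "(\<integral>x. T x \<partial>lborel) = 0" by (simp_all add: has_bochner_integral_iff)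
  qed
  have sL: "smooth_map (\<lambda>x. Lop \<psi> x \<bullet> Lop \<psi> x)" by (intro smooth_inner smooth_Lop \<psi>(1))
  have Li: "integrable lborel (\<lambda>x. Lop \<psi> x \<bullet> Lop \<psi> x)"
    by (rule integrable_cont_bsupp[OF smooth_cont[OF sL] bsuppI[of R]]) (simp add: z)
  have sW: "smooth_map (\<lambda>x. Wf c d (x \<bullet> x) * (\<psi> x \<bullet> \<psi> x))" by (intro smooth_mult smooth_W smooth_inner \<psi>(1))
  have Wi: "integrable lborel (\<lambda>x. Wf c d (x \<bullet> x) * (\<psi> x \<bullet> \<psi> x))"
    by (rule integrable_cont_bsupp[OF smooth_cont[OF sW] bsuppI[of R]]) (simp add: R)
  have m1: "(\<integral>x. Wf c d (x \<bullet> x) * (\<psi> x \<bullet> \<psi> x) \<partial>lborel) \<le> (\<integral>x. Lop \<psi> x \<bullet> Lop \<psi> x + T x \<partial>lborel)"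
  proof (rule integral_mono_AE[OF Wi Bochner_Integration.integrable_add[OF Li Ti(1)]])
    have "AE x in lborel. x \<noteq> (0::real^4)" by (rule AE_lborel_singleton)
    then show "AE x in lborel. Wf c d (x \<bullet> x) * (\<psi> x \<bullet> \<psi> x) \<le> Lop \<psi> x \<bullet> Lop \<psi> x + T x"
    proof eventually_elim
      case (elim x)
      from weitzenboeck_divergence[OF \<psi>(1) elim]
      show ?case unfolding T_def F1_def[abs_def] F2_def[abs_def] F3_def[abs_def] F4_def[abs_def] F5_def[abs_def] by linarith
    qed
  qed
  have m2: "(\<integral>x. Lop \<psi> x \<bullet> Lop \<psi> x + T x \<partial>lborel) = (\<integral>x. Lop \<psi> x \<bullet> Lop \<psi> x \<partial>lborel)"
    unfolding Bochner_Integration.integral_add[OF Li Ti(1)] Ti(2) by (rule add_0_right)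
  note main = m1[unfolded m2]
  have l: "(\<integral>\<^sup>+x. ennreal (Wf c d (x \<bullet> x) * (\<psi> x \<bullet> \<psi> x)) \<partial>lborel) = ennreal (\<integral>x. Wf c d (x \<bullet> x) * (\<psi> x \<bullet> \<psi> x) \<partial>lborel)"
    by (rule nn_integral_eq_integral[OF Wi]) (rule AE_I2, intro mult_nonneg_nonneg inner_ge_zero less_imp_le[OF W_pos])
  have r: "(\<integral>\<^sup>+x. ennreal (Lop \<psi> x \<bullet> Lop \<psi> x) \<partial>lborel) = ennreal (\<integral>x. Lop \<psi> x \<bullet> Lop \<psi> x \<partial>lborel)"
    by (rule nn_integral_eq_integral[OF Li]) (rule AE_I2, rule inner_ge_zero)
  show ?thesis
    unfolding N2_def power2_norm_eq_inner l r by (rule ennreal_leI[OF main])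
qed

section \<open>Cutoff functions and the vanishing of weak L2 solutions\<close>

definition symb :: "4 \<Rightarrow> real^4 \<Rightarrow> 'v \<Rightarrow> 'v" where
  "symb k x v = gm x k v + (hh x * Jw x $ k) *\<^sub>R sl' x (Jw x) v"

text \<open>\<open>symmetric_first_order\<close> is phrased with plain partial derivatives, so the
  connection terms of \<open>cov\<close> are moved into the zero-order part.\<close>

definition zord :: "real^4 \<Rightarrow> 'v \<Rightarrow> 'v" where
  "zord x v = zo x v - (\<Sum>k\<in>UNIV. symb k x ((1/4) *\<^sub>R biv (Om k x) v))"

lemma lin_symb: "linear (symb k x)"
  unfolding symb_def by (intro linear_compose_add lin_gm linear_compose_scale_right P.lin_sl)

lemma lin_zo: "linear (zo x)"
proof (rule linearI)
  show "zo x (v + w) = zo x v + zo x w" for v w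
    by (simp add: zo_def linear_add[OF P.lin_sl] linear_add[OF P.lin_vol4] linear_cmul[OF P.lin_sl] algebra_simps)
  show "zo x (s *\<^sub>R v) = s *\<^sub>R zo x v" for s v
    by (simp add: zo_def linear_add[OF P.lin_sl] linear_cmul[OF P.lin_vol4] linear_cmul[OF P.lin_sl] algebra_simps)
qed

lemma lin_zord: "linear (zord x)"
proof (rule linearI)
  show "zord x (v + w) = zord x v + zord x w" for v w
    by (simp add: zord_def linear_add[OF lin_zo] linear_add[OF lin_biv] linear_add[OF lin_symb] scaleR_add_right sum.distrib algebra_simps)
  show "zord x (s *\<^sub>R v) = s *\<^sub>R zord x v" for s v
    by (simp add: zord_def linear_cmul[OF lin_zo] linear_cmul[OF lin_biv] linear_cmul[OF lin_symb] scaleR_diff_right scaleR_sum_right mult.commute)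
qed

lemma smooth_symb: "smooth_map \<phi> \<Longrightarrow> smooth_map (\<lambda>x. symb k x (\<phi> x))"
  unfolding symb_def by (intro smooth_add smooth_gm smooth_scaleR smooth_mult smooth_H smooth_Jw_k smooth_sl smooth_Jw)

lemma symb_sym: "symb k x v \<bullet> w = v \<bullet> symb k x w"
  unfolding symb_def by (simp add: inner_add_left inner_add_right gm_sym P.sl_sym)

sublocale S: symmetric_first_order symb zord
proof (rule symmetric_first_order.intro)
  show "linear (symb k x)" for k x by (rule lin_symb)
  show "linear (zord x)" for x by (rule lin_zord)
  show "smooth_map (\<lambda>x. symb k x v)" for k v by (rule smooth_symb[OF smooth_const])
  show "smooth_map (\<lambda>x. zord x v)" for v
    unfolding zord_def by (intro smooth_diff smooth_zo smooth_const smooth_sum smooth_symb smooth_scaleR smooth_biv_Om)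
  show "symb k x v \<bullet> w = v \<bullet> symb k x w" for k x v w by (rule symb_sym)
qed

lemma dop_eq: "S.dop = Lop"
proof (intro ext)
  fix \<psi> x
  have "S.dop \<psi> x = (\<Sum>k\<in>UNIV. symb k x (cov k \<psi> x)) + zo x (\<psi> x)"
    unfolding S.dop_def zord_def cov_def by (simp add: linear_diff[OF lin_symb] sum_subtractf)
  also have "(\<Sum>k\<in>UNIV. symb k x (cov k \<psi> x)) = dirac0 \<psi> x + hh x *\<^sub>R sl' x (Jw x) (covw \<psi> x)"
    unfolding symb_def dirac0_def covw_def by (simp add: sum.distrib linear_sum[OF P.lin_sl] linear_cmul[OF P.lin_sl] scaleR_sum_right)
  finally show "S.dop \<psi> x = Lop \<psi> x" by (simp add: Lop_def)
qed

lemma Lop_formally_skew: "S.formally_skew"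
  unfolding S.formally_skew_def dop_eq
proof (intro allI impI)
  fix \<phi> \<psi> :: "real^4 \<Rightarrow> 'v"
  assume \<phi>: "smooth_map \<phi>" "bsupp \<phi>" and \<psi>: "smooth_map \<psi>" "bsupp \<psi>"
  define F where "F k x = \<phi> x \<bullet> gm x k (\<psi> x) + (hh x * Jw x $ k) * (\<phi> x \<bullet> sl' x (Jw x) (\<psi> x))" for k x
  have s: "smooth_map (F k)" for k
    unfolding F_def[abs_def] by (intro smooth_add smooth_mult smooth_inner smooth_gm smooth_sl smooth_Jw smooth_Jw_k smooth_H \<phi> \<psi>)
  have b: "bsupp (F k)" for k
    by (rule bsupp_mono[OF \<phi>(2)]) (simp add: F_def)
  have i1: "integrable lborel (\<lambda>x. Lop \<phi> x \<bullet> \<psi> x)"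
    by (rule integrable_cont_bsupp[OF smooth_cont[OF smooth_inner[OF smooth_Lop[OF \<phi>(1)] \<psi>(1)]] bsupp_mono[OF \<psi>(2)]]) simp
  have i2: "integrable lborel (\<lambda>x. \<phi> x \<bullet> Lop \<psi> x)"
    by (rule integrable_cont_bsupp[OF smooth_cont[OF smooth_inner[OF \<phi>(1) smooth_Lop[OF \<psi>(1)]]] bsupp_mono[OF \<phi>(2)]]) simp
  have "0 = (\<integral>x. Lop \<phi> x \<bullet> \<psi> x + \<phi> x \<bullet> Lop \<psi> x \<partial>lborel)"
    using integrable_div(2)[of F, OF s b] unfolding F_def[abs_def] Lop_skew_pointwise[OF \<phi>(1) \<psi>(1)] by simp
  also have "\<dots> = (\<integral>x. Lop \<phi> x \<bullet> \<psi> x \<partial>lborel) + (\<integral>x. \<phi> x \<bullet> Lop \<psi> x \<partial>lborel)"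
    by (rule Bochner_Integration.integral_add[OF i1 i2])
  finally show "(\<integral>x. \<phi> x \<bullet> Lop \<psi> x \<partial>lborel) = (\<integral>x. - Lop \<phi> x \<bullet> \<psi> x \<partial>lborel)"
    by simp
qed

lemma dop_cutoff:
  assumes \<rho>: "smooth_map \<rho>" and \<psi>: "smooth_map \<psi>"
  shows "Lop (\<lambda>x. \<rho> x *\<^sub>R \<psi> x) x = \<rho> x *\<^sub>R Lop \<psi> x + (\<Sum>k\<in>UNIV. pd \<rho> k x *\<^sub>R symb k x (\<psi> x))"
  unfolding dop_eq[symmetric] S.dop_def pd_scaleR[OF \<rho> \<psi>]
  by (simp add: linear_add[OF lin_symb] linear_cmul[OF lin_symb] linear_cmul[OF lin_zord] sum.distrib scaleR_sum_right algebra_simps)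

lemma flat_exp_bound: "\<exists>C\<ge>0. \<forall>t\<le>1. \<bar>flat_exp 1 t\<bar> \<le> C"
proof -
  have "continuous_on {0..1} (flat_exp 1)"
    using flat_exp_deriv by (intro continuous_at_imp_continuous_on ballI DERIV_isCont)
  then have "bounded (flat_exp 1 ` {0..1})" by (intro compact_imp_bounded compact_continuous_image) auto
  then obtain C where C: "\<And>y. y \<in> flat_exp 1 ` {0..1} \<Longrightarrow> norm y \<le> C" unfolding bounded_iff by blast
  have "\<bar>flat_exp 1 t\<bar> \<le> max C 0" if "t \<le> 1" for t
    using C[of "flat_exp 1 t"] that by (cases "t > 0") (auto simp: flat_exp_def le_max_iff_disj)
  then show ?thesis by (intro exI[of _ "max C 0"]) simp
qed

lemma sl_norm: "(norm (sl' x u v))\<^sup>2 = (u \<bullet> u) * (norm v)\<^sup>2"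
  unfolding dot_square_norm[symmetric] P.sl_sym by (simp add: P.sl_sq)


lemma integrable_inner_L2:
  assumes \<phi>: "\<phi> \<in> borel_measurable borel" "N2 \<phi> < \<infinity>" and f: "smooth_map f" "bsupp f"
  shows "integrable lborel (\<lambda>x. \<phi> x \<bullet> (f x :: 'v))"
proof -
  obtain R where R: "\<And>x. norm x > R \<Longrightarrow> f x = 0" using f(2) unfolding bsupp_def by blast
  define \<phi>R where "\<phi>R x = indicator (cball 0 R) x *\<^sub>R \<phi> x" for x
  have m: "\<phi>R \<in> borel_measurable borel"
    unfolding \<phi>R_def[abs_def] by (intro borel_measurable_scaleR borel_measurable_indicator \<phi>(1)) simp
  have "N2 \<phi>R \<le> N2 \<phi>" unfolding N2_def \<phi>R_def by (intro nn_integral_mono ennreal_leI) (simp add: indicator_def)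
  then have "integrable lborel \<phi>R"
    by (intro integrable_L2_bsupp[OF m, of R]) (use \<phi>(2) in \<open>auto simp: \<phi>R_def\<close>)
  then have "integrable lborel (\<lambda>x. \<phi>R x \<bullet> f x)" by (rule S.integrable_inner_cont[OF _ smooth_cont[OF f(1)] f(2)])
  moreover have "\<phi>R x \<bullet> f x = \<phi> x \<bullet> f x" for x
    using R[of x] by (cases "norm x > R") (simp_all add: \<phi>R_def indicator_def)
  ultimately show ?thesis by simp
qed

text \<open>The Hopf part of the symbol pairs the covector with \<open>Jw x\<close>, which is
  orthogonal to x. Radial gradients are therefore measured by g_0 as in flat space, the form of
  completeness that the cutoff argument uses.\<close>

lemma radial_symb: "(\<Sum>k\<in>UNIV. (x $ k * s) *\<^sub>R symb k x v) = s *\<^sub>R sl' x x v"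
proof -
  have "(\<Sum>k\<in>UNIV. (x $ k * s) *\<^sub>R symb k x v) = s *\<^sub>R (sl' x x v + (hh x * (x \<bullet> Jw x)) *\<^sub>R sl' x (Jw x) v)"
    unfolding symb_def P.sl_def[of x x] inner_vec_def sum_distrib_left scaleR_sum_left
    by (simp add: scaleR_sum_right scaleR_add_right sum.distrib mult_ac)
  then show ?thesis by (simp add: Jw_inner)
qed

text \<open>Cutting \<phi> off at radius n produces a weak solution of \<open>Lop u\<close> = - g,
  where g contains only the gradient of the cutoff, of size O(1 / n) relative to \<phi>. Coercivity
  for weak solutions bounds the weighted square norm of u by O(1 / n^2); as n grows, \<phi> vanishes
  on every fixed ball because the weight is positive.\<close>

theorem weak_kernel_trivial:
  assumes \<phi>: "\<phi> \<in> borel_measurable borel" "N2 \<phi> < \<infinity>"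
    and weak: "\<And>\<psi>. smooth_map \<psi> \<Longrightarrow> bsupp \<psi> \<Longrightarrow> (\<integral>x. \<phi> x \<bullet> Lop \<psi> x \<partial>lborel) = 0"
  shows "AE x in lborel. \<phi> x = 0"
proof -
  obtain C where C: "C > 0" "\<forall>\<epsilon>>0. \<exists>m. moll C \<epsilon> m" using mollifiers_exist by (auto simp only:)
  obtain B where B: "B \<ge> 0" "\<forall>t\<le>1. \<bar>flat_exp 1 t\<bar> \<le> B" using flat_exp_bound by blast
  define W where "W x = Wf c d (x \<bullet> x)" for x :: "real^4"
  have Wc: "continuous_on UNIV W" unfolding W_def[abs_def] by (rule smooth_cont[OF smooth_W])
  have W0: "W x > 0" for x unfolding W_def by (rule W_pos) simp
  have Wm[measurable]: "W \<in> borel_measurable borel" by (rule borel_measurable_continuous_onI[OF Wc])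
  note \<phi>(1)[measurable]
  \<comment> \<open>The constant of \<open>friedrichs_estimate\<close> times the factor 4 B^2 from
    the squared gradient of the cutoff.\<close>
  define K where "K = 4 * (C * unit_ball_vol 4)\<^sup>2 * (4 * B\<^sup>2)"
  have K0: "K \<ge> 0" by (simp add: K_def)
  have est: "(\<integral>\<^sup>+x. ennreal (W x * (norm (bump ((1/n) *\<^sub>R x) *\<^sub>R \<phi> x))\<^sup>2) \<partial>lborel) \<le> ennreal (K / n\<^sup>2) * N2 \<phi>"
    if n: "n > 0" for n :: real
  proof -
    define \<rho> where "\<rho> x = bump ((1/n) *\<^sub>R x)" for x
    have s\<rho>: "smooth_map \<rho>" unfolding \<rho>_def by (rule smooth_bump_scaled)
    have \<rho>0: "\<rho> x = 0" if "norm x > n" for x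
      unfolding \<rho>_def by (rule bump_zero) (use that n in simp)
    have \<rho>b: "bsupp \<rho>" by (rule bsuppI[OF \<rho>0])
    have \<rho>1: "\<bar>\<rho> x\<bar> \<le> 1" for x by (simp add: \<rho>_def bump_def flat_exp_0)
    have pd\<rho>: "pd \<rho> k x = x $ k * (- (2 / n\<^sup>2) * flat_exp 1 (1 - (x \<bullet> x) / n\<^sup>2))" for k x
    proof -
      have r: "\<rho> = (\<lambda>x. flat_exp 0 (1 - (x \<bullet> x) / n\<^sup>2))"
        by (rule ext) (use n in \<open>simp add: \<rho>_def bump_def power2_eq_square\<close>)
      have "((\<lambda>t. flat_exp 0 (1 - t / n\<^sup>2)) has_real_derivative flat_exp 1 (1 - t / n\<^sup>2) * (- (1 / n\<^sup>2))) (at t)" for t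
      proof (rule DERIV_chain2[where f = "flat_exp 0"])
        show "(flat_exp 0 has_real_derivative flat_exp 1 (1 - t / n\<^sup>2)) (at (1 - t / n\<^sup>2))" using flat_exp_deriv[of 0] by simp
        show "((\<lambda>t. 1 - t / n\<^sup>2) has_real_derivative - (1 / n\<^sup>2)) (at t)"
          using DERIV_diff[OF DERIV_const[of 1] DERIV_cdivide[OF DERIV_ident, of "n\<^sup>2"]] by simp
      qed
      then show ?thesis unfolding r using pd_radial[of "\<lambda>t. flat_exp 0 (1 - t / n\<^sup>2)" "\<lambda>t. flat_exp 1 (1 - t / n\<^sup>2) * (- (1 / n\<^sup>2))" k x] by simp
    qed
    define a where "a x = - (2 / n\<^sup>2) * flat_exp 1 (1 - (x \<bullet> x) / n\<^sup>2)" for x :: "real^4"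
    have sumsymb: "(\<Sum>k\<in>UNIV. pd \<rho> k x *\<^sub>R symb k x v) = a x *\<^sub>R sl' x x v" for x v
      unfolding pd\<rho> a_def[symmetric] by (rule radial_symb)
    define u where "u x = \<rho> x *\<^sub>R \<phi> x" for x
    \<comment> \<open>The minus sign results from testing: the cutoff moves from \<open>Lop\<close>
      of \<psi> to \<phi>, and its gradient term changes sides by symmetry of Clifford
      multiplication.\<close>
    define g where "g x = - (a x *\<^sub>R sl' x x (\<phi> x))" for x
    have am: "a \<in> borel_measurable borel"
    proof -
      have "continuous_on UNIV (flat_exp 1)"
        using flat_exp_deriv by (intro continuous_at_imp_continuous_on ballI DERIV_isCont)
      then have "continuous_on UNIV (\<lambda>x::real^4. flat_exp 1 (1 - (x \<bullet> x) / n\<^sup>2))"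
        by (rule continuous_on_compose2) (use n in \<open>auto intro!: continuous_intros\<close>)
      then have "continuous_on UNIV a" unfolding a_def[abs_def] by (intro continuous_on_mult continuous_on_const)
      then show ?thesis by (rule borel_measurable_continuous_onI)
    qed
    have um: "u \<in> borel_measurable borel" unfolding u_def[abs_def] using borel_smooth[OF s\<rho>] by measurable
    have gm': "g \<in> borel_measurable borel"
    proof -
      have "(\<lambda>x. sl' x x (\<phi> x)) \<in> borel_measurable borel"
      proof -
        have "sl' x x (\<phi> x) = (\<Sum>b\<in>Basis. (\<phi> x \<bullet> b) *\<^sub>R sl' x x b)" for x
        proof -
          have "sl' x x (\<phi> x) = sl' x x (\<Sum>b\<in>Basis. (\<phi> x \<bullet> b) *\<^sub>R b)" by (simp add: euclidean_representation)
          also have "\<dots> = (\<Sum>b\<in>Basis. (\<phi> x \<bullet> b) *\<^sub>R sl' x x b)" by (simp add: linear_sum[OF P.lin_sl] linear_cmul[OF P.lin_sl])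
          finally show ?thesis .
        qed
        moreover have "(\<lambda>x. sl' x x b) \<in> borel_measurable borel" for b by (rule borel_smooth[OF smooth_sl[OF smooth_id smooth_const]])
        ultimately show ?thesis by simp
      qed
      then show ?thesis unfolding g_def[abs_def] using am by measurable
    qed
    have a0: "a x = 0" if "norm x > n" for x
    proof -
      have "n\<^sup>2 \<le> (norm x)\<^sup>2" using that n by (intro power_mono) auto
      then have "1 - (x \<bullet> x) / n\<^sup>2 \<le> 0" using n by (simp add: dot_square_norm)
      then show ?thesis by (simp add: a_def flat_exp_def)
    qed
    have gle: "(norm (g x))\<^sup>2 \<le> (4 * B\<^sup>2 / n\<^sup>2) * (norm (\<phi> x))\<^sup>2" for x
    proof (cases "norm x > n")
      case True
      then show ?thesis using a0[OF True] by (simp add: g_def)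
    next
      case False
      have "(norm (g x))\<^sup>2 = (a x)\<^sup>2 * ((x \<bullet> x) * (norm (\<phi> x))\<^sup>2)" by (simp add: g_def power_mult_distrib sl_norm)
      \<comment> \<open>On the support |x| is at most n, so the growth of x gives back n^2 against
        the n^-4 from the coefficient \<open>a\<close>.\<close>
      also have "\<dots> \<le> (4 * B\<^sup>2 / n^4) * (n\<^sup>2 * (norm (\<phi> x))\<^sup>2)"
      proof (intro mult_mono)
        have "1 - (x \<bullet> x) / n\<^sup>2 \<le> 1" by simp
        then have "\<bar>flat_exp 1 (1 - (x \<bullet> x) / n\<^sup>2)\<bar>\<^sup>2 \<le> B\<^sup>2" using B by (intro power_mono) auto
        then have "4 / n^4 * (flat_exp 1 (1 - (x \<bullet> x) / n\<^sup>2))\<^sup>2 \<le> 4 / n^4 * B\<^sup>2" by (intro mult_left_mono) auto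
        then show "(a x)\<^sup>2 \<le> 4 * B\<^sup>2 / n^4" by (simp add: a_def power_mult_distrib power_divide)
        show "x \<bullet> x \<le> n\<^sup>2" using False unfolding dot_square_norm by (intro power_mono) auto
      qed auto
      also have "\<dots> = (4 * B\<^sup>2 / n\<^sup>2) * (norm (\<phi> x))\<^sup>2" using n by (simp add: power4_eq_xxxx power2_eq_square field_simps)
      finally show ?thesis .
    qed
    have N2g: "N2 g \<le> ennreal (4 * B\<^sup>2 / n\<^sup>2) * N2 \<phi>"
    proof -
      have "N2 g \<le> (\<integral>\<^sup>+x. ennreal (4 * B\<^sup>2 / n\<^sup>2) * ennreal ((norm (\<phi> x))\<^sup>2) \<partial>lborel)"
        unfolding N2_def by (rule nn_integral_mono) (use gle n in \<open>simp add: ennreal_mult[symmetric] ennreal_leI\<close>)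
      also have "\<dots> = ennreal (4 * B\<^sup>2 / n\<^sup>2) * N2 \<phi>" unfolding N2_def by (rule nn_integral_cmult) measurable
      finally show ?thesis .
    qed
    have N2u: "N2 u \<le> N2 \<phi>"
      unfolding N2_def
    proof (intro nn_integral_mono ennreal_leI)
      fix x
      have "norm (u x) \<le> 1 * norm (\<phi> x)" unfolding u_def norm_scaleR using \<rho>1[of x] by (intro mult_right_mono) auto
      then show "(norm (u x))\<^sup>2 \<le> (norm (\<phi> x))\<^sup>2" by (intro power_mono) auto
    qed
    have phi_i: "integrable lborel (\<lambda>x. \<phi> x \<bullet> f x)" if "smooth_map f" "bsupp f" for f
      by (rule integrable_inner_L2[OF \<phi> that])
    have wk: "S.weak_adj u g"
      unfolding S.weak_adj_def dop_eq
    proof (intro allI impI)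
      fix \<psi> :: "real^4 \<Rightarrow> 'v" assume \<psi>: "smooth_map \<psi>" "bsupp \<psi>"
      define f1 where "f1 x = Lop (\<lambda>x. \<rho> x *\<^sub>R \<psi> x) x" for x
      define f2 where "f2 x = (\<Sum>k\<in>UNIV. pd \<rho> k x *\<^sub>R symb k x (\<psi> x))" for x
      have s\<rho>\<psi>: "smooth_map (\<lambda>x. \<rho> x *\<^sub>R \<psi> x)" by (intro smooth_scaleR s\<rho> \<psi>(1))
      have b\<rho>\<psi>: "bsupp (\<lambda>x. \<rho> x *\<^sub>R \<psi> x)" by (rule bsupp_mono[OF \<psi>(2)]) simp
      have s1: "smooth_map f1" unfolding f1_def[abs_def] by (rule smooth_Lop[OF s\<rho>\<psi>])
      have s2: "smooth_map f2" unfolding f2_def[abs_def] by (intro smooth_sum smooth_scaleR smooth_pd s\<rho> smooth_symb \<psi>(1))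
      have b1: "bsupp f1" unfolding f1_def[abs_def] using S.bsupp_dop[OF b\<rho>\<psi>] unfolding dop_eq .
      have b2: "bsupp f2" unfolding f2_def[abs_def] by (rule bsupp_mono[OF \<psi>(2)]) (simp add: linear_0[OF lin_symb])
      have "(\<integral>x. u x \<bullet> Lop \<psi> x \<partial>lborel) = (\<integral>x. \<phi> x \<bullet> f1 x - \<phi> x \<bullet> f2 x \<partial>lborel)"
        unfolding f1_def dop_cutoff[OF s\<rho> \<psi>(1)] f2_def u_def by (simp add: inner_add_right)
      also have "\<dots> = (\<integral>x. \<phi> x \<bullet> f1 x \<partial>lborel) - (\<integral>x. \<phi> x \<bullet> f2 x \<partial>lborel)"
        by (rule Bochner_Integration.integral_diff[OF phi_i[OF s1 b1] phi_i[OF s2 b2]])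
      also have "(\<integral>x. \<phi> x \<bullet> f1 x \<partial>lborel) = 0" unfolding f1_def by (rule weak[OF s\<rho>\<psi> b\<rho>\<psi>])
      also have "0 - (\<integral>x. \<phi> x \<bullet> f2 x \<partial>lborel) = (\<integral>x. g x \<bullet> \<psi> x \<partial>lborel)"
        unfolding f2_def sumsymb g_def by (simp add: P.sl_sym)
      finally show "(\<integral>x. u x \<bullet> Lop \<psi> x \<partial>lborel) = (\<integral>x. g x \<bullet> \<psi> x \<partial>lborel)" .
    qed
    have "(\<integral>\<^sup>+x. ennreal (W x * (norm (u x))\<^sup>2) \<partial>lborel) \<le> 4 * ennreal ((C * unit_ball_vol 4)\<^sup>2) * N2 g"
    proof (rule S.friedrichs_estimate[OF C Lop_formally_skew less_imp_le[OF n] um _ _ gm' _ _ wk Wc])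
      show "u x = 0" if "norm x > n" for x using \<rho>0[OF that] by (simp add: u_def)
      show "g x = 0" if "norm x > n" for x using a0[OF that] by (simp add: g_def)
      show "N2 u < \<infinity>" using N2u \<phi>(2) by (rule le_less_trans)
      show "N2 g < \<infinity>" using N2g \<phi>(2) by (auto intro!: le_less_trans[OF N2g] simp: ennreal_mult_less_top)
      show "W x \<ge> 0" for x using W0[of x] by simp
      show "(\<integral>\<^sup>+x. ennreal (W x * (norm (\<psi> x))\<^sup>2) \<partial>lborel) \<le> N2 (S.dop \<psi>)" if "smooth_map \<psi>" "bsupp \<psi>" for \<psi>
        unfolding dop_eq W_def by (rule Lop_coercive[OF that])
    qed
    also have "\<dots> \<le> 4 * ennreal ((C * unit_ball_vol 4)\<^sup>2) * (ennreal (4 * B\<^sup>2 / n\<^sup>2) * N2 \<phi>)"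
      by (rule mult_left_mono[OF N2g]) simp
    also have "\<dots> = ennreal (K / n\<^sup>2) * N2 \<phi>"
    proof -
      have "4 * ennreal ((C * unit_ball_vol 4)\<^sup>2) * ennreal (4 * B\<^sup>2 / n\<^sup>2) = ennreal 4 * ennreal ((C * unit_ball_vol 4)\<^sup>2) * ennreal (4 * B\<^sup>2 / n\<^sup>2)" by simp
      also have "\<dots> = ennreal (4 * (C * unit_ball_vol 4)\<^sup>2 * (4 * B\<^sup>2 / n\<^sup>2))"
        by (subst ennreal_mult[symmetric], simp, simp, subst ennreal_mult[symmetric]) auto
      also have "4 * (C * unit_ball_vol 4)\<^sup>2 * (4 * B\<^sup>2 / n\<^sup>2) = K / n\<^sup>2" by (simp add: K_def)
      finally show ?thesis by (simp only: mult.assoc[symmetric])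
    qed
    finally show ?thesis unfolding u_def \<rho>_def .
  qed
  have ball: "AE x in lborel. norm x \<le> R \<longrightarrow> \<phi> x = 0" if R: "R > 0" for R :: real
  proof -
    have [measurable]: "cball (0::real^4) R \<in> sets borel" by simp
    define I where "I = (\<integral>\<^sup>+x. ennreal (W x * (norm (\<phi> x))\<^sup>2) * indicator (cball 0 R) x \<partial>lborel)"
    \<comment> \<open>For n at least 2 R, points of the ball of radius R satisfy |x / n| at most
      1/2, so the bump there is at least exp (-4/3); \<open>e\<close> is the square of this lower
      bound.\<close>
    define e :: real where "e = (exp (- (4/3)))\<^sup>2"
    have e: "e > 0" by (simp add: e_def)
    have nI: "ennreal e * I \<le> ennreal (K / n\<^sup>2) * N2 \<phi>" if n: "n \<ge> 2 * R" for n
    proof -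
      have n0: "n > 0" using n R by simp
      have "ennreal e * I = (\<integral>\<^sup>+x. ennreal e * (ennreal (W x * (norm (\<phi> x))\<^sup>2) * indicator (cball 0 R) x) \<partial>lborel)"
        unfolding I_def by (rule nn_integral_cmult[symmetric]) measurable
      also have "\<dots> \<le> (\<integral>\<^sup>+x. ennreal (W x * (norm (bump ((1/n) *\<^sub>R x) *\<^sub>R \<phi> x))\<^sup>2) \<partial>lborel)"
      proof (rule nn_integral_mono)
        fix x :: "real^4"
        show "ennreal e * (ennreal (W x * (norm (\<phi> x))\<^sup>2) * indicator (cball 0 R) x) \<le> ennreal (W x * (norm (bump ((1/n) *\<^sub>R x) *\<^sub>R \<phi> x))\<^sup>2)"
        proof (cases "norm x \<le> R")
          case True
          have "(norm ((1/n) *\<^sub>R x))\<^sup>2 \<le> (1/2)\<^sup>2" using True n n0 by (intro power_mono) (auto simp: divide_le_eq)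
          then have "1 - ((1/n) *\<^sub>R x) \<bullet> ((1/n) *\<^sub>R x) \<ge> 3/4"
            unfolding power2_norm_eq_inner by (simp add: power2_eq_square)
          then obtain p where p: "p = 1 - ((1/n) *\<^sub>R x) \<bullet> ((1/n) *\<^sub>R x)" "p \<ge> 3/4" by blast
          have "1 / p \<le> 4/3" using p(2) by (simp add: divide_le_eq)
          then have "bump ((1/n) *\<^sub>R x) \<ge> exp (- (4/3))" unfolding bump_def flat_exp_0 p(1)[symmetric] using p(2) by simp
          then have "e \<le> (bump ((1/n) *\<^sub>R x))\<^sup>2" unfolding e_def by (intro power_mono) auto
          then have "e * (W x * (norm (\<phi> x))\<^sup>2) \<le> (bump ((1/n) *\<^sub>R x))\<^sup>2 * (W x * (norm (\<phi> x))\<^sup>2)"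
            using W0[of x] by (intro mult_right_mono) auto
          also have "\<dots> = W x * (norm (bump ((1/n) *\<^sub>R x) *\<^sub>R \<phi> x))\<^sup>2" by (simp add: power_mult_distrib)
          finally show ?thesis using True e W0[of x] by (simp add: ennreal_mult[symmetric] ennreal_leI)
        qed simp
      qed
      also have "\<dots> \<le> ennreal (K / n\<^sup>2) * N2 \<phi>" by (rule est[OF n0])
      finally show ?thesis .
    qed
    obtain M where M: "N2 \<phi> = ennreal M" "M \<ge> 0" using \<phi>(2) by (cases "N2 \<phi>") auto
    have "ennreal e * I \<le> 0"
    proof (rule ennreal_le_epsilon)
      fix \<eta> :: real assume \<eta>: "\<eta> > 0"
      define n where "n = max (2 * R) (max 1 (K * M / \<eta>))"
      have n: "n \<ge> 2 * R" "n \<ge> 1" "n \<ge> K * M / \<eta>" by (auto simp: n_def)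
      have "K * M / n\<^sup>2 \<le> \<eta>"
      proof -
        have "K * M \<le> \<eta> * n" using n(3) \<eta> by (simp add: divide_le_eq mult.commute)
        also have "\<dots> \<le> \<eta> * n\<^sup>2" using n(2) \<eta> by (intro mult_left_mono) (auto simp: power2_eq_square)
        finally show ?thesis using n(2) by (simp add: divide_le_eq)
      qed
      then have "ennreal (K / n\<^sup>2) * N2 \<phi> \<le> ennreal \<eta>"
        unfolding M(1) using K0 M(2) by (simp add: ennreal_mult[symmetric] ennreal_leI)
      then show "ennreal e * I \<le> 0 + ennreal \<eta>" using nI[OF n(1)] by simp
    qed
    then have "I = 0" using e by simp
    then have "AE x in lborel. ennreal (W x * (norm (\<phi> x))\<^sup>2) * indicator (cball 0 R) x = 0"
      unfolding I_def by (subst (asm) nn_integral_0_iff_AE) measurable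
    then show ?thesis
    proof eventually_elim
      case (elim x)
      then show ?case using W0[of x] by (auto simp: indicator_def ennreal_eq_0_iff mult_le_0_iff)
    qed
  qed
  \<comment> \<open>Countably many balls exhaust the space; the radii start at 1 because the claim
    for a ball was proved for positive radius.\<close>
  have "AE x in lborel. \<forall>n::nat. norm x \<le> real (Suc n) \<longrightarrow> \<phi> x = 0"
    by (subst AE_all_countable) (intro allI ball, simp)
  then show ?thesis
  proof eventually_elim
    case (elim x)
    obtain n :: nat where "norm x \<le> real n" using real_arch_simple by blast
    then have "norm x \<le> real (Suc n)" by simp
    then show ?case using elim by blast
  qed
qed

end

section \<open>Clifford contractions for the connection terms\<close>

section \<open>The Dirac operator in a moving frame\<close>

context clifford
begin

lemma sl_sl: "sl u (sl z v) = (\<Sum>\<mu>\<in>UNIV. \<Sum>\<nu>\<in>UNIV. (u $ \<mu> * z $ \<nu>) *\<^sub>R g \<mu> (g \<nu> v))"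
  by (simp add: sl_def g_simps scaleR_sum_right)

lemma sl_sum_left: "sl (\<Sum>i\<in>I. f i) v = (\<Sum>i\<in>I. sl (f i) v)"
  by (induction I rule: infinite_finite_induct) (simp_all add: sl_add_left, simp_all add: sl_def)

lemma sl_simps:
  "sl u (v + w) = sl u v + sl u w" "sl u (v - w) = sl u v - sl u w" "sl u (r *\<^sub>R v) = r *\<^sub>R sl u v"
  "sl u (- v) = - sl u v" "sl u (\<Sum>i\<in>I. f i) = (\<Sum>i\<in>I. sl u (f i))"
  by (simp_all add: linear_add[OF lin_sl] linear_diff[OF lin_sl] linear_cmul[OF lin_sl] linear_neg[OF lin_sl] linear_sum[OF lin_sl])

lemma sum_sl_J: "(\<Sum>k\<in>UNIV. u $ k *\<^sub>R sl (Jw (axis k 1)) v) = sl (Jw u) v"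
proof -
  have "Jw u = (\<Sum>k\<in>UNIV. u $ k *\<^sub>R Jw (axis k 1))"
    unfolding vec4_eq_iff by (simp add: qmul_comp sum4 axis_def)
  then show ?thesis by (simp add: sl_sum_left sl_scaleR_left)
qed

text \<open>Contracting the linear map \<open>Jw\<close> with two generators gives 2 (g 0 g 3 - g 1
  g 2), a multiple of a form of pure duality type, annihilating one of the half-spinor spaces.
  Multiplying it by a vector from the right or from the left is what produces the two combinations
  with the orientation element.\<close>

lemma J_trace:
  "(\<Sum>k\<in>UNIV. g k (sl (Jw (axis k 1)) (sl (Jw u) v))) = 2 *\<^sub>R sl u v - 2 *\<^sub>R sl u (vol4 v)"
  "sl (Jw u) (\<Sum>k\<in>UNIV. g k (sl (Jw (axis k 1)) v)) = - 2 *\<^sub>R sl u v - 2 *\<^sub>R sl u (vol4 v)"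
proof -
  have A: "(\<Sum>k\<in>UNIV. g k (sl (Jw (axis k 1)) v)) = 2 *\<^sub>R g 0 (g 3 v) - 2 *\<^sub>R g 1 (g 2 v)" for v
    unfolding sum4 sl_def
    by (simp add: qmul_comp axis_def g_order g_simps scaleR_2)
  have J: "sl (Jw u) v = - (u $ 3) *\<^sub>R g 0 v + u $ 2 *\<^sub>R g 1 v - u $ 1 *\<^sub>R g 2 v + u $ 0 *\<^sub>R g 3 v" for v
    unfolding sl_def sum4 by (simp add: qmul_comp)
  have S: "sl u v = u $ 0 *\<^sub>R g 0 v + u $ 1 *\<^sub>R g 1 v + u $ 2 *\<^sub>R g 2 v + u $ 3 *\<^sub>R g 3 v" for v
    unfolding sl_def sum4 ..
  show "(\<Sum>k\<in>UNIV. g k (sl (Jw (axis k 1)) (sl (Jw u) v))) = 2 *\<^sub>R sl u v - 2 *\<^sub>R sl u (vol4 v)"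
    unfolding A J S vol4_def by (simp add: g_order g_simps scaleR_add_right scaleR_diff_right algebra_simps)
  show "sl (Jw u) (\<Sum>k\<in>UNIV. g k (sl (Jw (axis k 1)) v)) = - 2 *\<^sub>R sl u v - 2 *\<^sub>R sl u (vol4 v)"
    unfolding A J S vol4_def by (simp add: g_order g_simps scaleR_add_right scaleR_diff_right algebra_simps)
qed

text \<open>Clifford contraction of the part of the connection that comes from differentiating the
  standard frame. The rank-one terms reduce by the square of \<open>Jw\<close>, and the terms with
  the derivative of \<open>Jw\<close> by \<open>J_trace\<close>; only multiples of x, with or
  without the orientation element, can remain.\<close>

lemma frame_derivative_contraction:
  fixes x :: "real^4" and h \<kappa> l p t :: real
  defines "w \<equiv> Jw x" and "t \<equiv> x \<bullet> x"
  assumes a: "\<And>k \<mu> \<nu>. a k \<mu> \<nu> = - p * x $ k * (if \<mu> = \<nu> then 1 else 0) + l * x $ k * (w $ \<mu> * w $ \<nu>)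
      + \<kappa> * (Jw (axis k 1) $ \<mu> * w $ \<nu>) + h * (w $ \<mu> * (Jw (axis k 1) $ \<nu> - \<kappa> * w $ \<nu> * x $ k))"
    and B: "\<And>k v. B k v = g k v + (h * w $ k) *\<^sub>R sl w v"
  shows "(\<Sum>k\<in>UNIV. B k (\<Sum>\<mu>\<in>UNIV. \<Sum>\<nu>\<in>UNIV. a k \<mu> \<nu> *\<^sub>R g \<mu> (g \<nu> v))) =
     (- 4 * p + l * t + 2 * \<kappa> - h\<^sup>2 * t) *\<^sub>R sl x v + (2 * (h - \<kappa>)) *\<^sub>R sl x (vol4 v)"
proof -
  define A where "A k = Jw (axis k 1)" for k
  have ww: "sl w (sl w v) = t *\<^sub>R v" for v
    unfolding sl_sq by (simp add: w_def t_def Jw_inner)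
  have diag: "(\<Sum>\<mu>\<in>UNIV. \<Sum>\<nu>\<in>UNIV. (if \<mu> = \<nu> then 1 else 0) *\<^sub>R g \<mu> (g \<nu> v)) = 4 *\<^sub>R v"
  proof -
    have "(4::real) = 1 + 1 + 1 + 1" by simp
    then have "4 *\<^sub>R v = v + v + v + v" by (simp only: scaleR_add_left scaleR_one)
    then show ?thesis unfolding sum4 by simp
  qed
  have inner: "(\<Sum>\<mu>\<in>UNIV. \<Sum>\<nu>\<in>UNIV. a k \<mu> \<nu> *\<^sub>R g \<mu> (g \<nu> v)) =
      ((- 4 * p + l * t - h * \<kappa> * t) * x $ k) *\<^sub>R v + \<kappa> *\<^sub>R sl (A k) (sl w v) + h *\<^sub>R sl w (sl (A k) v)" for k
  proof -
    have "a k \<mu> \<nu> *\<^sub>R g \<mu> (g \<nu> v) = (- p * x $ k) *\<^sub>R ((if \<mu> = \<nu> then 1 else 0) *\<^sub>R g \<mu> (g \<nu> v))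
        + (l * x $ k - h * \<kappa> * x $ k) *\<^sub>R ((w $ \<mu> * w $ \<nu>) *\<^sub>R g \<mu> (g \<nu> v))
        + \<kappa> *\<^sub>R ((A k $ \<mu> * w $ \<nu>) *\<^sub>R g \<mu> (g \<nu> v)) + h *\<^sub>R ((w $ \<mu> * A k $ \<nu>) *\<^sub>R g \<mu> (g \<nu> v))" for \<mu> \<nu>
      unfolding a A_def scaleR_scaleR scaleR_add_left[symmetric] by (rule arg_cong[of _ _ "\<lambda>s. s *\<^sub>R _"]) algebra
    then have "(\<Sum>\<mu>\<in>UNIV. \<Sum>\<nu>\<in>UNIV. a k \<mu> \<nu> *\<^sub>R g \<mu> (g \<nu> v)) = (- p * x $ k) *\<^sub>R (4 *\<^sub>R v)
        + (l * x $ k - h * \<kappa> * x $ k) *\<^sub>R sl w (sl w v) + \<kappa> *\<^sub>R sl (A k) (sl w v) + h *\<^sub>R sl w (sl (A k) v)"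
      by (simp only: sum.distrib scaleR_sum_right[symmetric] diag sl_sl)
    then show ?thesis unfolding ww by (simp add: algebra_simps)
  qed
  have Bx: "(\<Sum>k\<in>UNIV. x $ k *\<^sub>R B k v) = sl x v" for v
  proof -
    have "(\<Sum>k\<in>UNIV. x $ k *\<^sub>R B k v) = sl x v + (h * (\<Sum>k\<in>UNIV. x $ k * w $ k)) *\<^sub>R sl w v"
      unfolding B sl_def[of x] by (simp add: scaleR_add_right sum.distrib sum_distrib_left scaleR_sum_left mult_ac)
    also have "(\<Sum>k\<in>UNIV. x $ k * w $ k) = 0" using Jw_inner(1)[of x] by (simp add: w_def inner_vec_def)
    finally show ?thesis by simp
  qed
  have wA: "(\<Sum>k\<in>UNIV. w $ k *\<^sub>R sl (A k) v) = - sl x v" for v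
    unfolding A_def sum_sl_J by (simp add: w_def Jw_inner sl_minus_left)
  have wx: "sl w (sl x v) = - sl x (sl w v)" for v
    using sl_anticomm[of w x v] Jw_inner(1)[of x] by (simp add: w_def inner_commute add_eq_0_iff)
  have gw: "g k (sl w v) = (2 * w $ k) *\<^sub>R v - sl w (g k v)" for k v
    using sl_anticomm[of "axis k 1" w v] unfolding sl_axis by (simp add: inner_axis' algebra_simps)
  have T1: "(\<Sum>k\<in>UNIV. B k (sl (A k) (sl w v))) = (2 + h * t) *\<^sub>R sl x v - 2 *\<^sub>R sl x (vol4 v)"
  proof -
    have "(\<Sum>k\<in>UNIV. B k (sl (A k) (sl w v))) = (\<Sum>k\<in>UNIV. g k (sl (A k) (sl w v))) + h *\<^sub>R sl w (\<Sum>k\<in>UNIV. w $ k *\<^sub>R sl (A k) (sl w v))"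
      unfolding B by (simp add: sum.distrib scaleR_sum_right sl_simps)
    then show ?thesis unfolding wA unfolding A_def w_def J_trace unfolding w_def[symmetric]
      by (simp add: sl_simps wx ww algebra_simps)
  qed
  have T2: "(\<Sum>k\<in>UNIV. B k (sl w (sl (A k) v))) = 2 *\<^sub>R sl x (vol4 v) - (h * t) *\<^sub>R sl x v"
  proof -
    have "(\<Sum>k\<in>UNIV. B k (sl w (sl (A k) v))) = 2 *\<^sub>R (\<Sum>k\<in>UNIV. w $ k *\<^sub>R sl (A k) v) - sl w (\<Sum>k\<in>UNIV. g k (sl (A k) v))
        + (h * t) *\<^sub>R (\<Sum>k\<in>UNIV. w $ k *\<^sub>R sl (A k) v)"
      unfolding B gw ww by (simp add: sum.distrib sum_subtractf scaleR_sum_right sl_simps mult_ac)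
    then show ?thesis unfolding wA unfolding A_def w_def J_trace by (simp add: algebra_simps)
  qed
  have linB: "linear (B k)" for k
    unfolding B[abs_def] by (intro linear_compose_add lin_g linear_compose_scale_right lin_sl)
  have "(\<Sum>k\<in>UNIV. B k (\<Sum>\<mu>\<in>UNIV. \<Sum>\<nu>\<in>UNIV. a k \<mu> \<nu> *\<^sub>R g \<mu> (g \<nu> v))) =
      (- 4 * p + l * t - h * \<kappa> * t) *\<^sub>R (\<Sum>k\<in>UNIV. x $ k *\<^sub>R B k v) + \<kappa> *\<^sub>R (\<Sum>k\<in>UNIV. B k (sl (A k) (sl w v)))
      + h *\<^sub>R (\<Sum>k\<in>UNIV. B k (sl w (sl (A k) v)))"
    unfolding inner by (simp add: linear_add[OF linB] linear_cmul[OF linB] sum.distrib scaleR_sum_right)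
  then show ?thesis unfolding Bx T1 T2 by (simp add: algebra_simps power2_eq_square)
qed

text \<open>A symmetric coefficient sees only the anticommutator of two Clifford multiplications.
  Hence the Christoffel symbols contribute to the Dirac operator only through their metric
  trace.\<close>

lemma symmetric_contraction:
  assumes S: "\<And>k l. S k l = S l (k::4)"
  shows "(\<Sum>k\<in>UNIV. \<Sum>l\<in>UNIV. S k l *\<^sub>R sl (e k) (sl (e l) v)) = (\<Sum>k\<in>UNIV. \<Sum>l\<in>UNIV. S k l * (e k \<bullet> e l)) *\<^sub>R v"
proof -
  let ?X = "\<Sum>k\<in>UNIV. \<Sum>l\<in>UNIV. S k l *\<^sub>R sl (e k) (sl (e l) v)"
  have "?X = (\<Sum>k\<in>UNIV. \<Sum>l\<in>UNIV. S l k *\<^sub>R sl (e l) (sl (e k) v))"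
    by (rule sum.swap)
  also have "\<dots> = (\<Sum>k\<in>UNIV. \<Sum>l\<in>UNIV. S k l *\<^sub>R sl (e l) (sl (e k) v))"
    by (intro sum.cong refl arg_cong[of _ _ "\<lambda>s. s *\<^sub>R _"] S)
  finally have "?X + ?X = ?X + (\<Sum>k\<in>UNIV. \<Sum>l\<in>UNIV. S k l *\<^sub>R sl (e l) (sl (e k) v))" by (rule arg_cong)
  then have "?X + ?X = (\<Sum>k\<in>UNIV. \<Sum>l\<in>UNIV. S k l *\<^sub>R (sl (e k) (sl (e l) v) + sl (e l) (sl (e k) v)))"
    by (simp only: scaleR_add_right sum.distrib)
  also have "\<dots> = 2 *\<^sub>R ((\<Sum>k\<in>UNIV. \<Sum>l\<in>UNIV. S k l * (e k \<bullet> e l)) *\<^sub>R v)"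
    unfolding sl_anticomm by (simp add: scaleR_sum_left scaleR_sum_right mult_ac)
  finally have "2 *\<^sub>R ?X = 2 *\<^sub>R ((\<Sum>k\<in>UNIV. \<Sum>l\<in>UNIV. S k l * (e k \<bullet> e l)) *\<^sub>R v)" by (simp only: scaleR_2)
  then show ?thesis by (rule scaleR_left_imp_eq[rotated]) simp
qed

end

section \<open>The metric in Cartesian coordinates, an explicit frame and the volume density\<close>

section \<open>The Iwai-Katayama metric\<close>

text \<open>Completeness of the orthogonal frame x, x i, x j, x k. It eliminates the directions x i
  and x j from the metric in favour of the identity and \<open>Jw\<close>.\<close>

lemma quaternion_frame:
  "x $ m * x $ n + qmul x qi $ m * qmul x qi $ n + qmul x qj $ m * qmul x qj $ n + Jw x $ m * Jw x $ n
    = (x \<bullet> x) * (if m = n then 1 else 0)"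
proof -
  have "\<forall>m n. x $ m * x $ n + qmul x qi $ m * qmul x qi $ n + qmul x qj $ m * qmul x qj $ n + Jw x $ m * Jw x $ n
    = (x \<bullet> x) * (if m = n then 1 else 0)"
    unfolding all4 inner4 by (simp add: qmul_comp algebra_simps)
  then show ?thesis by simp
qed

lemma rank_one_product:
  fixes w :: "real^4"
  shows "(\<Sum>m\<in>UNIV. ((if \<mu> = m then 1 else 0) + p * (w $ \<mu> * w $ m)) * ((if \<nu> = m then 1 else 0) + q * (w $ \<nu> * w $ m)))
    = (if \<mu> = \<nu> then 1 else 0) + (p + q + p * q * (w \<bullet> w)) * (w $ \<mu> * w $ \<nu>)"
proof -
  have e: "((if \<mu> = m then 1 else 0) + p * (w $ \<mu> * w $ m)) * ((if \<nu> = m then 1 else 0) + q * (w $ \<nu> * w $ m)) =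
      (if \<mu> = m then (if \<nu> = m then 1 else 0) + q * (w $ \<nu> * w $ m) else 0) + (if \<nu> = m then p * (w $ \<mu> * w $ m) else 0)
      + (p * q * (w $ \<mu> * w $ \<nu>)) * (w $ m * w $ m)" for m
    by (simp add: algebra_simps)
  show ?thesis
    unfolding e sum.distrib sum_distrib_left[symmetric]
    by (simp add: inner_vec_def algebra_simps)
qed

locale ik_metric = radial_profile c d for c d :: real +
  fixes a b :: real
  assumes a: "a > 0" and b: "b > 0"
begin

definition Ff :: "real \<Rightarrow> real" where "Ff t = 2 * sqrt (a + b * t)"
text \<open>For t > 0 equal to (1 - 1 / U) / t, in a form that is smooth at t = 0; it is the amount
  of \<open>Jw\<close> squared removed from the flat metric.\<close>

definition Sf :: "real \<Rightarrow> real" where "Sf t = (c + d * t) / Uf c d t"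
definition S1f :: "real \<Rightarrow> real" where "S1f t = (d * Uf c d t - (c + d * t) * (c + 2 * d * t)) / (Uf c d t)\<^sup>2"
text \<open>The symmetric orthonormal frame, a square root of the inverse metric, with
  \<open>Th\<close> as dual coframe. Unlike the polar frame it is smooth at the origin.\<close>

definition Fr :: "real^4 \<Rightarrow> 4 \<Rightarrow> 4 \<Rightarrow> real" where
  "Fr x \<mu> k = inverse (Ff (x \<bullet> x)) * ((if \<mu> = k then 1 else 0) + Hf c d (x \<bullet> x) * (Jw x $ \<mu> * Jw x $ k))"
definition Th :: "real^4 \<Rightarrow> 4 \<Rightarrow> 4 \<Rightarrow> real" where
  "Th x \<mu> k = Ff (x \<bullet> x) * ((if \<mu> = k then 1 else 0) + (- Kf c d (x \<bullet> x)) * (Jw x $ \<mu> * Jw x $ k))"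

lemma F_pos: "t \<ge> 0 \<Longrightarrow> Ff t > 0"
  unfolding Ff_def using a b by (simp add: add_pos_nonneg)

lemma F_sq: "t \<ge> 0 \<Longrightarrow> (Ff t)\<^sup>2 = 4 * (a + b * t)"
  unfolding Ff_def using a b by (simp add: power_mult_distrib add_nonneg_nonneg)

lemma qmul_rotated:
  assumes x: "x \<noteq> 0" and q: "x \<bullet> qmul x q = 0"
  shows "((u - ((x \<bullet> u) / (norm x)\<^sup>2) *\<^sub>R x) /\<^sub>R norm x) \<bullet> qmul (x /\<^sub>R norm x) q = (u \<bullet> qmul x q) / (x \<bullet> x)"
proof -
  have "qmul (x /\<^sub>R norm x) q = qmul x q /\<^sub>R norm x"
    by (simp add: vec4_eq_iff qmul_def algebra_simps)
  then show ?thesis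
    by (simp add: inner_diff_left q dot_square_norm power2_eq_square divide_inverse)
qed

text \<open>Passing from t to the radius r turns the metric into 4 (a + b t) times dr^2 + r^2
  g_lambda. By the completeness relation this is the flat metric with the Hopf direction scaled by 1
  / U, and the formula makes sense at the origin, where it agrees with the prescribed
  extension.\<close>

lemma Gmat_eq: "Gmat a b c d x $ m $ n = 4 * (a + b * (x \<bullet> x)) * ((if m = n then 1 else 0) - Sf (x \<bullet> x) * (Jw x $ m * Jw x $ n))"
proof (cases "x = 0")
  case True
  then show ?thesis by (simp add: Gmat_def gIK_def linear_0[OF lin_Jw] inner_axis_axis)
next
  case False
  define t where "t = x \<bullet> x"
  have t: "t > 0" "(norm x)\<^sup>2 = t" using False by (simp_all add: t_def dot_square_norm)
  have U: "Uf c d t > 0" using U_pos t(1) by simp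
  have o: "x \<bullet> qmul x qi = 0" "x \<bullet> qmul x qj = 0" "x \<bullet> qmul x qk = 0"
    using Jw_inner(1)[of x] by (simp_all add: inner4 qmul_comp Jw_def)
  have lam: "(lambdaIK c d t)\<^sup>2 = 1 / Uf c d t"
    unfolding lambdaIK_def Uf_def[symmetric] using U by (simp add: power_divide)
  have gam: "(gammaIK a b t)\<^sup>2 = (a + b * t) / t"
    unfolding gammaIK_def using a b t(1) by (simp add: add_nonneg_nonneg)
  have ax: "axis m 1 \<bullet> v = v $ m" "v \<bullet> axis m 1 = v $ m" for v :: "real^4" and m by (simp_all add: inner_axis inner_axis')
  define i j w where "i = qmul x qi" and "j = qmul x qj" and "w = Jw x"
  have qf: "x $ m * x $ n + i $ m * i $ n + j $ m * j $ n = t * (if m = n then 1 else 0) - w $ m * w $ n"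
    using quaternion_frame[of x m n] by (simp only: i_def j_def w_def t_def)
  have al: "4 * \<alpha> / t * (t * \<delta> - p + y * p) = 4 * \<alpha> * (\<delta> - (1 - y) / t * p)" for \<alpha> \<delta> p y
    using t(1) by (simp add: field_simps)
  have rot: "((axis m 1 - (x $ m / t) *\<^sub>R x) /\<^sub>R norm x) \<bullet> qmul (x /\<^sub>R norm x) q = qmul x q $ m / t"
    if "x \<bullet> qmul x q = 0" for m q
    using qmul_rotated[OF False that, of "axis m 1"] by (simp only: t(2) t_def[symmetric] ax)
  have "Gmat a b c d x $ m $ n = (a + b * t) / t * (2 * x $ m * (2 * x $ n)
      + 4 * t\<^sup>2 * ((i $ m / t) * (i $ n / t) + (j $ m / t) * (j $ n / t) + 1 / Uf c d t * (w $ m / t) * (w $ n / t)))"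
    unfolding Gmat_def gIK_def berger_def Let_def
    using False by (simp only: vec_lambda_beta if_False t(2) t_def[symmetric] ax lam gam i_def j_def w_def Jw_def
        rot[OF o(1)] rot[OF o(2)] rot[OF o(3)])
  also have "\<dots> = 4 * (a + b * t) / t * (x $ m * x $ n + i $ m * i $ n + j $ m * j $ n + 1 / Uf c d t * (w $ m * w $ n))"
    using t(1) by (simp add: power2_eq_square field_simps)
  also have "\<dots> = 4 * (a + b * t) * ((if m = n then 1 else 0) - (1 - 1 / Uf c d t) / t * (w $ m * w $ n))"
    unfolding qf by (rule al)
  also have "(1 - 1 / Uf c d t) / t = Sf t"
  proof -
    have "1 - 1 / Uf c d t = (Uf c d t - 1) / Uf c d t" using U by (simp add: diff_divide_distrib)
    also have "Uf c d t - 1 = t * (c + d * t)" by (simp add: Uf_def power2_eq_square algebra_simps)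
    finally show ?thesis using t(1) by (simp add: Sf_def)
  qed
  finally show ?thesis by (simp only: t_def w_def)
qed

lemma U_V: "t \<ge> 0 \<Longrightarrow> Uf c d t = (Vf c d t)\<^sup>2"
  using V_sq by (simp add: Uf_def)

lemma H_K: assumes "t \<ge> 0" shows "Hf c d t - Kf c d t = Hf c d t * Kf c d t * t"
  using H_eq[OF assms] K_eq[OF assms] by algebra

lemma Fr_Th: "(\<Sum>m\<in>UNIV. Fr x \<mu> m * Th x \<nu> m) = (if \<mu> = \<nu> then 1 else 0)"
proof -
  have "(\<Sum>m\<in>UNIV. Fr x \<mu> m * Th x \<nu> m) = inverse (Ff (x \<bullet> x)) * Ff (x \<bullet> x) *
      ((if \<mu> = \<nu> then 1 else 0) + (Hf c d (x \<bullet> x) + - Kf c d (x \<bullet> x) + Hf c d (x \<bullet> x) * - Kf c d (x \<bullet> x) * (Jw x \<bullet> Jw x)) * (Jw x $ \<mu> * Jw x $ \<nu>))"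
    unfolding Fr_def Th_def rank_one_product[symmetric] sum_distrib_left by (rule sum.cong) (simp_all only: mult_ac)
  then show ?thesis using F_pos[of "x \<bullet> x"] H_K[of "x \<bullet> x"] by (simp add: Jw_inner)
qed

lemma Fr_sym: "Fr x \<mu> k = Fr x k \<mu>" and Th_sym: "Th x \<mu> k = Th x k \<mu>"
  by (simp_all add: Fr_def Th_def mult.commute)

lemma Fr_Th_col: "(\<Sum>\<mu>\<in>UNIV. Fr x \<mu> m * Th x \<mu> n) = (if m = n then 1 else 0)"
  unfolding Fr_sym[of x _ m] Th_sym[of x _ n] by (rule Fr_Th)

lemma Th_Th: "(\<Sum>\<mu>\<in>UNIV. Th x \<mu> m * Th x \<mu> n) = Gmat a b c d x $ m $ n"
proof -
  define t where "t = x \<bullet> x"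
  have t: "t \<ge> 0" by (simp add: t_def)
  define K where "K = Kf c d t"
  have "(\<Sum>\<mu>\<in>UNIV. Th x \<mu> m * Th x \<mu> n) = (Ff t)\<^sup>2 *
      ((if m = n then 1 else 0) + (- K + - K + - K * - K * (Jw x \<bullet> Jw x)) * (Jw x $ m * Jw x $ n))"
    unfolding Th_sym[of x _ m] Th_sym[of x _ n] unfolding Th_def rank_one_product[symmetric] sum_distrib_left t_def[symmetric] K_def
    by (rule sum.cong) (simp_all only: mult_ac power2_eq_square)
  also have "- K + - K + - K * - K * (Jw x \<bullet> Jw x) = - Sf t"
  proof -
    have V: "Vf c d t > 0" by (rule V_pos[OF t])
    have "Sf t * (Vf c d t)\<^sup>2 = (Hf c d t)\<^sup>2 * t + 2 * Hf c d t"
      using V by (simp add: Sf_def U_V[OF t] q_eq[OF t])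
    then have "(2 * K - K\<^sup>2 * t) * (Vf c d t)\<^sup>2 = Sf t * (Vf c d t)\<^sup>2"
      using K_eq[OF t] H_eq[OF t] unfolding K_def by algebra
    then have "2 * K - K\<^sup>2 * t = Sf t" using V by simp
    then show ?thesis by (simp add: Jw_inner t_def power2_eq_square)
  qed
  finally show ?thesis unfolding Gmat_eq F_sq[OF t] by (simp add: t_def)
qed

lemma Fr_Fr: "(\<Sum>\<mu>\<in>UNIV. Fr x \<mu> k * Fr x \<mu> l) =
  ((if k = l then 1 else 0) + (c + d * (x \<bullet> x)) * (Jw x $ k * Jw x $ l)) / (4 * (a + b * (x \<bullet> x)))"
proof -
  define t where "t = x \<bullet> x"
  have t: "t \<ge> 0" by (simp add: t_def)
  define H where "H = Hf c d t"
  have "(\<Sum>\<mu>\<in>UNIV. Fr x \<mu> k * Fr x \<mu> l) = (inverse (Ff t))\<^sup>2 *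
      ((if k = l then 1 else 0) + (H + H + H * H * (Jw x \<bullet> Jw x)) * (Jw x $ k * Jw x $ l))"
    unfolding Fr_sym[of x _ k] Fr_sym[of x _ l] unfolding Fr_def rank_one_product[symmetric] sum_distrib_left t_def[symmetric] H_def
    by (rule sum.cong) (simp_all only: mult_ac power2_eq_square)
  also have "H + H + H * H * (Jw x \<bullet> Jw x) = c + d * t"
    using q_eq[OF t] by (simp add: Jw_inner t_def H_def power2_eq_square)
  finally show ?thesis unfolding power_inverse F_sq[OF t] by (simp add: t_def divide_inverse mult.commute)
qed

lemma smooth_F: "smooth_map (\<lambda>x::real^4. Ff (x \<bullet> x))"
  unfolding Ff_def using a b
  by (intro smooth_mult smooth_const smooth_sqrt smooth_add smooth_inner smooth_id) (simp add: add_pos_nonneg)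

lemma smooth_inv_F: "smooth_map (\<lambda>x::real^4. inverse (Ff (x \<bullet> x)))"
  by (rule smooth_inverse[OF smooth_F F_pos]) simp

lemma smooth_Jw_coord: "smooth_map (\<lambda>x. Jw x $ k)"
  by (rule smooth_linear[OF bounded_linear_vec_nth smooth_of_linear[OF bl_Jw]])

lemma smooth_Fr: "smooth_map (\<lambda>x. Fr x \<mu> k)"
  unfolding Fr_def by (intro smooth_mult smooth_inv_F smooth_add smooth_const smooth_H smooth_Jw_coord)

lemma smooth_Th: "smooth_map (\<lambda>x. Th x \<mu> k)"
  unfolding Th_def by (intro smooth_mult smooth_F smooth_add smooth_const smooth_uminus smooth_K smooth_Jw_coord)

text \<open>The metric is the square of the symmetric matrix \<open>Th\<close>, which has eigenvalue
  F three times and F / V once, in the Hopf direction.\<close>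

lemma det_G: "det (Gmat a b c d x) = ((Ff (x \<bullet> x)) ^ 4 / Vf c d (x \<bullet> x))\<^sup>2"
proof -
  define T :: "real^4^4" where "T = (\<chi> m n. Th x m n)"
  have "Gmat a b c d x = transpose T ** T"
    by (simp add: vec_eq_iff matrix_matrix_mult_def transpose_def T_def Th_Th)
  then have G: "det (Gmat a b c d x) = (det T)\<^sup>2" by (simp add: det_mul det_transpose power2_eq_square)
  define f v where "f = Ff (x \<bullet> x)" and "v = Vf c d (x \<bullet> x)"
  have v: "v > 0" unfolding v_def by (rule V_pos) simp
  have "det T = f ^ 4 / v"
  proof (cases "x = 0")
    case True
    have "T $ i $ j = 0" if "i \<noteq> j" for i j using that True by (simp add: T_def Th_def linear_0[OF lin_Jw])
    then have "det T = (\<Prod>i\<in>UNIV. T $ i $ i)" by (rule det_diagonal)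
    also have "\<dots> = (\<Prod>i\<in>(UNIV::4 set). f)" using True by (simp add: T_def Th_def f_def linear_0[OF lin_Jw])
    finally show ?thesis using True by (simp add: v_def Vf_def Uf_def)
  next
    case False
    \<comment> \<open>Rows of the polar frame diagonalize \<open>Th\<close>; only invertibility of
      this change of basis is needed to compare determinants.\<close>
    define R D :: "real^4^4" where "R = (\<chi> i. polar x i)" and "D = (\<chi> i j. if i = j then if i = 3 then f / v else f else 0)"
    have "R ** transpose R = mat 1"
      by (simp add: vec_eq_iff matrix_matrix_mult_def transpose_def R_def mat_def polar_rows[OF False, unfolded inner_vec_def inner_real_def])
    then have R: "det R \<noteq> 0" using det_mul[of R "transpose R"] by (auto simp: det_transpose)
    have Kv: "1 - Kf c d (x \<bullet> x) * (x \<bullet> x) = 1 / v"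
    proof -
      have "v * (1 - Kf c d (x \<bullet> x) * (x \<bullet> x)) = 1"
        using K_eq[of "x \<bullet> x", OF inner_ge_zero, folded v_def] H_eq[of "x \<bullet> x", OF inner_ge_zero, folded v_def]
        by (simp add: right_diff_distrib mult.assoc[symmetric] mult.commute[of v])
      then show ?thesis using v by (simp add: field_simps)
    qed
    have RT: "R ** T = D ** R"
    proof -
      have "(\<Sum>k\<in>UNIV. R $ i $ k * T $ k $ j) = (\<Sum>k\<in>UNIV. D $ i $ k * R $ k $ j)" for i j
      proof -
        have "(\<Sum>k\<in>UNIV. R $ i $ k * T $ k $ j) = f * (polar x i $ j - Kf c d (x \<bullet> x) * (polar x i \<bullet> Jw x) * Jw x $ j)"
          unfolding R_def T_def Th_def f_def[symmetric]
          by (simp add: inner_vec_def sum_distrib_left sum_distrib_right sum_subtractf algebra_simps if_distrib[of "\<lambda>c. _ * c"] cong: if_cong)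
        also have "polar x i \<bullet> Jw x = norm x * (polar x i \<bullet> polar x 3)" using False by (simp add: polar_simps)
        also have "f * (polar x i $ j - Kf c d (x \<bullet> x) * (norm x * (polar x i \<bullet> polar x 3)) * Jw x $ j) = (if i = 3 then f / v else f) * polar x i $ j"
        proof (cases "i = 3")
          case True
          have "Jw x $ j = norm x * polar x 3 $ j" using False by (simp add: polar_simps)
          then have "f * (polar x i $ j - Kf c d (x \<bullet> x) * (norm x * (polar x i \<bullet> polar x 3)) * Jw x $ j) = f * (1 - Kf c d (x \<bullet> x) * (x \<bullet> x)) * polar x 3 $ j"
            unfolding True polar_rows[OF False] by (simp add: dot_square_norm power2_eq_square algebra_simps)
          then show ?thesis unfolding Kv using True by simp
        next
          case F: False
          then show ?thesis unfolding polar_rows[OF False] by simp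
        qed
        also have "\<dots> = (\<Sum>k\<in>UNIV. D $ i $ k * R $ k $ j)"
          by (simp add: D_def R_def if_distrib[of "\<lambda>c. c * _"] cong: if_cong)
        finally show ?thesis .
      qed
      then show ?thesis by (simp add: vec_eq_iff matrix_matrix_mult_def)
    qed
    have "det D = (\<Prod>i\<in>UNIV. D $ i $ i)" by (rule det_diagonal) (simp add: D_def)
    also have "\<dots> = f ^ 4 / v"
    proof -
      have "(\<Prod>i\<in>UNIV. h i) = h (0::4) * h 1 * h 2 * h 3" for h :: "4 \<Rightarrow> real"
      proof -
        have four: "(4::4) = 0" by simp
        have "(\<Prod>i\<in>UNIV. h i) = h 1 * h 2 * h 3 * h 4" for h :: "4 \<Rightarrow> real" unfolding UNIV_4 by (simp add: mult_ac)
        then show ?thesis unfolding four by (simp add: mult_ac)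
      qed
      then show ?thesis by (simp add: D_def power4_eq_xxxx)
    qed
    finally have D: "det D = f ^ 4 / v" .
    have "det R * det T = det D * det R" using RT by (metis det_mul)
    then have "det R * det T = det R * (f ^ 4 / v)" unfolding D by (simp only: mult.commute)
    then show ?thesis using R by (simp only: mult_cancel_left) simp
  qed
  then show ?thesis unfolding G by (simp only: f_def v_def)
qed

lemma vol_eq: "vol_density (Gmat a b c d) x = (Ff (x \<bullet> x)) ^ 4 / Vf c d (x \<bullet> x)"
  unfolding vol_density_def det_G real_sqrt_abs using F_pos[of "x \<bullet> x"] V_pos[of "x \<bullet> x"] by simp

end

section \<open>Derivatives of the standard frame and the trace of the Christoffel symbols\<close>

context ik_metric
begin

abbreviation G :: "real^4 \<Rightarrow> real^4^4" where "G \<equiv> Gmat a b c d"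

text \<open>Twice the derivative of log F in t, so that the gradient of log F at x is
  \<open>logF1\<close> times x.\<close>

definition logF1 :: "real \<Rightarrow> real" where "logF1 t = 4 * b / (Ff t)\<^sup>2"

lemma DERIV_F: assumes t: "t \<ge> 0" shows "(Ff has_real_derivative 2 * b / Ff t) (at t)"
proof -
  have p: "a + b * t > 0" using a b t by (simp add: add_pos_nonneg)
  then show ?thesis unfolding Ff_def[abs_def] by (auto intro!: derivative_eq_intros simp: field_simps)
qed

lemma pd_inv_F: "pd (\<lambda>y. inverse (Ff (y \<bullet> y))) k x = - logF1 (x \<bullet> x) * x $ k * inverse (Ff (x \<bullet> x))"
proof -
  have D: "((\<lambda>t. inverse (Ff t)) has_real_derivative - (2 * b / (Ff t) ^ 3)) (at t)" if t: "t \<ge> 0" for t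
    using F_pos[OF t] DERIV_F[OF t] by (auto intro!: derivative_eq_intros simp: field_simps power2_eq_square power3_eq_cube)
  have "pd (\<lambda>y. inverse (Ff (y \<bullet> y))) k x = 2 * x $ k * - (2 * b / (Ff (x \<bullet> x)) ^ 3)"
    by (rule pd_radial[OF D])
  then show ?thesis using F_pos[of "x \<bullet> x"] by (simp add: logF1_def field_simps power2_eq_square power3_eq_cube)
qed

lemma pd_Jw_coord: "pd (\<lambda>x. Jw x $ j) k x = Jw (axis k 1) $ j"
  unfolding pd_lin[OF bounded_linear_vec_nth smooth_of_linear[OF bl_Jw]] pd_of_linear[OF bl_Jw] ..

lemma pd_JJ: "pd (\<lambda>x. Jw x $ m * Jw x $ n) k x = Jw (axis k 1) $ m * Jw x $ n + Jw x $ m * Jw (axis k 1) $ n"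
  unfolding pd_mult[OF smooth_Jw_coord smooth_Jw_coord] pd_Jw_coord ..

lemma J_axis_inner: "(\<Sum>m\<in>UNIV. Jw (axis k 1) $ m * Jw x $ m) = x $ k"
proof -
  have "\<forall>k. (\<Sum>m\<in>UNIV. Jw (axis k 1) $ m * Jw x $ m) = x $ k"
    unfolding all4 sum4 by (simp add: qmul_comp axis_def)
  then show ?thesis by simp
qed

lemma pd_Fr: "pd (\<lambda>y. Fr y \<mu> m) k x = - logF1 (x \<bullet> x) * x $ k * Fr x \<mu> m + inverse (Ff (x \<bullet> x)) *
    (2 * x $ k * H1f c d (x \<bullet> x) * (Jw x $ \<mu> * Jw x $ m) + Hf c d (x \<bullet> x) * (Jw (axis k 1) $ \<mu> * Jw x $ m + Jw x $ \<mu> * Jw (axis k 1) $ m))"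
proof -
  have s: "smooth_map (\<lambda>y. (if \<mu> = m then 1 else 0) + Hf c d (y \<bullet> y) * (Jw y $ \<mu> * Jw y $ m))"
    by (intro smooth_mult smooth_add smooth_const smooth_H smooth_Jw_coord)
  have "pd (\<lambda>y. (if \<mu> = m then 1 else 0) + Hf c d (y \<bullet> y) * (Jw y $ \<mu> * Jw y $ m)) k x =
      2 * x $ k * H1f c d (x \<bullet> x) * (Jw x $ \<mu> * Jw x $ m) + Hf c d (x \<bullet> x) * (Jw (axis k 1) $ \<mu> * Jw x $ m + Jw x $ \<mu> * Jw (axis k 1) $ m)"
    unfolding pd_plus[OF smooth_const smooth_mult[OF smooth_H smooth_mult[OF smooth_Jw_coord smooth_Jw_coord]]]
      pd_mult[OF smooth_H smooth_mult[OF smooth_Jw_coord smooth_Jw_coord]] pd_JJ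
    using pd_radial[OF DERIV_H, of k x] by simp
  then show ?thesis
    unfolding Fr_def pd_mult[OF smooth_inv_F s] pd_inv_F by (simp only: mult_ac)
qed

text \<open>Besides the conformal term, the derivative of the rank-one part of \<open>Fr\<close> is
  contracted with the coframe; \<open>Jw\<close> is an eigenvector of the coframe, and H - H K t = K
  simplifies the coefficient.\<close>

lemma frame_derivative: "(\<Sum>m\<in>UNIV. pd (\<lambda>y. Fr y \<mu> m) k x * Th x \<nu> m) =
    - logF1 (x \<bullet> x) * x $ k * (if \<mu> = \<nu> then 1 else 0)
    + 2 * (1 - Kf c d (x \<bullet> x) * (x \<bullet> x)) * H1f c d (x \<bullet> x) * x $ k * (Jw x $ \<mu> * Jw x $ \<nu>)
    + Kf c d (x \<bullet> x) * (Jw (axis k 1) $ \<mu> * Jw x $ \<nu>)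
    + Hf c d (x \<bullet> x) * (Jw x $ \<mu> * (Jw (axis k 1) $ \<nu> - Kf c d (x \<bullet> x) * Jw x $ \<nu> * x $ k))"
proof -
  define t where "t = x \<bullet> x"
  define f K H H1 p where "f = Ff t" and "K = Kf c d t" and "H = Hf c d t" and "H1 = H1f c d t" and "p = logF1 t"
  define w A where "w = Jw x" and "A = Jw (axis k 1)"
  have t: "t \<ge> 0" by (simp add: t_def)
  have f: "inverse f * f = 1" using F_pos[OF t] by (simp add: f_def)
  have Th: "Th x \<nu> m = f * ((if \<nu> = m then 1 else 0) - K * w $ \<nu> * w $ m)" for m
    by (simp add: Th_def f_def K_def w_def t_def)
  have s1: "(\<Sum>m\<in>UNIV. w $ m * ((if \<nu> = m then 1 else 0) - K * w $ \<nu> * w $ m)) = (1 - K * t) * w $ \<nu>"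
  proof -
    have "(\<Sum>m\<in>UNIV. w $ m * ((if \<nu> = m then 1 else 0) - K * w $ \<nu> * w $ m)) = w $ \<nu> - K * w $ \<nu> * (w \<bullet> w)"
      by (simp add: right_diff_distrib sum_subtractf sum_distrib_left inner_vec_def if_distrib[of "\<lambda>c. _ * c"] mult_ac cong: if_cong)
    then show ?thesis by (simp add: w_def Jw_inner t_def algebra_simps)
  qed
  have s2: "(\<Sum>m\<in>UNIV. A $ m * ((if \<nu> = m then 1 else 0) - K * w $ \<nu> * w $ m)) = A $ \<nu> - K * w $ \<nu> * x $ k"
  proof -
    have "(\<Sum>m\<in>UNIV. A $ m * ((if \<nu> = m then 1 else 0) - K * w $ \<nu> * w $ m)) = A $ \<nu> - K * w $ \<nu> * (\<Sum>m\<in>UNIV. A $ m * w $ m)"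
      by (simp add: right_diff_distrib sum_subtractf sum_distrib_left if_distrib[of "\<lambda>c. _ * c"] mult_ac cong: if_cong)
    then show ?thesis by (simp only: A_def w_def J_axis_inner)
  qed
  have e: "pd (\<lambda>y. Fr y \<mu> m) k x * Th x \<nu> m = (- p * x $ k) * (Fr x \<mu> m * Th x \<nu> m)
      + (2 * x $ k * H1 * w $ \<mu> + H * A $ \<mu>) * (w $ m * ((if \<nu> = m then 1 else 0) - K * w $ \<nu> * w $ m))
      + (H * w $ \<mu>) * (A $ m * ((if \<nu> = m then 1 else 0) - K * w $ \<nu> * w $ m))" for m
  proof -
    have "pd (\<lambda>y. Fr y \<mu> m) k x * Th x \<nu> m = (- p * x $ k) * (Fr x \<mu> m * Th x \<nu> m)
      + (inverse f * f) * ((2 * x $ k * H1 * (w $ \<mu> * w $ m) + H * (A $ \<mu> * w $ m + w $ \<mu> * A $ m)) * ((if \<nu> = m then 1 else 0) - K * w $ \<nu> * w $ m))"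
      unfolding pd_Fr t_def[symmetric] f_def[symmetric] H_def[symmetric] H1_def[symmetric] p_def[symmetric] w_def[symmetric] A_def[symmetric]
      unfolding Th by (simp only: distrib_left distrib_right mult_ac)
    then show ?thesis unfolding f by (simp only: distrib_left distrib_right mult_ac mult_1_left add_ac)
  qed
  have "(\<Sum>m\<in>UNIV. pd (\<lambda>y. Fr y \<mu> m) k x * Th x \<nu> m) = - p * x $ k * (if \<mu> = \<nu> then 1 else 0)
      + (2 * x $ k * H1 * w $ \<mu> + H * A $ \<mu>) * ((1 - K * t) * w $ \<nu>) + (H * w $ \<mu>) * (A $ \<nu> - K * w $ \<nu> * x $ k)"
    unfolding e sum.distrib sum_distrib_left[symmetric] s1 s2 Fr_Th ..
  also have "\<dots> = - p * x $ k * (if \<mu> = \<nu> then 1 else 0) + 2 * (1 - K * t) * H1 * x $ k * (w $ \<mu> * w $ \<nu>)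
      + (H - H * K * t) * (A $ \<mu> * w $ \<nu>) + H * (w $ \<mu> * (A $ \<nu> - K * w $ \<nu> * x $ k))"
    by (simp add: algebra_simps)
  also have "H - H * K * t = K" using H_K[OF t] by (simp add: H_def K_def)
  finally show ?thesis unfolding t_def[symmetric] K_def H_def H1_def p_def w_def A_def .
qed

lemma DERIV_S: assumes t: "t \<ge> 0" shows "(Sf has_real_derivative S1f t) (at t)"
  unfolding Sf_def[abs_def] S1f_def
  using U_pos[OF t] by (auto intro!: derivative_eq_intros DERIV_U simp: power2_eq_square)

lemma smooth_S: "smooth_map (\<lambda>x::real^4. Sf (x \<bullet> x))"
  unfolding Sf_def using U_pos
  by (intro smooth_divide smooth_U smooth_add smooth_mult smooth_const smooth_inner smooth_id) auto

lemma smooth_G: "smooth_map (\<lambda>x. G x $ m $ n)"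
  unfolding Gmat_eq
  by (intro smooth_mult smooth_diff smooth_add smooth_const smooth_inner smooth_id smooth_S smooth_Jw_coord)

lemma pd_G: "pd (\<lambda>y. G y $ m $ n) k x =
    8 * b * x $ k * ((if m = n then 1 else 0) - Sf (x \<bullet> x) * (Jw x $ m * Jw x $ n))
    - 4 * (a + b * (x \<bullet> x)) * (2 * x $ k * S1f (x \<bullet> x) * (Jw x $ m * Jw x $ n)
        + Sf (x \<bullet> x) * (Jw (axis k 1) $ m * Jw x $ n + Jw x $ m * Jw (axis k 1) $ n))"
proof -
  have s1: "smooth_map (\<lambda>x::real^4. 4 * (a + b * (x \<bullet> x)))"
    by (intro smooth_mult smooth_add smooth_const smooth_inner smooth_id)
  have s2: "smooth_map (\<lambda>x. Sf (x \<bullet> x) * (Jw x $ m * Jw x $ n))" by (intro smooth_mult smooth_S smooth_Jw_coord)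
  have "((\<lambda>t. 4 * (a + b * t)) has_real_derivative 4 * b) (at t)" for t
    by (auto intro!: derivative_eq_intros)
  then have p1: "pd (\<lambda>x::real^4. 4 * (a + b * (x \<bullet> x))) k x = 8 * b * x $ k"
    using pd_radial[of "\<lambda>t. 4 * (a + b * t)" "\<lambda>t. 4 * b" k x] by simp
  have p2: "pd (\<lambda>x. Sf (x \<bullet> x) * (Jw x $ m * Jw x $ n)) k x =
      2 * x $ k * S1f (x \<bullet> x) * (Jw x $ m * Jw x $ n) + Sf (x \<bullet> x) * (Jw (axis k 1) $ m * Jw x $ n + Jw x $ m * Jw (axis k 1) $ n)"
    unfolding pd_mult[OF smooth_S smooth_mult[OF smooth_Jw_coord smooth_Jw_coord]] pd_JJ
    using pd_radial[OF DERIV_S, of k x] by simp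
  show ?thesis
    unfolding Gmat_eq pd_mult[OF s1 smooth_diff[OF smooth_const s2]] pd_diff[OF smooth_const s2] p1 p2 pd_of_const
    by (simp only: diff_0 mult_minus_right diff_conv_add_uminus[symmetric] add_uminus_conv_diff)
qed

text \<open>Contraction of the Christoffel symbols with the inverse metric, the only combination the
  Dirac operator sees. By symmetry the result is radial; the relation (1 + q t) S = q with q = c + d
  t makes the terms with b collapse to the logarithmic derivative of F.\<close>

lemma christoffel_contraction:
  "(\<Sum>k\<in>UNIV. \<Sum>l\<in>UNIV. christoffel G n k l x * (\<Sum>\<mu>\<in>UNIV. Fr x \<mu> k * Fr x \<mu> l)) =
    (c + d * (x \<bullet> x) - 2 * logF1 (x \<bullet> x) + 2 * V1f c d (x \<bullet> x) / Vf c d (x \<bullet> x)) * x $ n"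
proof -
  define t where "t = x \<bullet> x"
  have t: "t \<ge> 0" by (simp add: t_def)
  define \<alpha> q S S1 where "\<alpha> = a + b * t" and "q = c + d * t" and "S = Sf t" and "S1 = S1f t"
  define w A where "w = Jw x" and "A k = Jw (axis k 1)" for k
  have \<alpha>: "\<alpha> > 0" using a b t by (simp add: \<alpha>_def add_pos_nonneg)
  define D where "D k m n = 8 * b * x $ k * ((if m = n then 1 else 0) - S * (w $ m * w $ n))
    - 4 * \<alpha> * (2 * x $ k * S1 * (w $ m * w $ n) + S * (A k $ m * w $ n + w $ m * A k $ n))" for k m n
  \<comment> \<open>The inverse metric multiplied by 4 \<open>\<alpha>\<close>, as supplied by
    \<open>Fr_Fr\<close>.\<close>
  define M where "M k l = (if k = l then 1 else 0) + q * (w $ k * w $ l)" for k l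
  have D: "pd (\<lambda>y. G y $ m $ n) k x = D k m n" for k m n
    unfolding D_def pd_G t_def[symmetric] \<alpha>_def S_def S1_def w_def A_def ..
  have xw: "(\<Sum>k\<in>UNIV. x $ k * w $ k) = 0" using Jw_inner(1)[of x] by (simp add: w_def inner_vec_def)
  have ww: "(\<Sum>k\<in>UNIV. w $ k * w $ k) = t" using Jw_inner(2)[of x] by (simp add: w_def inner_vec_def t_def)
  have Aw: "(\<Sum>m\<in>UNIV. A k $ m * w $ m) = x $ k" for k unfolding A_def w_def by (rule J_axis_inner)
  have wA: "(\<Sum>k\<in>UNIV. w $ k * A k $ m) = - x $ m" for m
  proof -
    have "\<forall>m. (\<Sum>k\<in>UNIV. w $ k * A k $ m) = - x $ m" unfolding all4 sum4 A_def w_def by (simp add: qmul_comp axis_def)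
    then show ?thesis by simp
  qed
  have trA: "(\<Sum>k\<in>UNIV. A k $ k) = 0" unfolding sum4 A_def by (simp add: qmul_comp axis_def)
  have delta: "(\<Sum>k\<in>UNIV. (if n = k then 1 else 0) * y k) = y n" "(\<Sum>k\<in>(UNIV::4 set). (if k = k then 1 else 0)) = (4::real)" for y :: "4 \<Rightarrow> real" and n
    by (simp_all add: if_distrib[of "\<lambda>c. c * _"] cong: if_cong)
  have T1a: "(\<Sum>k\<in>UNIV. D k n k) = (8 * b + 4 * \<alpha> * S) * x $ n"
  proof -
    have "D k n k = 8 * b * ((if n = k then 1 else 0) * x $ k) - (8 * b * S * w $ n + 8 * \<alpha> * S1 * w $ n) * (x $ k * w $ k)
       - 4 * \<alpha> * S * (w $ k * A k $ n) - 4 * \<alpha> * S * w $ n * A k $ k" for k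
      unfolding D_def by (simp add: algebra_simps)
    then show ?thesis by (simp only: sum_subtractf sum_distrib_left[symmetric] delta xw wA trA; simp add: algebra_simps)
  qed
  have T1b: "(\<Sum>k\<in>UNIV. \<Sum>l\<in>UNIV. D k n l * (w $ k * w $ l)) = 4 * \<alpha> * S * t * x $ n"
  proof -
    have "D k n l * (w $ k * w $ l) = (8 * b * (x $ k * w $ k)) * ((if n = l then 1 else 0) * w $ l)
       - ((8 * b * S * w $ n + 8 * \<alpha> * S1 * w $ n) * (x $ k * w $ k)) * (w $ l * w $ l)
       - (4 * \<alpha> * S * (w $ k * A k $ n)) * (w $ l * w $ l) - (4 * \<alpha> * S * w $ n * w $ k) * (A k $ l * w $ l)" for k l
      unfolding D_def by (simp add: algebra_simps)
    then have i: "(\<Sum>l\<in>UNIV. D k n l * (w $ k * w $ l)) = ((8 * b * w $ n) * (x $ k * w $ k)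
       - ((8 * b * S * w $ n + 8 * \<alpha> * S1 * w $ n) * t) * (x $ k * w $ k) - (4 * \<alpha> * S * t) * (w $ k * A k $ n) - (4 * \<alpha> * S * w $ n) * (x $ k * w $ k))" for k
      by (simp only: sum_subtractf sum_distrib_left[symmetric] delta ww Aw; simp add: mult_ac)
    show ?thesis unfolding i by (simp only: sum_subtractf sum_distrib_left[symmetric] xw wA; simp add: algebra_simps)
  qed
  have T2a: "(\<Sum>k\<in>UNIV. D n k k) = (8 * b * (4 - S * t) - 8 * \<alpha> * (S1 * t + S)) * x $ n"
  proof -
    have "D n k k = 8 * b * x $ n * (if k = k then 1 else 0) - (8 * b * x $ n * S + 8 * \<alpha> * x $ n * S1) * (w $ k * w $ k)
       - 8 * \<alpha> * S * (A n $ k * w $ k)" for k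
      unfolding D_def by (simp add: algebra_simps)
    then show ?thesis by (simp only: sum_subtractf sum_distrib_left[symmetric] delta ww Aw; simp add: algebra_simps)
  qed
  have T2b: "(\<Sum>k\<in>UNIV. \<Sum>l\<in>UNIV. D n k l * (w $ k * w $ l)) = (8 * b * (t - S * t\<^sup>2) - 8 * \<alpha> * (S1 * t\<^sup>2 + S * t)) * x $ n"
  proof -
    have "D n k l * (w $ k * w $ l) = (8 * b * x $ n * w $ k) * ((if k = l then 1 else 0) * w $ l)
       - ((8 * b * x $ n * S + 8 * \<alpha> * x $ n * S1) * (w $ k * w $ k)) * (w $ l * w $ l)
       - (4 * \<alpha> * S * (A n $ k * w $ k)) * (w $ l * w $ l) - (4 * \<alpha> * S * (w $ k * w $ k)) * (A n $ l * w $ l)" for k l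
      unfolding D_def by (simp add: algebra_simps)
    then have i: "(\<Sum>l\<in>UNIV. D n k l * (w $ k * w $ l)) = ((8 * b * x $ n) * (w $ k * w $ k)
       - ((8 * b * x $ n * S + 8 * \<alpha> * x $ n * S1) * t) * (w $ k * w $ k)
       - (4 * \<alpha> * S * t) * (A n $ k * w $ k) - (4 * \<alpha> * S * x $ n) * (w $ k * w $ k))" for k
      by (simp only: sum_subtractf sum_distrib_left[symmetric] delta ww Aw; simp add: mult_ac)
    show ?thesis unfolding i by (simp only: sum_subtractf sum_distrib_left[symmetric] ww Aw; simp add: algebra_simps power2_eq_square)
  qed
  have M: "(\<Sum>k\<in>UNIV. \<Sum>l\<in>UNIV. Y k l * M k l) = (\<Sum>k\<in>UNIV. Y k k) + q * (\<Sum>k\<in>UNIV. \<Sum>l\<in>UNIV. Y k l * (w $ k * w $ l))" for Y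
  proof -
    have "Y k l * M k l = (if k = l then 1 else 0) * Y k l + q * (Y k l * (w $ k * w $ l))" for k l
      unfolding M_def by (simp add: algebra_simps)
    then show ?thesis by (simp only: sum.distrib sum_distrib_left[symmetric] delta)
  qed
  have Ms: "M k l = M l k" for k l by (auto simp: M_def)
  have sw: "(\<Sum>k\<in>UNIV. \<Sum>l\<in>UNIV. D l n k * M k l) = (\<Sum>k\<in>UNIV. \<Sum>l\<in>UNIV. D k n l * M k l)"
    by (subst sum.swap) (intro sum.cong refl arg_cong2[of _ _ _ _ "(*)"] Ms)
  have e: "christoffel G n k l x * (\<Sum>\<mu>\<in>UNIV. Fr x \<mu> k * Fr x \<mu> l) = (1 / (8 * \<alpha>)) * (D k n l * M k l + D l n k * M k l - D n k l * M k l)" for k l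
    unfolding christoffel_def D Fr_Fr t_def[symmetric] w_def[symmetric] \<alpha>_def[symmetric] q_def[symmetric] M_def[symmetric]
    by (simp add: algebra_simps diff_divide_distrib add_divide_distrib)
  have "(\<Sum>k\<in>UNIV. \<Sum>l\<in>UNIV. christoffel G n k l x * (\<Sum>\<mu>\<in>UNIV. Fr x \<mu> k * Fr x \<mu> l)) =
      1 / (8 * \<alpha>) * (2 * ((8 * b + 4 * \<alpha> * S) * x $ n + q * (4 * \<alpha> * S * t * x $ n))
        - ((8 * b * (4 - S * t) - 8 * \<alpha> * (S1 * t + S)) * x $ n + q * ((8 * b * (t - S * t\<^sup>2) - 8 * \<alpha> * (S1 * t\<^sup>2 + S * t)) * x $ n)))"
    unfolding e sum_distrib_left[symmetric] sum.distrib sum_subtractf sw M T1a T1b T2a T2b by simp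
  also have "\<dots> = 1 / (8 * \<alpha>) * ((8 * \<alpha> * (S * (1 + q * t)) - 16 * b + 8 * b * t * (S * (1 + q * t) - q) + 8 * \<alpha> * ((S1 * t + S) * (1 + q * t))) * x $ n)"
    by (simp add: algebra_simps power2_eq_square)
  also have "S * (1 + q * t) = q"
  proof -
    have "1 + q * t = Uf c d t" by (simp add: Uf_def q_def power2_eq_square algebra_simps)
    then show ?thesis using U_pos[OF t] by (simp add: S_def Sf_def q_def)
  qed
  also have "(S1 * t + S) * (1 + q * t) = 2 * V1f c d t / Vf c d t"
  proof -
    have U: "1 + q * t = Uf c d t" by (simp add: Uf_def q_def power2_eq_square algebra_simps)
    have V: "Vf c d t > 0" by (rule V_pos[OF t])
    have "S1 * t + S = (d * t * Uf c d t - (Uf c d t - 1) * (c + 2 * d * t) + q * Uf c d t) / (Uf c d t)\<^sup>2"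
      unfolding U[symmetric] using U_pos[OF t] unfolding S1_def S_def S1f_def Sf_def q_def[symmetric] U[symmetric]
      by (simp add: divide_simps) (simp add: algebra_simps power2_eq_square)
    also have "d * t * Uf c d t - (Uf c d t - 1) * (c + 2 * d * t) + q * Uf c d t = c + 2 * d * t"
      by (simp add: q_def algebra_simps)
    also have "c + 2 * d * t = 2 * Vf c d t * V1f c d t" using V1_eq[OF t] by simp
    finally show ?thesis unfolding U using V by (simp add: U_V[OF t] power2_eq_square)
  qed
  also have "1 / (8 * \<alpha>) * ((8 * \<alpha> * q - 16 * b + 8 * b * t * (q - q) + 8 * \<alpha> * (2 * V1f c d t / Vf c d t)) * x $ n) =
      (q - 2 * (b / \<alpha>) + 2 * V1f c d t / Vf c d t) * x $ n"
    using \<alpha> by (simp add: field_simps)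
  also have "b / \<alpha> = logF1 t" unfolding logF1_def F_sq[OF t] \<alpha>_def by (rule mult_divide_mult_cancel_left[symmetric]) simp
  finally show ?thesis unfolding q_def t_def .
qed

end

section \<open>Reduction of the Dirac operator in an arbitrary frame to \<open>Lop\<close>\<close>

section \<open>The Dirac operator of the Iwai-Katayama metric\<close>

lemma sum_swap4:
  fixes T :: "4 \<Rightarrow> 4 \<Rightarrow> 4 \<Rightarrow> 4 \<Rightarrow> 'b::comm_monoid_add"
  shows "(\<Sum>m\<in>UNIV. \<Sum>n\<in>UNIV. \<Sum>\<mu>\<in>UNIV. \<Sum>\<nu>\<in>UNIV. T m n \<mu> \<nu>) = (\<Sum>\<mu>\<in>UNIV. \<Sum>\<nu>\<in>UNIV. \<Sum>m\<in>UNIV. \<Sum>n\<in>UNIV. T m n \<mu> \<nu>)"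
proof -
  have "(\<Sum>m\<in>UNIV. \<Sum>n\<in>UNIV. \<Sum>\<mu>\<in>UNIV. \<Sum>\<nu>\<in>UNIV. T m n \<mu> \<nu>) = (\<Sum>m\<in>UNIV. \<Sum>\<mu>\<in>UNIV. \<Sum>n\<in>UNIV. \<Sum>\<nu>\<in>UNIV. T m n \<mu> \<nu>)"
    by (rule sum.cong[OF refl]) (rule sum.swap)
  also have "\<dots> = (\<Sum>\<mu>\<in>UNIV. \<Sum>m\<in>UNIV. \<Sum>n\<in>UNIV. \<Sum>\<nu>\<in>UNIV. T m n \<mu> \<nu>)"
    by (rule sum.swap)
  also have "\<dots> = (\<Sum>\<mu>\<in>UNIV. \<Sum>m\<in>UNIV. \<Sum>\<nu>\<in>UNIV. \<Sum>n\<in>UNIV. T m n \<mu> \<nu>)"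
    by (rule sum.cong[OF refl], rule sum.cong[OF refl]) (rule sum.swap)
  also have "\<dots> = (\<Sum>\<mu>\<in>UNIV. \<Sum>\<nu>\<in>UNIV. \<Sum>m\<in>UNIV. \<Sum>n\<in>UNIV. T m n \<mu> \<nu>)"
    by (rule sum.cong[OF refl]) (rule sum.swap)
  finally show ?thesis .
qed

lemma sum_bilinear:
  fixes p q :: "4 \<Rightarrow> real"
  shows "(\<Sum>m\<in>UNIV. \<Sum>n\<in>UNIV. C m n * (\<Sum>\<mu>\<in>UNIV. p \<mu> * f \<mu> m) * (\<Sum>\<nu>\<in>UNIV. q \<nu> * f' \<nu> n)) =
    (\<Sum>\<mu>\<in>UNIV. \<Sum>\<nu>\<in>UNIV. p \<mu> * q \<nu> * (\<Sum>m\<in>UNIV. \<Sum>n\<in>(UNIV::4 set). C m n * f \<mu> (m::4) * f' \<nu> n))"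
proof -
  have "C m n * (\<Sum>\<mu>\<in>UNIV. p \<mu> * f \<mu> m) * (\<Sum>\<nu>\<in>UNIV. q \<nu> * f' \<nu> n) = (\<Sum>\<mu>\<in>UNIV. \<Sum>\<nu>\<in>UNIV. p \<mu> * q \<nu> * (C m n * f \<mu> m * f' \<nu> n))" for m n
    by (simp only: sum_distrib_left sum_distrib_right mult_ac)
  then show ?thesis by (simp only: sum_distrib_left sum_swap4[of "\<lambda>m n \<mu> \<nu>. p \<mu> * q \<nu> * (C m n * f \<mu> m * f' \<nu> n)"])
qed

lemma sum_bilinear_diag:
  fixes p q :: "4 \<Rightarrow> real"
  shows "(\<Sum>m\<in>UNIV. (\<Sum>\<mu>\<in>UNIV. p \<mu> * f \<mu> m) * (\<Sum>\<nu>\<in>UNIV. q \<nu> * f' \<nu> m)) =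
    (\<Sum>\<mu>\<in>UNIV. \<Sum>\<nu>\<in>UNIV. p \<mu> * q \<nu> * (\<Sum>m\<in>(UNIV::4 set). f \<mu> m * f' \<nu> m))"
proof -
  have d: "(\<Sum>n\<in>UNIV. (if m = n then 1 else 0) * y * z n) = y * z (m::4)" for m and y :: real and z
    by (simp add: if_distrib[of "\<lambda>c. c * _"] cong: if_cong)
  show ?thesis using sum_bilinear[of "\<lambda>m n. if m = n then 1 else 0" p f q f'] unfolding d by simp
qed

lemma gam_apply:
  "(gam 0 *v v) $ 0 = - \<i> * v $ 3" "(gam 0 *v v) $ 1 = - \<i> * v $ 2" "(gam 0 *v v) $ 2 = \<i> * v $ 1" "(gam 0 *v v) $ 3 = \<i> * v $ 0"
  "(gam 1 *v v) $ 0 = - v $ 3" "(gam 1 *v v) $ 1 = v $ 2" "(gam 1 *v v) $ 2 = v $ 1" "(gam 1 *v v) $ 3 = - v $ 0"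
  "(gam 2 *v v) $ 0 = - \<i> * v $ 2" "(gam 2 *v v) $ 1 = \<i> * v $ 3" "(gam 2 *v v) $ 2 = \<i> * v $ 0" "(gam 2 *v v) $ 3 = - \<i> * v $ 1"
  "(gam 3 *v v) $ 0 = v $ 2" "(gam 3 *v v) $ 1 = v $ 3" "(gam 3 *v v) $ 2 = v $ 0" "(gam 3 *v v) $ 3 = v $ 1"
  by (simp_all add: gam_def mat_of_list_def matrix_vector_mult_def sum4 idx4_def)

lemma clifford_gam: "clifford (\<lambda>i v. gam i *v v)"
proof
  show "gam i *v (v + w) = gam i *v v + gam i *v w" for i v w by (rule matrix_vector_right_distrib)
  show "gam i *v (r *\<^sub>R v) = r *\<^sub>R (gam i *v v)" for i r v
    by (simp add: matrix_vector_mult_def vec_eq_iff scaleR_sum_right mult_scaleR_right)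
  have "\<forall>i. (gam i *v v) \<bullet> w = v \<bullet> (gam i *v w)" for v w
    unfolding all4 inner_vec_def sum4 gam_apply by (simp add: inner_complex_def)
  then show "(gam i *v v) \<bullet> w = v \<bullet> (gam i *v w)" for i v w by (rule spec)
  have "\<forall>i j. gam i *v (gam j *v v) + gam j *v (gam i *v v) = (if i = j then 2 else 0) *\<^sub>R v" for v
    unfolding all4 vec4_eq_iff vector_add_component vector_scaleR_component gam_apply by (simp add: complex_eq_iff)
  then show "gam i *v (gam j *v v) + gam j *v (gam i *v v) = (if i = j then 2 else 0) *\<^sub>R v" for i j v by simp
qed

locale ik_frame = ik_metric c d a b for c d a b :: real +
  fixes E :: "real^4 \<Rightarrow> real^4^4"
  assumes frame: "smooth_orthonormal_frame (Gmat a b c d) E"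
begin

text \<open>The matrix expressing the given frame in the standard one, orthogonal because both
  frames are orthonormal. Its determinant may have either sign; only the orthogonality relations are
  used.\<close>

definition Q :: "real^4 \<Rightarrow> 4 \<Rightarrow> 4 \<Rightarrow> real" where
  "Q x i \<mu> = (\<Sum>m\<in>UNIV. E x $ i $ m * Th x \<mu> m)"

lemma smooth_E: "smooth_map (\<lambda>x. E x $ i $ m)"
  by (rule frame[unfolded smooth_orthonormal_frame_def smooth_fun_eq, THEN conjunct1, rule_format])

lemma E_orth: "(\<Sum>m\<in>UNIV. \<Sum>n\<in>UNIV. G x $ m $ n * E x $ i $ m * E x $ j $ n) = (if i = j then 1 else 0)"
  by (rule frame[unfolded smooth_orthonormal_frame_def, THEN conjunct2, rule_format])

lemma smooth_Q': "smooth_map (\<lambda>x. Q x i \<mu>)"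
  unfolding Q_def by (intro smooth_sum smooth_mult smooth_E smooth_Th)

lemma Q_row: "(\<Sum>\<mu>\<in>UNIV. Q x i \<mu> * Q x j \<mu>) = (if i = j then 1 else 0)"
proof -
  have "(\<Sum>\<mu>\<in>UNIV. Q x i \<mu> * Q x j \<mu>) = (\<Sum>m\<in>UNIV. \<Sum>n\<in>UNIV. E x $ i $ m * E x $ j $ n * (\<Sum>\<mu>\<in>UNIV. Th x \<mu> m * Th x \<mu> n))"
    unfolding Q_def by (rule sum_bilinear_diag)
  also have "\<dots> = (\<Sum>m\<in>UNIV. \<Sum>n\<in>UNIV. G x $ m $ n * E x $ i $ m * E x $ j $ n)"
    unfolding Th_Th by (simp only: mult_ac)
  also have "\<dots> = (if i = j then 1 else 0)" by (rule E_orth)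
  finally show ?thesis .
qed

lemma Q_col: "(\<Sum>i\<in>UNIV. Q x i \<mu> * Q x i \<nu>) = (if \<mu> = \<nu> then 1 else 0)"
proof -
  define q :: "real^4^4" where "q = (\<chi> i \<mu>. Q x i \<mu>)"
  have "q ** transpose q = mat 1"
    by (simp add: vec_eq_iff matrix_matrix_mult_def transpose_def q_def mat_def Q_row)
  then have "transpose q ** q = mat 1" by (rule matrix_left_right_inverse[THEN iffD1])
  then have "(transpose q ** q) $ \<mu> $ \<nu> = mat 1 $ \<mu> $ \<nu>" by simp
  then show ?thesis by (simp add: matrix_matrix_mult_def transpose_def q_def mat_def)
qed

lemma E_Q: "E x $ i $ m = (\<Sum>\<mu>\<in>UNIV. Q x i \<mu> * Fr x \<mu> m)"
proof -
  have "(\<Sum>\<mu>\<in>UNIV. Q x i \<mu> * Fr x \<mu> m) = (\<Sum>n\<in>UNIV. E x $ i $ n * (\<Sum>\<mu>\<in>UNIV. Fr x \<mu> m * Th x \<mu> n))"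
    unfolding Q_def sum_distrib_left sum_distrib_right by (subst sum.swap) (simp only: mult_ac)
  then show ?thesis unfolding Fr_Th_col by (simp add: if_distrib[of "\<lambda>c. _ * c"] cong: if_cong)
qed

lemma G_E: "(\<Sum>n\<in>UNIV. G x $ m $ n * E x $ j $ n) = (\<Sum>\<nu>\<in>UNIV. Q x j \<nu> * Th x \<nu> m)"
  unfolding Th_Th[symmetric] Q_def sum_distrib_left sum_distrib_right by (subst sum.swap) (simp only: mult_ac)

sublocale berger_dirac "\<lambda>i v. gam i *v v" Q c d
  by (intro berger_dirac.intro moving_clifford.intro clifford_gam moving_clifford_axioms.intro smooth_Q' Q_row Q_col radial_profile_axioms)

text \<open>The Levi-Civita connection matrix of the standard frame \<open>Fr\<close>,
  differentiated along coordinate directions.\<close>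

definition om :: "4 \<Rightarrow> real^4 \<Rightarrow> 4 \<Rightarrow> 4 \<Rightarrow> real" where
  "om k x \<mu> \<nu> = (\<Sum>m\<in>UNIV. pd (\<lambda>y. Fr y \<mu> m) k x * Th x \<nu> m)
     + (\<Sum>n\<in>UNIV. \<Sum>l\<in>UNIV. christoffel G n k l x * Fr x \<nu> n * Fr x \<mu> l)"

text \<open>The gauge transformation law of connection forms under E = Q \<open>Fr\<close>: the
  standard connection conjugated by Q, plus the pure gauge term \<open>Om\<close>.\<close>

lemma conn_form_eq: "conn_form G E e i j x =
  (\<Sum>k\<in>UNIV. E x $ e $ k * ((\<Sum>\<mu>\<in>UNIV. \<Sum>\<nu>\<in>UNIV. Q x i \<mu> * Q x j \<nu> * om k x \<mu> \<nu>) + Om k x i j))"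
proof -
  have pE: "pd (\<lambda>y. E y $ i $ m) k x = (\<Sum>\<mu>\<in>UNIV. pd (\<lambda>y. Q y i \<mu>) k x * Fr x \<mu> m) + (\<Sum>\<mu>\<in>UNIV. Q x i \<mu> * pd (\<lambda>y. Fr y \<mu> m) k x)" for k m
  proof -
    have "pd (\<lambda>y. E y $ i $ m) k x = (\<Sum>\<mu>\<in>UNIV. pd (\<lambda>y. Q y i \<mu> * Fr y \<mu> m) k x)"
      unfolding E_Q by (rule pd_sum) (simp, intro smooth_mult smooth_Q' smooth_Fr)
    then show ?thesis by (simp only: pd_mult[OF smooth_Q' smooth_Fr] sum.distrib)
  qed
  have one: "(\<Sum>m\<in>UNIV. pd (\<lambda>y. E y $ i $ m) k x * (\<Sum>\<nu>\<in>UNIV. Q x j \<nu> * Th x \<nu> m)) =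
      (\<Sum>\<mu>\<in>UNIV. \<Sum>\<nu>\<in>UNIV. Q x i \<mu> * Q x j \<nu> * (\<Sum>m\<in>UNIV. pd (\<lambda>y. Fr y \<mu> m) k x * Th x \<nu> m)) + Om k x i j" for k
    unfolding pE distrib_right sum.distrib sum_bilinear_diag Fr_Th Om_def
    by (simp add: if_distrib[of "\<lambda>c. _ * c"] cong: if_cong)
  have two: "(\<Sum>n\<in>UNIV. \<Sum>l\<in>UNIV. christoffel G n k l x * E x $ j $ n * E x $ i $ l) =
      (\<Sum>\<mu>\<in>UNIV. \<Sum>\<nu>\<in>UNIV. Q x i \<mu> * Q x j \<nu> * (\<Sum>n\<in>UNIV. \<Sum>l\<in>UNIV. christoffel G n k l x * Fr x \<nu> n * Fr x \<mu> l))" for k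
    unfolding E_Q sum_bilinear by (subst sum.swap) (simp only: mult_ac)
  have "(\<Sum>m\<in>UNIV. \<Sum>n\<in>UNIV. G x $ m $ n * (\<Sum>k\<in>UNIV. E x $ e $ k * pd (\<lambda>y. E y $ i $ m) k x) * E x $ j $ n) =
      (\<Sum>m\<in>UNIV. (\<Sum>k\<in>UNIV. E x $ e $ k * pd (\<lambda>y. E y $ i $ m) k x) * (\<Sum>n\<in>UNIV. G x $ m $ n * E x $ j $ n))"
    by (simp only: sum_distrib_left mult_ac)
  also have "\<dots> = (\<Sum>k\<in>UNIV. E x $ e $ k * (\<Sum>m\<in>UNIV. pd (\<lambda>y. E y $ i $ m) k x * (\<Sum>n\<in>UNIV. G x $ m $ n * E x $ j $ n)))"
    unfolding sum_distrib_right sum_distrib_left[of "E x $ e $ _"] by (subst sum.swap) (simp only: mult.assoc)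
  finally have A: "(\<Sum>m\<in>UNIV. \<Sum>n\<in>UNIV. G x $ m $ n * (\<Sum>k\<in>UNIV. E x $ e $ k * pd (\<lambda>y. E y $ i $ m) k x) * E x $ j $ n) =
      (\<Sum>k\<in>UNIV. E x $ e $ k * (\<Sum>m\<in>UNIV. pd (\<lambda>y. E y $ i $ m) k x * (\<Sum>\<nu>\<in>UNIV. Q x j \<nu> * Th x \<nu> m)))"
    unfolding G_E .
  have B: "(\<Sum>n\<in>UNIV. \<Sum>k\<in>UNIV. \<Sum>l\<in>UNIV. christoffel G n k l x * E x $ e $ k * E x $ i $ l * E x $ j $ n) =
      (\<Sum>k\<in>UNIV. E x $ e $ k * (\<Sum>n\<in>UNIV. \<Sum>l\<in>UNIV. christoffel G n k l x * E x $ j $ n * E x $ i $ l))"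
    by (subst sum.swap) (simp only: sum_distrib_left mult_ac)
  show ?thesis
    unfolding conn_form_def A B one two om_def distrib_left sum.distrib by (simp only: add_ac)
qed

definition Fv :: "real^4 \<Rightarrow> 4 \<Rightarrow> real^4" where "Fv x k = (\<chi> \<mu>. Fr x \<mu> k)"

lemma frame_gam: "(\<Sum>e\<in>UNIV. E x $ e $ k *\<^sub>R (gam e *v v)) = sl' x (Fv x k) v"
  unfolding E_Q P.sl_def gm_def Fv_def scaleR_sum_left scaleR_sum_right
  by (subst sum.swap) (simp add: mult.commute)

lemma rotated_bivector:
  "(\<Sum>i\<in>UNIV. \<Sum>j\<in>UNIV. (\<Sum>\<mu>\<in>UNIV. \<Sum>\<nu>\<in>UNIV. Q x i \<mu> * Q x j \<nu> * M \<mu> \<nu>) *\<^sub>R (gam i *v (gam j *v v))) =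
   (\<Sum>\<mu>\<in>UNIV. \<Sum>\<nu>\<in>UNIV. M \<mu> \<nu> *\<^sub>R gm x \<mu> (gm x \<nu> v))"
proof -
  have "M \<mu> \<nu> *\<^sub>R gm x \<mu> (gm x \<nu> v) = (\<Sum>i\<in>UNIV. \<Sum>j\<in>UNIV. (Q x i \<mu> * Q x j \<nu> * M \<mu> \<nu>) *\<^sub>R (gam i *v (gam j *v v)))" for \<mu> \<nu>
    by (simp add: gm_def g_simps scaleR_sum_right mult_ac)
  then have "(\<Sum>\<mu>\<in>UNIV. \<Sum>\<nu>\<in>UNIV. M \<mu> \<nu> *\<^sub>R gm x \<mu> (gm x \<nu> v)) =
     (\<Sum>\<mu>\<in>UNIV. \<Sum>\<nu>\<in>UNIV. \<Sum>i\<in>UNIV. \<Sum>j\<in>UNIV. (Q x i \<mu> * Q x j \<nu> * M \<mu> \<nu>) *\<^sub>R (gam i *v (gam j *v v)))"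
    by (simp only:)
  also have "\<dots> = (\<Sum>i\<in>UNIV. \<Sum>j\<in>UNIV. \<Sum>\<mu>\<in>UNIV. \<Sum>\<nu>\<in>UNIV. (Q x i \<mu> * Q x j \<nu> * M \<mu> \<nu>) *\<^sub>R (gam i *v (gam j *v v)))"
    by (rule sum_swap4)
  finally show ?thesis unfolding scaleR_sum_left by (rule sym)
qed

text \<open>The pure gauge part of the connection turns the partial derivative into
  \<open>cov\<close>, and the conjugated part turns the constant gamma matrices into
  \<open>gm\<close>. What remains is the Dirac operator in the standard frame.\<close>

lemma dirac_moving_frame:
  "dirac G E \<psi> x = (\<Sum>k\<in>UNIV. sl' x (Fv x k) (cov k \<psi> x - (1/4) *\<^sub>R (\<Sum>\<mu>\<in>UNIV. \<Sum>\<nu>\<in>UNIV. om k x \<mu> \<nu> *\<^sub>R gm x \<mu> (gm x \<nu> (\<psi> x)))))"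
proof -
  define Z where "Z k = (\<Sum>\<mu>\<in>UNIV. \<Sum>\<nu>\<in>UNIV. om k x \<mu> \<nu> *\<^sub>R gm x \<mu> (gm x \<nu> (\<psi> x)))" for k
  have s: "spin_cov G E \<psi> e x = (\<Sum>k\<in>UNIV. E x $ e $ k *\<^sub>R (cov k \<psi> x - (1/4) *\<^sub>R Z k))" for e
  proof -
    have "(\<Sum>i\<in>UNIV. \<Sum>j\<in>UNIV. (conn_form G E e i j x / 4) *\<^sub>R ((gam i ** gam j) *v \<psi> x)) =
        (\<Sum>k\<in>UNIV. (E x $ e $ k / 4) *\<^sub>R (\<Sum>i\<in>UNIV. \<Sum>j\<in>UNIV. ((\<Sum>\<mu>\<in>UNIV. \<Sum>\<nu>\<in>UNIV. Q x i \<mu> * Q x j \<nu> * om k x \<mu> \<nu>) + Om k x i j) *\<^sub>R (gam i *v (gam j *v \<psi> x))))"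
      (is "?l = (\<Sum>k\<in>UNIV. (E x $ e $ k / 4) *\<^sub>R (\<Sum>i\<in>UNIV. \<Sum>j\<in>UNIV. ?R k i j *\<^sub>R ?v i j))")
    proof -
      have "(conn_form G E e i j x / 4) *\<^sub>R ((gam i ** gam j) *v \<psi> x) = (\<Sum>k\<in>UNIV. (E x $ e $ k / 4 * ?R k i j) *\<^sub>R ?v i j)" for i j
        unfolding conn_form_eq matrix_vector_mul_assoc[symmetric] sum_divide_distrib scaleR_sum_left by (simp only: times_divide_eq_left)
      then have "?l = (\<Sum>i\<in>UNIV. \<Sum>j\<in>UNIV. \<Sum>k\<in>UNIV. (E x $ e $ k / 4 * ?R k i j) *\<^sub>R ?v i j)" by (simp only:)
      also have "\<dots> = (\<Sum>i\<in>UNIV. \<Sum>k\<in>UNIV. \<Sum>j\<in>UNIV. (E x $ e $ k / 4 * ?R k i j) *\<^sub>R ?v i j)"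
        by (rule sum.cong[OF refl]) (rule sum.swap)
      also have "\<dots> = (\<Sum>k\<in>UNIV. \<Sum>i\<in>UNIV. \<Sum>j\<in>UNIV. (E x $ e $ k / 4 * ?R k i j) *\<^sub>R ?v i j)"
        by (rule sum.swap)
      finally show ?thesis by (simp only: scaleR_sum_right scaleR_scaleR)
    qed
    then have "(\<Sum>i\<in>UNIV. \<Sum>j\<in>UNIV. (conn_form G E e i j x / 4) *\<^sub>R ((gam i ** gam j) *v \<psi> x)) =
        (\<Sum>k\<in>UNIV. (E x $ e $ k / 4) *\<^sub>R (Z k + biv (Om k x) (\<psi> x)))"
      by (simp only: scaleR_add_left sum.distrib rotated_bivector Z_def biv_def)
    then have "spin_cov G E \<psi> e x = (\<Sum>k\<in>UNIV. E x $ e $ k *\<^sub>R pd \<psi> k x) - (\<Sum>k\<in>UNIV. (E x $ e $ k / 4) *\<^sub>R (Z k + biv (Om k x) (\<psi> x)))"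
      unfolding spin_cov_def by (rule arg_cong)
    also have "\<dots> = (\<Sum>k\<in>UNIV. E x $ e $ k *\<^sub>R (cov k \<psi> x - (1/4) *\<^sub>R Z k))"
      unfolding sum_subtractf[symmetric] cov_def by (rule sum.cong[OF refl]) (simp add: scaleR_diff_right scaleR_add_right)
    finally show ?thesis .
  qed
  have "dirac G E \<psi> x = (\<Sum>k\<in>UNIV. \<Sum>e\<in>UNIV. E x $ e $ k *\<^sub>R (gam e *v (cov k \<psi> x - (1/4) *\<^sub>R Z k)))"
    unfolding dirac_def s g_simps by (rule sum.swap)
  then show ?thesis by (simp only: frame_gam Z_def)
qed

text \<open>The connection terms reduce to multiples of x and of x times the orientation element.
  The latter is already in \<open>zo\<close>. Of the former, 3/2 times the gradient of log F is the
  conformal correction in dimension 4, and V1 / V times x is the gradient of log of the square root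
  of V, the half-density correction.\<close>

lemma dirac_Lop:
  "Ff (x \<bullet> x) *\<^sub>R dirac G E \<psi> x = Lop \<psi> x + (3/2 * logF1 (x \<bullet> x) - V1f c d (x \<bullet> x) / Vf c d (x \<bullet> x)) *\<^sub>R sl' x x (\<psi> x)"
proof -
  define t where "t = x \<bullet> x"
  have t: "t \<ge> 0" by (simp add: t_def)
  define f H K H1 p V V1 where "f = Ff t" and "H = Hf c d t" and "K = Kf c d t" and "H1 = H1f c d t" and "p = logF1 t"
    and "V = Vf c d t" and "V1 = V1f c d t"
  define w where "w = Jw x"
  have f: "f > 0" unfolding f_def by (rule F_pos[OF t])
  define v where "v = \<psi> x"
  define B where "B k v = gm x k v + (H * w $ k) *\<^sub>R sl' x w v" for k v
  have fB: "f *\<^sub>R sl' x (Fv x k) v = B k v" for k v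
  proof -
    have "f *\<^sub>R Fv x k = axis k 1 + (H * w $ k) *\<^sub>R w"
    proof -
      have c: "f * (inverse f * y) = y" for y using f by simp
      show ?thesis
        unfolding Fv_def Fr_def t_def[symmetric] f_def[symmetric] H_def[symmetric] w_def[symmetric]
        by (simp add: vec_eq_iff c axis_def)
    qed
    then have "sl' x (f *\<^sub>R Fv x k) v = B k v"
      by (simp only: P.sl_add_left P.sl_scaleR_left P.sl_axis B_def)
    then show ?thesis by (simp only: P.sl_scaleR_left)
  qed
  have linB: "linear (B k)" for k
    unfolding B_def[abs_def] by (intro linear_compose_add P.lin_g linear_compose_scale_right P.lin_sl)
  define Za Zc where "Za k = (\<Sum>\<mu>\<in>UNIV. \<Sum>\<nu>\<in>UNIV. (\<Sum>m\<in>UNIV. pd (\<lambda>y. Fr y \<mu> m) k x * Th x \<nu> m) *\<^sub>R gm x \<mu> (gm x \<nu> v))"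
    and "Zc k = (\<Sum>\<mu>\<in>UNIV. \<Sum>\<nu>\<in>UNIV. (\<Sum>n\<in>UNIV. \<Sum>l\<in>UNIV. christoffel G n k l x * Fr x \<nu> n * Fr x \<mu> l) *\<^sub>R gm x \<mu> (gm x \<nu> v))" for k
  have one: "(\<Sum>k\<in>UNIV. B k (cov k \<psi> x)) = dirac0 \<psi> x + H *\<^sub>R sl' x w (covw \<psi> x)"
    unfolding B_def dirac0_def covw_def w_def[symmetric] by (simp add: sum.distrib P.sl_simps scaleR_sum_right)
  have two: "(\<Sum>k\<in>UNIV. B k (Za k)) = (- 4 * p + 2 * (1 - K * t) * H1 * t + 2 * K - H\<^sup>2 * t) *\<^sub>R sl' x x v + (2 * (H - K)) *\<^sub>R sl' x x (vol' x v)"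
    unfolding Za_def t_def
  proof (rule P.frame_derivative_contraction)
    show "(\<Sum>m\<in>UNIV. pd (\<lambda>y. Fr y \<mu> m) k x * Th x \<nu> m) = - p * x $ k * (if \<mu> = \<nu> then 1 else 0)
       + 2 * (1 - K * (x \<bullet> x)) * H1 * x $ k * (Jw x $ \<mu> * Jw x $ \<nu>)
       + K * (Jw (axis k 1) $ \<mu> * Jw x $ \<nu>) + H * (Jw x $ \<mu> * (Jw (axis k 1) $ \<nu> - K * Jw x $ \<nu> * x $ k))" for k \<mu> \<nu>
      unfolding frame_derivative p_def K_def H_def H1_def t_def ..
    show "B k v = gm x k v + (H * Jw x $ k) *\<^sub>R sl' x (Jw x) v" for k v unfolding B_def w_def ..
  qed
  \<comment> \<open>The Christoffel symbol is symmetric in the two indices whose Clifford factors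
    stand next to each other, so \<open>symmetric_contraction\<close> replaces them by the metric
    trace.\<close>
  have three: "(\<Sum>k\<in>UNIV. B k (Zc k)) = (c + d * t - 2 * p + 2 * V1 / V) *\<^sub>R sl' x x v"
  proof -
    have Zc: "Zc k = (\<Sum>n\<in>UNIV. \<Sum>l\<in>UNIV. christoffel G n k l x *\<^sub>R sl' x (Fv x l) (sl' x (Fv x n) v))" for k
      unfolding Zc_def P.sl_sl scaleR_sum_left scaleR_sum_right
      by (subst sum_swap4) (simp add: Fv_def mult_ac)
    have "(\<Sum>k\<in>UNIV. B k (Zc k)) = f *\<^sub>R (\<Sum>k\<in>UNIV. \<Sum>n\<in>UNIV. \<Sum>l\<in>UNIV. christoffel G n k l x *\<^sub>R sl' x (Fv x k) (sl' x (Fv x l) (sl' x (Fv x n) v)))"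
      unfolding fB[symmetric] Zc by (simp only: P.sl_simps scaleR_sum_right)
    also have "(\<Sum>k\<in>UNIV. \<Sum>n\<in>UNIV. \<Sum>l\<in>UNIV. christoffel G n k l x *\<^sub>R sl' x (Fv x k) (sl' x (Fv x l) (sl' x (Fv x n) v)))
        = (\<Sum>n\<in>UNIV. \<Sum>k\<in>UNIV. \<Sum>l\<in>UNIV. christoffel G n k l x *\<^sub>R sl' x (Fv x k) (sl' x (Fv x l) (sl' x (Fv x n) v)))"
      by (rule sum.swap)
    also have "\<dots> = (\<Sum>n\<in>UNIV. ((c + d * t - 2 * p + 2 * V1 / V) * x $ n) *\<^sub>R sl' x (Fv x n) v)"
    proof (rule sum.cong[OF refl])
      fix n
      have s: "christoffel G n k l x = christoffel G n l k x" for k l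
      proof -
        have "G y $ k $ l = G y $ l $ k" for y by (simp add: Gmat_eq mult.commute)
        then show ?thesis unfolding christoffel_def by simp
      qed
      have i: "Fv x k \<bullet> Fv x l = (\<Sum>\<mu>\<in>UNIV. Fr x \<mu> k * Fr x \<mu> l)" for k l by (simp add: Fv_def inner_vec_def)
      show "(\<Sum>k\<in>UNIV. \<Sum>l\<in>UNIV. christoffel G n k l x *\<^sub>R sl' x (Fv x k) (sl' x (Fv x l) (sl' x (Fv x n) v)))
         = ((c + d * t - 2 * p + 2 * V1 / V) * x $ n) *\<^sub>R sl' x (Fv x n) v"
        unfolding P.symmetric_contraction[where S = "\<lambda>k l. christoffel G n k l x" and e = "Fv x", OF s] i christoffel_contraction
        unfolding t_def p_def V_def V1_def ..
    qed
    also have "f *\<^sub>R \<dots> = (c + d * t - 2 * p + 2 * V1 / V) *\<^sub>R (\<Sum>n\<in>UNIV. x $ n *\<^sub>R B n v)"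
      unfolding fB[symmetric] by (simp add: scaleR_sum_right mult_ac)
    also have "(\<Sum>n\<in>UNIV. x $ n *\<^sub>R B n v) = sl' x x v"
      using radial_symb[of x 1 v] unfolding symb_def B_def H_def t_def w_def by simp
    finally show ?thesis .
  qed
  have om: "(\<Sum>\<mu>\<in>UNIV. \<Sum>\<nu>\<in>UNIV. om k x \<mu> \<nu> *\<^sub>R gm x \<mu> (gm x \<nu> v)) = Za k + Zc k" for k
    unfolding om_def Za_def Zc_def by (simp only: scaleR_add_left sum.distrib)
  have "f *\<^sub>R dirac G E \<psi> x = (\<Sum>k\<in>UNIV. B k (cov k \<psi> x - (1/4) *\<^sub>R (Za k + Zc k)))"
    unfolding dirac_moving_frame v_def[symmetric] om fB[symmetric] by (rule scaleR_sum_right)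
  also have "\<dots> = (\<Sum>k\<in>UNIV. B k (cov k \<psi> x)) - (1/4) *\<^sub>R ((\<Sum>k\<in>UNIV. B k (Za k)) + (\<Sum>k\<in>UNIV. B k (Zc k)))"
    by (simp only: linear_diff[OF linB] linear_add[OF linB] linear_cmul[OF linB] sum_subtractf sum.distrib scaleR_sum_right[symmetric])
  finally have D: "f *\<^sub>R dirac G E \<psi> x = dirac0 \<psi> x + H *\<^sub>R sl' x w (covw \<psi> x)
     - (1/4) *\<^sub>R ((- 4 * p + 2 * (1 - K * t) * H1 * t + 2 * K - H\<^sup>2 * t) *\<^sub>R sl' x x v + (2 * (H - K)) *\<^sub>R sl' x x (vol' x v)
       + (c + d * t - 2 * p + 2 * V1 / V) *\<^sub>R sl' x x v)"
    unfolding one two three .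
  have V: "V > 0" unfolding V_def by (rule V_pos[OF t])
  \<comment> \<open>Derivative of log V in disguise: 1 - K t = 1 / V, and H1 t = V1 - H.\<close>
  have k1: "2 * (1 - K * t) * H1 * t + 2 * K = 2 * V1 / V"
  proof -
    have "V * (1 - K * t) = 1"
      using K_eq[OF t, folded K_def V_def] H_eq[OF t, folded V_def]
      by (simp add: right_diff_distrib mult.assoc[symmetric] mult.commute[of V])
    moreover have "H1 * t = V1 - H" unfolding H1_def V1_def H_def by (rule H1_eq[OF t])
    moreover have "K * V = H" unfolding K_def V_def H_def by (rule K_eq[OF t])
    ultimately have "(2 * (1 - K * t) * H1 * t + 2 * K) * V = 2 * V1" by algebra
    then show ?thesis using V by (simp add: field_simps)
  qed
  have k2: "c + d * t = H\<^sup>2 * t + 2 * H" unfolding H_def by (rule q_eq[OF t, symmetric])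
  have k3: "H - K = H * K * t" unfolding H_def K_def by (rule H_K[OF t])
  have k4: "(- 4 * p + 2 * (1 - K * t) * H1 * t + 2 * K - H\<^sup>2 * t) + (c + d * t - 2 * p + 2 * V1 / V) = - 4 * (3/2 * p - V1 / V - H / 2)"
  proof -
    have aux: "y + 2 * K = 2 * z \<Longrightarrow> q = y' + 2 * H \<Longrightarrow> - 4 * p + y + 2 * K - y' + (q - 2 * p + 2 * z) = - 4 * (3/2 * p - z - H / 2)" for y y' q z
      by (simp add: field_simps)
    show ?thesis
      using aux[of "2 * (1 - K * t) * H1 * t" "V1 / V" "c + d * t" "H\<^sup>2 * t"] k1 k2 by (simp only: times_divide_eq_right)
  qed
  have r: "A *\<^sub>R X + Y + A' *\<^sub>R X = (A + A') *\<^sub>R X + Y" for A A' and X Y :: "complex^4"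
    by (simp add: scaleR_add_left)
  have "f *\<^sub>R dirac G E \<psi> x = dirac0 \<psi> x + H *\<^sub>R sl' x w (covw \<psi> x) + (3/2 * p - V1 / V) *\<^sub>R sl' x x v
      - (H / 2) *\<^sub>R sl' x x v - (H / 2 * (K * t)) *\<^sub>R sl' x x (vol' x v)"
    unfolding D r k3 k4 by (simp add: algebra_simps)
  then show ?thesis
    unfolding Lop_def zo_def t_def[symmetric] f_def[symmetric] H_def[symmetric] K_def[symmetric] p_def[symmetric] V_def[symmetric] V1_def[symmetric] w_def[symmetric] v_def[symmetric]
    by (simp add: P.sl_simps algebra_simps)
qed

end

section \<open>The complex pairing, the conformal rescaling and the conclusion\<close>

definition imul :: "complex^4 \<Rightarrow> complex^4" where "imul v = (\<chi> k. \<i> * v $ k)"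

lemma bl_imul: "bounded_linear imul"
  unfolding linear_conv_bounded_linear[symmetric]
  by (rule linearI) (simp_all add: imul_def vec_eq_iff distrib_left mult_scaleR_right)

text \<open>The Hermitian product is recovered from its real part, so the real theory of symmetric
  operators covers the complex weak equation.\<close>

lemma herm_eq: "herm u v = complex_of_real (u \<bullet> v) - \<i> * complex_of_real (u \<bullet> imul v)"
proof -
  have "cnj y * z = complex_of_real (y \<bullet> z) - \<i> * complex_of_real (y \<bullet> (\<i> * z))" for y z :: complex
    by (simp add: complex_eq_iff inner_complex_def)
  then show ?thesis
    by (simp add: herm_def inner_vec_def imul_def sum_subtractf sum_distrib_left)
qed

lemma test_spinorI:
  assumes \<psi>: "smooth_map \<psi>" "bsupp \<psi>"
  shows "test_spinor \<psi>"
  unfolding test_spinor_def smooth_spinor_def smooth_fun_eq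
proof (intro conjI allI)
  show "smooth_map (\<lambda>x. Re (\<psi> x $ k))" "smooth_map (\<lambda>x. Im (\<psi> x $ k))" for k
    by (intro smooth_linear[OF bounded_linear_Re] smooth_linear[OF bounded_linear_Im] smooth_linear[OF bounded_linear_vec_nth] \<psi>(1))+
  obtain R where R: "\<forall>x. norm x > R \<longrightarrow> \<psi> x = 0" using \<psi>(2) unfolding bsupp_def by (rule exE)
  have "{x. \<psi> x \<noteq> 0} \<subseteq> cball 0 R"
  proof
    fix x assume "x \<in> {x. \<psi> x \<noteq> 0}"
    then show "x \<in> cball 0 R" using R[rule_format, of x] by (cases "norm x > R") auto
  qed
  then show "compact (closure {x. \<psi> x \<noteq> 0})"
    using bounded_subset[OF bounded_cball] by (simp add: compact_closure)
qed

context ik_frame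
begin

text \<open>The conformal weight F^(-3/2) in dimension 4 times V^(1/2), the inverse square root of
  the volume density of g_0.\<close>

definition eta :: "real \<Rightarrow> real" where "eta t = sqrt (Vf c d t / (Ff t) ^ 3)"

lemma eta_pos: "t \<ge> 0 \<Longrightarrow> eta t > 0"
  unfolding eta_def using V_pos F_pos by simp

lemma eta_sq: "t \<ge> 0 \<Longrightarrow> (eta t)\<^sup>2 * (Ff t) ^ 3 = Vf c d t"
  unfolding eta_def using V_pos[of t] F_pos[of t] by simp

lemma smooth_eta: "smooth_map (\<lambda>x::real^4. eta (x \<bullet> x))"
  unfolding eta_def
proof (intro smooth_sqrt smooth_divide smooth_V smooth_power smooth_F)
  show "0 < Ff (x \<bullet> x) ^ 3" for x :: "real^4" using F_pos[of "x \<bullet> x"] by simp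
  then show "0 < Vf c d (x \<bullet> x) / Ff (x \<bullet> x) ^ 3" for x :: "real^4" using V_pos[of "x \<bullet> x"] by simp
qed

lemma DERIV_eta:
  assumes t: "t \<ge> 0"
  shows "(eta has_real_derivative eta t * ((V1f c d t / Vf c d t - 3/2 * logF1 t) / 2)) (at t)"
proof -
  define f v v1 where "f = Ff t" and "v = Vf c d t" and "v1 = V1f c d t"
  have p: "f > 0" "v > 0" using F_pos[OF t] V_pos[OF t] by (simp_all add: f_def v_def)
  define g where "g = v / f ^ 3"
  have g: "g > 0" using p by (simp add: g_def)
  define D where "D = (v1 * f ^ 3 - v * (3 * f\<^sup>2 * (2 * b / f))) / (f ^ 3 * f ^ 3)"
  have "((\<lambda>t. Vf c d t / (Ff t) ^ 3) has_real_derivative D) (at t)"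
    using p DERIV_divide[OF DERIV_V[OF t] DERIV_power[OF DERIV_F[OF t], of 3]]
    unfolding D_def f_def v_def v1_def by (simp add: mult_ac)
  from DERIV_chain2[where f = sqrt and g = "\<lambda>t. Vf c d t / (Ff t) ^ 3", OF DERIV_real_sqrt[OF g, unfolded g_def f_def v_def] this]
  have "(eta has_real_derivative inverse (sqrt g) / 2 * D) (at t)"
    unfolding eta_def[abs_def] g_def f_def v_def .
  moreover have "inverse (sqrt g) / 2 * D = eta t * ((v1 / v - 3/2 * logF1 t) / 2)"
  proof -
    have e: "eta t = sqrt g" unfolding eta_def g_def f_def v_def ..
    have s: "inverse (sqrt g) = sqrt g / g" 
    proof -
      have "sqrt g * sqrt g = g" "sqrt g > 0" using g by simp_all
      then show ?thesis using g by (simp add: field_simps)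
    qed
    have "D = g * (v1 / v - 6 * b / f\<^sup>2)"
      unfolding D_def g_def using p by (simp add: field_simps power2_eq_square power3_eq_cube)
    moreover have "3/2 * logF1 t = 6 * b / f\<^sup>2" by (simp add: logF1_def f_def)
    ultimately show ?thesis unfolding e s using g by simp
  qed
  ultimately show ?thesis unfolding v_def v1_def by simp
qed

text \<open>The logarithmic gradient of \<open>eta\<close> is exactly the negative of the extra
  vector in \<open>dirac_Lop\<close>, so the product rule cancels it.\<close>

lemma dirac_conjugate:
  assumes \<psi>: "smooth_map \<psi>"
  shows "Ff (x \<bullet> x) *\<^sub>R dirac G E (\<lambda>x. eta (x \<bullet> x) *\<^sub>R \<psi> x) x = eta (x \<bullet> x) *\<^sub>R Lop \<psi> x"
proof -
  define s where "s = V1f c d (x \<bullet> x) / Vf c d (x \<bullet> x) - 3/2 * logF1 (x \<bullet> x)"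
  have "pd (\<lambda>x. eta (x \<bullet> x)) k x = 2 * x $ k * (eta (x \<bullet> x) * (s / 2))" for k
    unfolding s_def by (rule pd_radial[OF DERIV_eta])
  then have p: "pd (\<lambda>x. eta (x \<bullet> x)) k x = x $ k * (eta (x \<bullet> x) * s)" for k by simp
  have q: "3/2 * logF1 (x \<bullet> x) - V1f c d (x \<bullet> x) / Vf c d (x \<bullet> x) = - s" by (simp add: s_def)
  show ?thesis
    unfolding dirac_Lop dop_cutoff[OF smooth_eta \<psi>] p radial_symb q by (simp add: linear_cmul[OF P.lin_sl])
qed

text \<open>Division by \<open>eta\<close> transports the whole problem to Lebesgue measure. The
  square norm becomes that of \<phi> with weight F, which is bounded below, so \<phi> is in L2; and
  the weak equation for the Dirac operator becomes the one for \<open>Lop\<close>, test fields being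
  multiplied by the smooth positive function \<open>eta\<close>.\<close>

theorem harmonic_spinor_zero:
  assumes \<Phi>: "L2_harmonic_spinor G E \<Phi>"
  shows "AE x in lborel. \<Phi> x = 0"
proof -
  define \<phi> where "\<phi> x = inverse (eta (x \<bullet> x)) *\<^sub>R \<Phi> x" for x
  have e: "eta (x \<bullet> x) > 0" and f: "Ff (x \<bullet> x) > 0" and v: "Vf c d (x \<bullet> x) > 0" for x :: "real^4"
    by (simp_all add: eta_pos F_pos V_pos)
  have ef: "(eta (x \<bullet> x))\<^sup>2 * (Ff (x \<bullet> x)) ^ 3 = Vf c d (x \<bullet> x)" for x :: "real^4" by (rule eta_sq) simp
  have \<Phi>\<phi>: "\<Phi> x = eta (x \<bullet> x) *\<^sub>R \<phi> x" for x using e[of x] by (simp add: \<phi>_def)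
  have \<Phi>m: "\<Phi> \<in> borel_measurable borel" using \<Phi> unfolding L2_harmonic_spinor_def by simp
  have \<Phi>i: "integrable lborel (\<lambda>x. (norm (\<Phi> x))\<^sup>2 * vol_density G x)" using \<Phi> unfolding L2_harmonic_spinor_def by simp
  have \<phi>m: "\<phi> \<in> borel_measurable borel"
    unfolding \<phi>_def[abs_def]
    by (rule borel_measurable_scaleR[OF borel_smooth[OF smooth_inverse[OF smooth_eta e]] \<Phi>m])
  have n: "N2 \<phi> < \<infinity>"
  proof -
    \<comment> \<open>The inverse of the minimum 2 sqrt a of F, attained at the origin.\<close>
    define C where "C = inverse (2 * sqrt a)"
    have "(norm (\<phi> x))\<^sup>2 \<le> C * ((norm (\<Phi> x))\<^sup>2 * vol_density G x)" for x
    proof -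
      have F: "Ff (x \<bullet> x) \<ge> 2 * sqrt a" using b by (simp add: Ff_def)
      have "(norm (\<Phi> x))\<^sup>2 * vol_density G x = (norm (\<phi> x))\<^sup>2 * ((eta (x \<bullet> x))\<^sup>2 * (Ff (x \<bullet> x)) ^ 3 / Vf c d (x \<bullet> x)) * Ff (x \<bullet> x)"
        unfolding vol_eq \<Phi>\<phi>[of x] by (simp add: power_mult_distrib power3_eq_cube power4_eq_xxxx)
      also have "\<dots> = (norm (\<phi> x))\<^sup>2 * Ff (x \<bullet> x)" unfolding ef using v[of x] by simp
      finally have "(norm (\<Phi> x))\<^sup>2 * vol_density G x \<ge> (norm (\<phi> x))\<^sup>2 * (2 * sqrt a)"
        using mult_left_mono[OF F, of "(norm (\<phi> x))\<^sup>2"] by simp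
      then have "C * ((norm (\<phi> x))\<^sup>2 * (2 * sqrt a)) \<le> C * ((norm (\<Phi> x))\<^sup>2 * vol_density G x)"
        using a by (intro mult_left_mono) (simp_all add: C_def)
      moreover have "C * ((norm (\<phi> x))\<^sup>2 * (2 * sqrt a)) = (norm (\<phi> x))\<^sup>2" using a by (simp add: C_def)
      ultimately show ?thesis by simp
    qed
    then have "N2 \<phi> \<le> (\<integral>\<^sup>+x. ennreal (C * ((norm (\<Phi> x))\<^sup>2 * vol_density G x)) \<partial>lborel)"
      unfolding N2_def by (intro nn_integral_mono ennreal_leI)
    also have "\<dots> = ennreal (\<integral>x. C * ((norm (\<Phi> x))\<^sup>2 * vol_density G x) \<partial>lborel)"
    proof (rule nn_integral_eq_integral)
      show "integrable lborel (\<lambda>x. C * ((norm (\<Phi> x))\<^sup>2 * vol_density G x))" by (rule integrable_mult_right[OF \<Phi>i])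
      show "AE x in lborel. 0 \<le> C * ((norm (\<Phi> x))\<^sup>2 * vol_density G x)"
      proof (rule AE_I2)
        fix x :: "real^4"
        have "vol_density G x \<ge> 0" unfolding vol_eq using f[of x] v[of x] by simp
        then show "0 \<le> C * ((norm (\<Phi> x))\<^sup>2 * vol_density G x)" using a by (simp add: C_def)
      qed
    qed
    finally show ?thesis by (simp add: le_less_trans)
  qed
  have weak: "(\<integral>x. \<phi> x \<bullet> Lop \<psi> x \<partial>lborel) = 0" if \<psi>: "smooth_map \<psi>" "bsupp \<psi>" for \<psi>
  proof -
    define \<psi>' where "\<psi>' x = eta (x \<bullet> x) *\<^sub>R \<psi> x" for x
    have "test_spinor \<psi>'"
    proof (rule test_spinorI)
      show "smooth_map \<psi>'" unfolding \<psi>'_def[abs_def] by (rule smooth_scaleR[OF smooth_eta \<psi>(1)])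
      show "bsupp \<psi>'" by (rule bsupp_mono[OF \<psi>(2)]) (simp add: \<psi>'_def)
    qed
    then have z: "(\<integral>x. herm (\<Phi> x) (dirac G E \<psi>' x) * complex_of_real (vol_density G x) \<partial>lborel) = 0"
      using \<Phi> unfolding L2_harmonic_spinor_def by simp
    have "herm (\<Phi> x) (dirac G E \<psi>' x) * complex_of_real (vol_density G x) = herm (\<phi> x) (Lop \<psi> x)" for x
    proof -
      define h where "h = eta (x \<bullet> x)"
      define F where "F = Ff (x \<bullet> x)"
      define V where "V = Vf c d (x \<bullet> x)"
      have p: "h > 0" "F > 0" "V > 0" using e[of x] f[of x] v[of x] by (simp_all add: h_def F_def V_def)
      have D: "dirac G E \<psi>' x = (h / F) *\<^sub>R Lop \<psi> x"
      proof -
        have "F *\<^sub>R dirac G E \<psi>' x = F *\<^sub>R ((h / F) *\<^sub>R Lop \<psi> x)"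
          using dirac_conjugate[OF \<psi>(1), of x] p unfolding \<psi>'_def[abs_def] h_def F_def by simp
        then show ?thesis by (rule scaleR_left_imp_eq[rotated]) (use p(2) in simp)
      qed
      have s: "herm (r *\<^sub>R u) (s *\<^sub>R w) = complex_of_real (r * s) * herm u w" for r s u w
        unfolding herm_def vector_scaleR_component unfolding sum_distrib_left scaleR_conv_of_real by (simp add: mult_ac)
      \<comment> \<open>One factor \<open>eta\<close> from the spinor, one divided by F from the
        conjugated operator, and the volume density: the product is 1, so the weighted pairing is
        the plain Lebesgue one.\<close>
      have "h * (h / F) * (F ^ 4 / V) = 1"
      proof -
        have "h * (h / F) * (F ^ 4 / V) = (h\<^sup>2 * F ^ 3) / V"
          using p(2) by (simp add: power2_eq_square power3_eq_cube power4_eq_xxxx)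
        also have "h\<^sup>2 * F ^ 3 = V" using ef[of x] by (simp only: h_def F_def V_def)
        also have "V / V = 1" using p(3) by (intro divide_self) (rule less_imp_neq[symmetric])
        finally show ?thesis .
      qed
      then have A: "complex_of_real (h * (h / F)) * complex_of_real (F ^ 4 / V) = 1"
        unfolding of_real_mult[symmetric] by (simp only: of_real_1)
      have c: "y * z * y' = (y * y') * z" for y y' z :: complex by (simp only: mult_ac)
      show ?thesis
        unfolding \<Phi>\<phi>[of x] D vol_eq h_def[symmetric] F_def[symmetric] V_def[symmetric] s c A by simp
    qed
    then have z': "(\<integral>x. herm (\<phi> x) (Lop \<psi> x) \<partial>lborel) = 0" using z by simp
    have L: "smooth_map (Lop \<psi>)" "bsupp (Lop \<psi>)"
      using smooth_Lop[OF \<psi>(1)] S.bsupp_dop[OF \<psi>(2)] unfolding dop_eq by simp_all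
    have i1: "integrable lborel (\<lambda>x. \<phi> x \<bullet> Lop \<psi> x)" by (rule integrable_inner_L2[OF \<phi>m n L])
    have i2: "integrable lborel (\<lambda>x. \<phi> x \<bullet> imul (Lop \<psi> x))"
      by (rule integrable_inner_L2[OF \<phi>m n smooth_linear[OF bl_imul L(1)] bsupp_mono[OF L(2)]])
        (simp add: linear_0[OF bounded_linear.linear[OF bl_imul]])
    have i: "integrable lborel (\<lambda>x. herm (\<phi> x) (Lop \<psi> x))"
      unfolding herm_eq by (intro Bochner_Integration.integrable_diff integrable_mult_right integrable_of_real i1 i2)
    have "(\<integral>x. \<phi> x \<bullet> Lop \<psi> x \<partial>lborel) = (\<integral>x. Re (herm (\<phi> x) (Lop \<psi> x)) \<partial>lborel)"
      by (simp add: herm_eq)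
    also have "\<dots> = Re (\<integral>x. herm (\<phi> x) (Lop \<psi> x) \<partial>lborel)" by (rule integral_Re[OF i])
    finally show ?thesis by (simp add: z')
  qed
  have "AE x in lborel. \<phi> x = 0" by (rule weak_kernel_trivial[OF \<phi>m n weak])
  then show ?thesis by eventually_elim (simp add: \<Phi>\<phi>)
qed

end

theorem theorem1p1:
  fixes a b c d :: real
    and E :: "real^4 \<Rightarrow> real^4^4"
    and \<Phi> :: "real^4 \<Rightarrow> complex^4"
  assumes "a > 0" "b > 0" "c > 0" "d > 0"
    and "smooth_orthonormal_frame (Gmat a b c d) E"
    and "L2_harmonic_spinor (Gmat a b c d) E \<Phi>"
  shows "AE x in lborel. \<Phi> x = 0"
proof -
  interpret ik_frame c d a b E
    using assms by unfold_locales
  show ?thesis by (rule harmonic_spinor_zero[OF assms(6)])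
qed

end
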